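(* Let $M=\mathbb{P}(\mathcal{O}\oplus\mathcal{L})\to S$ be an admissible manifold. The following properties are equivalent for a conical admissible K\"ahler class $\Omega=\Omega(x,\kappa)$: (1) the modified $K$-energy is bounded from below on $\Omega$; (2) the extremal polynomial $F_\Omega(z)$ is nonnegative on $(-1,1)$; (3) the infimum of the modified Calabi energy on $\Omega$ is zero. Moreover, if $F_\Omega(z)$ is nonnegative on $(-1,1)$ and has $m$ distinct repeated roots $z_1<\dots<z_m$ on $(-1,1)$, then, with $z_0=-1$ and $z_{m+1}=1$, $M$ splits into the $m+1$ parts $M_i=z^{-1}((z_i,z_{i+1}))$, $0\le i\le m$, and each part admits an admissible extremal K\"ahler metric with generalized cusp singularities at its ends $z=z_j$, $1\le j\le m$.
   Context: Admissible manifold: $M=\mathbb{P}(\mathcal{O}\oplus\mathcal{L})\to S$, with $\mathcal{L}$ a holomorphic line bundle over a compact complex manifold $S$, such that: (i) $S$ is covered by a product $\tilde S=S_1\times\cdots\times S_N$ of simply connected K\"ahler manifolds $(S_i,g_i,\omega_i)$ of complex dimension $d_i$, where $g_i$ has constant scalar curvature $2d_is_i$; (ii) $z$ is a Morse--Bott function on $M$ with image $[-1,1]$ and critical set $z^{-1}(\{-1,1\})$, and $M^0:=z^{-1}((-1,1))$ is a principal $\mathbb{C}^*$-bundle over $S$; (iii) for real numbers $x_i\in(0,1)$ there are K\"ahler metrics on $M^0$ of the form $$g=\sum_{i=1}^N\frac{1+x_iz}{x_i}g_i+\frac{dz^2}{\Theta(z)}+\Theta(z)\theta^2,\qquad \omega_g=\sum_{i=1}^N\frac{1+x_iz}{x_i}\omega_i+dz\wedge\theta,\qquad(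 * )$$ where $\theta$ is a connection $1$-form with $\theta(K)=1$, $d\theta=\sum_i\omega_i$, $K=J\nabla_gz$ is a Killing field generating the $S^1$-action, $\Theta$ is smooth on $[-1,1]$ with $\Theta(\pm1)=0$, $\Theta>0$ on $(-1,1)$; the fibre complex structure is $Jdz=\Theta\theta$. For $\kappa>0$ let $\mathcal{A}(\kappa)=\{\Theta\in C^\infty[-1,1]: \Theta>0 \text{ on }(-1,1),\ \Theta(\pm1)=0,\ \Theta'(\pm1)=\mp2\kappa\}$. Metrics $g$ with $\Theta\in\mathcal{A}(\kappa)$ are the conical admissible metrics with angle $2\pi\kappa$; after fibre-preserving diffeomorphisms, those with fixed $x=(x_1,\dots,x_N)$ and $\kappa$ are regarded as lying in one class $\Omega(x,\kappa)$. An admissible metric is extremal iff its scalar curvature is an affine function of $z$. On a part $z^{-1}((a,b))$, an admissible extremal metric is a metric of the form $( * )$ with $\Theta$ smooth and positive on $(a,b)$ and scalar curvature affine in $z$. Extremal polynomial: with $p_c(z)=\prod_{i=1}^N(1+x_iz)^{d_i}$, $\alpha_r=\int_{-1}^1p_c(t)t^r\,dt$ and $\beta_{r,\kappa}=\kappa p_c(1)+(-1)^r\kappa p_c(-1)+\int_{-1}^1\sum_i\frac{d_is_ix_i}{1+x_it}p_c(t)t^r\,dt$, let $A,B$ solve $A\alpha_1+B\alpha_0=-2\beta_{0,\kappa}$, $A\alpha_2+B\alpha_1=-2\beta_{1,\kappa}$. Then $F_\Omega$ is the polynomial with $F_\Omega(\pm1)=0$ and $F_\Omega''(z)=\big(Az+B+\sum_i\frac{2d_is_ix_i}{1+x_iz}\big)p_c(z)$.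 Potentials: let $u_{c,\kappa}(z)=\frac1{2\kappa}\big((1-z)\log(1-z)+(1+z)\log(1+z)\big)$ and let $\mathcal{C}_\kappa$ be the set of $u\in C^0([-1,1])$ with $u''>0$ on $(-1,1)$, $u-u_{c,\kappa}\in C^\infty([-1,1])$, $u(0)=u'(0)=0$. The class $\Omega(x,\kappa)$ is identified with $\mathcal{C}_\kappa$ via $\Theta=1/u''$. Let $g_c$, $\omega_c$, $J_c$ be the metric, K\"ahler form and complex structure for $u_{c,\kappa}$, and $y_c=u_{c,\kappa}'(z)$. The Legendre transform of $u$ is $\varphi_u(y)=-u(z)+yz$ with $y=u'(z)$; let $\varphi_c$ be that of $u_{c,\kappa}$. In the fixed complex structure $J_c$ the metric of $u$ has K\"ahler form $\omega_u=\omega_c+dJ_cd\tilde\varphi_u$, with K\"ahler potential $\tilde\varphi_u=\varphi_u(y_c)-\varphi_c(y_c)$ relative to $\omega_c$. Modified $K$-energy: for a path $\varphi_t$ of such K\"ahler potentials from $0$ to $\varphi$, with metrics $g_t$ and forms $\omega_{g_t}$, and $n=\dim_{\mathbb{C}}M$, $$\mu_{g_c}(\varphi)=-\int_0^1\int_M\frac{\partial\varphi_t}{\partial t}\,pr^\perp_{g_t}S_{g_t}\,\omega_{g_t}^n\,dt,$$ independent of the path, where $pr_g^\perp S_g$ is the part of the scalar curvature $L^2$-orthogonal to the Killing potentials; for an admissible metric with $F=\Theta p_c$ it equals $\frac{F_\Omega''(z)-F''(z)}{p_c(z)}$. It is bounded from below on $\Omega$ if $\mu_{g_c}(\tilde\varphi_u)$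 is bounded below uniformly in $u\in\mathcal{C}_\kappa$. The modified Calabi energy of an admissible metric $g$ is $\int_M(pr_g^\perp S_g)^2\,dV_g$, a positive constant multiple of $\int_{-1}^1\frac{(F''(z)-F_\Omega''(z))^2}{p_c(z)}\,dz$; its infimum is over all metrics in $\Omega(x,\kappa)$. Generalized cusp: a metric $g$ on a Riemann surface has a generalized cusp point at $p$ if there is an integer $k\in\mathbb{N}$ such that near $p$ it can be written as $g=\rho_1(s)\frac{ds^2}{s^k}+\rho_2(s)s^k\theta^2$, $s\in(0,s_0]$, with $\rho_1,\rho_2$ positive and smooth at $p$. The metric on $M_i$ is said to have a generalized cusp singularity at the end $z=z_j$ if the fibre metric $\frac{dz^2}{\Theta(z)}+\Theta(z)\theta^2$ has one there. *)

theory Defs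
  imports "HOL-Analysis.Analysis" "HOL-Computational_Algebra.Polynomial"
begin

definition smooth_on_line :: "real set \<Rightarrow> (real \<Rightarrow> real) \<Rightarrow> bool" where
  "smooth_on_line I f \<longleftrightarrow>
     (\<exists>Df. (\<forall>x\<in>I. Df 0 x = f x) \<and>
        (\<forall>n::nat. \<forall>x\<in>I. (Df n has_real_derivative Df (Suc n) x) (at x within I)))"

definition dirD :: "('v::real_normed_vector \<Rightarrow> 'w::real_normed_vector) \<Rightarrow> 'v \<Rightarrow> 'v \<Rightarrow> 'w" where
  "dirD f q v = vector_derivative (\<lambda>t. f (q + t *\<^sub>R v)) (at 0)"

text \<open>Charts of manifolds of different dimensions all take values in coordinate subspaces of one
  space \<open>complex^'n\<close>; \<open>Ck_on k E W f\<close> is for \<open>W\<close> relatively open in the subspace \<open>E\<close>.\<close>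

primrec Ck_on :: "nat \<Rightarrow> 'v set \<Rightarrow> 'v set \<Rightarrow> ('v::real_normed_vector \<Rightarrow> 'w::real_normed_vector) \<Rightarrow> bool" where
  "Ck_on 0 E W f = continuous_on W f"
| "Ck_on (Suc k) E W f \<longleftrightarrow> continuous_on W f \<and>
     (\<forall>v\<in>E. (\<forall>q\<in>W. (\<lambda>t::real. f (q + t *\<^sub>R v)) differentiable (at 0)) \<and>
            Ck_on k E W (\<lambda>q. dirD f q v))"

definition smooth_in :: "'v set \<Rightarrow> 'v set \<Rightarrow> ('v::real_normed_vector \<Rightarrow> 'w::real_normed_vector) \<Rightarrow> bool" where
  "smooth_in E W f \<longleftrightarrow> (\<forall>k. Ck_on k E W f)"

definition coord_space :: "'n::finite set \<Rightarrow> (complex^'n) set" where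
  "coord_space B = {v. \<forall>a. a \<notin> B \<longrightarrow> v $ a = 0}"

definition coord_proj :: "'n::finite set \<Rightarrow> complex^'n \<Rightarrow> complex^'n" where
  "coord_proj B v = (\<chi> a. if a \<in> B then v $ a else 0)"

definition holo_fun :: "'n::finite set \<Rightarrow> (complex^'n) set \<Rightarrow> (complex^'n \<Rightarrow> complex) \<Rightarrow> bool" where
  "holo_fun B W f \<longleftrightarrow>
     (\<forall>w\<in>W. \<exists>L. (f has_derivative L) (at w within W) \<and>
                (\<forall>v\<in>coord_space B. L (\<i> *s v) = \<i> * L v))"

definition holo_map :: "'n::finite set \<Rightarrow> (complex^'n) set \<Rightarrow> (complex^'n \<Rightarrow> complex^'n) \<Rightarrow> bool" where
  "holo_map B W f \<longleftrightarrow> (\<forall>a. holo_fun B W (\<lambda>w. f w $ a))"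

text \<open>A Riemannian metric in holomorphic coordinates: base point, two real tangent vectors.
  The complex structure acts on tangent vectors as multiplication by \<open>\<i>\<close>.\<close>

type_synonym 'n tensor = "complex^'n \<Rightarrow> complex^'n \<Rightarrow> complex^'n \<Rightarrow> real"

definition kform :: "'n::finite tensor \<Rightarrow> 'n tensor" where
  "kform g q v w = g q (\<i> *s v) w"

definition kaehler_coords :: "'n::finite set \<Rightarrow> (complex^'n) set \<Rightarrow> 'n tensor \<Rightarrow> bool" where
  "kaehler_coords B W g \<longleftrightarrow>
     (\<forall>v\<in>coord_space B. \<forall>w\<in>coord_space B. smooth_in (coord_space B) W (\<lambda>q. g q v w)) \<and>
     (\<forall>q\<in>W. bilinear (g q) \<and>
        (\<forall>v\<in>coord_space B. \<forall>w\<in>coord_space B.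
            g q v w = g q w v \<and> g q (\<i> *s v) (\<i> *s w) = g q v w) \<and>
        (\<forall>v\<in>coord_space B. v \<noteq> 0 \<longrightarrow> g q v v > 0) \<and>
        (\<forall>u\<in>coord_space B. \<forall>v\<in>coord_space B. \<forall>w\<in>coord_space B.
            dirD (\<lambda>p. kform g p v w) q u + dirD (\<lambda>p. kform g p w u) q v
              + dirD (\<lambda>p. kform g p u v) q w = 0))"

text \<open>\<open>H\<^sub>a\<^sub>b\<close> is normalised by \<open>g (v, v) = \<Sum> H\<^sub>a\<^sub>b v\<^sub>a cnj v\<^sub>b\<close>, i.e.
  \<open>\<omega> = (\<i>/2) \<Sum> H\<^sub>a\<^sub>b dw\<^sub>a \<and> d(cnj w\<^sub>b)\<close>, so \<open>H\<close> is the identity for the flat metric and the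
  Riemannian volume density is \<open>det H\<close>. Outside \<open>B\<close> the matrix is padded by the identity, which
  changes neither the determinant nor the inverse on \<open>B\<close>.\<close>

definition herm_matrix :: "'n::finite set \<Rightarrow> 'n tensor \<Rightarrow> complex^'n \<Rightarrow> complex^'n^'n" where
  "herm_matrix B g q =
     (\<chi> a b. if a \<in> B \<and> b \<in> B then Complex (g q (axis a 1) (axis b 1)) (g q (axis a 1) (axis b \<i>))
             else if a = b then 1 else 0)"

definition vol_density :: "'n::finite set \<Rightarrow> 'n tensor \<Rightarrow> complex^'n \<Rightarrow> real" where
  "vol_density B g q = Re (det (herm_matrix B g q))"

definition ddbar :: "(complex^'n::finite \<Rightarrow> real) \<Rightarrow> complex^'n \<Rightarrow> 'n \<Rightarrow> 'n \<Rightarrow> complex" where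
  "ddbar f q a b =
     (let D2 = (\<lambda>v w. dirD (\<lambda>p. dirD f p v) q w) in
      Complex (D2 (axis a 1) (axis b 1) + D2 (axis a \<i>) (axis b \<i>))
              (D2 (axis a 1) (axis b \<i>) - D2 (axis a \<i>) (axis b 1)) / 4)"

text \<open>The Ricci form is \<open>- \<i> \<partial>\<close>-\<open>\<partial>\<close>-bar of the logarithm of the volume density, and the scalar curvature
  is twice its trace with respect to \<open>\<omega>\<close>. In terms of \<open>H\<close> this yields the factor \<open>-4\<close>; it
  is the Riemannian scalar curvature (equal to 2 for the unit 2-sphere).\<close>

definition scalar_curvature :: "'n::finite set \<Rightarrow> 'n tensor \<Rightarrow> complex^'n \<Rightarrow> real" where
  "scalar_curvature B g q =
     - 4 * Re (trace (matrix_inv (herm_matrix B g q) **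
        (\<chi> a b. if a \<in> B \<and> b \<in> B then ddbar (\<lambda>p. ln (vol_density B g p)) q a b else 0)))"

definition killing_field :: "(complex^'n::finite) set \<Rightarrow> 'n tensor \<Rightarrow> (complex^'n \<Rightarrow> complex^'n) \<Rightarrow> bool" where
  "killing_field W g X \<longleftrightarrow> smooth_in UNIV W X \<and>
     (\<forall>q\<in>W. \<forall>v w. dirD (\<lambda>p. g p v w) q (X q) + g q (dirD X q v) w + g q v (dirD X q w) = 0)"

definition is_gradient :: "(complex^'n::finite) set \<Rightarrow> 'n tensor \<Rightarrow> (complex^'n \<Rightarrow> real) \<Rightarrow> (complex^'n \<Rightarrow> complex^'n) \<Rightarrow> bool" where
  "is_gradient W g f G \<longleftrightarrow> (\<forall>q\<in>W. \<forall>v. g q (G q) v = dirD f q v)"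

type_synonym ('a, 'n) chart = "'a set \<times> ('a \<Rightarrow> complex^'n)"

definition complex_manifold :: "'n::finite set \<Rightarrow> 'a topology \<Rightarrow> ('a, 'n) chart set \<Rightarrow> bool" where
  "complex_manifold B X A \<longleftrightarrow>
     topspace X \<noteq> {} \<and> Hausdorff_space X \<and> second_countable X \<and>
     (\<Union>(fst ` A)) = topspace X \<and>
     (\<forall>(U, \<phi>)\<in>A. openin X U \<and> \<phi> ` U \<subseteq> coord_space B \<and>
        openin (top_of_set (coord_space B)) (\<phi> ` U) \<and>
        homeomorphic_map (subtopology X U) (top_of_set (\<phi> ` U)) \<phi>) \<and>
     (\<forall>(U, \<phi>)\<in>A. \<forall>(V, \<psi>)\<in>A. holo_map B (\<phi> ` (U \<inter> V)) (\<lambda>w. \<psi> (inv_into U \<phi> w)))"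

definition kaehler_metric :: "'n::finite set \<Rightarrow> ('a, 'n) chart set \<Rightarrow> (('a, 'n) chart \<Rightarrow> 'n tensor) \<Rightarrow> bool" where
  "kaehler_metric B A G \<longleftrightarrow>
     (\<forall>c\<in>A. kaehler_coords B (snd c ` fst c) (G c)) \<and>
     (\<forall>c\<in>A. \<forall>c'\<in>A. let F = (\<lambda>w. snd c' (inv_into (fst c) (snd c) w)) in
        \<forall>q\<in>snd c ` (fst c \<inter> fst c'). \<forall>v\<in>coord_space B. \<forall>w\<in>coord_space B.
          G c' (F q) (dirD F q v) (dirD F q w) = G c q v w)"

definition simply_connected_space :: "'a topology \<Rightarrow> bool" where
  "simply_connected_space X \<longleftrightarrow> path_connected_space X \<and>
     (\<forall>\<gamma>. pathin X \<gamma> \<and> \<gamma> 0 = \<gamma> 1 \<longrightarrow>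
        (\<exists>a. homotopic_with (\<lambda>r. r 0 = r 1) (top_of_set {0..1}) X \<gamma> (\<lambda>_. a)))"

definition covering_projection :: "'a topology \<Rightarrow> 'b topology \<Rightarrow> ('a \<Rightarrow> 'b) \<Rightarrow> bool" where
  "covering_projection X Y p \<longleftrightarrow> continuous_map X Y p \<and> p ` topspace X = topspace Y \<and>
     (\<forall>y\<in>topspace Y. \<exists>U \<V>. openin Y U \<and> y \<in> U \<and>
        \<Union>\<V> = {x \<in> topspace X. p x \<in> U} \<and> pairwise disjnt \<V> \<and>
        (\<forall>V\<in>\<V>. openin X V \<and> homeomorphic_map (subtopology X V) (subtopology Y U) p))"

text \<open>The base \<open>S\<close> is \<open>base\<close>; it is covered via \<open>cov\<close> by the product of the factors
  \<open>S\<^sub>i\<close> (\<open>i :: 'b\<close>, so \<open>N = CARD('b)\<close>). The coordinates are indexed by \<open>'d\<close>, and \<open>blk a = i\<close>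
  means that \<open>a\<close> is a coordinate of \<open>S\<^sub>i\<close>. \<open>tot\<close>, \<open>prj\<close> and
  \<open>triv\<close> describe the total space of the line bundle \<open>\<L>\<close>, \<open>hnorm\<close> a Hermitian norm on it.\<close>

record ('a, 's, 'l, 'd, 'b) admissible_data =
  blk :: "'d \<Rightarrow> 'b"
  fac :: "'b \<Rightarrow> 'a topology"
  fac_atlas :: "'b \<Rightarrow> ('a set \<times> ('a \<Rightarrow> (complex, 'd) vec)) set"
  fac_metric :: "'b \<Rightarrow> ('a set \<times> ('a \<Rightarrow> (complex, 'd) vec)) \<Rightarrow> (complex, 'd) vec \<Rightarrow> (complex, 'd) vec \<Rightarrow> (complex, 'd) vec \<Rightarrow> real"
  base :: "'s topology"
  cov :: "('b \<Rightarrow> 'a) \<Rightarrow> 's"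
  tot :: "'l set"
  prj :: "'l \<Rightarrow> 's"
  triv :: "('s set \<times> ('l \<Rightarrow> complex)) set"
  hnorm :: "'l \<Rightarrow> real"

definition block :: "('a, 's, 'l, 'd::finite, 'b::finite) admissible_data \<Rightarrow> 'b \<Rightarrow> 'd set" where
  "block D i = {a. blk D a = i}"

text \<open>Holomorphic charts of the base: a local section \<open>\<sigma>\<close> of the covering followed by a product of
  charts of the factors.\<close>

type_synonym ('a, 's, 'd, 'b) base_chart = "'s set \<times> ('s \<Rightarrow> 'b \<Rightarrow> 'a) \<times> ('b \<Rightarrow> ('a, 'd) chart)"

definition bdom :: "('a, 's, 'd::finite, 'b::finite) base_chart \<Rightarrow> 's set" where
  "bdom c = fst c"

definition bcoord :: "('a, 's, 'l, 'd::finite, 'b::finite) admissible_data \<Rightarrow> ('a, 's, 'd, 'b) base_chart \<Rightarrow> 's \<Rightarrow> complex^'d" where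
  "bcoord D = (\<lambda>(U, \<sigma>, c) p. \<chi> a. snd (c (blk D a)) (\<sigma> p (blk D a)) $ a)"

definition binv :: "('a, 's, 'l, 'd::finite, 'b::finite) admissible_data \<Rightarrow> ('a, 's, 'd, 'b) base_chart \<Rightarrow> complex^'d \<Rightarrow> 's" where
  "binv D b = inv_into (bdom b) (bcoord D b)"

definition base_charts :: "('a, 's, 'l, 'd::finite, 'b::finite) admissible_data \<Rightarrow> ('a, 's, 'd, 'b) base_chart set" where
  "base_charts D = {(U, \<sigma>, c).
     openin (base D) U \<and> (\<forall>i. c i \<in> fac_atlas D i) \<and>
     continuous_map (subtopology (base D) U) (product_topology (fac D) UNIV) \<sigma> \<and>
     (\<forall>p\<in>U. cov D (\<sigma> p) = p \<and> (\<forall>i. \<sigma> p i \<in> fst (c i))) \<and>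
     open (bcoord D (U, \<sigma>, c) ` U)}"

text \<open>The metric \<open>g\<^sub>i\<close> as a (degenerate) tensor on the base.\<close>

definition base_metric :: "('a, 's, 'l, 'd::finite, 'b::finite) admissible_data \<Rightarrow> ('a, 's, 'd, 'b) base_chart \<Rightarrow> 'b \<Rightarrow> 'd tensor" where
  "base_metric D b i q v w =
     fac_metric D i (snd (snd b) i) (coord_proj (block D i) q) (coord_proj (block D i) v) (coord_proj (block D i) w)"

definition kaehler_product_base :: "('a, 's, 'l, 'd::finite, 'b::finite) admissible_data \<Rightarrow> ('b \<Rightarrow> real) \<Rightarrow> bool" where
  "kaehler_product_base D s \<longleftrightarrow>
     surj (blk D) \<and>
     (\<forall>i. complex_manifold (block D i) (fac D i) (fac_atlas D i) \<and>
          simply_connected_space (fac D i) \<and>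
          kaehler_metric (block D i) (fac_atlas D i) (fac_metric D i) \<and>
          (\<forall>c\<in>fac_atlas D i. \<forall>q\<in>snd c ` fst c.
             scalar_curvature (block D i) (fac_metric D i c) q = 2 * real (card (block D i)) * s i)) \<and>
     Hausdorff_space (base D) \<and> compact_space (base D) \<and>
     covering_projection (product_topology (fac D) UNIV) (base D) (cov D) \<and>
     (\<forall>b\<in>base_charts D. \<forall>b'\<in>base_charts D.
        let W = bcoord D b ` (bdom b \<inter> bdom b'); F = (\<lambda>w. bcoord D b' (binv D b w)) in
        holo_map UNIV W F \<and>
        (\<forall>i. \<forall>q\<in>W. \<forall>v w. base_metric D b' i (F q) (dirD F q v) (dirD F q w) = base_metric D b i q v w))"

definition hermitian_line_bundle :: "('a, 's, 'l, 'd::finite, 'b::finite) admissible_data \<Rightarrow> bool" where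
  "hermitian_line_bundle D \<longleftrightarrow>
     \<Union>(fst ` triv D) = topspace (base D) \<and>
     prj D ` tot D = topspace (base D) \<and>
     (\<forall>(U, f)\<in>triv D. openin (base D) U \<and>
        bij_betw (\<lambda>l. (prj D l, f l)) {l \<in> tot D. prj D l \<in> U} (U \<times> UNIV)) \<and>
     (\<forall>(U, f)\<in>triv D. \<forall>(V, f')\<in>triv D. \<exists>h.
        (\<forall>p\<in>U \<inter> V. h p \<noteq> 0) \<and>
        (\<forall>l\<in>tot D. prj D l \<in> U \<inter> V \<longrightarrow> f' l = h (prj D l) * f l) \<and>
        (\<forall>b\<in>base_charts D. holo_fun UNIV (bcoord D b ` (bdom b \<inter> U \<inter> V)) (\<lambda>w. h (binv D b w)))) \<and>
     (\<forall>(U, f)\<in>triv D. \<exists>r.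
        (\<forall>l\<in>tot D. prj D l \<in> U \<longrightarrow> hnorm D l = cmod (f l) * exp (r (prj D l))) \<and>
        (\<forall>b\<in>base_charts D. smooth_in UNIV (bcoord D b ` (bdom b \<inter> U)) (\<lambda>w. r (binv D b w))))"

text \<open>\<open>M = \<P>(\<O> \<oplus> \<L>)\<close> is \<open>\<L>\<close> together with a section at infinity: \<open>Inl l\<close> is the line \<open>[1 : l]\<close>,
  and \<open>Inr p\<close> is the line \<open>[0 : \<L>\<^sub>p]\<close>. So \<open>M\<^sup>0\<close> is \<open>\<L>\<close> minus its zero section, and functions
  on \<open>M\<^sup>0\<close> are functions of \<open>l\<close>.\<close>

definition proj_bundle :: "('a, 's, 'l, 'd::finite, 'b::finite) admissible_data \<Rightarrow> ('l + 's) set" where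
  "proj_bundle D = Inl ` tot D \<union> Inr ` topspace (base D)"

definition M0 :: "('a, 's, 'l, 'd::finite, 'b::finite) admissible_data \<Rightarrow> 'l set" where
  "M0 D = {l \<in> tot D. hnorm D l \<noteq> 0}"

text \<open>The fibre coordinate is \<open>\<zeta> = 1 / f\<close>, which vanishes on the section at infinity,
  so that \<open>\<theta> = J dy\<close> with \<open>y = - ln |l|\<close> and \<open>d\<theta> = \<Sum> \<omega>\<^sub>i\<close> makes \<open>\<L>\<close> positive; \<open>y\<close> is
  the fibre variable \<open>y\<^sub>c\<close>.\<close>

definition ylog :: "('a, 's, 'l, 'd::finite, 'b::finite) admissible_data \<Rightarrow> 'l \<Rightarrow> real" where
  "ylog D l = - ln (hnorm D l)"

text \<open>Charts over \<open>(b, U, f)\<close>. The function \<open>Y\<close> selects a complex structure on (part of) \<open>M\<^sup>0\<close>: its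
  holomorphic fibre coordinate is obtained by rescaling \<open>\<zeta>\<close> so that its logarithmic norm becomes
  \<open>Y\<close> instead of \<open>y\<close>. With \<open>Y = ylog D\<close> this is the given complex structure
  \<open>J\<^sub>c\<close>. If \<open>Y\<close> is an antiderivative of \<open>1 / \<Theta>\<close> composed with \<open>z\<close>, it is the one with
  \<open>J dz = \<Theta> \<theta>\<close>. The angular part, hence \<open>\<theta>\<close>, does not depend on \<open>Y\<close>.\<close>

type_synonym ('a, 's, 'l, 'd, 'b) bundle_chart = "('a, 's, 'd, 'b) base_chart \<times> 's set \<times> ('l \<Rightarrow> complex)"

definition bundle_charts :: "('a, 's, 'l, 'd::finite, 'b::finite) admissible_data \<Rightarrow> ('a, 's, 'l, 'd, 'b) bundle_chart set" where
  "bundle_charts D = {(b, U, f). b \<in> base_charts D \<and> (U, f) \<in> triv D \<and> bdom b \<subseteq> U}"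

definition cdom :: "('a, 's, 'l, 'd::finite, 'b::finite) admissible_data \<Rightarrow> ('a, 's, 'l, 'd, 'b) bundle_chart \<Rightarrow> 'l set" where
  "cdom D c = {l \<in> M0 D. prj D l \<in> bdom (fst c)}"

definition ccoord :: "('a, 's, 'l, 'd::finite, 'b::finite) admissible_data \<Rightarrow> ('l \<Rightarrow> real) \<Rightarrow> ('a, 's, 'l, 'd, 'b) bundle_chart \<Rightarrow> 'l \<Rightarrow> complex^('d option)" where
  "ccoord D Y c l = (\<chi> k. case k of
       None \<Rightarrow> of_real (exp (Y l - ylog D l)) / snd (snd c) l
     | Some a \<Rightarrow> bcoord D (fst c) (prj D l) $ a)"

definition in_chart :: "('a, 's, 'l, 'd::finite, 'b::finite) admissible_data \<Rightarrow> 'l set \<Rightarrow> ('l \<Rightarrow> real) \<Rightarrow> ('a, 's, 'l, 'd, 'b) bundle_chart \<Rightarrow> ('l \<Rightarrow> real) \<Rightarrow> complex^('d option) \<Rightarrow> real" where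
  "in_chart D P Y c f q = f (inv_into (P \<inter> cdom D c) (ccoord D Y c) q)"

definition base_part :: "complex^('d::finite option) \<Rightarrow> complex^'d" where
  "base_part v = (\<chi> a. v $ Some a)"

definition theta :: "('a, 's, 'l, 'd::finite, 'b::finite) admissible_data \<Rightarrow> 'l set \<Rightarrow> ('l \<Rightarrow> real) \<Rightarrow> ('a, 's, 'l, 'd, 'b) bundle_chart \<Rightarrow> complex^('d option) \<Rightarrow> complex^('d option) \<Rightarrow> real" where
  "theta D P Y c q v = - dirD (in_chart D P Y c Y) q (\<i> *s v)"

definition admissible_manifold :: "('a, 's, 'l, 'd::finite, 'b::finite) admissible_data \<Rightarrow> ('b \<Rightarrow> real) \<Rightarrow> bool" where
  "admissible_manifold D s \<longleftrightarrow>
     kaehler_product_base D s \<and> hermitian_line_bundle D \<and>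
     (\<forall>c\<in>bundle_charts D. \<forall>q\<in>ccoord D (ylog D) c ` cdom D c. \<forall>v w.
        let \<theta> = theta D (M0 D) (ylog D) c in
        dirD (\<lambda>p. \<theta> p w) q v - dirD (\<lambda>p. \<theta> p v) q w
          = (\<Sum>i\<in>UNIV. kform (base_metric D (fst c) i) (base_part q) (base_part v) (base_part w)))"

text \<open>The metric \<open>(*)\<close> on \<open>P\<close>, in the chart \<open>c\<close> of the complex structure given by \<open>Y\<close>.\<close>

definition adm_metric :: "('a, 's, 'l, 'd::finite, 'b::finite) admissible_data \<Rightarrow> ('b \<Rightarrow> real) \<Rightarrow> 'l set \<Rightarrow> ('l \<Rightarrow> real) \<Rightarrow> ('l \<Rightarrow> real) \<Rightarrow> (real \<Rightarrow> real) \<Rightarrow> ('a, 's, 'l, 'd, 'b) bundle_chart \<Rightarrow> ('d option) tensor" where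
  "adm_metric D x P Y z \<Theta> c q v w =
     (let zq = in_chart D P Y c z in
       (\<Sum>i\<in>UNIV. (1 + x i * zq q) / x i * base_metric D (fst c) i (base_part q) (base_part v) (base_part w))
       + dirD zq q v * dirD zq q w / \<Theta> (zq q)
       + \<Theta> (zq q) * theta D P Y c q v * theta D P Y c q w)"

definition adm_scal :: "('a, 's, 'l, 'd::finite, 'b::finite) admissible_data \<Rightarrow> ('b \<Rightarrow> real) \<Rightarrow> 'l set \<Rightarrow> ('l \<Rightarrow> real) \<Rightarrow> ('l \<Rightarrow> real) \<Rightarrow> (real \<Rightarrow> real) \<Rightarrow> 'l \<Rightarrow> real" where
  "adm_scal D x P Y z \<Theta> l =
     (let c = (SOME c. c \<in> bundle_charts D \<and> l \<in> cdom D c) in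
      scalar_curvature UNIV (adm_metric D x P Y z \<Theta> c) (ccoord D Y c l))"

definition u_can :: "real \<Rightarrow> real \<Rightarrow> real" where
  "u_can \<kappa> z = ((1 - z) * ln (1 - z) + (1 + z) * ln (1 + z)) / (2 * \<kappa>)"

definition potentials :: "real \<Rightarrow> (real \<Rightarrow> real) set" where
  "potentials \<kappa> = {u. continuous_on {-1..1} u \<and> (\<forall>z\<in>{-1<..<1}. deriv (deriv u) z > 0) \<and>
     smooth_on_line {-1..1} (\<lambda>z. u z - u_can \<kappa> z) \<and> u 0 = 0 \<and> deriv u 0 = 0}"

definition momentum :: "(real \<Rightarrow> real) \<Rightarrow> real \<Rightarrow> real" where
  "momentum u = the_inv_into {-1<..<1} (deriv u)"

definition legendre :: "(real \<Rightarrow> real) \<Rightarrow> real \<Rightarrow> real" where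
  "legendre u y = - u (momentum u y) + y * momentum u y"

definition zfun :: "('a, 's, 'l, 'd::finite, 'b::finite) admissible_data \<Rightarrow> (real \<Rightarrow> real) \<Rightarrow> 'l \<Rightarrow> real" where
  "zfun D u l = momentum u (ylog D l)"

text \<open>The metric of \<open>u\<close> in the fixed complex structure: \<open>J\<^sub>c\<close> satisfies \<open>y\<^sub>c = u'(z)\<close> for the moment map
  \<open>z = zfun D u\<close> of the metric of \<open>u\<close>.\<close>

definition metric_of :: "('a, 's, 'l, 'd::finite, 'b::finite) admissible_data \<Rightarrow> ('b \<Rightarrow> real) \<Rightarrow> (real \<Rightarrow> real) \<Rightarrow> ('a, 's, 'l, 'd, 'b) bundle_chart \<Rightarrow> ('d option) tensor" where
  "metric_of D x u = adm_metric D x (M0 D) (ylog D) (zfun D u) (\<lambda>z. 1 / deriv (deriv u) z)"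

definition scal_of :: "('a, 's, 'l, 'd::finite, 'b::finite) admissible_data \<Rightarrow> ('b \<Rightarrow> real) \<Rightarrow> (real \<Rightarrow> real) \<Rightarrow> 'l \<Rightarrow> real" where
  "scal_of D x u = adm_scal D x (M0 D) (ylog D) (zfun D u) (\<lambda>z. 1 / deriv (deriv u) z)"

text \<open>\<open>\<nu>\<close> is the Riemannian volume measure of the metric of \<open>u\<close> on \<open>M\<^sup>0\<close> (the two sections removed
  from \<open>M\<close> are null sets). It is determined uniquely by this property.\<close>

definition volume_measure :: "('a, 's, 'l, 'd::finite, 'b::finite) admissible_data \<Rightarrow> ('b \<Rightarrow> real) \<Rightarrow> (real \<Rightarrow> real) \<Rightarrow> 'l measure \<Rightarrow> bool" where
  "volume_measure D x u \<nu> \<longleftrightarrow>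
     space \<nu> = M0 D \<and>
     sets \<nu> = {A. A \<subseteq> M0 D \<and> (\<forall>c\<in>bundle_charts D. ccoord D (ylog D) c ` (A \<inter> cdom D c) \<in> sets borel)} \<and>
     (\<forall>c\<in>bundle_charts D. \<forall>A\<in>sets \<nu>. A \<subseteq> cdom D c \<longrightarrow>
        emeasure \<nu> A = (\<integral>\<^sup>+ q \<in> ccoord D (ylog D) c ` A. ennreal (vol_density UNIV (metric_of D x u c) q) \<partial>lborel))"

text \<open>Killing potentials are the real functions whose gradient \<open>G\<close> is such that \<open>J G\<close> is a Killing field;
  they are taken to be square integrable.\<close>

definition killing_potentials :: "('a, 's, 'l, 'd::finite, 'b::finite) admissible_data \<Rightarrow> ('b \<Rightarrow> real) \<Rightarrow> (real \<Rightarrow> real) \<Rightarrow> 'l measure \<Rightarrow> ('l \<Rightarrow> real) set" where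
  "killing_potentials D x u \<nu> = {f. integrable \<nu> (\<lambda>l. (f l)\<^sup>2) \<and>
     (\<forall>c\<in>bundle_charts D.
        let W = ccoord D (ylog D) c ` cdom D c; fq = in_chart D (M0 D) (ylog D) c f; g = metric_of D x u c in
        smooth_in UNIV W fq \<and>
        (\<exists>G. is_gradient W g fq G \<and> killing_field W g (\<lambda>q. \<i> *s G q)))}"

definition pr_perp_scal :: "('a, 's, 'l, 'd::finite, 'b::finite) admissible_data \<Rightarrow> ('b \<Rightarrow> real) \<Rightarrow> (real \<Rightarrow> real) \<Rightarrow> 'l measure \<Rightarrow> 'l \<Rightarrow> real" where
  "pr_perp_scal D x u \<nu> l = scal_of D x u l -
     (SOME p. p \<in> killing_potentials D x u \<nu> \<and>
        (\<forall>f\<in>killing_potentials D x u \<nu>. (\<integral>m. (scal_of D x u m - p m) * f m \<partial>\<nu>) = 0)) l"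

definition modified_calabi_energy :: "('a, 's, 'l, 'd::finite, 'b::finite) admissible_data \<Rightarrow> ('b \<Rightarrow> real) \<Rightarrow> (real \<Rightarrow> real) \<Rightarrow> 'l measure \<Rightarrow> real" where
  "modified_calabi_energy D x u \<nu> = (\<integral>l. (pr_perp_scal D x u \<nu> l)\<^sup>2 \<partial>\<nu>)"

definition kpot :: "('a, 's, 'l, 'd::finite, 'b::finite) admissible_data \<Rightarrow> real \<Rightarrow> (real \<Rightarrow> real) \<Rightarrow> 'l \<Rightarrow> real" where
  "kpot D \<kappa> u l = legendre u (ylog D l) - legendre (u_can \<kappa>) (ylog D l)"

text \<open>\<open>\<omega>\<^sup>n = n! dV\<close> with \<open>n = CARD('d option) = dim M\<close>. The argument \<open>U\<close> is a path of symplectic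
  potentials and \<open>vol\<close> gives the volume measures of the corresponding metrics.\<close>

definition K_energy_along :: "('a, 's, 'l, 'd::finite, 'b::finite) admissible_data \<Rightarrow> ('b \<Rightarrow> real) \<Rightarrow> real \<Rightarrow> ((real \<Rightarrow> real) \<Rightarrow> 'l measure) \<Rightarrow> (real \<Rightarrow> real \<Rightarrow> real) \<Rightarrow> real" where
  "K_energy_along D x \<kappa> vol U =
     - integral {0..1} (\<lambda>t.
         \<integral>l. vector_derivative (\<lambda>t. kpot D \<kappa> (U t) l) (at t within {0..1})
              * pr_perp_scal D x (U t) (vol (U t)) l * fact (CARD('d option)) \<partial>(vol (U t)))"

text \<open>The value does not depend on the path from \<open>0\<close> to the Kaehler potential \<open>kpot D \<kappa> u\<close>; the one used
  is given by the segment from \<open>u_can \<kappa>\<close> to \<open>u\<close> in the convex set \<open>potentials \<kappa>\<close>.\<close>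

definition modified_K_energy :: "('a, 's, 'l, 'd::finite, 'b::finite) admissible_data \<Rightarrow> ('b \<Rightarrow> real) \<Rightarrow> real \<Rightarrow> ((real \<Rightarrow> real) \<Rightarrow> 'l measure) \<Rightarrow> (real \<Rightarrow> real) \<Rightarrow> real" where
  "modified_K_energy D x \<kappa> vol u = K_energy_along D x \<kappa> vol (\<lambda>t z. (1 - t) * u_can \<kappa> z + t * u z)"

definition p_c :: "('a, 's, 'l, 'd::finite, 'b::finite) admissible_data \<Rightarrow> ('b \<Rightarrow> real) \<Rightarrow> real \<Rightarrow> real" where
  "p_c D x z = (\<Prod>i\<in>UNIV. (1 + x i * z) ^ card (block D i))"

definition base_scal :: "('a, 's, 'l, 'd::finite, 'b::finite) admissible_data \<Rightarrow> ('b \<Rightarrow> real) \<Rightarrow> ('b \<Rightarrow> real) \<Rightarrow> real \<Rightarrow> real" where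
  "base_scal D x s z = (\<Sum>i\<in>UNIV. real (card (block D i)) * s i * x i / (1 + x i * z))"

definition alpha_c :: "('a, 's, 'l, 'd::finite, 'b::finite) admissible_data \<Rightarrow> ('b \<Rightarrow> real) \<Rightarrow> nat \<Rightarrow> real" where
  "alpha_c D x r = integral {-1..1} (\<lambda>t. p_c D x t * t ^ r)"

definition beta_c :: "('a, 's, 'l, 'd::finite, 'b::finite) admissible_data \<Rightarrow> ('b \<Rightarrow> real) \<Rightarrow> ('b \<Rightarrow> real) \<Rightarrow> real \<Rightarrow> nat \<Rightarrow> real" where
  "beta_c D x s \<kappa> r = \<kappa> * p_c D x 1 + (-1) ^ r * \<kappa> * p_c D x (-1)
     + integral {-1..1} (\<lambda>t. base_scal D x s t * p_c D x t * t ^ r)"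

definition extremal_polynomial :: "('a, 's, 'l, 'd::finite, 'b::finite) admissible_data \<Rightarrow> ('b \<Rightarrow> real) \<Rightarrow> ('b \<Rightarrow> real) \<Rightarrow> real \<Rightarrow> real poly \<Rightarrow> bool" where
  "extremal_polynomial D x s \<kappa> F \<longleftrightarrow>
     (\<exists>A B. A * alpha_c D x 1 + B * alpha_c D x 0 = - 2 * beta_c D x s \<kappa> 0 \<and>
            A * alpha_c D x 2 + B * alpha_c D x 1 = - 2 * beta_c D x s \<kappa> 1 \<and>
            poly F (-1) = 0 \<and> poly F 1 = 0 \<and>
            (\<forall>z\<in>{-1..1}. poly (pderiv (pderiv F)) z = (A * z + B + 2 * base_scal D x s z) * p_c D x z))"

text \<open>The fixed moment map \<open>z\<close> on all of \<open>M\<close>; it is \<open>1\<close> on the zero section of \<open>\<L>\<close> and \<open>-1\<close> on the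
  section at infinity.\<close>

definition zM :: "('a, 's, 'l, 'd::finite, 'b::finite) admissible_data \<Rightarrow> real \<Rightarrow> 'l + 's \<Rightarrow> real" where
  "zM D \<kappa> m = (case m of
       Inl l \<Rightarrow> if hnorm D l = 0 then 1 else zfun D (u_can \<kappa>) l
     | Inr p \<Rightarrow> - 1)"

definition zpart :: "('a, 's, 'l, 'd::finite, 'b::finite) admissible_data \<Rightarrow> real \<Rightarrow> real \<Rightarrow> real \<Rightarrow> ('l + 's) set" where
  "zpart D \<kappa> a b = {m \<in> proj_bundle D. zM D \<kappa> m \<in> {a<..<b}}"

text \<open>The metric \<open>(*)\<close> with profile \<open>\<Theta>\<close> on \<open>z\<^sup>-\<^sup>1((a, b))\<close> is extremal; \<open>z\<close> and \<open>\<theta>\<close> are fixed, and the complex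
  structure, given by \<open>J dz = \<Theta> \<theta>\<close>, depends on \<open>\<Theta>\<close>.\<close>

definition adm_extremal_on :: "('a, 's, 'l, 'd::finite, 'b::finite) admissible_data \<Rightarrow> ('b \<Rightarrow> real) \<Rightarrow> real \<Rightarrow> real \<Rightarrow> real \<Rightarrow> (real \<Rightarrow> real) \<Rightarrow> bool" where
  "adm_extremal_on D x \<kappa> a b \<Theta> \<longleftrightarrow>
     smooth_on_line {a<..<b} \<Theta> \<and> (\<forall>z\<in>{a<..<b}. \<Theta> z > 0) \<and>
     (\<exists>V A B. (\<forall>z\<in>{a<..<b}. (V has_real_derivative 1 / \<Theta> z) (at z)) \<and>
        (let P = Inl -` zpart D \<kappa> a b; z = zfun D (u_can \<kappa>) in
         \<forall>l\<in>P. adm_scal D x P (\<lambda>l. V (z l)) z \<Theta> l = A * z l + B))"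

text \<open>The metric \<open>E dz\<^sup>2 + G \<theta>\<^sup>2\<close> over the interval \<open>I\<close> has a generalized cusp at the end \<open>e\<close>; \<open>z = \<psi> s\<close> is
  the change of variable, with derivative \<open>\<psi>'\<close>.\<close>

definition generalized_cusp :: "(real \<Rightarrow> real) \<Rightarrow> (real \<Rightarrow> real) \<Rightarrow> real set \<Rightarrow> real \<Rightarrow> bool" where
  "generalized_cusp E G I e \<longleftrightarrow>
     (\<exists>k::nat. k \<ge> 1 \<and> (\<exists>s0>0. \<exists>\<psi> \<psi>' \<rho>1 \<rho>2.
        smooth_on_line {0<..s0} \<psi> \<and> inj_on \<psi> {0<..s0} \<and> \<psi> ` {0<..s0} \<subseteq> I \<and>
        (\<psi> \<longlongrightarrow> e) (at_right 0) \<and>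
        (\<forall>s\<in>{0<..s0}. (\<psi> has_real_derivative \<psi>' s) (at s within {0<..s0})) \<and>
        smooth_on_line {0..s0} \<rho>1 \<and> smooth_on_line {0..s0} \<rho>2 \<and>
        (\<forall>s\<in>{0..s0}. \<rho>1 s > 0 \<and> \<rho>2 s > 0) \<and>
        (\<forall>s\<in>{0<..s0}. E (\<psi> s) * (\<psi>' s)\<^sup>2 = \<rho>1 s / s ^ k \<and> G (\<psi> s) = \<rho>2 s * s ^ k)))"

end

theory Submission
 imports Defs
begin

text \<open>For the metric with symplectic potential \<open>u\<close> put \<open>F\<^sub>u = p\<^sub>c / u''\<close>. In bundle charts the metric is a block
diagonal Hermitian matrix bordered by the fibre direction; this gives the volume density and the scalar
curvature \<open>2 \<Sum> d\<^sub>i s\<^sub>i x\<^sub>i / (1 + x\<^sub>i z) - F\<^sub>u'' / p\<^sub>c\<close>, and shows that the volume measure pushes forward under \<open>z\<close> to a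
multiple of \<open>p\<^sub>c dz\<close> independent of \<open>u\<close>. The average of a Killing potential over the circles in a fibre is affine in
\<open>z\<close>, so the projected scalar curvature is \<open>(F'' - F\<^sub>u'') / p\<^sub>c\<close> with \<open>F\<close> the extremal polynomial. Integrating by parts
twice, with \<open>q = \<kappa> (1 - z\<^sup>2) u''\<close> the K-energy becomes a multiple of the integral of \<open>F (q - 1) / (\<kappa> (1 - z\<^sup>2)) - p\<^sub>c ln q\<close>: it is
bounded below for \<open>F >= 0\<close>, while a potential with large \<open>u''\<close> where \<open>F < 0\<close> makes it arbitrarily negative. The
Calabi energy is a weighted \<open>L\<^sup>2\<close>-norm of \<open>(F - F\<^sub>u)''\<close>, and the functions \<open>F\<^sub>u\<close> are the positive ones with the
boundary values and slopes of \<open>F\<close>, so it can be made small exactly when \<open>F >= 0\<close>. Between consecutive roots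
\<open>\<Theta> = F / p\<^sub>c\<close> is extremal, and a root of order \<open>k\<close> is a cusp with exponent \<open>k\<close>.\<close>

text \<open>Along a segment of potentials \<open>q\<close> moves linearly, so the K-energy can be
  integrated in closed form, and for fixed z its integrand is convex in \<open>q\<close>; the
  pointwise minimum contains \<open>ln F\<close>, which is integrable because F is a polynomial. The
  geometric obstacle is that a metric lives in a complex structure that may vary with its profile.
  In the fibre coordinate adapted to a given \<open>Y\<close>, however, \<open>Y\<close> is always
  \<open>ln |\<zeta>| - rho\<close> with \<open>rho\<close> a function on the base, its Levi form is
  the sum of the base metrics, and z is a function \<open>Z\<close> of \<open>Y\<close> with
  \<open>Z' = \<Theta>(Z)\<close>. One chart computation therefore serves both the metrics in the
  fixed complex structure and the extremal metrics on the parts. The Killing potentials are not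
  classified: orthogonality to all of them follows from orthogonality to 1 and z, because every
  circle average is affine in z and the volume density is invariant under rotation of the
  fibres.\<close>

lemmas real_deriv_vec = has_real_derivative_iff_has_vector_derivative

abbreviation pderiv2 :: "real poly => real poly" where "pderiv2 F \<equiv> pderiv (pderiv F)"

section \<open>Smooth functions on the line\<close>

text \<open>\<open>smooth_on_line\<close> demands the whole tower of derivatives at once. A set of
  functions in which each member has a derivative again in the set yields the tower by iterating a
  choice function, so smoothness becomes a closure check.\<close>

lemma smooth_line_coinduct:
 assumes step: "!!f. f : S ==> \<exists>f'\<in>S. \<forall>x\<in>I. (f has_real_derivative f' x) (at x within I)" and "f : S"
 shows "smooth_on_line I f"
proof -
 define nxt where "nxt f = (SOME f'. f' : S & (\<forall>x\<in>I. (f has_real_derivative f' x) (at x within I)))" for f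
 have nxt: "nxt f : S & (\<forall>x\<in>I. (f has_real_derivative nxt f x) (at x within I))" if "f : S" for f
 proof -
  have "\<exists>f'. f' : S & (\<forall>x\<in>I. (f has_real_derivative f' x) (at x within I))" using step[OF that] by blast
  from someI_ex[OF this] show ?thesis unfolding nxt_def .
 qed
 have mem: "(nxt ^^ n) f : S" for n by (induction n) (use assms(2) nxt in auto)
 show ?thesis unfolding smooth_on_line_def by (rule exI[of _ "%n. (nxt ^^ n) f"]) (use nxt[OF mem] in auto)
qed

lemma smooth_line_derivE:
 assumes "smooth_on_line I f"
 obtains f' where "smooth_on_line I f'" "!!x. x : I ==> (f has_real_derivative f' x) (at x within I)"
proof -
 obtain Df where D: "\<forall>x\<in>I. Df 0 x = f x" "\<forall>n. \<forall>x\<in>I. (Df n has_real_derivative Df (Suc n) x) (at x within I)"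
  using assms unfolding smooth_on_line_def by blast
 have "(f has_real_derivative Df 1 x) (at x within I)" if "x : I" for x
  by (rule has_field_derivative_transform_within[of "Df 0" _ _ _ 1]) (use D(2)[rule_format, OF that, of 0] D(1) that in auto)
 moreover have "smooth_on_line I (Df 1)"
  unfolding smooth_on_line_def by (rule exI[of _ "%n. Df (Suc n)"]) (use D in auto)
 ultimately show thesis using that by blast
qed

lemma smooth_line_cong: "smooth_on_line I f ==> (!!x. x : I ==> f x = g x) ==> smooth_on_line I g"
 unfolding smooth_on_line_def by metis

lemma smooth_line_subset: "smooth_on_line I f ==> J \<subseteq> I ==> smooth_on_line J f"
 unfolding smooth_on_line_def by (meson DERIV_subset subsetD)

text \<open>Derivatives of products and reciprocals mix the functions with their derivatives, so the
  invariant set for \<open>smooth_line_coinduct\<close> is the whole algebra generated by the smooth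
  functions.\<close>

inductive_set smooth_alg :: "real set => (real => real) set" for I where base: "smooth_on_line I f ==> f : smooth_alg I"
| add: "f : smooth_alg I ==> g : smooth_alg I ==> (%x. f x + g x) : smooth_alg I"
| mult: "f : smooth_alg I ==> g : smooth_alg I ==> (%x. f x * g x) : smooth_alg I"
| inv: "f : smooth_alg I ==> (!!x. x : I ==> f x ~= 0) ==> (%x. inverse (f x)) : smooth_alg I"

lemma smooth_line_linear: "smooth_on_line I (%x. a * x + b)"
proof (rule smooth_line_coinduct[of "{%x. a * x + b |a b. True}"])
 fix f :: "real => real" assume "f : {%x. a * x + b |a b. True}"
 then obtain a b where f: "f = (%x. a * x + b)" by auto
 have "\<forall>x\<in>I. (f has_real_derivative 0 * x + a) (at x within I)" unfolding f by (auto intro!: derivative_eq_intros)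
 thus "\<exists>f'\<in>{%x. a * x + b |a b. True}. \<forall>x\<in>I. (f has_real_derivative f' x) (at x within I)"
  by (intro bexI[of _ "%x. 0 * x + a"]) blast+
qed blast

lemma smooth_line_const: "smooth_on_line I (%x. b)" using smooth_line_linear[of I 0 b] by simp

lemma smooth_alg_smooth: "f : smooth_alg I ==> smooth_on_line I f"
proof (rule smooth_line_coinduct)
 fix f assume "f : smooth_alg I"
 thus "\<exists>f'\<in>smooth_alg I. \<forall>x\<in>I. (f has_real_derivative f' x) (at x within I)"
 proof induction
  case (base f)
  thus ?case using smooth_line_derivE smooth_alg.base by metis
 next
  case (add f g)
  then obtain f' g' where *: "f' : smooth_alg I" "g' : smooth_alg I"
   "\<forall>x\<in>I. (f has_real_derivative f' x) (at x within I)" "\<forall>x\<in>I. (g has_real_derivative g' x) (at x within I)" by blast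
  show ?case by (rule bexI[of _ "%x. f' x + g' x"]) (use * in \<open>auto intro!: derivative_eq_intros smooth_alg.add\<close>)
 next
  case (mult f g)
  then obtain f' g' where *: "f' : smooth_alg I" "g' : smooth_alg I"
   "\<forall>x\<in>I. (f has_real_derivative f' x) (at x within I)" "\<forall>x\<in>I. (g has_real_derivative g' x) (at x within I)" by blast
  show ?case
  proof (rule bexI[of _ "%x. f' x * g x + f x * g' x"])
   show "(%x. f' x * g x + f x * g' x) : smooth_alg I" using * mult by (intro smooth_alg.add smooth_alg.mult)
  qed (use * in \<open>auto intro!: derivative_eq_intros\<close>)
 next
  case (inv f)
  then obtain f' where *: "f' : smooth_alg I" "\<forall>x\<in>I. (f has_real_derivative f' x) (at x within I)" by blast
  show ?case
  proof (rule bexI[of _ "%x. (- 1) * (inverse (f x) * (f' x * inverse (f x)))"])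
   show "(%x. (- 1) * (inverse (f x) * (f' x * inverse (f x)))) : smooth_alg I"
    using * inv by (intro smooth_alg.mult smooth_alg.inv smooth_alg.base[OF smooth_line_const])
  qed (use * inv in \<open>auto intro!: derivative_eq_intros\<close>)
 qed
qed

lemma smooth_line_add: "smooth_on_line I f ==> smooth_on_line I g ==> smooth_on_line I (%x. f x + g x)"
 and smooth_line_mult: "smooth_on_line I f ==> smooth_on_line I g ==> smooth_on_line I (%x. f x * g x)"
 and smooth_line_inverse: "smooth_on_line I f ==> (!!x. x : I ==> f x ~= 0) ==> smooth_on_line I (%x. inverse (f x))"
 by (auto intro: smooth_alg_smooth smooth_alg.intros)

lemma smooth_line_divide: "smooth_on_line I f ==> smooth_on_line I g ==> (!!x. x : I ==> g x ~= 0) ==> smooth_on_line I (%x. f x / g x)"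
 unfolding divide_inverse by (intro smooth_line_mult smooth_line_inverse) auto

lemma smooth_line_poly: "smooth_on_line I (poly p)"
 by (rule smooth_line_coinduct[of "range poly"]) (auto intro!: DERIV_subset[OF poly_DERIV])

lemma smooth_line_ident: "smooth_on_line I (%x. x)" using smooth_line_linear[of I 1 0] by simp

lemma smooth_line_continuous: "smooth_on_line I f ==> continuous_on I f"
 by (metis DERIV_continuous_on smooth_line_derivE)

lemma smooth_line_antideriv:
 assumes "smooth_on_line {a..b::real} f" "c : {a..b}"
 obtains g where "smooth_on_line {a..b} g" "g c = 0"
  "!!x. x : {a..b} ==> (g has_real_derivative f x) (at x within {a..b})"
proof -
 have cf: "continuous_on {a..b} f" using assms smooth_line_continuous by blast
 define g where "g x = integral {a..x} f - integral {a..c} f" for x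
 have D: "(g has_real_derivative f x) (at x within {a..b})" if "x : {a..b}" for x unfolding g_def
  using integral_has_vector_derivative[OF cf that] real_deriv_vec by (auto intro!: derivative_eq_intros)
 \<comment> \<open>It suffices to add \<open>g\<close> itself to the smooth functions: its
   derivative \<open>f\<close> is already one of them.\<close>
 have "smooth_on_line {a..b} g"
 proof (rule smooth_line_coinduct[of "insert g {f. smooth_on_line {a..b} f}"])
  fix h assume h: "h : insert g {f. smooth_on_line {a..b} f}"
  show "\<exists>f'\<in>insert g {f. smooth_on_line {a..b} f}. \<forall>x\<in>{a..b}. (h has_real_derivative f' x) (at x within {a..b})"
  proof (cases "h = g")
   case True
   thus ?thesis using D assms(1) by blast
  next
   case False
   hence "smooth_on_line {a..b} h" using h by blast
   then obtain f' where "smooth_on_line {a..b} f'" "!!x. x : {a..b} ==> (h has_real_derivative f' x) (at x within {a..b})"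
    using smooth_line_derivE by blast
   thus ?thesis by blast
  qed
 qed simp
 thus thesis using that D by (simp add: g_def)
qed

text \<open>Since \<open>Z\<close> solves the autonomous equation \<open>Z' = \<Theta>(Z)\<close>,
  the derivative of \<open>G(Z)\<close> is \<open>(G' \<Theta>)(Z)\<close>, again a smooth function
  composed with \<open>Z\<close>; the set of such composites is closed under
  differentiation.\<close>

lemma smooth_line_compose_flow:
 assumes J: "open J" and I: "open I" and Z: "!!y. y : J ==> Z y : I" "!!y. y : J ==> (Z has_real_derivative \<Theta> (Z y)) (at y)"
  and "smooth_on_line I \<Theta>" "smooth_on_line I G"
 shows "smooth_on_line J (%y. G (Z y))"
proof (rule smooth_line_coinduct[of "{%y. G (Z y) |G. smooth_on_line I G}"])
 fix f assume "f : {%y. G (Z y) |G. smooth_on_line I G}"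
 then obtain G where G: "smooth_on_line I G" "f = (%y. G (Z y))" by auto
 obtain G' where G': "smooth_on_line I G'" "!!x. x : I ==> (G has_real_derivative G' x) (at x within I)"
  using smooth_line_derivE[OF G(1)] by blast
 have "(f has_real_derivative G' (Z y) * \<Theta> (Z y)) (at y within J)" if "y : J" for y
 proof -
  have "(G has_real_derivative G' (Z y)) (at (Z y))"
   using G'(2)[OF Z(1)[OF that]] at_within_open[OF Z(1)[OF that] I] by simp
  hence "(f has_real_derivative G' (Z y) * \<Theta> (Z y)) (at y)" unfolding G(2) by (rule DERIV_chain2) (rule Z(2)[OF that])
  thus ?thesis by (rule DERIV_subset) simp
 qed
 moreover have "smooth_on_line I (%x. G' x * \<Theta> x)" using G'(1) assms(5) by (rule smooth_line_mult)
 ultimately show "\<exists>f'\<in>{%y. G (Z y) |G. smooth_on_line I G}. \<forall>y\<in>J. (f has_real_derivative f' y) (at y within J)"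
  by (intro bexI[of _ "%y. G' (Z y) * \<Theta> (Z y)"]) auto
qed (use assms in auto)

lemma smooth_line_ln:
 assumes "open I" "smooth_on_line I f" "!!x. x : I ==> f x > 0"
 shows "smooth_on_line I (%x. ln (f x))"
proof (rule smooth_line_coinduct[of "insert (%x. ln (f x)) {f. smooth_on_line I f}"])
 fix g assume g: "g : insert (%x. ln (f x)) {f. smooth_on_line I f}"
 show "\<exists>f'\<in>insert (%x. ln (f x)) {f. smooth_on_line I f}. \<forall>x\<in>I. (g has_real_derivative f' x) (at x within I)"
 proof (cases "smooth_on_line I g")
  case True
  thus ?thesis by (auto elim: smooth_line_derivE)
 next
  case False
  hence g: "g = (%x. ln (f x))" using g by auto
  obtain f' where f': "smooth_on_line I f'" "!!x. x : I ==> (f has_real_derivative f' x) (at x within I)"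
   using smooth_line_derivE[OF assms(2)] by blast
  have "smooth_on_line I (%x. f' x / f x)" using f' assms by (intro smooth_line_divide) force+
  moreover have "(g has_real_derivative f' x / f x) (at x within I)" if "x : I" for x
   unfolding g using f'(2)[OF that] assms(3)[OF that] by (auto intro!: derivative_eq_intros)
  ultimately show ?thesis by auto
 qed
qed simp

section \<open>Symplectic potentials\<close>

abbreviation "du_can \<kappa> z \<equiv> (ln (1 + z) - ln (1 - z)) / (2 * \<kappa> :: real)"

abbreviation "ddu_can \<kappa> z \<equiv> 1 / (\<kappa> * (1 - z\<^sup>2)) :: real"

lemma u_can_deriv:
 assumes "\<kappa> > 0" "abs z < 1"
 shows "(u_can \<kappa> has_real_derivative du_can \<kappa> z) (at z)"
proof -
 have p: "1 + z > 0" "1 - z > 0" using assms by (auto simp: abs_less_iff)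
 have "((%z. (1 - z) * ln (1 - z)) has_real_derivative - ln (1 - z) - 1) (at z)"
  using p by (auto intro!: derivative_eq_intros)
 moreover have "((%z. (1 + z) * ln (1 + z)) has_real_derivative ln (1 + z) + 1) (at z)"
  using p by (auto intro!: derivative_eq_intros)
 ultimately have "((%z. (1 - z) * ln (1 - z) + (1 + z) * ln (1 + z)) has_real_derivative (- ln (1 - z) - 1) + (ln (1 + z) + 1)) (at z)"
  by (rule DERIV_add)
 from DERIV_cdivide[OF this, of "2 * \<kappa>"] show ?thesis unfolding u_can_def by simp
qed

lemma u_can_deriv2:
 assumes "\<kappa> > 0" "abs z < 1"
 shows "((%z. du_can \<kappa> z) has_real_derivative ddu_can \<kappa> z) (at z)"
proof -
 have "1 + z > 0" "1 - z > 0" using assms by (auto simp: abs_less_iff)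
 have "1 - z\<^sup>2 = (1 + z) * (1 - z)" by (simp add: power2_eq_square algebra_simps)
 moreover have "1 / (1 + z) + 1 / (1 - z) = 2 / ((1 + z) * (1 - z))"
  using \<open>1 + z > 0\<close> \<open>1 - z > 0\<close> by (simp add: divide_simps)
 ultimately have "(1 / (1 + z) + 1 / (1 - z)) / (2 * \<kappa>) = ddu_can \<kappa> z" using assms by simp
 moreover have "((%z. ln (1 + z) - ln (1 - z)) has_real_derivative 1 / (1 + z) + 1 / (1 - z)) (at z)"
  using \<open>1 + z > 0\<close> \<open>1 - z > 0\<close> by (auto intro!: derivative_eq_intros)
 note DERIV_cdivide[OF this, of "2 * \<kappa>"]
 ultimately show ?thesis by simp
qed

text \<open>The absolute value lets one statement serve both the endpoint behaviour of
  \<open>u_can\<close> and the antiderivative of \<open>ln |z - r|\<close> on either side of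
  \<open>r\<close>. At 0 the bound \<open>y |ln y| <= 2 sqrt y\<close> comes from
  \<open>ln t <= t\<close> at \<open>t = 1 / sqrt y\<close>.\<close>

lemma continuous_on_x_ln_abs: "continuous_on UNIV (%x::real. x * ln \<bar>x\<bar>)"
proof -
 have "isCont (%x::real. x * ln \<bar>x\<bar>) x" for x
 proof (cases "x = 0")
  case True
  have "((%x::real. x * ln \<bar>x\<bar>) \<longlongrightarrow> 0) (at 0)"
  proof (rule Lim_null_comparison)
   have "((%x::real. 2 * sqrt \<bar>x\<bar>) \<longlongrightarrow> 2 * sqrt \<bar>0\<bar>) (at 0)" by (intro tendsto_intros)
   thus "((%x::real. 2 * sqrt \<bar>x\<bar>) \<longlongrightarrow> 0) (at 0)" by simp
   have "y * (- ln y) <= 2 * sqrt y" "ln y <= 0" if "0 < y" "y < 1" for y :: real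
   proof -
    have "- ln y = 2 * ln (1 / sqrt y)" using that by (simp add: ln_div ln_sqrt)
    also have "... <= 2 * (1 / sqrt y)" using ln_bound[of "1 / sqrt y"] that by simp
    finally have "y * (- ln y) <= y * (2 * (1 / sqrt y))" using that by (intro mult_left_mono) auto
    also have "... = 2 * (y / sqrt y)" by simp
    also have "y / sqrt y = sqrt y" using that by (intro real_div_sqrt) simp
    finally show "y * (- ln y) <= 2 * sqrt y" .
    show "ln y <= 0" using that by simp
   qed
   hence "norm (y * ln \<bar>y\<bar>) <= 2 * sqrt \<bar>y\<bar>" if "y ~= 0" "\<bar>y\<bar> < 1" for y :: real
    using that by (simp add: abs_mult abs_of_nonpos)
   thus "\<forall>\<^sub>F x in at 0. norm (x * ln \<bar>x\<bar>) <= 2 * sqrt \<bar>x\<bar>"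
    unfolding eventually_at by (intro exI[of _ 1]) (auto simp: dist_real_def)
  qed
  thus ?thesis using True by (simp add: isCont_def)
 next
  case False
  thus ?thesis by (intro continuous_intros) auto
 qed
 thus ?thesis by (simp add: continuous_at_imp_continuous_on)
qed

lemma continuous_u_can:
 assumes "\<kappa> > 0" shows "continuous_on {-1..1} (u_can \<kappa>)"
proof -
 have xlnx: "continuous_on {0..} (%x::real. x * ln x)"
  using continuous_on_subset[OF continuous_on_x_ln_abs, of "{0..}"] by (rule continuous_on_eq) auto
 have "continuous_on {-1..1} (%z::real. (1 - z) * ln (1 - z))"
  by (rule continuous_on_compose2[OF xlnx]) (auto intro!: continuous_intros)
 moreover have "continuous_on {-1..1} (%z::real. (1 + z) * ln (1 + z))"
  by (rule continuous_on_compose2[OF xlnx]) (auto intro!: continuous_intros)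
 ultimately have "continuous_on {-1..1} (%z::real. (1 - z) * ln (1 - z) + (1 + z) * ln (1 + z))"
  by (rule continuous_on_add)
 hence "continuous_on {-1..1} (%z. ((1 - z) * ln (1 - z) + (1 + z) * ln (1 + z)) / (2 * \<kappa>))"
  by (rule continuous_on_divide[OF _ continuous_on_const]) (use assms in auto)
 moreover have "u_can \<kappa> = (%z. ((1 - z) * ln (1 - z) + (1 + z) * ln (1 + z)) / (2 * \<kappa>))" by (auto simp: u_can_def)
 ultimately show ?thesis by simp
qed

lemma deriv_Icc_interior:
 fixes f :: "real => real"
 assumes "(f has_real_derivative d) (at x within {a..b})" "a < x" "x < b"
 shows "(f has_real_derivative d) (at x)" using assms at_within_Icc_at[of a x b] by simp

lemma deriv_interior_cong:
 fixes f g :: "real => real"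
 assumes "(f has_real_derivative d) (at x)" "a < x" "x < b" "!!z. a < z ==> z < b ==> f z = g z"
 shows "(g has_real_derivative d) (at x)"
 by (rule has_field_derivative_transform_within_open[OF assms(1), of "{a<..<b}"]) (use assms in auto)

text \<open>A potential is handled as the explicit singular part \<open>u_can\<close> plus a
  function smooth up to the ends; \<open>w1\<close> and \<open>w2\<close> are the first two
  derivatives of that function, hence bounded on the closed interval.\<close>

lemma potentialsE:
 assumes "u : potentials \<kappa>" "\<kappa> > 0"
 obtains w1 w2 where "smooth_on_line {-1..1} w1" "smooth_on_line {-1..1} w2"
  "!!z. z : {-1..1} ==> ((%z. u z - u_can \<kappa> z) has_real_derivative w1 z) (at z within {-1..1})"
  "!!z. z : {-1..1} ==> (w1 has_real_derivative w2 z) (at z within {-1..1})"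
  "!!z. abs z < 1 ==> (u has_real_derivative du_can \<kappa> z + w1 z) (at z)" "!!z. abs z < 1 ==> deriv u z = du_can \<kappa> z + w1 z"
  "!!z. abs z < 1 ==> (deriv u has_real_derivative ddu_can \<kappa> z + w2 z) (at z)"
  "!!z. abs z < 1 ==> deriv (deriv u) z = ddu_can \<kappa> z + w2 z"
proof -
 have sm: "smooth_on_line {-1..1} (%z. u z - u_can \<kappa> z)" using assms by (simp add: potentials_def)
 obtain w1 where w1: "smooth_on_line {-1..1} w1"
  "!!z. z : {-1..1} ==> ((%z. u z - u_can \<kappa> z) has_real_derivative w1 z) (at z within {-1..1})"
  using smooth_line_derivE[OF sm] by blast
 obtain w2 where w2: "smooth_on_line {-1..1} w2" "!!z. z : {-1..1} ==> (w1 has_real_derivative w2 z) (at z within {-1..1})"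
  using smooth_line_derivE[OF w1(1)] by blast
 have d1: "(u has_real_derivative du_can \<kappa> z + w1 z) (at z)" if z: "abs z < 1" for z
 proof -
  have "((%z. u z - u_can \<kappa> z) has_real_derivative w1 z) (at z)"
   by (rule deriv_Icc_interior[OF w1(2)]) (use z in auto)
  from DERIV_add[OF this u_can_deriv[OF assms(2) z]] show ?thesis by (simp add: add.commute)
 qed
 hence e1: "deriv u z = du_can \<kappa> z + w1 z" if "abs z < 1" for z using that by (auto intro: DERIV_imp_deriv)
 have d2: "(deriv u has_real_derivative ddu_can \<kappa> z + w2 z) (at z)" if z: "abs z < 1" for z
 proof -
  have "(w1 has_real_derivative w2 z) (at z)" by (rule deriv_Icc_interior[OF w2(2)]) (use z in auto)
  from DERIV_add[OF u_can_deriv2[OF assms(2) z] this] show ?thesis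
   by (rule deriv_interior_cong[of _ _ _ "-1" 1]) (use z e1 in auto)
 qed
 hence e2: "deriv (deriv u) z = ddu_can \<kappa> z + w2 z" if "abs z < 1" for z using that by (auto intro: DERIV_imp_deriv)
 show thesis by (rule that[OF w1(1) w2(1) w1(2) w2(2) d1 e1 d2 e2])
qed

text \<open>The device for constructing potentials. The last hypothesis is \<open>u'' > 0\<close>
  multiplied by \<open>\<kappa> (1 - z^2)\<close>, a form in which the blow-up of
  \<open>u_can\<close> at the ends has been removed.\<close>

lemma u_can_add_potential:
 assumes "\<kappa> > 0" "smooth_on_line {-1..1} w" "smooth_on_line {-1..1} w1"
  "!!z. z : {-1..1} ==> (w has_real_derivative w1 z) (at z within {-1..1})"
  "!!z. z : {-1..1} ==> (w1 has_real_derivative w2 z) (at z within {-1..1})"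
  "w 0 = 0" "w1 0 = 0" "!!z. abs z < 1 ==> 1 + \<kappa> * (1 - z\<^sup>2) * w2 z > 0"
 shows "(%z. u_can \<kappa> z + w z) : potentials \<kappa>"
  "!!z. abs z < 1 ==> deriv (deriv (%z. u_can \<kappa> z + w z)) z = ddu_can \<kappa> z + w2 z"
proof -
 let ?u = "%z. u_can \<kappa> z + w z"
 have d1: "(?u has_real_derivative du_can \<kappa> z + w1 z) (at z)" if z: "abs z < 1" for z
 proof -
  have "(w has_real_derivative w1 z) (at z)" by (rule deriv_Icc_interior[OF assms(4)]) (use z in auto)
  from DERIV_add[OF u_can_deriv[OF assms(1) z] this] show ?thesis .
 qed
 hence e1: "deriv ?u z = du_can \<kappa> z + w1 z" if "abs z < 1" for z using that by (auto intro: DERIV_imp_deriv)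
 have d2: "(deriv ?u has_real_derivative ddu_can \<kappa> z + w2 z) (at z)" if z: "abs z < 1" for z
 proof -
  have "(w1 has_real_derivative w2 z) (at z)" by (rule deriv_Icc_interior[OF assms(5)]) (use z in auto)
  from DERIV_add[OF u_can_deriv2[OF assms(1) z] this] show ?thesis
   by (rule deriv_interior_cong[of _ _ _ "-1" 1]) (use z e1 in auto)
 qed
 thus e2: "deriv (deriv ?u) z = ddu_can \<kappa> z + w2 z" if "abs z < 1" for z using that by (auto intro: DERIV_imp_deriv)
 have "deriv (deriv ?u) z > 0" if z: "abs z < 1" for z
 proof -
  have "z\<^sup>2 < 1" using z by (simp add: abs_square_less_1)
  hence "\<kappa> * (1 - z\<^sup>2) > 0" using assms(1) by simp
  moreover have "k > 0 ==> 1 / k + w = (1 + k * w) / k" for k w :: real by (simp add: add_divide_distrib)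
  from this[of "\<kappa> * (1 - z\<^sup>2)" "w2 z"] calculation have "ddu_can \<kappa> z + w2 z = (1 + \<kappa> * (1 - z\<^sup>2) * w2 z) / (\<kappa> * (1 - z\<^sup>2))"
   by blast
  ultimately show ?thesis using e2[OF z] assms(8)[OF z] by simp
 qed
 moreover have "continuous_on {-1..1} ?u"
  using continuous_u_can[OF assms(1)] smooth_line_continuous[OF assms(2)] by (intro continuous_intros)
 moreover have "smooth_on_line {-1..1} (%z. ?u z - u_can \<kappa> z)" using assms(2) by simp
 moreover have "?u 0 = 0" using assms(6) by (simp add: u_can_def)
 moreover have "deriv ?u 0 = 0" using e1[of 0] assms(7) by simp
 ultimately show "?u : potentials \<kappa>" by (auto simp: potentials_def)
qed

lemma u_can_potential: "\<kappa> > 0 ==> u_can \<kappa> : potentials \<kappa>"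
 using u_can_add_potential(1)[of \<kappa> "%z. 0" "%z. 0" "%z. 0"] smooth_line_const[of _ 0] by simp

lemma potentials_strict_mono:
 assumes "u : potentials \<kappa>" "\<kappa> > 0" "-1 < a" "a < b" "b < 1"
 shows "deriv u a < deriv u b"
proof (rule potentialsE[OF assms(1,2)])
 fix w1 w2 assume *: "!!z. abs z < 1 ==> (deriv u has_real_derivative ddu_can \<kappa> z + w2 z) (at z)"
  "!!z. abs z < 1 ==> deriv (deriv u) z = ddu_can \<kappa> z + w2 z"
 show ?thesis
 proof (rule DERIV_pos_imp_increasing[OF assms(4)])
  fix x assume x: "a <= x" "x <= b"
  hence "\<bar>x\<bar> < 1" using assms by auto
  with * assms(1) x show "\<exists>y. (deriv u has_real_derivative y) (at x) & 0 < y"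
   by (auto simp: potentials_def abs_less_iff) (metis greaterThanLessThan_iff)
 qed
qed

text \<open>The derivative of \<open>u_can\<close> is \<open>artanh z / \<kappa>\<close>, so its
  inverse is explicit; such points bracket the solutions for a general potential.\<close>

lemma u_can_deriv_tanh:
 fixes \<kappa> y :: real
 assumes "\<kappa> > 0"
 shows "(ln (1 + tanh (\<kappa> * y)) - ln (1 - tanh (\<kappa> * y))) / (2 * \<kappa>) = y"
proof -
 let ?t = "tanh (\<kappa> * y) :: real"
 have t: "\<bar>?t\<bar> < 1" using tanh_real_bounds[of "\<kappa> * y"] by (simp add: abs_less_iff)
 have "\<kappa> * y = artanh ?t" by (simp add: artanh_tanh_real)
 also have "... = ln ((1 + ?t) / (1 - ?t)) / 2" by (simp add: artanh_def)
 also have "... = (ln (1 + ?t) - ln (1 - ?t)) / 2" using t by (subst ln_div) (auto simp: abs_less_iff)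
 finally show ?thesis using assms by (simp add: field_simps)
qed

lemma potentials_deriv_bij:
 assumes "u : potentials \<kappa>" "\<kappa> > 0"
 shows "bij_betw (deriv u) {-1<..<1} UNIV" unfolding bij_betw_def
proof
 have "strict_mono_on {-1<..<1} (deriv u)" using potentials_strict_mono[OF assms] by (auto simp: strict_mono_on_def)
 thus "inj_on (deriv u) {-1<..<1}" by (rule strict_mono_on_imp_inj_on)
 show "deriv u ` {-1<..<1} = UNIV"
 proof (intro equalityI subset_UNIV subsetI)
  fix y :: real
  obtain w1 w2 where w: "smooth_on_line {-1..1} w1" "!!z. abs z < 1 ==> deriv u z = du_can \<kappa> z + w1 z"
   "!!z. abs z < 1 ==> (deriv u has_real_derivative ddu_can \<kappa> z + w2 z) (at z)"
   by (rule potentialsE[OF assms], rule that, assumption+)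
  have "bounded (w1 ` {-1..1})"
   using smooth_line_continuous[OF w(1)] by (intro compact_imp_bounded compact_continuous_image) auto
  then obtain B where B: "B > 0" "!!z. z : {-1..1} ==> \<bar>w1 z\<bar> <= B" by (auto simp: bounded_pos)
  \<comment> \<open>\<open>deriv u\<close> differs from the derivative of \<open>u_can\<close> by at
    most \<open>B\<close>, and at these two points the latter equals \<open>y - B\<close> and
    \<open>y + B\<close>.\<close>
  let ?a = "tanh (\<kappa> * (y - B))" and ?b = "tanh (\<kappa> * (y + B))"
  have ab: "-1 < ?a" "?a < 1" "-1 < ?b" "?b < 1" using tanh_real_bounds by (auto simp: greaterThanLessThan_iff)
  have le: "?a <= ?b" using B assms(2) by (simp add: tanh_real_le_iff)
  have 1: "deriv u ?a <= y"
   using w(2)[of ?a] u_can_deriv_tanh[OF assms(2)] B(2)[of ?a] ab by (simp add: abs_less_iff abs_le_iff)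
  have 2: "y <= deriv u ?b"
   using w(2)[of ?b] u_can_deriv_tanh[OF assms(2)] B(2)[of ?b] ab by (simp add: abs_less_iff abs_le_iff)
  have "continuous_on {?a..?b} (deriv u)"
  proof (rule continuous_at_imp_continuous_on, rule ballI)
   fix x assume "x : {?a..?b}"
   hence "\<bar>x\<bar> < 1" using ab by (auto simp: abs_less_iff)
   thus "isCont (deriv u) x" by (rule DERIV_isCont[OF w(3)])
  qed
  then obtain z where "z >= ?a" "z <= ?b" "deriv u z = y" using IVT'[of "deriv u" ?a y ?b] 1 2 le by auto
  thus "y : deriv u ` {-1<..<1}" using ab by (intro image_eqI[of _ _ z]) auto
 qed
qed

lemma momentum:
 assumes "u : potentials \<kappa>" "\<kappa> > 0"
 shows "-1 < momentum u y" "momentum u y < 1" "deriv u (momentum u y) = y" "!!z. abs z < 1 ==> momentum u (deriv u z) = z"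
proof -
 note bij = potentials_deriv_bij[OF assms]
 have inj: "inj_on (deriv u) {-1<..<1}" and im: "y : deriv u ` {-1<..<1}" using bij by (auto simp: bij_betw_def)
 show "-1 < momentum u y" "momentum u y < 1"
  using the_inv_into_into[OF inj im subset_refl] by (auto simp: momentum_def)
 show "deriv u (momentum u y) = y" unfolding momentum_def by (rule f_the_inv_into_f[OF inj im])
 show "momentum u (deriv u z) = z" if "abs z < 1" for z
  unfolding momentum_def by (rule the_inv_into_f_f[OF inj]) (use that in auto)
qed

lemma momentum_between:
 assumes "u : potentials \<kappa>" "\<kappa> > 0" "-1 < a" "b < 1" "-1 < b" "a < 1" "deriv u a < y" "y < deriv u b"
 shows "a < momentum u y" "momentum u y < b"
proof -
 note m = momentum(1-3)[OF assms(1,2), of y]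
 show "a < momentum u y"
  using potentials_strict_mono[OF assms(1,2) m(1), of a] m assms by (cases "momentum u y = a") force+
 show "momentum u y < b"
  using potentials_strict_mono[OF assms(1,2) \<open>-1 < b\<close>, of "momentum u y"] m assms by (cases "momentum u y = b") force+
qed

text \<open>\<open>momentum u y\<close> is the zero of the increasing function
  \<open>deriv u - y\<close>, so the signs at two nearby points pin it down, and these signs survive
  pointwise convergence. Potential and argument may both vary: continuity in \<open>y\<close> and
  continuity along a segment of potentials are instances.\<close>

lemma tendsto_momentum:
 assumes "\<kappa> > 0" "u0 : potentials \<kappa>" "\<forall>\<^sub>F s in F. U s : potentials \<kappa>"
  "!!z. abs z < 1 ==> ((%s. deriv (U s) z - Y s) \<longlongrightarrow> deriv u0 z - y0) F"
 shows "((%s. momentum (U s) (Y s)) \<longlongrightarrow> momentum u0 y0) F"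
proof (rule tendstoI)
 fix e :: real assume "e > 0"
 note m = momentum(1-3)[OF assms(2,1), of y0]
 \<comment> \<open>The second entries keep \<open>a\<close> and \<open>b\<close> inside (-1,1),
   strictly on either side of the limit.\<close>
 define a where "a = max (momentum u0 y0 - e / 2) ((momentum u0 y0 - 1) / 2)"
 define b where "b = min (momentum u0 y0 + e / 2) ((momentum u0 y0 + 1) / 2)"
 have ab: "-1 < a" "a < momentum u0 y0" "momentum u0 y0 < b" "b < 1" using m \<open>e > 0\<close>
  by (auto simp: a_def b_def less_max_iff_disj min_less_iff_disj)
 have aa: "\<bar>a\<bar> < 1" "\<bar>b\<bar> < 1" using ab m by (auto simp: abs_less_iff)
 have "deriv u0 a - y0 < 0" using potentials_strict_mono[OF assms(2,1) ab(1,2)] m by simp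
 hence 1: "\<forall>\<^sub>F s in F. deriv (U s) a - Y s < 0" using order_tendstoD(2)[OF assms(4)[OF aa(1)]] by blast
 have "deriv u0 b - y0 > 0" using potentials_strict_mono[OF assms(2,1) m(1) ab(3,4)] m by simp
 hence 2: "\<forall>\<^sub>F s in F. deriv (U s) b - Y s > 0" using order_tendstoD(1)[OF assms(4)[OF aa(2)]] by blast
 from assms(3) 1 2 show "\<forall>\<^sub>F s in F. dist (momentum (U s) (Y s)) (momentum u0 y0) < e"
 proof eventually_elim
  case (elim s)
  hence "a < momentum (U s) (Y s)" "momentum (U s) (Y s) < b"
   using momentum_between[OF elim(1) assms(1), of a b "Y s"] ab by auto
  thus ?case using \<open>e > 0\<close> by (auto simp: dist_real_def a_def b_def abs_less_iff)
 qed
qed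

lemma momentum_deriv:
 assumes "u : potentials \<kappa>" "\<kappa> > 0"
 shows "(momentum u has_real_derivative 1 / deriv (deriv u) (momentum u y)) (at y)"
proof -
 note m = momentum[OF assms]
 obtain w1 w2 where w: "!!z. abs z < 1 ==> (deriv u has_real_derivative ddu_can \<kappa> z + w2 z) (at z)"
   "!!z. abs z < 1 ==> deriv (deriv u) z = ddu_can \<kappa> z + w2 z" by (rule potentialsE[OF assms]) metis
 have "((%y. momentum u y) \<longlongrightarrow> momentum u y) (at y)"
  by (rule tendsto_momentum[where U = "%_. u", OF assms(2,1)]) (use assms in \<open>auto intro!: tendsto_intros\<close>)
 hence "isCont (momentum u) y" by (simp add: isCont_def)
 hence "(momentum u has_real_derivative inverse (deriv (deriv u) (momentum u y))) (at y)"
 proof (rule DERIV_inverse_function[rotated -1, where a = "y - 1" and b = "y + 1"])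
  have a: "\<bar>momentum u y\<bar> < 1" using m(1,2)[of y] by (auto simp: abs_less_iff)
  show "(deriv u has_real_derivative deriv (deriv u) (momentum u y)) (at (momentum u y))" using w[OF a] by simp
  show "deriv (deriv u) (momentum u y) ~= 0" using m(1,2)[of y] assms(1) by (force simp: potentials_def)
 qed (use m(3) in auto)
 thus ?thesis by (simp add: inverse_eq_divide)
qed

text \<open>Young's inequality: the transform is the supremum of \<open>y z - u z\<close>. Convexity
  enters as monotonicity of \<open>deriv u\<close> at a mean value point between \<open>z\<close>
  and \<open>momentum u y\<close>.\<close>

lemma legendre_max:
 assumes "u : potentials \<kappa>" "\<kappa> > 0" "-1 < z" "z < 1"
 shows "y * z - u z <= legendre u y"
proof -
 note m = momentum(1-3)[OF assms(1,2), of y]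
 have du: "(u has_real_derivative deriv u x) (at x)" if "-1 < x" "x < 1" for x
  by (rule potentialsE[OF assms(1,2)]) (use that in \<open>metis abs_less_iff minus_less_iff\<close>)
 consider "z = momentum u y" | "z < momentum u y" | "z > momentum u y" by linarith
 hence "u z - u (momentum u y) >= y * (z - momentum u y)"
 proof cases
  case 2
  have "\<exists>x>z. x < momentum u y & u (momentum u y) - u z = (momentum u y - z) * deriv u x"
   by (rule MVT2[OF 2]) (use du m assms in auto)
  then obtain x where x: "z < x" "x < momentum u y" "u (momentum u y) - u z = (momentum u y - z) * deriv u x" by auto
  have "deriv u x < y" using potentials_strict_mono[OF assms(1,2) _ x(2)] x m assms by auto
  hence "(momentum u y - z) * deriv u x <= (momentum u y - z) * y" using 2 by (intro mult_left_mono) auto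
  thus ?thesis using x(3) by (simp add: algebra_simps)
 next
  case 3
  have "\<exists>x>momentum u y. x < z & u z - u (momentum u y) = (z - momentum u y) * deriv u x"
   by (rule MVT2[OF 3]) (use du m assms in auto)
  then obtain x where x: "momentum u y < x" "x < z" "u z - u (momentum u y) = (z - momentum u y) * deriv u x" by auto
  have "deriv u x > y" using potentials_strict_mono[OF assms(1,2) m(1) x(1)] x m assms by auto
  hence "(z - momentum u y) * deriv u x >= (z - momentum u y) * y" using 3 by (intro mult_left_mono) auto
  thus ?thesis using x(3) by (simp add: algebra_simps)
 qed simp
 thus ?thesis by (simp add: legendre_def algebra_simps)
qed

lemma potentials_segment:
 assumes "u : potentials \<kappa>" "\<kappa> > 0" "0 <= t" "t <= 1"
 shows "(%z. (1 - t) * u_can \<kappa> z + t * u z) : potentials \<kappa>"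
  "!!z. abs z < 1 ==> deriv (%z. (1 - t) * u_can \<kappa> z + t * u z) z = (1 - t) * deriv (u_can \<kappa>) z + t * deriv u z"
  "!!z. abs z < 1 ==> deriv (deriv (%z. (1 - t) * u_can \<kappa> z + t * u z)) z
   = (1 - t) * (ddu_can \<kappa> z) + t * deriv (deriv u) z"
proof -
 let ?U = "%z. (1 - t) * u_can \<kappa> z + t * u z"
 obtain w1 w2 where w: "smooth_on_line {-1..1} w1" "smooth_on_line {-1..1} w2"
  "!!z. z : {-1..1} ==> ((%z. u z - u_can \<kappa> z) has_real_derivative w1 z) (at z within {-1..1})"
  "!!z. z : {-1..1} ==> (w1 has_real_derivative w2 z) (at z within {-1..1})"
  "!!z. abs z < 1 ==> (u has_real_derivative du_can \<kappa> z + w1 z) (at z)" "!!z. abs z < 1 ==> deriv u z = du_can \<kappa> z + w1 z"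
  "!!z. abs z < 1 ==> deriv (deriv u) z = ddu_can \<kappa> z + w2 z" by (rule potentialsE[OF assms(1,2)], rule that, assumption+)
 have sm: "smooth_on_line {-1..1} (%z. u z - u_can \<kappa> z)" using assms by (simp add: potentials_def)
 have U: "?U = (%z. u_can \<kappa> z + t * (u z - u_can \<kappa> z))" by (auto simp: algebra_simps)
 have pos: "1 + \<kappa> * (1 - z\<^sup>2) * (t * w2 z) > 0" if z: "abs z < 1" for z
 proof -
  have k: "\<kappa> * (1 - z\<^sup>2) > 0" using z assms(2) by (simp add: abs_square_less_1)
  have "z : {-1<..<1}" using z by (auto simp: abs_less_iff)
  hence "deriv (deriv u) z > 0" using assms(1) unfolding potentials_def by blast
  hence "0 < \<kappa> * (1 - z\<^sup>2) * (ddu_can \<kappa> z + w2 z)" using k w(7)[OF z] by simp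
  also have "... = 1 + \<kappa> * (1 - z\<^sup>2) * w2 z"
  proof -
   have "k > 0 ==> k * (1 / k + w) = 1 + k * w" for k w :: real by (simp add: distrib_left)
   thus ?thesis using k by blast
  qed
  finally have *: "0 < 1 + \<kappa> * (1 - z\<^sup>2) * w2 z" .
  have eq: "1 + \<kappa> * (1 - z\<^sup>2) * (t * w2 z) = (1 - t) + t * (1 + \<kappa> * (1 - z\<^sup>2) * w2 z)" by (simp add: algebra_simps)
  show ?thesis
  proof (cases "t = 0")
   case False
   hence "t * (1 + \<kappa> * (1 - z\<^sup>2) * w2 z) > 0" using * assms(3) by (intro mult_pos_pos) auto
   thus ?thesis unfolding eq using assms(4) by linarith
  qed simp
 qed
 note uc = u_can_add_potential[of \<kappa> "%z. t * (u z - u_can \<kappa> z)" "%z. t * w1 z" "%z. t * w2 z", OF assms(2)]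
 have prem: "smooth_on_line {-1..1} (%z. t * (u z - u_can \<kappa> z))" "smooth_on_line {-1..1} (%z. t * w1 z)"
  "!!z. z : {-1..1} ==> ((%z. t * (u z - u_can \<kappa> z)) has_real_derivative t * w1 z) (at z within {-1..1})"
  "!!z. z : {-1..1} ==> ((%z. t * w1 z) has_real_derivative t * w2 z) (at z within {-1..1})"
  "t * (u 0 - u_can \<kappa> 0) = 0" "t * w1 0 = 0" using w(1-4) sm w(6)[of 0] assms(1)
  by (auto intro!: smooth_line_mult smooth_line_const DERIV_cmult simp: potentials_def u_can_def)
 show "?U : potentials \<kappa>" unfolding U by (rule uc(1)[OF prem pos])
 show "deriv (deriv ?U) z = (1 - t) * (ddu_can \<kappa> z) + t * deriv (deriv u) z" if "abs z < 1" for z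
 proof -
  have "deriv (deriv ?U) z = ddu_can \<kappa> z + t * w2 z" unfolding U by (rule uc(2)[OF prem pos that])
  moreover have "c + t * w = (1 - t) * c + t * (c + w)" for c w :: real by (simp add: algebra_simps)
  ultimately show ?thesis unfolding w(7)[OF that] by metis
 qed
 show "deriv ?U z = (1 - t) * deriv (u_can \<kappa>) z + t * deriv u z" if z: "abs z < 1" for z
  by (rule DERIV_imp_deriv) (use w(5,6)[OF z] u_can_deriv[OF assms(2) z] DERIV_imp_deriv[OF u_can_deriv[OF assms(2) z]] in
   \<open>auto intro!: derivative_eq_intros\<close>)
qed

text \<open>Envelope argument: the derivative in \<open>t\<close> of the supremum of
  \<open>y z - U t z\<close> is the explicit \<open>t\<close>-derivative at the maximiser, so for
  \<open>momentum\<close> continuity in \<open>t\<close> is enough.\<close>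

lemma legendre_segment_deriv:
 assumes "u : potentials \<kappa>" "\<kappa> > 0" "t : {0..1}" defines "U \<equiv> %t z. (1 - t) * u_can \<kappa> z + t * u z"
 shows "((%t. legendre (U t) y) has_real_derivative
  - (u (momentum (U t) y) - u_can \<kappa> (momentum (U t) y))) (at t within {0..1})"
proof -
 define w where "w z = u z - u_can \<kappa> z" for z
 define m where "m t = momentum (U t) y" for t
 have P: "U s : potentials \<kappa>" if "s : {0..1}" for s
  unfolding U_def by (rule potentials_segment(1)[OF assms(1,2)]) (use that in auto)
 have mb: "-1 < m s" "m s < 1" if "s : {0..1}" for s using momentum(1,2)[OF P[OF that] assms(2)] by (auto simp: m_def)
 have ev: "\<forall>\<^sub>F s in at t within {0..1}. s : {0..1}" by (simp add: eventually_at_filter)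
 have mt: "(m \<longlongrightarrow> m t) (at t within {0..1})" unfolding m_def
 proof (rule tendsto_momentum[OF assms(2) P[OF assms(3)]])
  show "\<forall>\<^sub>F s in at t within {0..1}. U s : potentials \<kappa>" using ev by eventually_elim (rule P)
  fix z :: real assume z: "abs z < 1"
  have "((%s. (1 - s) * deriv (u_can \<kappa>) z + s * deriv u z - y) \<longlongrightarrow> (1 - t) * deriv (u_can \<kappa>) z + t * deriv u z - y) (at t within {0..1})"
   by (intro tendsto_intros)
  moreover have "\<forall>\<^sub>F s in at t within {0..1}. (1 - s) * deriv (u_can \<kappa>) z + s * deriv u z - y = deriv (U s) z - y"
   using ev by eventually_elim (use potentials_segment(2)[OF assms(1,2) _ _ z] in \<open>auto simp: U_def\<close>)
  moreover have "deriv (U t) z = (1 - t) * deriv (u_can \<kappa>) z + t * deriv u z"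
   using potentials_segment(2)[OF assms(1,2) _ _ z] assms(3) by (auto simp: U_def)
  ultimately show "((%s. deriv (U s) z - y) \<longlongrightarrow> deriv (U t) z - y) (at t within {0..1})"
   by (auto intro: Lim_transform_eventually)
 qed
 have cw: "continuous_on {-1..1} w"
  unfolding w_def using assms(1) by (intro smooth_line_continuous) (simp add: potentials_def)
 have "isCont w (m t)" by (rule continuous_on_interior[OF cw]) (use mb[OF assms(3)] in auto)
 hence wm: "((%s. w (m s)) \<longlongrightarrow> w (m t)) (at t within {0..1})" using mt isCont_tendsto_compose by blast
 \<comment> \<open>Each of the two suprema is tested at the maximiser of the other; the two
   inequalities trap the difference quotient between values of \<open>- w\<close>.\<close>
 have ineq: "\<bar>legendre (U s) y - legendre (U t) y + (s - t) * w (m t)\<bar> <= \<bar>s - t\<bar> * \<bar>w (m s) - w (m t)\<bar>"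
  if s: "s : {0..1}" for s
 proof -
  have Us: "U s z = U t z + (s - t) * w z" for z by (simp add: U_def w_def algebra_simps)
  have 1: "y * m t - U s (m t) <= legendre (U s) y" by (rule legendre_max[OF P[OF s] assms(2) mb[OF assms(3)]])
  have 2: "y * m s - U t (m s) <= legendre (U t) y" by (rule legendre_max[OF P[OF assms(3)] assms(2) mb[OF s]])
  have L: "legendre (U s) y = y * m s - U s (m s)" "legendre (U t) y = y * m t - U t (m t)"
   by (simp_all add: legendre_def m_def)
  let ?d = "legendre (U s) y - legendre (U t) y + (s - t) * w (m t)"
  have a: "0 <= ?d" using 1 L Us[of "m t"] by simp
  have "legendre (U s) y - legendre (U t) y <= - (s - t) * w (m s)" using 2 L Us[of "m s"] by (simp add: algebra_simps)
  hence "?d <= (s - t) * (w (m t) - w (m s))" by (simp add: algebra_simps)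
  also have "... <= \<bar>(s - t) * (w (m t) - w (m s))\<bar>" by simp
  also have "... = \<bar>s - t\<bar> * \<bar>w (m s) - w (m t)\<bar>" by (simp add: abs_mult abs_minus_commute)
  finally show ?thesis using a by simp
 qed
 have "((%s. (legendre (U s) y - legendre (U t) y) / (s - t)) \<longlongrightarrow> - w (m t)) (at t within {0..1})"
 proof (rule LIM_zero_cancel, rule Lim_null_comparison)
  show "((%s. \<bar>w (m s) - w (m t)\<bar>) \<longlongrightarrow> 0) (at t within {0..1})" using LIM_zero[OF wm] tendsto_rabs_zero by blast
  have "\<forall>\<^sub>F s in at t within {0..1}. s ~= t" by (simp add: eventually_at_filter)
  with ev show "\<forall>\<^sub>F s in at t within {0..1}. norm ((legendre (U s) y - legendre (U t) y) / (s - t) - - w (m t)) <= \<bar>w (m s) - w (m t)\<bar>"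
  proof eventually_elim
   case (elim s)
   have "(legendre (U s) y - legendre (U t) y) / (s - t) - - w (m t) = (legendre (U s) y - legendre (U t) y + (s - t) * w (m t)) / (s - t)"
    using elim by (simp add: field_simps)
   thus ?case using ineq[OF elim(1)] elim(2) by (simp add: abs_divide pos_divide_le_eq mult.commute)
  qed
 qed
 thus ?thesis unfolding has_field_derivative_iff w_def m_def .
qed

section \<open>The functionals on symplectic potentials\<close>

text \<open>The ratio of \<open>u''\<close> to the second derivative of \<open>u_can\<close>; the
  value 1 at the ends is its limit, which makes it smooth on the closed interval.\<close>

definition qf :: "real => (real => real) => real => real" where
 "qf \<kappa> u z = (if abs z < 1 then \<kappa> * (1 - z\<^sup>2) * deriv (deriv u) z else 1)"

text \<open>The function \<open>P / u''\<close>, written through \<open>qf\<close> so that it is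
  smooth up to the ends, where it vanishes.\<close>

definition prof :: "real => real poly => (real => real) => real => real" where
 "prof \<kappa> P u z = (1 - z\<^sup>2) * (\<kappa> * poly P z / qf \<kappa> u z)"

lemma qf_eq:
 assumes "!!z. abs z < 1 ==> deriv (deriv u) z = ddu_can \<kappa> z + w2 z" "\<kappa> > 0" "z : {-1..1}"
 shows "qf \<kappa> u z = 1 + \<kappa> * (1 - z\<^sup>2) * w2 z"
proof (cases "abs z < 1")
 case True
 hence "\<kappa> * (1 - z\<^sup>2) > 0" using assms(2) by (simp add: abs_square_less_1)
 moreover have "k > 0 ==> k * (1 / k + w) = 1 + k * w" for k w :: real by (simp add: distrib_left)
 ultimately show ?thesis using True assms(1) by (simp add: qf_def)
next
 case False
 hence "z = 1 | z = -1" using assms(3) by auto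
 thus ?thesis by (auto simp: qf_def)
qed

lemma qf_pos:
 assumes "u : potentials \<kappa>" "\<kappa> > 0"
 shows "qf \<kappa> u z > 0"
proof (cases "abs z < 1")
 case True
 hence "\<kappa> * (1 - z\<^sup>2) > 0" using assms(2) by (simp add: abs_square_less_1)
 moreover have "z : {-1<..<1}" using True by (auto simp: abs_less_iff)
 hence "deriv (deriv u) z > 0" using assms(1) unfolding potentials_def by blast
 ultimately show ?thesis using True by (simp add: qf_def)
qed (simp add: qf_def)

lemma qf_smooth:
 assumes "u : potentials \<kappa>" "\<kappa> > 0"
 shows "smooth_on_line {-1..1} (qf \<kappa> u)"
proof -
 obtain w1 w2 where w: "smooth_on_line {-1..1} w2" "!!z. abs z < 1 ==> deriv (deriv u) z = ddu_can \<kappa> z + w2 z"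
  by (rule potentialsE[OF assms], rule that, assumption+)
 have "smooth_on_line {-1..1} (%z. 1 + poly [:\<kappa>, 0, - \<kappa>:] z * w2 z)"
  by (intro smooth_line_add smooth_line_mult smooth_line_const smooth_line_poly w)
 thus ?thesis by (rule smooth_line_cong) (use qf_eq[OF w(2) assms(2)] in \<open>simp add: algebra_simps power2_eq_square\<close>)
qed

lemma prof_interior:
 assumes "abs z < 1" "\<kappa> > 0"
 shows "prof \<kappa> P u z = poly P z / deriv (deriv u) z"
proof -
 have "1 - z\<^sup>2 > 0" using assms by (simp add: abs_square_less_1)
 thus ?thesis using assms by (simp add: prof_def qf_def)
qed

lemma deriv_deriv_eq:
 assumes "!!z. z : {a<..<b} ==> (f has_real_derivative f1 z) (at z)" "!!z. z : {a<..<b} ==> (f1 has_real_derivative f2 z) (at z)"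
  and "z : {a<..<b}"
 shows "deriv f z = f1 z" "deriv (deriv f) z = f2 z" "(deriv f has_real_derivative f2 z) (at z)"
proof -
 have e: "deriv f z = f1 z" if "z : {a<..<b}" for z using assms(1)[OF that] by (rule DERIV_imp_deriv)
 show "deriv f z = f1 z" by (rule e[OF assms(3)])
 show "(deriv f has_real_derivative f2 z) (at z)"
  by (rule deriv_interior_cong[OF assms(2)[OF assms(3)], of a b]) (use assms(3) e in auto)
 thus "deriv (deriv f) z = f2 z" by (rule DERIV_imp_deriv)
qed

text \<open>The slopes at the ends are those of \<open>(1 - z^2) h\<close>, namely
  \<open>-2 z h\<close>, with \<open>h = \<kappa> P\<close> there because \<open>qf\<close> is 1. So
  all profiles share their boundary values and slopes, whatever the potential.\<close>

lemma prof_derivs: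
 assumes "u : potentials \<kappa>" "\<kappa> > 0"
 obtains F1 F2 where "continuous_on {-1..1} F1" "continuous_on {-1..1} F2"
  "!!z. z : {-1..1} ==> (prof \<kappa> P u has_real_derivative F1 z) (at z within {-1..1})"
  "!!z. z : {-1..1} ==> (F1 has_real_derivative F2 z) (at z within {-1..1})"
  "F1 1 = - 2 * \<kappa> * poly P 1" "F1 (-1) = 2 * \<kappa> * poly P (-1)" "!!z. abs z < 1 ==> deriv (deriv (prof \<kappa> P u)) z = F2 z"
  "!!z. abs z < 1 ==> (prof \<kappa> P u has_real_derivative F1 z) (at z)" "!!z. abs z < 1 ==> (F1 has_real_derivative F2 z) (at z)"
proof -
 define h where "h z = \<kappa> * poly P z / qf \<kappa> u z" for z
 have "smooth_on_line {-1..1} h" unfolding h_def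
  by (intro smooth_line_divide smooth_line_mult smooth_line_const smooth_line_poly qf_smooth assms)
   (metis qf_pos[OF assms] less_irrefl)
 then obtain h' where h': "smooth_on_line {-1..1} h'" "smooth_on_line {-1..1} h"
   "!!z. z : {-1..1} ==> (h has_real_derivative h' z) (at z within {-1..1})" using smooth_line_derivE by blast
 define F1 where "F1 z = (-2 * z) * h z + (1 - z\<^sup>2) * h' z" for z
 have "smooth_on_line {-1..1} (%z. (-2 * z + 0) * h z + poly [:1, 0, -1:] z * h' z)"
  by (intro smooth_line_add smooth_line_mult smooth_line_linear smooth_line_poly h')
 hence sF1: "smooth_on_line {-1..1} F1" by (rule smooth_line_cong) (simp add: F1_def power2_eq_square algebra_simps)
 then obtain F2 where F2: "smooth_on_line {-1..1} F2" "!!z. z : {-1..1} ==> (F1 has_real_derivative F2 z) (at z within {-1..1})"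
  using smooth_line_derivE by blast
 have D1: "(prof \<kappa> P u has_real_derivative F1 z) (at z within {-1..1})" if "z : {-1..1}" for z
  using h'(3)[OF that] unfolding prof_def[abs_def] h_def[symmetric] F1_def by (auto intro!: derivative_eq_intros)
 have i1: "(prof \<kappa> P u has_real_derivative F1 z) (at z)" if "abs z < 1" for z
  by (rule deriv_Icc_interior[OF D1]) (use that in auto)
 have i2: "(F1 has_real_derivative F2 z) (at z)" if "abs z < 1" for z
  by (rule deriv_Icc_interior[OF F2(2)]) (use that in auto)
 have i3: "deriv (deriv (prof \<kappa> P u)) z = F2 z" if "abs z < 1" for z
  by (rule deriv_deriv_eq(2)[of "-1" 1, OF i1 i2]) (use that in auto)
 show thesis by (rule that[OF _ _ D1 F2(2) _ _ i3 i1 i2])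
   (use smooth_line_continuous[OF sF1] smooth_line_continuous[OF F2(1)] in \<open>auto simp: F1_def h_def qf_def\<close>)
qed

section \<open>Integration by parts and integrability of logarithms of polynomials\<close>

lemma integral_by_parts_twice:
 fixes w G :: "real => real"
 assumes "!!z. z : {-1..1} ==> (w has_real_derivative w1 z) (at z within {-1..1})"
  "!!z. z : {-1..1} ==> (w1 has_real_derivative w2 z) (at z within {-1..1})"
  "!!z. z : {-1..1} ==> (G has_real_derivative G1 z) (at z within {-1..1})"
  "!!z. z : {-1..1} ==> (G1 has_real_derivative G2 z) (at z within {-1..1})"
  "G 1 = 0" "G (-1) = 0" "G1 1 = 0" "G1 (-1) = 0"
 shows "((%z. w z * G2 z - w2 z * G z) has_integral 0) {-1..1}"
proof -
 have "((%z. w z * G2 z - w2 z * G z) has_integral ((w 1 * G1 1 - w1 1 * G 1) - (w (-1) * G1 (-1) - w1 (-1) * G (-1)))) {-1..1}"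
 proof (rule fundamental_theorem_of_calculus)
  fix z :: real assume z: "z : {-1..1}"
  show "((%z. w z * G1 z - w1 z * G z) has_vector_derivative w z * G2 z - w2 z * G z) (at z within {-1..1})"
   unfolding real_deriv_vec[symmetric] using assms(1-4)[OF z] by (auto intro!: derivative_eq_intros)
 qed simp
 thus ?thesis using assms(5-8) by simp
qed

text \<open>The antiderivative \<open>(z - r) ln |z - r| - (z - r)\<close> is continuous through
  \<open>r\<close>, so the fundamental theorem applies with \<open>r\<close> as an exceptional
  point.\<close>

lemma ln_abs_diff_integrable: "(%z::real. ln \<bar>z - r\<bar>) integrable_on {a..b}"
proof (cases "a <= b")
 case True
 have "((%z. ln \<bar>z - r\<bar>) has_integral (((b - r) * ln \<bar>b - r\<bar> - (b - r)) - ((a - r) * ln \<bar>a - r\<bar> - (a - r)))) {a..b}"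
 proof (rule fundamental_theorem_of_calculus_interior_strong[of "{r}"])
  show "continuous_on {a..b} (%x. (x - r) * ln \<bar>x - r\<bar> - (x - r))"
   by (intro continuous_on_diff continuous_on_compose2[OF continuous_on_x_ln_abs, of _ "%x. x - r"] continuous_intros) auto
  fix x assume "x : {a<..<b} - {r}"
  hence "x - r ~= 0" by auto
  have dx: "((%x. x - r) has_real_derivative 1) (at x)" by (auto intro!: derivative_eq_intros)
  have L: "((%x. ln \<bar>x - r\<bar>) has_real_derivative 1 / (x - r)) (at x)"
  proof (cases "x > r")
   case True
   hence "((%x. ln (x - r)) has_real_derivative 1 / (x - r)) (at x)" by (auto intro!: derivative_eq_intros)
   thus ?thesis by (rule deriv_interior_cong[of _ _ _ r "x + 1"]) (use True in auto)
  next
   case False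
   hence x: "x < r" using \<open>x - r ~= 0\<close> by simp
   hence "((%x. ln (r - x)) has_real_derivative (- 1) / (r - x)) (at x)" by (auto intro!: derivative_eq_intros)
   moreover have "(- 1) / (r - x) = 1 / (x - r)" using x by (simp add: divide_simps)
   ultimately have "((%x. ln (r - x)) has_real_derivative 1 / (x - r)) (at x)" by simp
   thus ?thesis by (rule deriv_interior_cong[of _ _ _ "x - 1" r]) (use x in auto)
  qed
  show "((%x. (x - r) * ln \<bar>x - r\<bar> - (x - r)) has_vector_derivative ln \<bar>x - r\<bar>) (at x)"
   unfolding real_deriv_vec[symmetric] using \<open>x - r ~= 0\<close> DERIV_diff[OF DERIV_mult[OF dx L] dx] by simp
 qed (use True in auto)
 thus ?thesis by blast
qed (auto simp: integrable_on_empty)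

text \<open>For the lower bound of the K-energy, whose density has a minimum containing the
  logarithm of a polynomial that may have roots in the interval. Linear factors are split off one by
  one.\<close>

lemma ln_abs_poly_integrable:
 assumes "p ~= 0" shows "(%z::real. ln \<bar>poly p z\<bar>) integrable_on {a..b}" using assms
proof (induction "degree p" arbitrary: p rule: less_induct)
 case less
 show ?case
 proof (cases "\<exists>r. poly p r = 0")
  case False
  hence "continuous_on {a..b} (%z. ln \<bar>poly p z\<bar>)" by (intro continuous_intros) auto
  thus ?thesis by (rule integrable_continuous_real)
 next
  case True
  then obtain r s where p: "p = [:- r, 1:] * s" using poly_eq_0_iff_dvd by (metis dvd_def)
  have s: "s ~= 0" using p less.prems by auto
  hence "degree s < degree p" unfolding p by (subst degree_mult_eq) auto
  hence "(%z. ln \<bar>z - r\<bar> + ln \<bar>poly s z\<bar>) integrable_on {a..b}"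
   by (intro integrable_add ln_abs_diff_integrable less.hyps s)
  thus ?thesis
  proof (rule integrable_spike_finite[rotated -1])
   show "finite {z. poly p z = 0}" using less.prems by (rule poly_roots_finite)
   fix x assume "x : {a..b} - {z. poly p z = 0}"
   moreover have "poly p x = (x - r) * poly s x" by (simp add: p algebra_simps)
   ultimately show "ln \<bar>poly p x\<bar> = ln \<bar>x - r\<bar> + ln \<bar>poly s x\<bar>" by (simp add: abs_mult ln_mult)
  qed
 qed
qed

text \<open>The variational analysis sees the extremal polynomial only through its boundary values
  and slopes, which are those common to all profiles \<open>P / u''\<close>.\<close>

locale extremal_profile =
 fixes \<kappa> :: real and P F :: "real poly"
 assumes \<kappa>: "\<kappa> > 0" and P: "!!z. z : {-1..1} ==> poly P z > 0" and F0: "poly F 1 = 0" "poly F (-1) = 0"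
  and F1: "poly (pderiv F) 1 = - 2 * \<kappa> * poly P 1" "poly (pderiv F) (-1) = 2 * \<kappa> * poly P (-1)"
begin

lemma quotient_ends:
 fixes G :: "real poly" assumes "poly G 1 = 0" "poly G (-1) = 0"
 shows "\<exists>H. G = [:1, 0, -1:] * H"
proof -
 obtain A where A: "G = [:- 1, 1:] * A" using assms(1) poly_eq_0_iff_dvd by (metis dvd_def)
 have "poly A (-1) = 0" using assms(2) A by simp
 then obtain B where B: "A = [:1, 1:] * B" using poly_eq_0_iff_dvd[of A "-1"] by (auto simp: dvd_def)
 have "G = [:1, 0, -1:] * (- B)" unfolding A B by (simp add: algebra_simps)
 thus ?thesis by blast
qed

text \<open>The quotient of F by \<open>1 - z^2\<close>. It is positive at both ends, so
  nonnegativity of F on the open interval passes to \<open>Ft\<close> on the closed one.\<close>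

definition Ft :: "real poly" where "Ft = (SOME H. F = [:1, 0, -1:] * H)"

lemma Ft: "F = [:1, 0, -1:] * Ft" unfolding Ft_def using someI_ex[OF quotient_ends[OF F0]] .

lemma poly_F: "poly F z = (1 - z\<^sup>2) * poly Ft z" by (subst Ft) (simp add: power2_eq_square algebra_simps)

lemma Ft_ends: "poly Ft 1 = \<kappa> * poly P 1" "poly Ft (-1) = \<kappa> * poly P (-1)"
proof -
 have "poly (pderiv F) z = -2 * z * poly Ft z + (1 - z\<^sup>2) * poly (pderiv Ft) z" for z
  by (subst Ft, subst pderiv_mult) (simp add: pderiv_pCons power2_eq_square algebra_simps)
 from this[of 1] this[of "-1"] F1 show "poly Ft 1 = \<kappa> * poly P 1" "poly Ft (-1) = \<kappa> * poly P (-1)" by auto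
qed

lemma Ft_nonneg:
 assumes "\<forall>z\<in>{-1<..<1}. poly F z >= 0" "z : {-1..1}"
 shows "poly Ft z >= 0"
proof (cases "abs z < 1")
 case True
 hence "1 - z\<^sup>2 > 0" "poly F z >= 0" using assms by (auto simp: abs_square_less_1 abs_less_iff)
 thus ?thesis by (simp add: poly_F zero_le_mult_iff)
next
 case False
 hence "z = 1 | z = -1" using assms(2) by auto
 thus ?thesis using Ft_ends \<kappa> P[of 1] P[of "-1"] by auto
qed

lemma Ft_nonzero: "Ft ~= 0" using Ft_ends(1) \<kappa> P[of 1] by auto

lemma F_nonzero: "F ~= 0" using Ft Ft_nonzero by (metis mult_eq_0_iff one_neq_zero pCons_eq_0_iff)

lemma continuous_qf: "u : potentials \<kappa> ==> continuous_on {-1..1} (qf \<kappa> u)"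
 using qf_smooth \<kappa> smooth_line_continuous by blast

section \<open>The K-energy as an integral over z, and when it is bounded below\<close>

definition Kdens :: "(real => real) => real => real" where
 "Kdens u z = poly Ft z / \<kappa> * (qf \<kappa> u z - 1) - poly P z * ln (qf \<kappa> u z)"

lemma Kdens_integrable: "u : potentials \<kappa> ==> Kdens u integrable_on {-1..1}" unfolding Kdens_def[abs_def]
 by (intro integrable_continuous_real continuous_intros continuous_qf)
  (use \<kappa> qf_pos in \<open>auto simp: less_imp_neq\<close>, metis less_irrefl qf_pos)

text \<open>Two integrations by parts move the derivatives onto \<open>w = u - u_can\<close>,
  leaving \<open>w'' (F - F_t)\<close>. Along the segment \<open>qf\<close> equals
  \<open>1 + t (q - 1)\<close>; after exchanging the integrals, the \<open>t\<close>-integral of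
  \<open>(q - 1) / (1 + t (q - 1))\<close> gives \<open>ln q\<close>.\<close>

lemma K_energy_profile:
 assumes u: "u : potentials \<kappa>"
 shows "integral {0..1} (%t. integral {-1..1} (%z. (u z - u_can \<kappa> z) *
   (poly (pderiv2 F) z - deriv (deriv (prof \<kappa> P (%z. (1 - t) * u_can \<kappa> z + t * u z))) z)))
  = integral {-1..1} (Kdens u)"
proof -
 obtain w1 w2 where w: "!!z. z : {-1..1} ==> ((%z. u z - u_can \<kappa> z) has_real_derivative w1 z) (at z within {-1..1})"
  "!!z. z : {-1..1} ==> (w1 has_real_derivative w2 z) (at z within {-1..1})"
  "!!z. abs z < 1 ==> deriv (deriv u) z = ddu_can \<kappa> z + w2 z" by (rule potentialsE[OF u \<kappa>], rule that, assumption+)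
 define q where "q = qf \<kappa> u"
 have q: "q z = 1 + \<kappa> * (1 - z\<^sup>2) * w2 z" if "z : {-1..1}" for z unfolding q_def by (rule qf_eq[OF w(3) \<kappa> that])
 have qpos: "q z > 0" for z unfolding q_def by (rule qf_pos[OF u \<kappa>])
 have cq: "continuous_on {-1..1} q" unfolding q_def by (rule continuous_qf[OF u])
 \<comment> \<open>The integrand \<open>w2 (F - F_t)\<close> expressed in \<open>q\<close>: the
   factor \<open>\<kappa> (1 - z^2) w2\<close> is \<open>q - 1\<close>, and the denominator is
   \<open>qf\<close> of the potential at time \<open>t\<close>.\<close>
 define g where "g t z = (q z - 1) * (poly Ft z / \<kappa> - poly P z / (1 + t * (q z - 1)))" for t z
 have qt: "1 + t * (q z - 1) > 0" if "t : {0..1}" for t z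
 proof -
  have eq: "1 + t * (q z - 1) = (1 - t) + t * q z" by (simp add: algebra_simps)
  show ?thesis
  proof (cases "t = 0")
   case False
   hence "t * q z > 0" using that qpos[of z] by simp
   thus ?thesis unfolding eq using that by simp
  qed simp
 qed
 have inner: "integral {-1..1} (%z. (u z - u_can \<kappa> z) *
   (poly (pderiv2 F) z - deriv (deriv (prof \<kappa> P (%z. (1 - t) * u_can \<kappa> z + t * u z))) z)) = integral {-1..1} (g t)"
  if t: "t : {0..1}" for t
 proof -
  let ?U = "%z. (1 - t) * u_can \<kappa> z + t * u z"
  have U: "?U : potentials \<kappa>" "!!z. abs z < 1 ==> deriv (deriv ?U) z = ddu_can \<kappa> z + t * w2 z"
  proof -
   show "?U : potentials \<kappa>" using potentials_segment(1)[OF u \<kappa>, of t] t by auto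
   fix z :: real assume z: "abs z < 1"
   have "(1 - t) * c + t * (c + w) = c + t * w" for c w :: real by (simp add: algebra_simps)
   thus "deriv (deriv ?U) z = ddu_can \<kappa> z + t * w2 z"
    using potentials_segment(3)[OF u \<kappa> _ _ z, of t] t w(3)[OF z] by (metis atLeastAtMost_iff)
  qed
  obtain G1 G2 where G: "continuous_on {-1..1} G2"
   "!!z. z : {-1..1} ==> (prof \<kappa> P ?U has_real_derivative G1 z) (at z within {-1..1})"
   "!!z. z : {-1..1} ==> (G1 has_real_derivative G2 z) (at z within {-1..1})"
   "G1 1 = - 2 * \<kappa> * poly P 1" "G1 (-1) = 2 * \<kappa> * poly P (-1)" "!!z. abs z < 1 ==> deriv (deriv (prof \<kappa> P ?U)) z = G2 z"
   by (rule prof_derivs[OF U(1) \<kappa>], rule that, assumption+)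
  have qU: "qf \<kappa> ?U z = 1 + t * (q z - 1)" if "z : {-1..1}" for z using qf_eq[OF U(2) \<kappa> that] q[OF that] by simp
  have p0: "prof \<kappa> P ?U 1 = 0" "prof \<kappa> P ?U (-1) = 0" by (simp_all add: prof_def)
  have parts: "((%z. (u z - u_can \<kappa> z) * (poly (pderiv2 F) z - G2 z) - w2 z * (poly F z - prof \<kappa> P ?U z)) has_integral 0) {-1..1}"
   by (rule integral_by_parts_twice[OF w(1,2), of _ "%z. poly (pderiv F) z - G1 z"])
    (use G(2-5) F0 F1 p0 in \<open>auto intro!: derivative_eq_intros DERIV_subset[OF poly_DERIV]\<close>)
  have gi: "(g t has_integral integral {-1..1} (g t)) {-1..1}"
  proof (rule integrable_integral, rule integrable_continuous_real)
   show "continuous_on {-1..1} (g t)"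
    unfolding g_def using qt[OF t] \<kappa> by (intro continuous_intros cq) (auto simp: less_imp_neq[symmetric])
  qed
  have e: "w2 z * (poly F z - prof \<kappa> P ?U z) = g t z" if "z : {-1..1}" for z
  proof -
   have "w2 z * (poly F z - prof \<kappa> P ?U z) = (1 - z\<^sup>2) * w2 z * (poly Ft z - \<kappa> * poly P z / qf \<kappa> ?U z)"
    unfolding poly_F prof_def by (simp add: algebra_simps)
   also have "... = \<kappa> * (1 - z\<^sup>2) * w2 z * (poly Ft z / \<kappa> - poly P z / qf \<kappa> ?U z)" using \<kappa> by (simp add: field_simps)
   finally show ?thesis using q[OF that] qU[OF that] by (simp add: g_def)
  qed
  have "((%z. ((u z - u_can \<kappa> z) * (poly (pderiv2 F) z - G2 z) - w2 z * (poly F z - prof \<kappa> P ?U z)) + g t z)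
    has_integral 0 + integral {-1..1} (g t)) {-1..1}" by (rule has_integral_add[OF parts gi])
  hence "((%z. (u z - u_can \<kappa> z) * (poly (pderiv2 F) z - deriv (deriv (prof \<kappa> P ?U)) z))
    has_integral 0 + integral {-1..1} (g t)) {-1..1}"
  \<comment> \<open>At -1 and 1 the iterated \<open>deriv\<close> is uncontrolled; the two points
    form a null set.\<close>
  proof (rule has_integral_spike_finite[rotated -1, where S = "{-1, 1}"])
   fix z :: real assume "z : {-1..1} - {-1, 1}"
   hence "abs z < 1" "z : {-1..1}" by auto
   thus "(u z - u_can \<kappa> z) * (poly (pderiv2 F) z - deriv (deriv (prof \<kappa> P ?U)) z)
    = ((u z - u_can \<kappa> z) * (poly (pderiv2 F) z - G2 z) - w2 z * (poly F z - prof \<kappa> P ?U z)) + g t z"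
    using G(6) e by simp
  qed simp
  thus ?thesis by (simp add: integral_unique)
 qed
 have "integral {0..1} (%t. integral {-1..1} (%z. (u z - u_can \<kappa> z) *
   (poly (pderiv2 F) z - deriv (deriv (prof \<kappa> P (%z. (1 - t) * u_can \<kappa> z + t * u z))) z)))
  = integral {0..1} (%t. integral {-1..1} (g t))" by (rule integral_cong) (rule inner)
 also have "... = integral (cbox 0 1) (%t. integral (cbox (-1) 1) (g t))" by simp
 also have "... = integral (cbox (-1) 1) (%z. integral (cbox 0 1) (%t. g t z))"
 proof (rule integral_swap_continuous)
  have "continuous_on (cbox (0, -1) (1, 1)) (%x. q (snd x))"
   by (rule continuous_on_compose2[OF cq]) (auto intro!: continuous_intros simp: cbox_Pair_eq)
  moreover have "fst x : {0..1}" if "x : cbox (0, -1::real) (1, 1)" for x :: "real \<times> real" using that by (auto simp: cbox_Pair_eq)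
  ultimately show "continuous_on (cbox (0, - 1) (1, 1)) (%(t, z). g t z)" unfolding g_def case_prod_beta using qt \<kappa>
   by (intro continuous_intros) (auto simp: less_imp_neq[symmetric])
 qed
 also have "... = integral {-1..1} (Kdens u)"
 proof (unfold box_real, rule integral_cong)
  fix z :: real assume "z : {-1..1}"
  have "((%t. g t z) has_integral ((1 * ((q z - 1) * (poly Ft z / \<kappa>)) - poly P z * ln (1 + 1 * (q z - 1)))
    - (0 * ((q z - 1) * (poly Ft z / \<kappa>)) - poly P z * ln (1 + 0 * (q z - 1))))) {0..1}"
  proof (rule fundamental_theorem_of_calculus)
   fix t :: real assume t: "t : {0..1}"
   have L: "((%t. ln (1 + t * (q z - 1))) has_real_derivative (q z - 1) / (1 + t * (q z - 1))) (at t within {0..1})"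
    using qt[OF t, of z] by (auto intro!: derivative_eq_intros simp: field_simps)
   have e: "1 * ((q z - 1) * (poly Ft z / \<kappa>)) - poly P z * ((q z - 1) / (1 + t * (q z - 1))) = g t z"
    unfolding g_def by (simp add: right_diff_distrib mult.commute)
   show "((%t. t * ((q z - 1) * (poly Ft z / \<kappa>)) - poly P z * ln (1 + t * (q z - 1))) has_vector_derivative g t z) (at t within {0..1})"
    unfolding real_deriv_vec[symmetric] e[symmetric]
    by (rule DERIV_diff[OF DERIV_cmult_right[OF DERIV_ident] DERIV_cmult[OF L]])
  qed simp
  thus "integral {0..1} (%t. g t z) = Kdens u z" by (simp add: integral_unique Kdens_def q_def)
 qed
 finally show ?thesis .
qed

text \<open>For fixed z and \<open>a = Ft / \<kappa>\<close> positive,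
  \<open>a (q - 1) - P ln q\<close> is smallest at \<open>q = P / a\<close>, with minimum
  \<open>P - a - P ln P + P ln a\<close>, a bound free of \<open>u\<close>. Its only singular term
  \<open>P ln a\<close> is controlled because \<open>a\<close> is a polynomial.\<close>

lemma Kdens_bounded_below:
 assumes "\<forall>z\<in>{-1<..<1}. poly F z >= 0"
 shows "\<exists>C. \<forall>u\<in>potentials \<kappa>. C <= integral {-1..1} (Kdens u)"
proof -
 define a where "a = smult (1 / \<kappa>) Ft"
 have a0: "a ~= 0" using Ft_nonzero \<kappa> by (simp add: a_def)
 have a_nonneg: "poly a z >= 0" if "z : {-1..1}" for z using Ft_nonneg[OF assms that] \<kappa> by (simp add: a_def)
 have bdd: "\<exists>B>0. \<forall>z\<in>{-1..1}. \<bar>poly p z\<bar> <= B" for p :: "real poly"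
 proof -
  have "bounded (poly p ` {-1..1})" by (intro compact_imp_bounded compact_continuous_image continuous_intros) auto
  thus ?thesis by (auto simp: bounded_pos)
 qed
 obtain A where A: "A > 0" "!!z. z : {-1..1} ==> \<bar>poly a z\<bar> <= A" using bdd by blast
 obtain M where M: "M > 0" "!!z. z : {-1..1} ==> \<bar>poly P z\<bar> <= M" using bdd by blast
 \<comment> \<open>The minimum with \<open>P ln a\<close> lowered to
   \<open>P ln A + M (ln a - ln A)\<close>, which is valid as \<open>ln a <= ln A\<close> and
   \<open>P <= M\<close>; the logarithm of \<open>a\<close> then has a constant coefficient.\<close>
 define R where "R z = poly P z - poly P z * ln (poly P z) + poly P z * ln A + M * (ln \<bar>poly a z\<bar> - ln A) - poly a z" for z
 have Ri: "R integrable_on {-1..1}" unfolding R_def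
  by (intro integrable_add integrable_diff integrable_on_mult_right integrable_continuous_real ln_abs_poly_integrable a0 continuous_intros)
   (use P in \<open>force+\<close>)
 have "integral {-1..1} R <= integral {-1..1} (Kdens u)" if u: "u : potentials \<kappa>" for u
 proof -
  \<comment> \<open>At a root of \<open>a\<close> the convention \<open>ln 0 = 0\<close> spoils the
    bound, so the value there is replaced; there are finitely many roots.\<close>
  define R' where "R' z = (if poly a z = 0 then Kdens u z else R z)" for z
  have fin: "finite {z. poly a z = 0}" using a0 by (rule poly_roots_finite)
  have "integral {-1..1} R = integral {-1..1} R'"
   by (rule integral_spike[of "{z. poly a z = 0}"]) (use fin in \<open>auto simp: R'_def intro: negligible_finite\<close>)
  also have "... <= integral {-1..1} (Kdens u)"
  proof (rule integral_le)
   show "R' integrable_on {-1..1}" by (rule integrable_spike_finite[OF fin _ Ri]) (auto simp: R'_def)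
   show "Kdens u integrable_on {-1..1}" by (rule Kdens_integrable[OF u])
   fix z :: real assume z: "z : {-1..1}"
   show "R' z <= Kdens u z"
   proof (cases "poly a z = 0")
    case False
    hence ap: "poly a z > 0" using a_nonneg[OF z] by simp
    have Pp: "poly P z > 0" by (rule P[OF z])
    have qp: "qf \<kappa> u z > 0" by (rule qf_pos[OF u \<kappa>])
    have "ln (poly a z * qf \<kappa> u z / poly P z) <= poly a z * qf \<kappa> u z / poly P z - 1"
     using ap Pp qp by (intro ln_le_minus_one) simp
    hence "poly P z * ln (poly a z * qf \<kappa> u z / poly P z) <= poly P z * (poly a z * qf \<kappa> u z / poly P z - 1)"
     using Pp by (intro mult_left_mono) auto
    also have "ln (poly a z * qf \<kappa> u z / poly P z) = ln (poly a z) + ln (qf \<kappa> u z) - ln (poly P z)"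
     using ap Pp qp by (simp add: ln_div ln_mult)
    also have "poly P z * (poly a z * qf \<kappa> u z / poly P z - 1) = poly a z * qf \<kappa> u z - poly P z"
     using Pp by (simp add: field_simps)
    finally have 1: "poly P z * (ln (poly a z) + ln (qf \<kappa> u z) - ln (poly P z)) <= poly a z * qf \<kappa> u z - poly P z" .
    have "ln (poly a z) <= ln A" using A(2)[OF z] ap by simp
    hence "M * (ln (poly a z) - ln A) <= poly P z * (ln (poly a z) - ln A)"
     using M(2)[OF z] Pp by (intro mult_right_mono_neg) auto
    hence 2: "R z <= poly P z - poly P z * ln (poly P z) + poly P z * ln (poly a z) - poly a z"
     using ap by (simp add: R_def algebra_simps)
    have "Kdens u z = poly a z * (qf \<kappa> u z - 1) - poly P z * ln (qf \<kappa> u z)" by (simp add: Kdens_def a_def)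
    thus ?thesis using 1 2 False by (simp add: R'_def algebra_simps)
   qed (simp add: R'_def)
  qed
  finally show ?thesis .
 qed
 thus ?thesis by blast
qed

lemma smooth_line_real_polynomial_function: "real_polynomial_function f ==> smooth_on_line I f" for f :: "real => real"
proof (induction rule: real_polynomial_function.induct)
 case (linear f)
 then obtain c where "f = (%x. x * c)" using real_bounded_linear by auto
 thus ?case using smooth_line_linear[of I c 0] by (simp add: mult.commute)
qed (auto intro: smooth_line_const smooth_line_add smooth_line_mult)

text \<open>With \<open>w'' = k s^2\<close> and \<open>k >= 0\<close> one has \<open>q >= 1\<close>,
  so the term \<open>- P ln q\<close> is at most 0 and what remains is \<open>k\<close> times the
  integral of \<open>F s^2\<close>. Taking \<open>s\<close> close to the negative part of F makes
  this integral negative, and \<open>k\<close> can be taken as large as desired.\<close>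

lemma Kdens_unbounded:
 assumes z0: "z0 : {-1<..<1}" "poly F z0 < 0"
 shows "\<exists>u\<in>potentials \<kappa>. integral {-1..1} (Kdens u) < C"
proof -
 define g where "g z = max 0 (- poly F z)" for z
 have cg: "continuous_on {-1..1} g" unfolding g_def by (intro continuous_intros)
 obtain M where M: "M > 0" "!!z. z : {-1..1} ==> \<bar>poly F z\<bar> <= M"
 proof -
  have "bounded (poly F ` {-1..1})" by (intro compact_imp_bounded compact_continuous_image continuous_intros) auto
  thus thesis using that by (auto simp: bounded_pos)
 qed
 have gM: "0 <= g z & g z <= M" if "z : {-1..1}" for z using M(1) M(2)[OF that] by (auto simp: g_def)
 have Fg: "poly F z * (g z)^2 = - ((g z) ^ 3)" for z by (auto simp: g_def max_def power2_eq_square power3_eq_cube)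
 define I where "I = integral {-1..1} (%z. (g z) ^ 3)"
 have I: "I > 0"
 proof -
  have c3: "continuous_on {-1..1} (%z. (g z) ^ 3)" by (intro continuous_intros cg)
  have "I >= 0" unfolding I_def using gM by (intro integral_nonneg integrable_continuous_real c3) auto
  moreover have "I ~= 0"
  proof
   assume "I = 0"
   hence "((%z. (g z) ^ 3) has_integral 0) (cbox (-1) 1)"
    using integrable_integral[OF integrable_continuous_real[OF c3]] by (simp add: I_def)
   hence "(g z0) ^ 3 = 0" by (rule has_integral_0_cbox_imp_0[rotated 2]) (use c3 z0 gM in \<open>auto simp: box_real\<close>)
   thus False using z0(2) by (simp add: g_def)
  qed
  ultimately show ?thesis by simp
 qed
 \<comment> \<open>Replacing \<open>g\<close> by \<open>s\<close> costs at most
   \<open>M (2 M + 1) \<epsilon>\<close> pointwise; over an interval of length 2 this choice keeps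
   the error at most \<open>I / 2\<close>.\<close>
 define \<epsilon> where "\<epsilon> = min 1 (I / (4 * M * (2 * M + 1)))"
 have \<epsilon>: "\<epsilon> > 0" "\<epsilon> <= 1" using I M(1) by (auto simp: \<epsilon>_def)
 \<comment> \<open>\<open>g\<close> may have corners, while potentials must be smooth in the
   interior: hence the polynomial approximation.\<close>
 obtain s where s: "real_polynomial_function s" "!!z. z : {-1..1} ==> \<bar>g z - s z\<bar> < \<epsilon>"
  using Stone_Weierstrass_real_polynomial_function[OF _ cg \<epsilon>(1)] by auto
 have ss: "smooth_on_line {-1..1} s" by (rule smooth_line_real_polynomial_function[OF s(1)])
 have cs: "continuous_on {-1..1} s" by (rule smooth_line_continuous[OF ss])
 define J where "J = integral {-1..1} (%z. poly F z * (s z)^2)"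
 have J: "J < 0"
 proof -
  have "J <= integral {-1..1} (%z. - ((g z) ^ 3) + M * (2 * M + 1) * \<epsilon>)" unfolding J_def
  proof (rule integral_le)
   fix z :: real assume z: "z : {-1..1}"
   have sz: "\<bar>s z + g z\<bar> <= 2 * M + 1" using s(2)[OF z] gM[OF z] \<epsilon>(2) by linarith
   have "poly F z * (s z)^2 - poly F z * (g z)^2 = poly F z * ((s z + g z) * (s z - g z))" by (simp add: power2_eq_square algebra_simps)
   also have "... <= \<bar>poly F z\<bar> * (\<bar>s z + g z\<bar> * \<bar>s z - g z\<bar>)" by (metis abs_ge_self abs_mult)
   also have "... <= M * ((2 * M + 1) * \<epsilon>)"
    using M sz s(2)[OF z] z by (intro mult_mono) (auto simp: abs_minus_commute less_imp_le)
   finally show "poly F z * (s z)^2 <= - ((g z) ^ 3) + M * (2 * M + 1) * \<epsilon>" using Fg[of z] by (simp add: mult.assoc)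
  qed (intro integrable_continuous_real continuous_intros cg cs)+
  also have "... = - I + 2 * (M * (2 * M + 1) * \<epsilon>)"
  proof -
   have "((%z. - ((g z) ^ 3) + M * (2 * M + 1) * \<epsilon>) has_integral - I + M * (2 * M + 1) * \<epsilon> * (1 - (-1))) {-1..1}"
    unfolding I_def by (intro has_integral_add has_integral_neg integrable_integral integrable_continuous_real continuous_intros cg)
      (use has_integral_const_real[of "M * (2 * M + 1) * \<epsilon>" "-1" 1] in \<open>simp add: mult.commute\<close>)
   thus ?thesis by (simp add: integral_unique)
  qed
  also have "2 * (M * (2 * M + 1) * \<epsilon>) <= I / 2"
  proof -
   have "\<epsilon> <= I / (4 * M * (2 * M + 1))" by (simp add: \<epsilon>_def)
   moreover have "4 * M * (2 * M + 1) > 0" using M(1) by simp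
   ultimately have "\<epsilon> * (4 * M * (2 * M + 1)) <= I" by (simp add: pos_le_divide_eq)
   thus ?thesis by (simp add: algebra_simps)
  qed
  finally show ?thesis using I by simp
 qed
 define k where "k = max 0 ((C - 1) / J)"
 have k: "k >= 0" "k * J < C"
 proof -
  show "k >= 0" by (simp add: k_def)
  have "(C - 1) / J <= k" by (simp add: k_def)
  hence "k * J <= C - 1" using J by (simp add: neg_divide_le_eq)
  thus "k * J < C" by simp
 qed
 have "smooth_on_line {-1..1} (%z. k * (s z * s z))" by (intro smooth_line_mult smooth_line_const ss)
 then obtain w1 where w1: "smooth_on_line {-1..1} w1" "w1 0 = 0"
  "!!z. z : {-1..1} ==> (w1 has_real_derivative k * (s z * s z)) (at z within {-1..1})"
  by (rule smooth_line_antideriv[of _ _ _ 0]) auto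
 obtain w where w: "smooth_on_line {-1..1} w" "w 0 = 0"
  "!!z. z : {-1..1} ==> (w has_real_derivative w1 z) (at z within {-1..1})"
  by (rule smooth_line_antideriv[OF w1(1), of 0]) auto
 have nn: "\<kappa> * (1 - z\<^sup>2) * (k * (s z * s z)) >= 0" if "z : {-1..1}" for z
 proof -
  have "1 - z\<^sup>2 >= 0" using that by (simp add: abs_square_le_1 abs_le_iff)
  moreover have "k * (s z * s z) >= 0" using k(1) by simp
  ultimately show ?thesis using \<kappa> by (simp del: mult_eq_0_iff)
 qed
 define u where "u z = u_can \<kappa> z + w z" for z
 have u: "u : potentials \<kappa>" "!!z. abs z < 1 ==> deriv (deriv u) z = ddu_can \<kappa> z + k * (s z * s z)"
  using u_can_add_potential[OF \<kappa> w(1) w1(1) w(3) w1(3) w(2) w1(2)] nn unfolding u_def[abs_def]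
  by (auto simp: add_pos_nonneg abs_less_iff)
 have q: "qf \<kappa> u z = 1 + \<kappa> * (1 - z\<^sup>2) * (k * (s z * s z))" if "z : {-1..1}" for z by (rule qf_eq[OF u(2) \<kappa> that])
 have "integral {-1..1} (Kdens u) <= integral {-1..1} (%z. k * (poly F z * (s z)^2))"
 proof (rule integral_le)
  show "Kdens u integrable_on {-1..1}" by (rule Kdens_integrable[OF u(1)])
  show "(%z. k * (poly F z * (s z)^2)) integrable_on {-1..1}"
   by (intro integrable_continuous_real continuous_intros cs)
  fix z :: real assume z: "z : {-1..1}"
  have "poly P z * ln (qf \<kappa> u z) >= 0" using P[OF z] q[OF z] nn[OF z] by simp
  moreover have "poly Ft z / \<kappa> * (qf \<kappa> u z - 1) = k * (poly F z * (s z)^2)"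
   using q[OF z] \<kappa> by (simp add: poly_F power2_eq_square)
  ultimately show "Kdens u z <= k * (poly F z * (s z)^2)" by (simp add: Kdens_def)
 qed
 also have "... = k * J" by (simp add: J_def)
 finally show ?thesis using u(1) k(2) by (intro bexI[of _ u]) auto
qed

theorem K_bounded_iff: "(\<exists>C. \<forall>u\<in>potentials \<kappa>. C <= integral {-1..1} (Kdens u)) \<longleftrightarrow> (\<forall>z\<in>{-1<..<1}. poly F z >= 0)"
 using Kdens_bounded_below Kdens_unbounded by (meson not_le)

section \<open>The Calabi energy as a weighted norm of the defect of a profile\<close>

definition energy :: "(real => real) => real" where
 "energy u = integral {-1..1} (%z. (poly (pderiv2 F) z - deriv (deriv (prof \<kappa> P u)) z)^2 / poly P z)"

lemma energy_eq:
 assumes "continuous_on {-1..1} F2" "!!z. abs z < 1 ==> deriv (deriv (prof \<kappa> P u)) z = F2 z"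
 shows "((%z. (poly (pderiv2 F) z - F2 z)^2 / poly P z) has_integral energy u) {-1..1}"
proof -
 have "energy u = integral {-1..1} (%z. (poly (pderiv2 F) z - F2 z)^2 / poly P z)"
  unfolding energy_def by (rule integral_spike[of "{-1, 1}"]) (use assms(2) in auto)
 moreover have "(%z. (poly (pderiv2 F) z - F2 z)^2 / poly P z) integrable_on {-1..1}"
  by (intro integrable_continuous_real continuous_intros assms) (use P in force)
 ultimately show ?thesis by (simp add: integrable_integral)
qed

lemma energy_nonneg: "u : potentials \<kappa> ==> energy u >= 0"
proof -
 assume u: "u : potentials \<kappa>"
 obtain F2 where "continuous_on {-1..1} F2" "!!z. abs z < 1 ==> deriv (deriv (prof \<kappa> P u)) z = F2 z"
  by (rule prof_derivs[OF u \<kappa>, of P], rule that, assumption+)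
 from energy_eq[OF this] show ?thesis
  by (rule has_integral_nonneg) (use P in \<open>auto intro!: divide_nonneg_nonneg simp: less_imp_le\<close>)
qed

text \<open>The profile of \<open>u_can\<close> is \<open>Fc = \<kappa> (1 - z^2) P\<close>. The
  convex combination \<open>(1 - \<epsilon>) F + \<epsilon> Fc\<close> is positive with the right
  slopes, hence the profile of a potential, and its second derivative misses that of F by
  \<open>\<epsilon> (F - Fc)''\<close>.\<close>

lemma energy_small:
 assumes nn: "\<forall>z\<in>{-1<..<1}. poly F z >= 0"
 shows "\<exists>E0. \<forall>\<epsilon>. 0 < \<epsilon> --> \<epsilon> <= 1 --> (\<exists>u\<in>potentials \<kappa>. energy u = \<epsilon>\<^sup>2 * E0)"
proof -
 define Fc where "Fc = [:1, 0, -1:] * smult \<kappa> P"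
 define E0 where "E0 = integral {-1..1} (%z. (poly (pderiv (pderiv (F - Fc))) z)^2 / poly P z)"
 have "poly (smult \<kappa> P - Ft) 1 = 0" "poly (smult \<kappa> P - Ft) (-1) = 0" using Ft_ends by auto
 then obtain Q where Q: "smult \<kappa> P - Ft = [:1, 0, -1:] * Q" using quotient_ends by blast
 have Qz: "\<kappa> * poly P z - poly Ft z = (1 - z\<^sup>2) * poly Q z" for z
  using arg_cong[OF Q, of "%p. poly p z"] by (simp add: power2_eq_square algebra_simps)
 have "\<exists>u\<in>potentials \<kappa>. energy u = \<epsilon>\<^sup>2 * E0" if e: "0 < \<epsilon>" "\<epsilon> <= 1" for \<epsilon>
 proof -
  define G where "G = smult (1 - \<epsilon>) Ft + smult (\<epsilon> * \<kappa>) P"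
  have G: "poly G z > 0" if "z : {-1..1}" for z
   using Ft_nonneg[OF nn that] P[OF that] \<kappa> e by (simp add: G_def add_nonneg_pos)
  \<comment> \<open>Obtained by solving \<open>1 + \<kappa> (1 - z^2) w2 = \<kappa> P / G\<close>
    for \<open>w2\<close>; the division by \<open>1 - z^2\<close> is exact because
    \<open>\<kappa> P - Ft\<close> vanishes at both ends.\<close>
  define w2 where "w2 z = (1 - \<epsilon>) * poly Q z / (\<kappa> * poly G z)" for z
  have "smooth_on_line {-1..1} w2" unfolding w2_def
   by (intro smooth_line_divide smooth_line_mult smooth_line_const smooth_line_poly) (use G \<kappa> in force)
  then obtain w1 where w1: "smooth_on_line {-1..1} w1" "w1 0 = 0"
   "!!z. z : {-1..1} ==> (w1 has_real_derivative w2 z) (at z within {-1..1})"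
   by (rule smooth_line_antideriv[of _ _ _ 0]) auto
  obtain w where w: "smooth_on_line {-1..1} w" "w 0 = 0"
   "!!z. z : {-1..1} ==> (w has_real_derivative w1 z) (at z within {-1..1})"
   by (rule smooth_line_antideriv[OF w1(1), of 0]) auto
  have qe: "1 + \<kappa> * (1 - z\<^sup>2) * w2 z = \<kappa> * poly P z / poly G z" if "z : {-1..1}" for z
  proof -
   have "\<kappa> * (1 - z\<^sup>2) * w2 z = (1 - \<epsilon>) * ((1 - z\<^sup>2) * poly Q z) / poly G z" using \<kappa> by (simp add: w2_def)
   also have "(1 - \<epsilon>) * ((1 - z\<^sup>2) * poly Q z) = \<kappa> * poly P z - poly G z"
    unfolding Qz[symmetric] by (simp add: G_def algebra_simps)
   finally show ?thesis using G[OF that] by (simp add: field_simps)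
  qed
  define u where "u z = u_can \<kappa> z + w z" for z
  have pos: "1 + \<kappa> * (1 - z\<^sup>2) * w2 z > 0" if "abs z < 1" for z
   using qe[of z] G[of z] P[of z] \<kappa> that by (auto simp: abs_less_iff)
  have u: "u : potentials \<kappa>" "!!z. abs z < 1 ==> deriv (deriv u) z = ddu_can \<kappa> z + w2 z"
   using u_can_add_potential[OF \<kappa> w(1) w1(1) w(3) w1(3) w(2) w1(2) pos] unfolding u_def[abs_def] by auto
  let ?p = "[:1, 0, -1:] * G"
  have pr: "prof \<kappa> P u z = poly ?p z" if "z : {-1<..<1}" for z
  proof -
   have z: "z : {-1..1}" using that by auto
   have "qf \<kappa> u z = \<kappa> * poly P z / poly G z" using qf_eq[OF u(2) \<kappa> z] qe[OF z] by simp
   hence "\<kappa> * poly P z / qf \<kappa> u z = poly G z" using G[OF z] P[OF z] \<kappa> by simp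
   thus ?thesis by (simp add: prof_def power2_eq_square algebra_simps)
  qed
  have "deriv (deriv (prof \<kappa> P u)) z = poly (pderiv (pderiv ?p)) z" if "abs z < 1" for z
  proof (rule deriv_deriv_eq(2)[of "-1" 1 _ "poly (pderiv ?p)"])
   fix z :: real assume "z : {-1<..<1}"
   thus "(prof \<kappa> P u has_real_derivative poly (pderiv ?p) z) (at z)"
    using pr by (intro deriv_interior_cong[OF poly_DERIV, of "-1" z 1]) auto
  qed (use that poly_DERIV in \<open>auto simp: abs_less_iff\<close>)
  moreover have "?p = smult (1 - \<epsilon>) F + smult \<epsilon> Fc"
   unfolding Fc_def by (subst Ft) (simp add: G_def algebra_simps smult_add_right)
  hence "F - ?p = smult \<epsilon> (F - Fc)" by (simp add: smult_diff_left smult_diff_right)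
  hence "poly (pderiv2 F) z - poly (pderiv (pderiv ?p)) z = \<epsilon> * poly (pderiv (pderiv (F - Fc))) z" for z
   by (metis pderiv_diff pderiv_smult poly_diff poly_smult)
  ultimately have "energy u = integral {-1..1} (%z. \<epsilon>\<^sup>2 * ((poly (pderiv (pderiv (F - Fc))) z)^2 / poly P z))"
   unfolding energy_def by (intro integral_spike[of "{-1, 1}"]) (auto simp: power_mult_distrib)
  also have "... = \<epsilon>\<^sup>2 * E0" unfolding E0_def by (rule integral_mult_right)
  finally show ?thesis using u(1) by (intro bexI[of _ u])
 qed
 thus ?thesis by blast
qed

text \<open>Profiles are positive, so their difference \<open>D\<close> to F is at least
  \<open>\<delta> = - F(z0)\<close> at \<open>z0\<close>, while \<open>D\<close> and
  \<open>D'\<close> vanish at -1. Taylor's formula with integral remainder turns this into a lower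
  bound for the norm of \<open>D''\<close>.\<close>

lemma energy_large:
 assumes z0: "z0 : {-1<..<1}" "poly F z0 < 0"
 shows "\<exists>c>0. \<forall>u\<in>potentials \<kappa>. energy u >= c"
proof -
 obtain M where M: "M > 0" "!!z. z : {-1..1} ==> \<bar>poly P z\<bar> <= M"
 proof -
  have "bounded (poly P ` {-1..1})" by (intro compact_imp_bounded compact_continuous_image continuous_intros) auto
  thus thesis using that by (auto simp: bounded_pos)
 qed
 define \<delta> where "\<delta> = - poly F z0"
 have \<delta>: "\<delta> > 0" using z0 by (simp add: \<delta>_def)
 have "energy u >= \<delta>\<^sup>2 / (8 * M)" if u: "u : potentials \<kappa>" for u
 proof -
  obtain F1 F2 where F: "continuous_on {-1..1} F2"
   "!!z. z : {-1..1} ==> (prof \<kappa> P u has_real_derivative F1 z) (at z within {-1..1})"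
   "!!z. z : {-1..1} ==> (F1 has_real_derivative F2 z) (at z within {-1..1})"
   "F1 1 = - 2 * \<kappa> * poly P 1" "F1 (-1) = 2 * \<kappa> * poly P (-1)" "!!z. abs z < 1 ==> deriv (deriv (prof \<kappa> P u)) z = F2 z"
   by (rule prof_derivs[OF u \<kappa>, of P], rule that, assumption+)
  define h where "h z = F2 z - poly (pderiv2 F) z" for z
  have ch: "continuous_on {-1..1} h" unfolding h_def by (intro continuous_intros F)
  define D where "D z = prof \<kappa> P u z - poly F z" for z
  define D1 where "D1 z = F1 z - poly (pderiv F) z" for z
  have "((%t. (z0 - t) * h t) has_integral ((z0 - z0) * D1 z0 + D z0) - ((z0 - (-1)) * D1 (-1) + D (-1))) {-1..z0}"
  proof (rule fundamental_theorem_of_calculus)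
   fix t assume t: "t : {-1..z0}"
   hence t': "t : {-1..1}" using z0 by auto
   have "(D has_real_derivative D1 t) (at t within {-1..1})" "(D1 has_real_derivative h t) (at t within {-1..1})"
    unfolding D_def D1_def h_def using F(2,3)[OF t'] by (auto intro!: derivative_eq_intros DERIV_subset[OF poly_DERIV])
   hence "(D has_real_derivative D1 t) (at t within {-1..z0})" "(D1 has_real_derivative h t) (at t within {-1..z0})"
    using z0 by (auto intro: DERIV_subset)
   thus "((%t. (z0 - t) * D1 t + D t) has_vector_derivative (z0 - t) * h t) (at t within {-1..z0})"
    unfolding real_deriv_vec[symmetric] by (auto intro!: derivative_eq_intros)
  qed (use z0 in auto)
  moreover have "D1 (-1) = 0" "D (-1) = 0" using F1 F(5) F0 by (auto simp: D1_def D_def prof_def)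
  ultimately have i1: "((%t. (z0 - t) * h t) has_integral D z0) {-1..z0}" by simp
  have "prof \<kappa> P u z0 > 0"
  proof -
   have "1 - z0\<^sup>2 > 0" using z0 by (simp add: abs_square_less_1 abs_less_iff)
   thus ?thesis using P[of z0] qf_pos[OF u \<kappa>, of z0] z0 \<kappa> by (simp add: prof_def)
  qed
  hence d: "\<delta> <= D z0" by (simp add: \<delta>_def D_def)
  have "D z0 <= integral {-1..z0} (%t. \<delta> / 4 + 4 / \<delta> * (h t)^2)" unfolding integral_unique[OF i1, symmetric]
  proof (rule integral_le)
   show "(%t. (z0 - t) * h t) integrable_on {-1..z0}" using i1 by blast
   show "(%t. \<delta> / 4 + 4 / \<delta> * (h t)^2) integrable_on {-1..z0}"
    by (intro integrable_continuous_real continuous_intros continuous_on_subset[OF ch]) (use z0 in auto)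
   fix t assume t: "t : {-1..z0}"
   have "(z0 - t) * h t <= (z0 - t) * \<bar>h t\<bar>" using t by (intro mult_left_mono) auto
   also have "... <= 2 * \<bar>h t\<bar>" using t z0 by (intro mult_right_mono) auto
   \<comment> \<open>Young's inequality, weighted so that the first term integrates to
     \<open>\<delta> / 2\<close> over [-1,1]; the other half of \<open>\<delta>\<close> is left for
     the energy.\<close>
   also have "... <= \<delta> / 4 + 4 / \<delta> * (h t)^2"
   proof -
    have "0 <= (\<delta> / 4 - \<bar>h t\<bar>)^2 * (4 / \<delta>)" using \<delta> by simp
    also have "... = \<delta> / 4 - 2 * \<bar>h t\<bar> + 4 / \<delta> * (h t)^2" using \<delta> by (simp add: power2_eq_square field_simps)
    finally show ?thesis by simp
   qed
   finally show "(z0 - t) * h t <= \<delta> / 4 + 4 / \<delta> * (h t)^2" .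
  qed
  also have "... <= integral {-1..1} (%t. \<delta> / 4 + 4 / \<delta> * (h t)^2)" by (rule integral_subset_le)
    (use z0 \<delta> in \<open>auto intro!: integrable_continuous_real continuous_intros continuous_on_subset[OF ch]\<close>)
  also have "... <= integral {-1..1} (%t. \<delta> / 4 + 4 / \<delta> * M * ((poly (pderiv2 F) t - F2 t)^2 / poly P t))"
  proof (rule integral_le)
   fix t :: real assume t: "t : {-1..1}"
   have "(h t)^2 * poly P t <= (h t)^2 * M" using M(2)[OF t] by (intro mult_left_mono) auto
   hence "(h t)^2 <= M * ((h t)^2 / poly P t)" using P[OF t] by (simp add: pos_le_divide_eq mult.commute)
   moreover have "(h t)^2 = (poly (pderiv2 F) t - F2 t)^2" by (simp add: h_def power2_commute)
   ultimately have "4 / \<delta> * (h t)^2 <= 4 / \<delta> * (M * ((poly (pderiv2 F) t - F2 t)^2 / poly P t))"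
    using \<delta> by (intro mult_left_mono) auto
   thus "\<delta> / 4 + 4 / \<delta> * (h t)^2 <= \<delta> / 4 + 4 / \<delta> * M * ((poly (pderiv2 F) t - F2 t)^2 / poly P t)"
    by (simp add: mult.assoc)
  qed (intro integrable_continuous_real continuous_intros ch F, use P in force)+
  also have "... = \<delta> / 2 + 4 / \<delta> * M * energy u"
  proof -
   have "((%t. \<delta> / 4 + 4 / \<delta> * M * ((poly (pderiv2 F) t - F2 t)^2 / poly P t)) has_integral
     \<delta> / 4 * (1 - (-1)) + 4 / \<delta> * M * energy u) {-1..1}"
    by (intro has_integral_add has_integral_mult_right energy_eq F)
     (use has_integral_const_real[of "\<delta> / 4" "-1" 1] in simp)
   thus ?thesis by (simp add: integral_unique)
  qed
  finally have "\<delta> / 2 <= 4 / \<delta> * M * energy u" using d by linarith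
  thus ?thesis using \<delta> M(1) by (simp add: field_simps power2_eq_square)
 qed
 moreover have "\<delta>\<^sup>2 / (8 * M) > 0" using \<delta> M(1) by simp
 ultimately show ?thesis by blast
qed

theorem energy_INF_iff:
 assumes V: "V > 0"
 shows "(INF u\<in>potentials \<kappa>. V * energy u) = 0 \<longleftrightarrow> (\<forall>z\<in>{-1<..<1}. poly F z >= 0)"
proof
 have ne: "potentials \<kappa> ~= {}" using u_can_potential[OF \<kappa>] by blast
 have bdd: "bdd_below ((%u. V * energy u) ` potentials \<kappa>)" using energy_nonneg V by (intro bdd_belowI[of _ 0]) auto
 {
  assume eq: "(INF u\<in>potentials \<kappa>. V * energy u) = 0"
  show "\<forall>z\<in>{-1<..<1}. poly F z >= 0"
  proof (rule ccontr)
   assume "~ (\<forall>z\<in>{-1<..<1}. poly F z >= 0)"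
   then obtain z0 where "z0 : {-1<..<1}" "poly F z0 < 0" by (auto simp: not_le)
   from energy_large[OF this] obtain c where c: "c > 0" "!!u. u : potentials \<kappa> ==> energy u >= c" by blast
   have "V * c <= (INF u\<in>potentials \<kappa>. V * energy u)" by (rule cINF_greatest[OF ne]) (use c V in auto)
   thus False using eq c(1) V by (simp add: mult_le_0_iff)
  qed
 }
 {
  assume nn: "\<forall>z\<in>{-1<..<1}. poly F z >= 0"
  obtain E0 where E0: "!!\<epsilon>. 0 < \<epsilon> ==> \<epsilon> <= 1 ==> \<exists>u\<in>potentials \<kappa>. energy u = \<epsilon>\<^sup>2 * E0" using energy_small[OF nn] by blast
  have le: "(INF u\<in>potentials \<kappa>. V * energy u) <= V * E0 * \<epsilon>\<^sup>2" if e: "0 < \<epsilon>" "\<epsilon> <= 1" for \<epsilon>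
  proof -
   obtain u where u: "u : potentials \<kappa>" "energy u = \<epsilon>\<^sup>2 * E0" using E0[OF e] by blast
   show ?thesis using cINF_lower[OF bdd u(1)] u(2) by (simp add: mult_ac)
  qed
  have "(INF u\<in>potentials \<kappa>. V * energy u) <= 0"
  proof (rule tendsto_lowerbound)
   have "((%\<epsilon>. V * E0 * \<epsilon>\<^sup>2) \<longlongrightarrow> V * E0 * 0\<^sup>2) (at_right 0)" by (intro tendsto_intros)
   thus "((%\<epsilon>. V * E0 * \<epsilon>\<^sup>2) \<longlongrightarrow> 0) (at_right 0)" by simp
   show "\<forall>\<^sub>F \<epsilon> in at_right 0. (INF u\<in>potentials \<kappa>. V * energy u) <= V * E0 * \<epsilon>\<^sup>2"
    unfolding eventually_at_right_field using le by (intro exI[of _ 1]) auto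
  qed simp
  moreover have "0 <= (INF u\<in>potentials \<kappa>. V * energy u)" by (rule cINF_greatest[OF ne]) (use energy_nonneg V in auto)
  ultimately show "(INF u\<in>potentials \<kappa>. V * energy u) = 0" by simp
 }
qed

end

section \<open>Directional derivatives and smooth maps\<close>

text \<open>Chart images of the factors are open only inside a coordinate subspace, so
  neighbourhoods and derivatives are taken in the directions of \<open>E\<close>.\<close>

definition relopen :: "'v::real_normed_vector set => 'v set => bool" where
 "relopen E W \<longleftrightarrow> subspace E & (\<forall>q\<in>W. \<exists>e>0. \<forall>h\<in>E. norm h < e --> q + h : W)"

lemma relopen_UNIV: "open W ==> relopen UNIV W" unfolding relopen_def open_dist dist_norm
 by (auto simp: subspace_def) (metis add_diff_cancel_left')

lemma relopen_subspace: "relopen E W ==> subspace E" by (simp add: relopen_def)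

lemma relopen_line:
 assumes "relopen E W" "q : W" "v : E"
 shows "\<forall>\<^sub>F t in nhds 0. q + t *\<^sub>R v : W"
proof -
 from assms obtain e where e: "e > 0" "!!h. h : E ==> norm h < e ==> q + h : W" unfolding relopen_def by blast
 have "((%t. norm (t *\<^sub>R v)) \<longlongrightarrow> norm (0 *\<^sub>R v)) (nhds 0)" by (intro tendsto_intros) (simp add: filterlim_ident)
 hence "\<forall>\<^sub>F t in nhds 0. norm (t *\<^sub>R v) < e" by (rule order_tendstoD) (use e in simp)
 thus ?thesis by eventually_elim (use e(2) assms relopen_subspace subspace_scale in blast)
qed

definition ddiff :: "('v::real_normed_vector => 'w::real_normed_vector) => 'v => 'v => bool" where
 "ddiff f q v \<longleftrightarrow> (%t::real. f (q + t *\<^sub>R v)) differentiable (at 0)"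

lemma ddiff_works: "ddiff f q v \<longleftrightarrow> ((%t. f (q + t *\<^sub>R v)) has_vector_derivative dirD f q v) (at 0)"
 unfolding ddiff_def dirD_def by (rule vector_derivative_works)

lemma dirDI:
 assumes "((%t. f (q + t *\<^sub>R v)) has_vector_derivative d) (at 0)"
 shows "dirD f q v = d" "ddiff f q v"
 using assms vector_derivative_at[OF assms] by (auto simp: dirD_def ddiff_def differentiableI_vector)

lemma has_derivative_dirD:
 assumes "(f has_derivative f') (at q)"
 shows "dirD f q v = f' v" "ddiff f q v"
proof -
 have "((%t. f (q + t *\<^sub>R v)) has_derivative (%t. f' (t *\<^sub>R v))) (at 0)"
  by (rule has_derivative_compose[of "%t. q + t *\<^sub>R v" _ 0 UNIV f f', simplified])
   (auto intro!: derivative_eq_intros assms)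
 moreover have "f' (t *\<^sub>R v) = t *\<^sub>R f' v" for t using has_derivative_linear[OF assms] by (simp add: linear_cmul)
 ultimately have "((%t. f (q + t *\<^sub>R v)) has_vector_derivative f' v) (at 0)" by (simp add: has_vector_derivative_def)
 from dirDI[OF this] show "dirD f q v = f' v" "ddiff f q v" by auto
qed

lemma dirD_cong_eventually:
 assumes "\<forall>\<^sub>F t in nhds 0. f (q + t *\<^sub>R v) = g (q + t *\<^sub>R v)"
 shows "dirD f q v = dirD g q v" "ddiff f q v \<longleftrightarrow> ddiff g q v"
proof -
 have "((%t. f (q + t *\<^sub>R v)) has_vector_derivative d) (at 0) \<longleftrightarrow> ((%t. g (q + t *\<^sub>R v)) has_vector_derivative d) (at 0)" for d
  by (rule has_vector_derivative_cong_ev) (use assms eventually_nhds_x_imp_x[OF assms] in auto)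
 thus "dirD f q v = dirD g q v" "ddiff f q v \<longleftrightarrow> ddiff g q v" by (auto simp: dirD_def vector_derivative_def ddiff_works)
qed

lemma dirD_cong:
 assumes "relopen E W" "q : W" "v : E" "!!p. p : W ==> f p = g p"
 shows "dirD f q v = dirD g q v" "ddiff f q v \<longleftrightarrow> ddiff g q v"
proof -
 have "\<forall>\<^sub>F t in nhds 0. f (q + t *\<^sub>R v) = g (q + t *\<^sub>R v)"
  using relopen_line[OF assms(1-3)] by eventually_elim (use assms(4) in auto)
 from dirD_cong_eventually[OF this] show "dirD f q v = dirD g q v" "ddiff f q v \<longleftrightarrow> ddiff g q v" by auto
qed

lemma dirD_scaleR:
 assumes "ddiff f q v"
 shows "dirD f q (c *\<^sub>R v) = c *\<^sub>R dirD f q v" "ddiff f q (c *\<^sub>R v)"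
proof -
 have "((%t. f (q + (c * t) *\<^sub>R v)) has_vector_derivative c *\<^sub>R dirD f q v) (at 0)"
  using vector_diff_chain_at[of "%t. c * t" c 0 "%t. f (q + t *\<^sub>R v)" "dirD f q v"] assms[unfolded ddiff_works]
  by (simp add: o_def real_deriv_vec[symmetric])
 hence "((%t. f (q + t *\<^sub>R (c *\<^sub>R v))) has_vector_derivative c *\<^sub>R dirD f q v) (at 0)" by (simp add: mult.commute)
 from dirDI[OF this] show "dirD f q (c *\<^sub>R v) = c *\<^sub>R dirD f q v" "ddiff f q (c *\<^sub>R v)" by auto
qed

lemma dirD_minus: "ddiff f q v ==> dirD f q (- v) = - dirD f q v" using dirD_scaleR(1)[of f q v "-1"] by simp

lemma dirD_zero: "dirD f q 0 = 0" by (rule dirDI) simp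

lemma dirD_along:
 assumes "ddiff f (q + s *\<^sub>R v) v"
 shows "((%t. f (q + t *\<^sub>R v)) has_vector_derivative dirD f (q + s *\<^sub>R v) v) (at s)"
proof -
 have "((%t. f ((q + s *\<^sub>R v) + t *\<^sub>R v)) has_vector_derivative dirD f (q + s *\<^sub>R v) v) (at 0)"
  using assms by (simp add: ddiff_works)
 hence "(((%t. f ((q + s *\<^sub>R v) + t *\<^sub>R v)) \<circ> (%t. t - s)) has_vector_derivative 1 *\<^sub>R dirD f (q + s *\<^sub>R v) v) (at s)"
  by (intro vector_diff_chain_at) (auto intro!: derivative_eq_intros)
 moreover have "(%t. f ((q + s *\<^sub>R v) + t *\<^sub>R v)) \<circ> (%t. t - s) = (%t. f (q + t *\<^sub>R v))"
  by (auto simp: fun_eq_iff scaleR_diff_left)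
 ultimately show ?thesis by simp
qed

lemma Ck_on_cong:
 assumes "relopen E W" "!!p. p : W ==> f p = g p"
 shows "Ck_on k E W f = Ck_on k E W g" using assms(2)
proof (induction k arbitrary: f g)
 case 0
 thus ?case by (simp cong: continuous_on_cong)
next
 case (Suc k)
 have "continuous_on W f = continuous_on W g" using Suc.prems by (simp cong: continuous_on_cong)
 moreover have "(\<forall>q\<in>W. ddiff f q v) = (\<forall>q\<in>W. ddiff g q v)" if "v : E" for v
  using dirD_cong(2)[OF assms(1) _ that Suc.prems] by auto
 moreover have "Ck_on k E W (%q. dirD f q v) = Ck_on k E W (%q. dirD g q v)" if "v : E" for v
  by (rule Suc.IH) (rule dirD_cong(1)[OF assms(1) _ that Suc.prems])
 ultimately show ?case by (auto simp flip: ddiff_def)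
qed

lemma Ck_on_SucD:
 assumes "Ck_on (Suc k) E W f"
 shows "continuous_on W f" "!!q v. q : W ==> v : E ==> ddiff f q v" "!!v. v : E ==> Ck_on k E W (%q. dirD f q v)"
 using assms by (auto simp: ddiff_def)

lemma Ck_on_SucI:
 assumes "relopen E W" "continuous_on W f"
  "!!q v. q : W ==> v : E ==> ((%t. f (q + t *\<^sub>R v)) has_vector_derivative D q v) (at 0)"
  "!!v. v : E ==> Ck_on k E W (%q. D q v)"
 shows "Ck_on (Suc k) E W f"
proof -
 have "dirD f q v = D q v" "ddiff f q v" if "q : W" "v : E" for q v using dirDI[OF assms(3)[OF that]] by auto
 thus ?thesis using assms(2,4) Ck_on_cong[OF assms(1), of "%q. dirD f q v" "%q. D q v" k for v]
  by (auto simp flip: ddiff_def)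
qed

lemma Ck_on_Suc_imp: "Ck_on (Suc k) E W f ==> Ck_on k E W f"
proof (induction k arbitrary: f)
 case (Suc k)
 note f = Ck_on_SucD[OF Suc.prems]
 show ?case using f(1,2) Suc.IH[OF f(3)] by (auto simp flip: ddiff_def)
qed simp

lemma Ck_on_continuous: "Ck_on k E W f ==> continuous_on W f" by (cases k) auto

lemma Ck_on_const: "relopen E W ==> Ck_on k E W (%q. c)"
proof (induction k arbitrary: c)
 case (Suc k)
 show ?case by (rule Ck_on_SucI[where D = "%q v. 0"]) (use Suc in auto)
qed auto

lemma Ck_on_add:
 assumes "relopen E W" "Ck_on k E W f" "Ck_on k E W g"
 shows "Ck_on k E W (%q. f q + g q)" using assms(2,3)
proof (induction k arbitrary: f g)
 case (Suc k)
 show ?case by (rule Ck_on_SucI[where D = "%q v. dirD f q v + dirD g q v"])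
   (use Suc Ck_on_SucD[OF Suc.prems(1)] Ck_on_SucD[OF Suc.prems(2)] assms(1) in
    \<open>auto intro!: continuous_intros has_vector_derivative_add simp: ddiff_works\<close>)
qed (auto intro!: continuous_intros)

lemma Ck_on_bilinear:
 assumes bl: "bounded_bilinear B" and "relopen E W" "Ck_on k E W f" "Ck_on k E W g"
 shows "Ck_on k E W (%q. B (f q) (g q))" using assms(3,4)
proof (induction k arbitrary: f g)
 case 0
 thus ?case by (auto intro!: bounded_bilinear.continuous_on[OF bl])
next
 case (Suc k)
 note f = Ck_on_SucD[OF Suc.prems(1)] and g = Ck_on_SucD[OF Suc.prems(2)]
 show ?case
 proof (rule Ck_on_SucI[where D = "%q v. B (f q) (dirD g q v) + B (dirD f q v) (g q)"])
  fix q v assume "q : W" "v : E"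
  thus "((%t. B (f (q + t *\<^sub>R v)) (g (q + t *\<^sub>R v))) has_vector_derivative B (f q) (dirD g q v) + B (dirD f q v) (g q)) (at 0)"
   using bounded_bilinear.has_vector_derivative[OF bl, of "%t. f (q + t *\<^sub>R v)" "dirD f q v" 0 UNIV "%t. g (q + t *\<^sub>R v)" "dirD g q v"]
    f(2) g(2) by (simp add: ddiff_works)
 next
  fix v assume "v : E"
  thus "Ck_on k E W (%q. B (f q) (dirD g q v) + B (dirD f q v) (g q))"
   by (intro Ck_on_add Suc.IH assms(2) f(3) g(3) Ck_on_Suc_imp[OF Suc.prems(1)] Ck_on_Suc_imp[OF Suc.prems(2)])
 qed (use f g assms(2) in \<open>auto intro!: bounded_bilinear.continuous_on[OF bl]\<close>)
qed

lemma Ck_on_bounded_linear_comp: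
 assumes L: "bounded_linear L" and "relopen E W" "Ck_on k E W f"
 shows "Ck_on k E W (%q. L (f q))" using assms(3)
proof (induction k arbitrary: f)
 case 0
 thus ?case by (auto intro!: bounded_linear.continuous_on[OF L])
next
 case (Suc k)
 note f = Ck_on_SucD[OF Suc.prems(1)]
 show ?case
 proof (rule Ck_on_SucI[where D = "%q v. L (dirD f q v)"])
  fix q v assume "q : W" "v : E"
  thus "((%t. L (f (q + t *\<^sub>R v))) has_vector_derivative L (dirD f q v)) (at 0)"
   using f(2) by (intro bounded_linear.has_vector_derivative[OF L]) (simp add: ddiff_works)
 qed (use f Suc assms(2) in \<open>auto intro!: bounded_linear.continuous_on[OF L]\<close>)
qed

lemma Ck_on_precomp_linear:
 assumes A: "bounded_linear A" and "relopen E' W'" "relopen E W" "A ` E' \<subseteq> E" "A ` W' \<subseteq> W" and "Ck_on k E W f"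
 shows "Ck_on k E' W' (%q. f (A q))" using assms(6)
proof (induction k arbitrary: f)
 case 0
 have "continuous_on W' A" using A linear_continuous_on by blast
 with 0 assms(5) show ?case by (auto intro: continuous_on_compose2)
next
 case (Suc k)
 note f = Ck_on_SucD[OF Suc.prems(1)]
 have lin: "A (q + t *\<^sub>R v) = A q + t *\<^sub>R A v" for q t v
  using A by (simp add: bounded_linear.axioms(1) linear_add linear_cmul bounded_linear.linear)
 have "continuous_on W' A" using A linear_continuous_on by blast
 hence c: "continuous_on W' (%q. f (A q))" using f(1) assms(5) by (auto intro: continuous_on_compose2)
 show ?case
 proof (rule Ck_on_SucI[where D = "%q v. dirD f (A q) (A v)"])
  fix q v assume "q : W'" "v : E'"
  hence "A q : W" "A v : E" using assms by auto
  thus "((%t. f (A (q + t *\<^sub>R v))) has_vector_derivative dirD f (A q) (A v)) (at 0)"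
   using f(2) unfolding lin by (simp add: ddiff_works)
 next
  fix v assume "v : E'"
  thus "Ck_on k E' W' (%q. dirD f (A q) (A v))" using Suc.IH[OF f(3)] assms(4) by auto
 qed (use c assms in auto)
qed

text \<open>The tower of derivatives of the outer function is kept as a whole: differentiating
  \<open>D n (f q)\<close> brings in \<open>D (Suc n) (f q)\<close>, so the induction runs for all
  \<open>n\<close> simultaneously.\<close>

lemma Ck_on_compose_real:
 fixes f :: "'v::real_normed_vector => real"
 assumes D: "!!n x. x : J ==> (D n has_real_derivative D (Suc n) x) (at x)" and "relopen E W" "f ` W \<subseteq> J" "Ck_on k E W f"
 shows "Ck_on k E W (%q. D n (f q))" using assms(4)
proof (induction k arbitrary: n)
 have cD: "continuous_on J (D n)" for n by (auto intro!: continuous_at_imp_continuous_on DERIV_isCont D)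
 {
  case 0
  with cD assms(3) show ?case by (auto intro: continuous_on_compose2)
 next
  case (Suc k)
  note f = Ck_on_SucD[OF Suc.prems(1)]
  have "continuous_on W (%q. D n (f q))" using f(1) assms(3) cD by (auto intro: continuous_on_compose2)
  moreover have "((%t. D n (f (q + t *\<^sub>R v))) has_vector_derivative D (Suc n) (f q) * dirD f q v) (at 0)"
   if "q : W" "v : E" for q v
  proof -
   have "((%t. f (q + t *\<^sub>R v)) has_real_derivative dirD f q v) (at 0)"
    using f(2)[OF that] by (simp add: ddiff_works real_deriv_vec)
   moreover have "(D n has_real_derivative D (Suc n) (f q)) (at (f (q + 0 *\<^sub>R v)))" using D assms(3) that by auto
   ultimately show ?thesis
    using DERIV_chain2[of "D n" "D (Suc n) (f q)" "%t. f (q + t *\<^sub>R v)" 0] by (simp add: real_deriv_vec)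
  qed
  moreover have "Ck_on k E W (%q. D (Suc n) (f q) * dirD f q v)" if "v : E" for v
   by (rule Ck_on_bilinear[OF bounded_bilinear_mult assms(2) Suc.IH[OF Ck_on_Suc_imp[OF Suc.prems]] f(3)[OF that]])
  ultimately show ?case by (intro Ck_on_SucI[OF assms(2)])
 }
qed

lemma smooth_in_const: "relopen E W ==> smooth_in E W (%q. c)" by (simp add: smooth_in_def Ck_on_const)

lemma smooth_in_add: "relopen E W ==> smooth_in E W f ==> smooth_in E W g ==> smooth_in E W (%q. f q + g q)"
 by (simp add: smooth_in_def Ck_on_add)

lemma smooth_in_mult:
 fixes f g :: "'v::real_normed_vector => 'a::real_normed_algebra"
 shows "relopen E W ==> smooth_in E W f ==> smooth_in E W g ==> smooth_in E W (%q. f q * g q)"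
 by (simp add: smooth_in_def Ck_on_bilinear[OF bounded_bilinear_mult])

lemma smooth_in_bounded_linear_comp: "bounded_linear L ==> relopen E W ==> smooth_in E W f ==> smooth_in E W (%q. L (f q))"
 by (simp add: smooth_in_def Ck_on_bounded_linear_comp)

lemma smooth_in_uminus: "relopen E W ==> smooth_in E W f ==> smooth_in E W (%q. - f q)"
 using smooth_in_bounded_linear_comp[OF bounded_linear_minus[OF bounded_linear_ident]] .

lemma smooth_in_diff: "relopen E W ==> smooth_in E W f ==> smooth_in E W g ==> smooth_in E W (%q. f q - g q)"
 using smooth_in_add[of E W f "%q. - g q"] smooth_in_uminus[of E W g] by simp

lemma smooth_in_precomp_linear: "bounded_linear A ==> relopen E' W' ==> relopen E W ==> A ` E' \<subseteq> E ==> A ` W' \<subseteq> W ==>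
  smooth_in E W f ==> smooth_in E' W' (%q. f (A q))" by (simp add: smooth_in_def Ck_on_precomp_linear)

lemma smooth_in_cong: "relopen E W ==> (!!p. p : W ==> f p = g p) ==> smooth_in E W f = smooth_in E W g"
 using Ck_on_cong by (metis smooth_in_def)

lemma smooth_in_sum: "relopen E W ==> (!!i. i : I ==> smooth_in E W (f i)) ==> smooth_in E W (%q. \<Sum>i\<in>I. f i q)"
 by (induction I rule: infinite_finite_induct) (auto intro: smooth_in_add smooth_in_const)

lemma smooth_in_prod:
 fixes f :: "'i => 'v::real_normed_vector => 'a::real_normed_field"
 shows "relopen E W ==> (!!i. i : I ==> smooth_in E W (f i)) ==> smooth_in E W (%q. \<Prod>i\<in>I. f i q)"
 by (induction I rule: infinite_finite_induct) (auto intro: smooth_in_mult smooth_in_const)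

lemma smooth_in_dirD: "smooth_in E W f ==> v : E ==> smooth_in E W (%q. dirD f q v)"
 unfolding smooth_in_def using Ck_on_SucD(3) by blast

lemma smooth_in_ddiff: "smooth_in E W f ==> q : W ==> v : E ==> ddiff f q v"
 unfolding smooth_in_def using Ck_on_SucD(2) by blast

lemma smooth_in_continuous: "smooth_in E W f ==> continuous_on W f"
 unfolding smooth_in_def using Ck_on_continuous by blast

lemma smooth_in_linear:
 assumes "bounded_linear L" "relopen E W"
 shows "smooth_in E W L"
proof -
 have lin: "L (q + t *\<^sub>R v) = L q + t *\<^sub>R L v" for q t v
  using assms(1) by (simp add: linear_add linear_cmul bounded_linear.linear)
 have "Ck_on (Suc k) E W L" for k by (rule Ck_on_SucI[where D = "%q v. L v"])
   (use assms linear_continuous_on in \<open>auto simp: lin intro!: Ck_on_const derivative_eq_intros\<close>)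
 thus ?thesis unfolding smooth_in_def using Ck_on_Suc_imp by blast
qed

lemma smooth_line_open_family:
 assumes "open J" "smooth_on_line J h"
 obtains D where "!!n x. x : J ==> (D n has_real_derivative D (Suc n) x) (at x)" "!!x. x : J ==> D 0 x = h x"
proof -
 from assms(2) obtain D where D: "\<forall>x\<in>J. D 0 x = h x" "\<forall>n. \<forall>x\<in>J. (D n has_real_derivative D (Suc n) x) (at x within J)"
  unfolding smooth_on_line_def by blast
 hence "(D n has_real_derivative D (Suc n) x) (at x)" if "x : J" for n x
  using that at_within_open[OF that assms(1)] by metis
 thus thesis using that[of D] D(1) by blast
qed

lemma smooth_in_compose_real:
 fixes f :: "'v::real_normed_vector => real"
 assumes "open J" "smooth_on_line J h" "relopen E W" "f ` W \<subseteq> J" "smooth_in E W f"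
 shows "smooth_in E W (%q. h (f q))"
proof -
 obtain D where D: "!!n x. x : J ==> (D n has_real_derivative D (Suc n) x) (at x)" "!!x. x : J ==> D 0 x = h x"
  using smooth_line_open_family[OF assms(1,2)] by blast
 have "smooth_in E W (%q. D 0 (f q))" using assms Ck_on_compose_real[of J D, OF D(1)] unfolding smooth_in_def by blast
 moreover have "D 0 (f p) = h (f p)" if "p : W" for p using D(2) assms(4) that by auto
 ultimately show ?thesis using smooth_in_cong[OF assms(3)] by metis
qed

lemma dirD_compose_real:
 fixes f :: "'v::real_normed_vector => real"
 assumes "(h has_real_derivative h') (at (f q))" "ddiff f q v"
 shows "dirD (%p. h (f p)) q v = h' * dirD f q v" "ddiff (%p. h (f p)) q v"
proof -
 have "((%t. h (f (q + t *\<^sub>R v))) has_vector_derivative h' * dirD f q v) (at 0)"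
  using DERIV_chain2[of h h' "%t. f (q + t *\<^sub>R v)" 0 "dirD f q v" UNIV] assms
  by (simp add: ddiff_works real_deriv_vec)
 from dirDI[OF this] show "dirD (%p. h (f p)) q v = h' * dirD f q v" "ddiff (%p. h (f p)) q v" by auto
qed

lemma dirD_add_fun: "ddiff f q v ==> ddiff g q v ==> dirD (%p. f p + g p) q v = dirD f q v + dirD g q v"
 "ddiff f q v ==> ddiff g q v ==> ddiff (%p. f p + g p) q v"
 using dirDI[of "%p. f p + g p" q v, OF has_vector_derivative_add] by (simp_all add: ddiff_works)

lemma dirD_mult_fun:
 fixes f g :: "'v::real_normed_vector => real"
 assumes "ddiff f q v" "ddiff g q v"
 shows "dirD (%p. f p * g p) q v = f q * dirD g q v + dirD f q v * g q" "ddiff (%p. f p * g p) q v"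
 using dirDI[of "%p. f p * g p" q v, OF has_vector_derivative_mult[OF assms[unfolded ddiff_works]]] by simp_all

lemma dirD_uminus_fun: "ddiff f q v ==> dirD (%p. - f p) q v = - dirD f q v" "ddiff f q v ==> ddiff (%p. - f p) q v"
 using dirDI[of "%p. - f p" q v, OF has_vector_derivative_minus] by (simp_all add: ddiff_works)

lemma dirD_const: "dirD (%p. c) q v = 0" "ddiff (%p. c) q v" using dirDI[of "%p. c" q v 0] by auto

section \<open>Mean value estimates, total derivatives and symmetry of second derivatives\<close>

lemma dirD_mvt:
 fixes f :: "'v::real_normed_vector => real"
 assumes "!!s. 0 <= s ==> s <= 1 ==> ddiff f (q + s *\<^sub>R h) h"
 shows "\<exists>s. 0 < s & s < 1 & f (q + h) - f q = dirD f (q + s *\<^sub>R h) h"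
proof -
 have "\<exists>z>0. z < 1 & f (q + 1 *\<^sub>R h) - f (q + 0 *\<^sub>R h) = (1 - 0) * dirD f (q + z *\<^sub>R h) h"
  by (rule MVT2) (use assms dirD_along[of f q _ h] in \<open>auto simp: real_deriv_vec\<close>)
 thus ?thesis by auto
qed

lemma abs_le_add_halves:
 fixes a b c :: real
 assumes "\<bar>a\<bar> <= e / 2 * n" "\<bar>b\<bar> <= e / 2 * n" "c = a + b"
 shows "\<bar>c\<bar> <= e * n"
proof -
 have "\<bar>c\<bar> <= \<bar>a\<bar> + \<bar>b\<bar>" using assms(3) by simp
 also have "... <= e / 2 * n + e / 2 * n" using assms(1,2) by (rule add_mono)
 finally show ?thesis by simp
qed

text \<open>Strict differentiability in one direction: the estimate is uniform in the base point
  \<open>p\<close> near \<open>q\<close>, which allows increments along several directions to be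
  chained.\<close>

lemma C1_strict_estimate:
 fixes f :: "'v::real_normed_vector => real"
 assumes "relopen E W" "Ck_on 1 E W f" "q : W" "v : E" "\<epsilon> > 0"
 shows "\<exists>\<delta>>0. \<forall>p t. p - q : E --> norm (p - q) < \<delta> --> \<bar>t\<bar> < \<delta> --> \<bar>f (p + t *\<^sub>R v) - f p - t * dirD f q v\<bar> <= \<epsilon> * \<bar>t\<bar>"
proof -
 note f = Ck_on_SucD[OF assms(2)[unfolded One_nat_def]]
 from assms(1,3) obtain e where e: "e > 0" "!!h. h : E ==> norm h < e ==> q + h : W" unfolding relopen_def by blast
 have sub: "subspace E" using assms(1) relopen_subspace by blast
 have "continuous_on W (%p. dirD f p v)" using f(3)[OF assms(4)] by simp
 then obtain d where d: "d > 0" "!!p. p : W ==> dist p q < d ==> dist (dirD f p v) (dirD f q v) < \<epsilon>"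
  using assms(3,5) unfolding continuous_on_iff by metis
 define \<delta> where "\<delta> = min e d / (2 * (1 + norm v))"
 have nv: "1 + norm v > 0" by (simp add: add_pos_nonneg)
 have \<delta>: "\<delta> > 0" using e d nv by (simp add: \<delta>_def)
 have "\<bar>f (p + t *\<^sub>R v) - f p - t * dirD f q v\<bar> <= \<epsilon> * \<bar>t\<bar>"
  if p: "p - q : E" "norm (p - q) < \<delta>" and t: "\<bar>t\<bar> < \<delta>" for p t
 proof -
  have near: "p + s *\<^sub>R (t *\<^sub>R v) : W & dist (p + s *\<^sub>R (t *\<^sub>R v)) q < d" if s: "0 <= s" "s <= 1" for s
  proof -
   have "norm ((p - q) + (s * t) *\<^sub>R v) <= norm (p - q) + \<bar>s * t\<bar> * norm v" by (metis norm_triangle_ineq norm_scaleR)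
   also have "\<bar>s * t\<bar> <= \<delta>" using s t by (simp add: abs_mult) (meson abs_ge_zero less_imp_le mult_left_le_one_le order_trans)
   hence "\<bar>s * t\<bar> * norm v <= \<delta> * norm v" by (simp add: mult_right_mono)
   hence "norm (p - q) + \<bar>s * t\<bar> * norm v < \<delta> * (1 + norm v)" using p by (simp add: algebra_simps)
   also have "\<delta> * (1 + norm v) = min e d / 2" using nv by (simp add: \<delta>_def field_simps)
   also have "... < min e d" using e(1) d(1) by (auto simp: min_def)
   finally have lt: "norm ((p - q) + (s * t) *\<^sub>R v) < min e d" .
   have "(p - q) + (s * t) *\<^sub>R v : E" using p assms(4) sub by (simp add: subspace_add subspace_scale)
   hence "q + ((p - q) + (s * t) *\<^sub>R v) : W" by (rule e(2)) (use lt in simp)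
   moreover have "q + ((p - q) + (s * t) *\<^sub>R v) = p + s *\<^sub>R (t *\<^sub>R v)" by simp
   moreover have "dist (p + s *\<^sub>R (t *\<^sub>R v)) q < d" using lt by (simp add: dist_norm algebra_simps)
   ultimately show ?thesis by simp
  qed
  have "\<exists>s. 0 < s & s < 1 & f (p + t *\<^sub>R v) - f p = dirD f (p + s *\<^sub>R (t *\<^sub>R v)) (t *\<^sub>R v)"
   by (rule dirD_mvt) (use near f(2) assms(4) sub subspace_scale in blast)
  then obtain s where s: "0 < s" "s < 1" "f (p + t *\<^sub>R v) - f p = dirD f (p + s *\<^sub>R (t *\<^sub>R v)) (t *\<^sub>R v)" by blast
  have n: "p + s *\<^sub>R (t *\<^sub>R v) : W" "dist (p + s *\<^sub>R (t *\<^sub>R v)) q < d" using near[of s] s by auto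
  have "dirD f (p + s *\<^sub>R (t *\<^sub>R v)) (t *\<^sub>R v) = t * dirD f (p + s *\<^sub>R (t *\<^sub>R v)) v"
   using dirD_scaleR(1)[OF f(2)[OF n(1) assms(4)], of t] by simp
  hence "f (p + t *\<^sub>R v) - f p - t * dirD f q v = t * (dirD f (p + s *\<^sub>R (t *\<^sub>R v)) v - dirD f q v)"
   using s(3) by (simp add: right_diff_distrib)
  moreover have "\<bar>dirD f (p + s *\<^sub>R (t *\<^sub>R v)) v - dirD f q v\<bar> <= \<epsilon>" using d(2)[OF n] by (simp add: dist_real_def)
  ultimately show ?thesis by (simp add: abs_mult) (metis abs_ge_zero mult.commute mult_right_mono)
 qed
 thus ?thesis using \<delta> by blast
qed

text \<open>\<open>Ck_on\<close> speaks only of derivatives along single directions, and linearity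
  in the direction has to be proved. Changing the coordinates one at a time and adding the strict
  estimates yields the total derivative.\<close>

lemma has_derivative_of_C1:
 fixes f :: "'v::euclidean_space => real"
 assumes "open W" "Ck_on 1 UNIV W f" "q : W"
 shows "(f has_derivative dirD f q) (at q)"
proof -
 have ro: "relopen UNIV W" using assms(1) by (rule relopen_UNIV)
 define L where "L B h = (\<Sum>b\<in>B. (h \<bullet> b) * dirD f q b)" for B and h :: 'v
 define S where "S B h = (\<Sum>b\<in>B. (h \<bullet> b) *\<^sub>R b)" for B and h :: 'v
 have main: "\<forall>\<epsilon>>0. \<exists>\<delta>>0. \<forall>p h. norm (p - q) < \<delta> --> norm h < \<delta> --> \<bar>f (p + S B h) - f p - L B h\<bar> <= \<epsilon> * norm h"
  if "finite B" "B \<subseteq> Basis" for B using that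
 proof (induction B rule: finite_induct)
  case empty
  thus ?case by (auto simp: S_def L_def intro!: exI[of _ 1])
 next
  case (insert b B)
  show ?case
  proof (intro allI impI)
   fix \<epsilon> :: real assume "\<epsilon> > 0"
   hence e2: "\<epsilon> / 2 > 0" by simp
   obtain d1 where d1: "d1 > 0" "!!p h. norm (p - q) < d1 ==> norm h < d1 ==> \<bar>f (p + S B h) - f p - L B h\<bar> <= \<epsilon> / 2 * norm h"
    using insert.IH insert.prems e2 by (metis insert_subset)
   obtain d2 where d2: "d2 > 0" "!!p t. norm (p - q) < d2 ==> \<bar>t\<bar> < d2 ==>
    \<bar>f (p + t *\<^sub>R b) - f p - t * dirD f q b\<bar> <= \<epsilon> / 2 * \<bar>t\<bar>"
    using C1_strict_estimate[OF ro assms(2,3) UNIV_I e2, of b] by auto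
   \<comment> \<open>The partial sum \<open>S B h\<close> has norm at most \<open>card B\<close>
     times that of \<open>h\<close>; \<open>C\<close> leaves room for the shifted base point to stay
     within \<open>d2\<close>.\<close>
   define C where "C = 2 + real (card B)"
   have C: "C >= 2" by (simp add: C_def)
   define d where "d = min d1 (d2 / C)"
   have dp: "d > 0" using d1 d2 C by (simp add: d_def)
   have "\<bar>f (p + S (insert b B) h) - f p - L (insert b B) h\<bar> <= \<epsilon> * norm h"
    if p: "norm (p - q) < d" and h: "norm h < d" for p h
   proof -
    have bB: "b : Basis" "!!c. c : B ==> c : Basis" using insert.prems by auto
    have hb: "\<bar>h \<bullet> c\<bar> <= norm h" if "c : Basis" for c using that by (rule Basis_le_norm)
    have "norm (S B h) <= (\<Sum>c\<in>B. norm ((h \<bullet> c) *\<^sub>R c))" unfolding S_def by (rule norm_sum)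
    also have "... <= (\<Sum>c\<in>B. norm h)" by (intro sum_mono) (use hb bB in auto)
    finally have nS: "norm (S B h) <= real (card B) * norm h" by simp
    have Cd: "C * d <= d2" using C by (simp add: d_def field_simps min_def)
    have "norm (p + S B h - q) <= norm (p - q) + norm (S B h)"
     by (metis add_diff_eq add.commute norm_triangle_ineq diff_add_eq)
    also have "... < d + real (card B) * d" using p nS h
     by (intro add_less_le_mono) (auto intro!: order_trans[OF nS] mult_left_mono)
    also have "... <= C * d" using dp by (simp add: C_def algebra_simps)
    finally have 1: "norm (p + S B h - q) < d2" using Cd by simp
    have "d <= C * d" using C dp by simp
    hence 2: "\<bar>h \<bullet> b\<bar> < d2" using hb[OF bB(1)] h Cd by linarith
    have "\<bar>f (p + S B h + (h \<bullet> b) *\<^sub>R b) - f (p + S B h) - (h \<bullet> b) * dirD f q b\<bar> <= \<epsilon> / 2 * \<bar>h \<bullet> b\<bar>"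
     by (rule d2(2)[OF 1 2])
    also have "... <= \<epsilon> / 2 * norm h" using e2 hb[OF bB(1)] by (intro mult_left_mono) auto
    finally have 3: "\<bar>f (p + S B h + (h \<bullet> b) *\<^sub>R b) - f (p + S B h) - (h \<bullet> b) * dirD f q b\<bar> <= \<epsilon> / 2 * norm h" .
    have 4: "\<bar>f (p + S B h) - f p - L B h\<bar> <= \<epsilon> / 2 * norm h" by (rule d1(2)) (use p h in \<open>auto simp: d_def\<close>)
    have "S (insert b B) h = S B h + (h \<bullet> b) *\<^sub>R b" "L (insert b B) h = L B h + (h \<bullet> b) * dirD f q b"
     using insert.hyps by (simp_all add: S_def L_def)
    thus ?thesis using 3 4 by (intro abs_le_add_halves[OF 3 4]) (simp_all add: add.assoc[symmetric])
   qed
   thus "\<exists>\<delta>>0. \<forall>p h. norm (p - q) < \<delta> --> norm h < \<delta> --> \<bar>f (p + S (insert b B) h) - f p - L (insert b B) h\<bar> <= \<epsilon> * norm h"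
    using dp by blast
  qed
 qed
 have SB: "S Basis h = h" for h by (simp add: S_def euclidean_representation)
 have D: "(f has_derivative L Basis) (at q)" unfolding has_derivative_at_alt
 proof (intro conjI allI impI)
  show "bounded_linear (L Basis)"
   unfolding L_def by (intro bounded_linear_sum bounded_linear_mult_const bounded_linear_inner_left)
  fix \<epsilon> :: real assume "\<epsilon> > 0"
  then obtain d where d: "d > 0" "!!p h. norm (p - q) < d ==> norm h < d ==> \<bar>f (p + h) - f p - L Basis h\<bar> <= \<epsilon> * norm h"
   using main[of Basis] SB by auto
  show "\<exists>d>0. \<forall>y. norm (y - q) < d --> norm (f y - f q - L Basis (y - q)) <= \<epsilon> * norm (y - q)"
   using d(1) d(2)[of q "y - q" for y] by (intro exI[of _ d]) auto
 qed
 have "dirD f q = L Basis" using has_derivative_dirD(1)[OF D] by auto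
 thus ?thesis using D by simp
qed

text \<open>Two applications of the mean value theorem write the second difference, which is
  symmetric in \<open>v\<close> and \<open>w\<close>, as a mixed derivative at a nearby point;
  \<open>dirD_symmetric\<close> compares the two resulting limits.\<close>

lemma second_difference:
 fixes f :: "'v::real_normed_vector => real"
 assumes ro: "relopen E W" and C2: "Ck_on 2 E W f" and "q : W" "v : E" "w : E" "\<epsilon> > 0"
 shows "\<exists>\<delta>>0. \<forall>t. 0 < t --> t < \<delta> -->
  \<bar>(f (q + t *\<^sub>R v + t *\<^sub>R w) - f (q + t *\<^sub>R v) - f (q + t *\<^sub>R w) + f q) / t\<^sup>2 - dirD (%p. dirD f p v) q w\<bar> < \<epsilon>"
proof -
 note f = Ck_on_SucD[OF C2[unfolded numeral_2_eq_2]]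
 note fv = Ck_on_SucD[OF f(3)[OF assms(4)]]
 from ro assms(3) obtain e where e: "e > 0" "!!h. h : E ==> norm h < e ==> q + h : W" unfolding relopen_def by blast
 have sub: "subspace E" using ro relopen_subspace by blast
 have "continuous_on W (%p. dirD (%p. dirD f p v) p w)" using fv(3)[OF assms(5)] by simp
 then obtain d where d: "d > 0" "!!p. p : W ==> dist p q < d ==> dist (dirD (%p. dirD f p v) p w) (dirD (%p. dirD f p v) q w) < \<epsilon>"
  using assms(3,6) unfolding continuous_on_iff by metis
 define m where "m = 1 + norm v + norm w"
 have m: "m > 0" by (simp add: m_def add_pos_nonneg)
 define \<delta> where "\<delta> = min e d / m"
 have \<delta>: "\<delta> > 0" using e d m by (simp add: \<delta>_def)
 have "\<bar>(f (q + t *\<^sub>R v + t *\<^sub>R w) - f (q + t *\<^sub>R v) - f (q + t *\<^sub>R w) + f q) / t\<^sup>2 - dirD (%p. dirD f p v) q w\<bar> < \<epsilon>"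
  if t: "0 < t" "t < \<delta>" for t
 proof -
  have near: "q + a *\<^sub>R (t *\<^sub>R v) + b *\<^sub>R (t *\<^sub>R w) : W & dist (q + a *\<^sub>R (t *\<^sub>R v) + b *\<^sub>R (t *\<^sub>R w)) q < d"
   if "0 <= a" "a <= 1" "0 <= b" "b <= 1" for a b
  proof -
   let ?h = "a *\<^sub>R (t *\<^sub>R v) + b *\<^sub>R (t *\<^sub>R w)"
   have "norm ?h <= (a * t) * norm v + (b * t) * norm w"
    using norm_triangle_ineq[of "a *\<^sub>R (t *\<^sub>R v)" "b *\<^sub>R (t *\<^sub>R w)"] that t by simp
   also have "... <= t * norm v + t * norm w"
    using that t by (intro add_mono mult_right_mono) (auto simp: mult_left_le_one_le)
   also have "... < t * m" using t by (simp add: m_def algebra_simps)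
   also have "... < min e d" using t(2) m by (simp add: \<delta>_def pos_less_divide_eq)
   finally have lt: "norm ?h < min e d" .
   moreover have "?h : E" using assms(4,5) sub by (simp add: subspace_add subspace_scale)
   ultimately show ?thesis using e(2)[of ?h] by (simp add: add.assoc dist_norm)
  qed
  define \<phi> where "\<phi> p = f (p + t *\<^sub>R w) - f p" for p
  have \<phi>d: "ddiff \<phi> (q + s *\<^sub>R (t *\<^sub>R v)) (t *\<^sub>R v) & dirD \<phi> (q + s *\<^sub>R (t *\<^sub>R v)) (t *\<^sub>R v) =
    t * (dirD f (q + s *\<^sub>R (t *\<^sub>R v) + t *\<^sub>R w) v - dirD f (q + s *\<^sub>R (t *\<^sub>R v)) v)" if s: "0 <= s" "s <= 1" for s
  proof -
   let ?p = "q + s *\<^sub>R (t *\<^sub>R v)"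
   have W: "?p : W" "?p + t *\<^sub>R w : W" using near[of s 0] near[of s 1] s by auto
   have "((%r. f ((?p + t *\<^sub>R w) + r *\<^sub>R (t *\<^sub>R v)) - f (?p + r *\<^sub>R (t *\<^sub>R v))) has_vector_derivative
     dirD f (?p + t *\<^sub>R w) (t *\<^sub>R v) - dirD f ?p (t *\<^sub>R v)) (at 0)"
    using f(2)[OF W(1) subspace_scale[OF sub assms(4)]] f(2)[OF W(2) subspace_scale[OF sub assms(4)]]
    unfolding ddiff_works by (intro has_vector_derivative_diff)
   moreover have "(%r. f ((?p + t *\<^sub>R w) + r *\<^sub>R (t *\<^sub>R v)) - f (?p + r *\<^sub>R (t *\<^sub>R v))) = (%r. \<phi> (?p + r *\<^sub>R (t *\<^sub>R v)))"
    by (simp add: \<phi>_def add_ac)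
   ultimately have "((%r. \<phi> (?p + r *\<^sub>R (t *\<^sub>R v))) has_vector_derivative
     dirD f (?p + t *\<^sub>R w) (t *\<^sub>R v) - dirD f ?p (t *\<^sub>R v)) (at 0)" by simp
   from dirDI[OF this] show ?thesis
    using dirD_scaleR(1)[OF f(2)[OF W(1) assms(4)]] dirD_scaleR(1)[OF f(2)[OF W(2) assms(4)]]
    by (simp add: right_diff_distrib)
  qed
  obtain s where s: "0 < s" "s < 1" "\<phi> (q + t *\<^sub>R v) - \<phi> q = dirD \<phi> (q + s *\<^sub>R (t *\<^sub>R v)) (t *\<^sub>R v)"
   using dirD_mvt[of \<phi> q "t *\<^sub>R v"] \<phi>d by blast
  let ?p = "q + s *\<^sub>R (t *\<^sub>R v)"
  have dv: "ddiff (%p. dirD f p v) (?p + r *\<^sub>R (t *\<^sub>R w)) (t *\<^sub>R w)" if "0 <= r" "r <= 1" for r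
   using near[of s r] s that fv(2) assms(5) sub by (simp add: subspace_scale)
  obtain r where r: "0 < r" "r < 1" "dirD f (?p + t *\<^sub>R w) v - dirD f ?p v = dirD (%p. dirD f p v) (?p + r *\<^sub>R (t *\<^sub>R w)) (t *\<^sub>R w)"
   using dirD_mvt[of "%p. dirD f p v" ?p "t *\<^sub>R w"] dv by blast
  let ?x = "?p + r *\<^sub>R (t *\<^sub>R w)"
  have x: "?x : W" "dist ?x q < d" using near[of s r] s r by auto
  have "dirD (%p. dirD f p v) ?x (t *\<^sub>R w) = t * dirD (%p. dirD f p v) ?x w"
   using dirD_scaleR(1)[OF fv(2)[OF x(1) assms(5)]] by simp
  hence "\<phi> (q + t *\<^sub>R v) - \<phi> q = t\<^sup>2 * dirD (%p. dirD f p v) ?x w"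
   using s(3) \<phi>d[of s] r(3) s by (simp add: power2_eq_square)
  moreover have "\<phi> (q + t *\<^sub>R v) - \<phi> q = f (q + t *\<^sub>R v + t *\<^sub>R w) - f (q + t *\<^sub>R v) - f (q + t *\<^sub>R w) + f q"
   by (simp add: \<phi>_def)
  ultimately have "(f (q + t *\<^sub>R v + t *\<^sub>R w) - f (q + t *\<^sub>R v) - f (q + t *\<^sub>R w) + f q) / t\<^sup>2 = dirD (%p. dirD f p v) ?x w"
   using t by simp
  thus ?thesis using d(2)[OF x] by (simp add: dist_real_def)
 qed
 thus ?thesis using \<delta> by blast
qed

lemma dirD_symmetric:
 fixes f :: "'v::real_normed_vector => real"
 assumes "relopen E W" "Ck_on 2 E W f" "q : W" "v : E" "w : E"
 shows "dirD (%p. dirD f p v) q w = dirD (%p. dirD f p w) q v"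
proof (rule ccontr)
 let ?a = "dirD (%p. dirD f p v) q w" and ?b = "dirD (%p. dirD f p w) q v"
 assume ne: "?a ~= ?b"
 define \<epsilon> where "\<epsilon> = \<bar>?a - ?b\<bar> / 2"
 have \<epsilon>: "\<epsilon> > 0" using ne by (simp add: \<epsilon>_def)
 let ?D = "%t v w. (f (q + t *\<^sub>R v + t *\<^sub>R w) - f (q + t *\<^sub>R v) - f (q + t *\<^sub>R w) + f q) / t\<^sup>2"
 obtain d1 where d1: "d1 > 0" "!!t. 0 < t ==> t < d1 ==> \<bar>?D t v w - ?a\<bar> < \<epsilon>" using second_difference[OF assms \<epsilon>] by blast
 obtain d2 where d2: "d2 > 0" "!!t. 0 < t ==> t < d2 ==> \<bar>?D t w v - ?b\<bar> < \<epsilon>"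
  using second_difference[OF assms(1-3) assms(5,4) \<epsilon>] by blast
 define t where "t = min d1 d2 / 2"
 have t: "0 < t" "t < d1" "t < d2" using d1 d2 by (auto simp: t_def)
 have "f (q + t *\<^sub>R v + t *\<^sub>R w) = f (q + t *\<^sub>R w + t *\<^sub>R v)" by (simp add: add_ac)
 hence "?D t v w = ?D t w v" by simp
 moreover have "\<bar>a - b\<bar> < 2 * e" if "X = Y" "\<bar>X - a\<bar> < e" "\<bar>Y - b\<bar> < e" for X Y a b e :: real using that by linarith
 ultimately have "\<bar>?a - ?b\<bar> < 2 * \<epsilon>" using d1(2)[OF t(1,2)] d2(2)[OF t(1,3)] by blast
 thus False by (simp add: \<epsilon>_def)
qed

section \<open>Bordered and block diagonal Hermitian matrices\<close>

text \<open>Reindexes the terms of the Leibniz formula that survive when row \<open>None\<close> is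
  zero off the diagonal.\<close>

lemma bij_betw_permutes_option: "bij_betw (map_permutation (UNIV::'d::finite set) Some) {p. p permutes UNIV}
   {p. p permutes (UNIV::'d option set) & p None = None}"
proof -
 have eq: "{p. p permutes (UNIV::'d option set) & p None = None} = {p. p permutes range (Some :: 'd => _)}"
 proof (intro equalityI subsetI CollectI; clarsimp)
  fix p :: "'d option => 'd option"
  { assume p: "p permutes UNIV" "p None = None"
   show "p permutes range Some" using p by (intro permutes_superset[OF p(1)]) (metis DiffE option.exhaust rangeI) }
  { assume p: "p permutes range Some"
   show "p permutes UNIV & p None = None" using p permutes_subset[OF p] permutes_not_in[OF p, of None] by auto }
 qed
 have "(%\<pi> x. if x : range Some then Some (\<pi> (inv_into UNIV Some x)) else x) = map_permutation (UNIV::'d set) Some"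
  by (auto simp: fun_eq_iff map_permutation_def restrict_id_def)
 thus ?thesis using bij_betw_permutations[of "Some :: 'd => _" UNIV "range Some"] eq by (simp add: bij_betw_def)
qed

lemma det_option_triangular:
 fixes M :: "'a::comm_ring_1^('d::finite option)^('d option)"
 assumes "!!b. M $ None $ Some b = 0"
 shows "det M = M $ None $ None * det (\<chi> a b. M $ Some a $ Some b)"
proof -
 let ?t = "%p. of_int (sign p) * prod (%i. M $ i $ p i) (UNIV :: 'd option set)"
 have UN: "(UNIV :: 'd option set) = insert None (range Some)" by (auto simp: UNIV_option_conv)
 have "det M = sum ?t {p. p permutes UNIV}" by (simp add: det_def)
 also have "... = sum ?t {p. p permutes UNIV & p None = None}"
 proof (rule sum.mono_neutral_right)
  show "\<forall>p\<in>{p. p permutes UNIV} - {p. p permutes UNIV & p None = None}. ?t p = 0"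
  proof
   fix p :: "'d option => 'd option" assume "p : {p. p permutes UNIV} - {p. p permutes UNIV & p None = None}"
   then obtain b where "p None = Some b" by auto
   hence "M $ None $ p None = 0" using assms by simp
   hence "prod (%i. M $ i $ p i) (UNIV :: 'd option set) = 0" by (intro prod_zero) auto
   thus "?t p = 0" by simp
  qed
 qed (auto simp: finite_permutations)
 also have "... = sum (%q. ?t (map_permutation UNIV Some q)) {q. q permutes (UNIV::'d set)}"
  by (rule sum.reindex_bij_betw[OF bij_betw_permutes_option, symmetric])
 also have "... = sum (%q. M $ None $ None * (of_int (sign q) * prod (%i. M $ Some i $ Some (q i)) UNIV)) {q. q permutes (UNIV::'d set)}"
 proof (rule sum.cong[OF refl])
  fix q :: "'d => 'd" assume "q : {q. q permutes UNIV}"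
  hence q: "q permutes UNIV" by simp
  have s: "sign (map_permutation UNIV (Some::'d => _) q) = sign q" by (intro sign_map_permutation) (use q in auto)
  have 1: "map_permutation UNIV (Some::'d => _) q None = None"
   "!!i. map_permutation UNIV (Some::'d => _) q (Some i) = Some (q i)"
   by (auto simp: map_permutation_def restrict_id_def)
  have "prod (%i. M $ i $ map_permutation UNIV (Some::'d => _) q i) UNIV
    = M $ None $ None * prod (%i. M $ Some i $ Some (q i)) UNIV"
   unfolding UN by (subst prod.insert) (auto simp: 1 prod.reindex)
  thus "?t (map_permutation UNIV Some q) = M $ None $ None * (of_int (sign q) * prod (%i. M $ Some i $ Some (q i)) UNIV)"
   by (simp add: s algebra_simps)
 qed
 also have "... = M $ None $ None * det (\<chi> a b. M $ Some a $ Some b)" by (simp add: det_def sum_distrib_left)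
 finally show ?thesis .
qed

lemma det_option_triangular':
 fixes M :: "'a::comm_ring_1^('d::finite option)^('d option)"
 assumes "!!b. M $ Some b $ None = 0"
 shows "det M = M $ None $ None * det (\<chi> a b. M $ Some a $ Some b)"
proof -
 have "det (transpose M) = transpose M $ None $ None * det (\<chi> a b. transpose M $ Some a $ Some b)"
  by (rule det_option_triangular) (simp add: transpose_def assms)
 moreover have "(\<chi> a b. transpose M $ Some a $ Some b) = transpose (\<chi> a b. M $ Some a $ Some b)"
  by (simp add: transpose_def vec_eq_iff)
 moreover have "transpose M $ None $ None = M $ None $ None" by (simp add: transpose_def)
 ultimately show ?thesis by (simp only: det_transpose)
qed

lemma sum_option_UNIV: "sum f (UNIV :: 'd::finite option set) = f None + sum (%a. f (Some a)) UNIV"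
proof -
 have eq: "(UNIV :: 'd option set) = insert None (range Some)" by (auto simp: UNIV_option_conv)
 show ?thesis unfolding eq by (subst sum.insert) (auto simp: sum.reindex)
qed

lemma det_row_scale:
 fixes K :: "'a::comm_ring_1^'d::finite^'d"
 shows "det (\<chi> a b. l a * K $ a $ b) = prod l UNIV * det K"
proof -
 have "det (\<chi> a. l a *s K $ a) = prod l UNIV * det (\<chi> a. K $ a)" using det_rows_mul[of l "%a. K $ a"] by simp
 moreover have "(\<chi> a. l a *s K $ a) = (\<chi> a b. l a * K $ a $ b)" by (simp add: vec_eq_iff)
 ultimately show ?thesis by simp
qed

text \<open>\<open>H\<close> is \<open>K\<close> with a zero border plus a rank one term. The column
  operations \<open>R\<close> subtract multiples of column \<open>None\<close>, which empties row
  \<open>None\<close> off the diagonal and returns the inner block to \<open>K\<close>.\<close>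

lemma det_bordered_hermitian:
 fixes K :: "complex^'d::finite^'d" and \<eta> :: "'d option => complex" and H :: "complex^('d option)^('d option)"
 assumes "\<eta> None ~= 0"
  and H: "!!a b. H $ a $ b = (case (a, b) of (Some a', Some b') => K $ a' $ b' | _ => 0) + t * \<eta> a * cnj (\<eta> b)"
 shows "det H = t * (cmod (\<eta> None))^2 * det K"
proof -
 define R :: "complex^('d option)^('d option)" where
  "R = (\<chi> a b. (if a = b then 1 else 0) - (if a = None & b ~= None then cnj (\<eta> b) / cnj (\<eta> None) else 0))"
 have nz: "cnj (\<eta> None) ~= 0" using assms(1) by simp
 have dR: "det R = 1"
 proof -
  have "det R = R $ None $ None * det (\<chi> a b. R $ Some a $ Some b)" by (rule det_option_triangular') (simp add: R_def)
  also have "(\<chi> a b. R $ Some a $ Some b) = (mat 1 :: complex^'d^'d)" by (simp add: R_def vec_eq_iff mat_def)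
  finally show ?thesis by (simp add: R_def)
 qed
 have HR: "(H ** R) $ a $ b = (case (a, b) of (Some a', Some b') => K $ a' $ b' | (_, None) => t * \<eta> a * cnj (\<eta> None) | _ => 0)" for a b
 proof (cases b)
  case None
  thus ?thesis by (cases a) (simp_all add: matrix_matrix_mult_def sum_option_UNIV R_def H)
 next
  case (Some b')
  have "(H ** R) $ a $ b = H $ a $ None * (- cnj (\<eta> b) / cnj (\<eta> None)) + H $ a $ b"
   by (simp add: matrix_matrix_mult_def sum_option_UNIV R_def Some if_distrib[of "%x. _ * x"] sum.delta cong: if_cong)
  also have "... = (case a of Some a' => K $ a' $ b' | _ => 0)" using nz by (cases a) (simp_all add: H Some field_simps)
  finally show ?thesis using Some by (cases a) auto
 qed
 have "det H = det (H ** R)" by (simp add: det_mul dR)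
 also have "... = (H ** R) $ None $ None * det (\<chi> a b. (H ** R) $ Some a $ Some b)"
  by (rule det_option_triangular) (simp add: HR)
 also have "(\<chi> a b. (H ** R) $ Some a $ Some b) = K" by (simp add: HR vec_eq_iff)
 also have "(H ** R) $ None $ None = t * (cmod (\<eta> None))^2"
  unfolding HR by (simp add: complex_norm_square[symmetric] mult.assoc)
 finally show ?thesis .
qed

lemma matrix_inv_eqI:
 fixes A :: "'a::field^'n::finite^'n"
 assumes "invertible A"
 shows "matrix_inv A ** A = mat 1" "A ** matrix_inv A = mat 1"
proof -
 have "\<exists>A'. A ** A' = mat 1 & A' ** A = mat 1" using assms by (simp add: invertible_def)
 hence "A ** matrix_inv A = mat 1 & matrix_inv A ** A = mat 1" unfolding matrix_inv_def by (rule someI_ex)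
 thus "matrix_inv A ** A = mat 1" "A ** matrix_inv A = mat 1" by auto
qed

lemma matrix_inv_mult_eqI:
 fixes A :: "'a::field^'n::finite^'n"
 assumes "det A ~= 0" "A ** X = M"
 shows "matrix_inv A ** M = X" using matrix_inv_eqI[of A] assms
 by (metis invertible_det_nz matrix_mul_assoc matrix_mul_lid)

text \<open>For the trace of an inverse metric against a form of the same bordered shape: the fibre
  direction contributes \<open>r / t\<close>, the rest is a trace on the base. The equation
  \<open>H X = M\<close> is solved directly.\<close>

lemma trace_inv_bordered_hermitian:
 fixes K m :: "complex^'d::finite^'d" and \<eta> :: "'d option => complex" and H M :: "complex^('d option)^('d option)"
 assumes "\<eta> None ~= 0" "det K ~= 0" "t ~= 0"
  and H: "!!a b. H $ a $ b = (case (a, b) of (Some a', Some b') => K $ a' $ b' | _ => 0) + t * \<eta> a * cnj (\<eta> b)"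
  and M: "!!a b. M $ a $ b = (case (a, b) of (Some a', Some b') => m $ a' $ b' | _ => 0) + r * \<eta> a * cnj (\<eta> b)"
 shows "trace (matrix_inv H ** M) = trace (matrix_inv K ** m) + r / t"
proof -
 have nz: "cnj (\<eta> None) ~= 0" using assms(1) by simp
 have dH: "det H ~= 0" using det_bordered_hermitian[OF assms(1) H] assms by simp
 define Z where "Z = matrix_inv K ** m"
 have KZ: "K ** Z = m"
  unfolding Z_def using matrix_inv_eqI(2)[of K] assms(2) by (simp add: matrix_mul_assoc invertible_det_nz)
 hence KZ': "(\<Sum>c\<in>UNIV. K $ a $ c * Z $ c $ b) = m $ a $ b" for a b
  using KZ by (simp add: matrix_matrix_mult_def vec_eq_iff)
 define w where "w b = (case b of Some b' => (\<Sum>c\<in>UNIV. cnj (\<eta> (Some c)) * Z $ c $ b') | None => 0)" for b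
 \<comment> \<open>The inner block solves \<open>K Z = m\<close>; row \<open>None\<close> is chosen
   so that \<open>cnj \<eta>\<close> times \<open>X\<close> is \<open>r / t\<close> times
   \<open>cnj \<eta>\<close>, which reproduces the rank one part of \<open>M\<close>.\<close>
 define X :: "complex^('d option)^('d option)" where
  "X = (\<chi> a b. case a of Some a' => (case b of Some b' => Z $ a' $ b' | None => 0)
    | None => (r / t * cnj (\<eta> b) - w b) / cnj (\<eta> None))"
 have eX: "cnj (\<eta> None) * X $ None $ b + (\<Sum>c\<in>UNIV. cnj (\<eta> (Some c)) * X $ Some c $ b) = r / t * cnj (\<eta> b)" for b
  using nz by (cases b) (simp_all add: X_def w_def)
 have "H ** X = M"
 proof (simp only: vec_eq_iff, intro allI)
  fix a b
  have "(H ** X) $ a $ b = (\<Sum>c\<in>UNIV. (case (a, c) of (Some a', Some b') => K $ a' $ b' | _ => 0) * X $ c $ b)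
     + t * \<eta> a * (\<Sum>c\<in>UNIV. cnj (\<eta> c) * X $ c $ b)"
   by (simp add: matrix_matrix_mult_def H distrib_right sum.distrib sum_distrib_left mult.assoc)
  also have "(\<Sum>c\<in>UNIV. cnj (\<eta> c) * X $ c $ b) = r / t * cnj (\<eta> b)" using eX by (simp add: sum_option_UNIV)
  also have "(\<Sum>c\<in>UNIV. (case (a, c) of (Some a', Some b') => K $ a' $ b' | _ => 0) * X $ c $ b) =
    (case (a, b) of (Some a', Some b') => m $ a' $ b' | _ => 0)"
   by (cases a; cases b) (simp_all add: sum_option_UNIV X_def KZ')
  finally show "(H ** X) $ a $ b = M $ a $ b" using assms(3) by (simp add: M)
 qed
 hence "matrix_inv H ** M = X" using dH by (rule matrix_inv_mult_eqI[rotated])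
 hence "trace (matrix_inv H ** M) = trace X" by simp
 also have "... = r / t + (\<Sum>a\<in>UNIV. Z $ a $ a)" using nz by (simp add: trace_def sum_option_UNIV X_def w_def)
 finally show ?thesis by (simp add: trace_def Z_def)
qed

text \<open>The padding is that of \<open>herm_matrix\<close>: each factor contributes a matrix on
  all coordinates that is the identity off its own block.\<close>

locale block_matrix =
 fixes bl :: "'d::finite => 'b::finite" and K :: "'b => complex^'d^'d"
 assumes pad: "!!i a b. ~ (bl a = i & bl b = i) ==> K i $ a $ b = (if a = b then 1 else 0)"
begin

definition blockdiag :: "('b => complex) => complex^'d^'d" where
 "blockdiag l = (\<chi> a b. if bl a = bl b then l (bl a) * K (bl a) $ a $ b else 0)"

text \<open>The matrix for a set of blocks is assembled by multiplying the padded blocks one at a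
  time.\<close>

lemma det_partial_blockdiag:
 assumes "finite J"
 shows "det (\<chi> a b. if bl a = bl b & bl a : J then K (bl a) $ a $ b else if a = b then 1 else 0) = (\<Prod>i\<in>J. det (K i))"
 using assms
proof (induction J rule: finite_induct)
 case empty
 have "(\<chi> a b. if bl a = bl b & bl a : {} then K (bl a) $ a $ b else if a = b then 1 else 0) = (mat 1 :: complex^'d^'d)"
  by (simp add: mat_def vec_eq_iff)
 thus ?case by simp
next
 case (insert i J)
 let ?B = "%J. (\<chi> a b. if bl a = bl b & bl a : J then K (bl a) $ a $ b else if a = b then 1 else 0) :: complex^'d^'d"
 have e: "K i ** ?B J = ?B (insert i J)"
 proof (simp only: vec_eq_iff, intro allI)
  fix a b
  have "(K i ** ?B J) $ a $ b = (\<Sum>c\<in>UNIV. K i $ a $ c * ?B J $ c $ b)" by (simp add: matrix_matrix_mult_def)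
  also have "... = ?B (insert i J) $ a $ b"
  proof (cases "bl a = i")
   case True
   have "K i $ a $ c * ?B J $ c $ b = (if c = b then K i $ a $ b else 0)" for c
   proof (cases "bl c = i")
    case True thus ?thesis using insert by auto
   next
    case False
    hence "K i $ a $ c = 0" using pad[of a i c] True by auto
    thus ?thesis by auto
   qed
   hence "(\<Sum>c\<in>UNIV. K i $ a $ c * ?B J $ c $ b) = K i $ a $ b" by simp
   thus ?thesis using True pad[of a i b] by auto
  next
   case False
   have "K i $ a $ c * ?B J $ c $ b = (if c = a then ?B J $ a $ b else 0)" for c using pad[of a i c] False by auto
   hence "(\<Sum>c\<in>UNIV. K i $ a $ c * ?B J $ c $ b) = ?B J $ a $ b" by simp
   thus ?thesis using False by auto
  qed
  finally show "(K i ** ?B J) $ a $ b = ?B (insert i J) $ a $ b" .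
 qed
 have "det (?B (insert i J)) = det (K i) * det (?B J)" unfolding e[symmetric] by (rule det_mul)
 thus ?case using insert by simp
qed

lemma det_blockdiag: "det (blockdiag l) = (\<Prod>a\<in>UNIV. l (bl a)) * (\<Prod>i\<in>UNIV. det (K i))"
proof -
 have e: "blockdiag l = (\<chi> a b. l (bl a) * (\<chi> a b. if bl a = bl b & bl a : UNIV then K (bl a) $ a $ b else if a = b then 1 else 0) $ a $ b)"
  by (auto simp: blockdiag_def vec_eq_iff)
 show ?thesis unfolding e det_row_scale det_partial_blockdiag[OF finite] by simp
qed

lemma trace_inv_blockdiag:
 fixes m :: "'b => complex^'d^'d"
 assumes l: "!!i. l i ~= 0" and K: "!!i. det (K i) ~= 0" and m: "!!i a b. ~ (bl a = i & bl b = i) ==> m i $ a $ b = 0"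
 shows "trace (matrix_inv (blockdiag l) ** (\<chi> a b. \<Sum>i\<in>UNIV. m i $ a $ b))
  = (\<Sum>i\<in>UNIV. trace (matrix_inv (K i) ** m i) / l i)"
proof -
 have dB: "det (blockdiag l) ~= 0" using l K by (simp add: det_blockdiag)
 define Z where "Z i = matrix_inv (K i) ** m i" for i
 have KZ: "K i ** Z i = m i" for i
  unfolding Z_def using matrix_inv_eqI(2)[of "K i"] K by (simp add: matrix_mul_assoc invertible_det_nz)
 hence KZ': "(\<Sum>c\<in>UNIV. K i $ a $ c * Z i $ c $ b) = m i $ a $ b" for i a b
  using KZ[of i] by (simp add: matrix_matrix_mult_def vec_eq_iff)
 have Z0: "Z i $ a $ b = 0" if "bl a ~= i" for i a b
 proof -
  have "K i $ a $ c * Z i $ c $ b = (if c = a then Z i $ a $ b else 0)" for c using pad[of a i c] that by auto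
  hence "(\<Sum>c\<in>UNIV. K i $ a $ c * Z i $ c $ b) = Z i $ a $ b" by simp
  thus ?thesis using KZ'[of i a b] m[of a i b] that by simp
 qed
 define X where "X = (\<chi> a b. Z (bl a) $ a $ b / l (bl a))"
 have "blockdiag l ** X = (\<chi> a b. \<Sum>i\<in>UNIV. m i $ a $ b)"
 proof (simp only: vec_eq_iff, intro allI)
  fix a b
  have 1: "(blockdiag l) $ a $ c * X $ c $ b = K (bl a) $ a $ c * Z (bl a) $ c $ b" for c
   using pad[of a "bl a" c] l by (auto simp: blockdiag_def X_def)
  have "(blockdiag l ** X) $ a $ b = (\<Sum>c\<in>UNIV. K (bl a) $ a $ c * Z (bl a) $ c $ b)"
   using 1 by (simp add: matrix_matrix_mult_def)
  also have "... = m (bl a) $ a $ b" by (rule KZ')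
  also have "... = (\<Sum>i\<in>UNIV. if i = bl a then m (bl a) $ a $ b else 0)" by simp
  also have "... = (\<Sum>i\<in>UNIV. m i $ a $ b)" by (intro sum.cong refl) (use m[of a _ b] in auto)
  finally show "(blockdiag l ** X) $ a $ b = (\<chi> a b. \<Sum>i\<in>UNIV. m i $ a $ b) $ a $ b" by simp
 qed
 hence "matrix_inv (blockdiag l) ** (\<chi> a b. \<Sum>i\<in>UNIV. m i $ a $ b) = X" by (rule matrix_inv_mult_eqI[OF dB])
 hence "trace (matrix_inv (blockdiag l) ** (\<chi> a b. \<Sum>i\<in>UNIV. m i $ a $ b)) = trace X" by (simp only:)
 also have "... = (\<Sum>a\<in>UNIV. \<Sum>i\<in>UNIV. Z i $ a $ a / l i)" unfolding trace_def
 proof (rule sum.cong[OF refl])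
  fix a
  have "(\<Sum>i\<in>UNIV. Z i $ a $ a / l i) = (\<Sum>i\<in>UNIV. if i = bl a then Z i $ a $ a / l i else 0)"
   by (intro sum.cong refl) (use Z0 in auto)
  thus "X $ a $ a = (\<Sum>i\<in>UNIV. Z i $ a $ a / l i)" by (simp add: X_def)
 qed
 also have "... = (\<Sum>i\<in>UNIV. trace (Z i) / l i)" by (subst sum.swap) (simp add: trace_def sum_divide_distrib)
 finally show ?thesis by (simp add: Z_def)
qed

lemma trace_inv_block_self:
 assumes K: "det (K i) ~= 0"
 shows "trace (matrix_inv (K i) ** (\<chi> a b. if bl a = i & bl b = i then K i $ a $ b else 0)) = of_nat (card {a. bl a = i})"
proof -
 define X :: "complex^'d^'d" where "X = (\<chi> a b. if a = b & bl a = i then 1 else 0)"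
 have "K i ** X = (\<chi> a b. if bl a = i & bl b = i then K i $ a $ b else 0)"
 proof (simp only: vec_eq_iff, intro allI)
  fix a b
  have "K i $ a $ c * X $ c $ b = (if c = b then (if bl b = i then K i $ a $ b else 0) else 0)" for c
   by (auto simp: X_def)
  hence "(K i ** X) $ a $ b = (if bl b = i then K i $ a $ b else 0)" by (simp add: matrix_matrix_mult_def)
  thus "(K i ** X) $ a $ b = (\<chi> a b. if bl a = i & bl b = i then K i $ a $ b else 0) $ a $ b"
   using pad[of a i b] by auto
 qed
 hence "matrix_inv (K i) ** (\<chi> a b. if bl a = i & bl b = i then K i $ a $ b else 0) = X"
  by (rule matrix_inv_mult_eqI[OF K])
 thus ?thesis by (simp add: trace_def X_def flip: sum.inter_filter)
qed

end

lemma det_cnj: "det (\<chi> a b. cnj (A $ a $ b)) = cnj (det (A :: complex^'n::finite^'n))"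
 unfolding det_def cnj_sum complex_cnj_mult cnj_prod by (simp only: vec_lambda_beta complex_cnj_of_int)

text \<open>On the segment from the identity to \<open>M\<close> the determinant is real and does not vanish.\<close>

lemma det_hermitian_pos:
 fixes M :: "complex^'n::finite^'n"
 assumes herm: "!!a b. M $ a $ b = cnj (M $ b $ a)"
  and pos: "!!v. v ~= 0 ==> Re (\<Sum>a\<in>UNIV. \<Sum>b\<in>UNIV. cnj (v $ a) * M $ a $ b * v $ b) > 0"
 shows "Im (det M) = 0" "Re (det M) > 0"
proof -
 define N where "N t = (\<chi> a b. of_real (1 - t) * (if a = b then 1 else 0) + of_real t * M $ a $ b)" for t
 have im: "Im (det (N t)) = 0" for t
 proof -
  have "(\<chi> a b. cnj (N t $ a $ b)) = transpose (N t)"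
   unfolding vec_eq_iff transpose_def N_def by (simp add: herm[symmetric])
  hence "cnj (det (N t)) = det (N t)" using det_cnj[of "N t"] by (simp add: det_transpose)
  thus ?thesis by (simp add: complex_eq_iff)
 qed
 have nz: "det (N t) ~= 0" if t: "0 <= t" "t <= 1" for t
 proof
  assume "det (N t) = 0"
  hence "~ invertible (N t)" by (simp add: invertible_det_nz)
  then obtain v where v: "N t *v v = 0" "v ~= 0"
   using matrix_left_invertible_ker[of "N t"] by (auto simp: invertible_left_inverse)
  have "(\<Sum>b\<in>UNIV. N t $ a $ b * v $ b) = 0" for a
   using arg_cong[OF v(1), of "%w. w $ a"] by (simp add: matrix_vector_mult_def)
  hence "0 = Re (\<Sum>a\<in>UNIV. cnj (v $ a) * (\<Sum>b\<in>UNIV. N t $ a $ b * v $ b))" by simp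
  also have "(\<Sum>a\<in>UNIV. cnj (v $ a) * (\<Sum>b\<in>UNIV. N t $ a $ b * v $ b)) =
    of_real (1 - t) * (\<Sum>a\<in>UNIV. cnj (v $ a) * v $ a) + of_real t * (\<Sum>a\<in>UNIV. \<Sum>b\<in>UNIV. cnj (v $ a) * M $ a $ b * v $ b)"
  proof -
   have "cnj (v $ a) * (\<Sum>b\<in>UNIV. N t $ a $ b * v $ b) =
    of_real (1 - t) * (cnj (v $ a) * v $ a) + of_real t * (\<Sum>b\<in>UNIV. cnj (v $ a) * M $ a $ b * v $ b)" for a
   proof -
    have "N t $ a $ b * v $ b = (if b = a then of_real (1 - t) * v $ a else 0) + of_real t * (M $ a $ b * v $ b)" for b
     by (auto simp: N_def algebra_simps)
    hence eq: "(\<Sum>b\<in>UNIV. N t $ a $ b * v $ b) = of_real (1 - t) * v $ a + of_real t * (\<Sum>b\<in>UNIV. M $ a $ b * v $ b)"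
     by (simp add: sum.distrib sum_distrib_left)
    show ?thesis unfolding eq distrib_left by (simp add: sum_distrib_left mult.left_commute mult.assoc)
   qed
   thus ?thesis by (simp add: sum.distrib sum_distrib_left)
  qed
  also have "Re ... = (1 - t) * (\<Sum>a\<in>UNIV. (cmod (v $ a))^2) + t * Re (\<Sum>a\<in>UNIV. \<Sum>b\<in>UNIV. cnj (v $ a) * M $ a $ b * v $ b)"
   by (simp add: cmod_power2) (simp add: power2_eq_square)
  finally have eq: "(1 - t) * (\<Sum>a\<in>UNIV. (cmod (v $ a))^2) + t * Re (\<Sum>a\<in>UNIV. \<Sum>b\<in>UNIV. cnj (v $ a) * M $ a $ b * v $ b) = 0" by simp
  obtain a where "v $ a ~= 0" using v(2) by (auto simp: vec_eq_iff)
  hence "(\<Sum>a\<in>UNIV. (cmod (v $ a))^2) > 0" by (intro sum_pos2[of _ a]) auto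
  moreover note pos[OF v(2)]
  ultimately show False using eq t by (cases "t = 0") (auto simp: add_nonneg_pos order_less_imp_not_eq2)
 qed
 have cont: "continuous_on {0..1} (%t. Re (det (N t)))" unfolding det_def N_def by (auto intro!: continuous_intros)
 have nzr: "Re (det (N t)) ~= 0" if "0 <= t" "t <= 1" for t using nz[OF that] im[of t] by (simp add: complex_eq_iff)
 have N0: "N 0 = mat 1" by (simp add: N_def mat_def vec_eq_iff)
 have N1: "N 1 = M" by (simp add: N_def vec_eq_iff)
 show "Im (det M) = 0" using im[of 1] N1 by simp
 show "Re (det M) > 0"
 proof (rule ccontr)
  assume "~ Re (det M) > 0"
  hence "\<exists>t. 0 <= t & t <= 1 & Re (det (N t)) = 0" by (intro IVT2') (use cont N0 N1 in auto)
  thus False using nzr by blast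
 qed
qed

section \<open>Charts of the base and of the bundle\<close>

locale admissible =
 fixes D :: "('a, 's, 'l, 'd::finite, 'b::finite) admissible_data" and s :: "'b => real"
 assumes adm: "admissible_manifold D s"
begin

abbreviation "base_met c i q v w \<equiv> base_metric D (fst c) i (base_part q) (base_part v) (base_part w)"

abbreviation "scoord \<equiv> ccoord D (ylog D)"

abbreviation "blkproj i \<equiv> coord_proj (block D i)"

abbreviation "cover_space \<equiv> product_topology (fac D) UNIV"

lemma kpb: "kaehler_product_base D s" and hlb: "hermitian_line_bundle D"
 using adm unfolding admissible_manifold_def by blast+

lemma factor_manifold: "complex_manifold (block D i) (fac D i) (fac_atlas D i)"
 and factor_metric: "kaehler_metric (block D i) (fac_atlas D i) (fac_metric D i)"
 and factor_scalar: "c : fac_atlas D i ==> q : snd c ` fst c ==>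
   scalar_curvature (block D i) (fac_metric D i c) q = 2 * real (card (block D i)) * s i" and blk_surj: "surj (blk D)"
 and compact_base: "compact_space (base D)" and cov: "covering_projection (cover_space) (base D) (cov D)"
 using kpb unfolding kaehler_product_base_def by blast+

lemma block_nonempty: "card (block D i) > 0"
proof -
 obtain a where "blk D a = i" using blk_surj by (metis surjD)
 thus ?thesis by (auto simp: block_def card_gt_0_iff)
qed

lemma factor_chart:
 assumes "c : fac_atlas D i"
 shows "openin (fac D i) (fst c)" "snd c ` fst c \<subseteq> coord_space (block D i)"
  "openin (top_of_set (coord_space (block D i))) (snd c ` fst c)"
  "homeomorphic_map (subtopology (fac D i) (fst c)) (top_of_set (snd c ` fst c)) (snd c)" "inj_on (snd c) (fst c)"
proof -
 obtain U \<phi> where c: "c = (U, \<phi>)" by fastforce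
 have *: "openin (fac D i) U & \<phi> ` U \<subseteq> coord_space (block D i) &
    openin (top_of_set (coord_space (block D i))) (\<phi> ` U) &
    homeomorphic_map (subtopology (fac D i) U) (top_of_set (\<phi> ` U)) \<phi>"
  using factor_manifold[of i] assms c unfolding complex_manifold_def by blast
 thus "openin (fac D i) (fst c)" "snd c ` fst c \<subseteq> coord_space (block D i)"
  "openin (top_of_set (coord_space (block D i))) (snd c ` fst c)"
  and h: "homeomorphic_map (subtopology (fac D i) (fst c)) (top_of_set (snd c ` fst c)) (snd c)" using c by auto
 have "topspace (subtopology (fac D i) (fst c)) = fst c" using * c openin_subset by fastforce
 thus "inj_on (snd c) (fst c)" using homeomorphic_imp_injective_map[OF h] by simp
qed

lemma continuous_coord_proj: "continuous_on S (coord_proj (B :: 'd set))" unfolding coord_proj_def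
proof (rule continuous_on_vec_lambda)
 show "continuous_on S (%v. if i : B then v $ i else 0)" for i :: 'd
  by (cases "i : B") (auto intro!: continuous_intros)
qed

lemma coord_proj_in: "coord_proj B v : coord_space B" by (simp add: coord_proj_def coord_space_def)

definition charts_range :: "('b => ('a, 'd) chart) => (complex^'d) set" where
 "charts_range c = {w. \<forall>i. blkproj i w : snd (c i) ` fst (c i)}"

text \<open>Inverse of the product of the factor charts, with values in the covering space; followed
  by \<open>cov\<close> it is a continuous left inverse of \<open>bcoord\<close>, independent of the
  local section in the base chart.\<close>

definition charts_inv :: "('b => ('a, 'd) chart) => complex^'d => 'b => 'a" where
 "charts_inv c w i = inv_into (fst (c i)) (snd (c i)) (blkproj i w)"

lemma open_charts_range:
 assumes "!!i. c i : fac_atlas D i" shows "open (charts_range c)"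
proof -
 have "open {w. blkproj i w : snd (c i) ` fst (c i)}" for i
 proof -
  obtain T where T: "open T" "snd (c i) ` fst (c i) = coord_space (block D i) \<inter> T"
   using factor_chart(3)[OF assms[of i]] by (auto simp: openin_open)
  have "{w. blkproj i w : snd (c i) ` fst (c i)} = blkproj i -` T" using T(2) coord_proj_in by auto
  thus ?thesis using T(1) continuous_coord_proj[of UNIV] by (metis open_vimage)
 qed
 moreover have "charts_range c = (\<Inter>i. {w. blkproj i w : snd (c i) ` fst (c i)})" by (auto simp: charts_range_def)
 ultimately show ?thesis by (simp add: open_INT)
qed

lemma charts_inv_in:
 assumes "w : charts_range c"
 shows "charts_inv c w i : fst (c i)" "snd (c i) (charts_inv c w i) = blkproj i w"
proof -
 have "blkproj i w : snd (c i) ` fst (c i)" using assms by (simp add: charts_range_def)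
 thus "charts_inv c w i : fst (c i)" "snd (c i) (charts_inv c w i) = blkproj i w"
  unfolding charts_inv_def by (auto intro: inv_into_into f_inv_into_f)
qed

lemma continuous_charts_inv:
 assumes c: "!!i. c i : fac_atlas D i"
 shows "continuous_map (top_of_set (charts_range c)) (cover_space) (charts_inv c)"
 unfolding continuous_map_componentwise_UNIV
proof
 fix i
 have ho: "homeomorphic_map (subtopology (fac D i) (fst (c i))) (top_of_set (snd (c i) ` fst (c i))) (snd (c i))"
  by (rule factor_chart(4)[OF c])
 have ts: "topspace (subtopology (fac D i) (fst (c i))) = fst (c i)"
  using openin_subset[OF factor_chart(1)[OF c]] by auto
 obtain g where g: "homeomorphic_maps (subtopology (fac D i) (fst (c i))) (top_of_set (snd (c i) ` fst (c i))) (snd (c i)) g"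
  using ho homeomorphic_map_maps by blast
 have gi: "g y = inv_into (fst (c i)) (snd (c i)) y" if "y : snd (c i) ` fst (c i)" for y
 proof -
  obtain p where p: "p : fst (c i)" "y = snd (c i) p" using \<open>y : _\<close> by auto
  have "g (snd (c i) p) = p" using g p(1) ts by (auto simp: homeomorphic_maps_def)
  thus ?thesis using p factor_chart(5)[OF c] by (simp add: inv_into_f_f)
 qed
 have "continuous_map (top_of_set (snd (c i) ` fst (c i))) (subtopology (fac D i) (fst (c i))) g"
  using g by (simp add: homeomorphic_maps_def)
 hence cg: "continuous_map (top_of_set (snd (c i) ` fst (c i))) (fac D i) g"
  by (simp add: continuous_map_in_subtopology)
 have cp: "continuous_map (top_of_set (charts_range c)) (top_of_set (snd (c i) ` fst (c i))) (blkproj i)"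
  using continuous_coord_proj by (auto simp: charts_range_def)
 have "continuous_map (top_of_set (charts_range c)) (fac D i) (g \<circ> blkproj i)"
  by (rule continuous_map_compose[OF cp cg])
 thus "continuous_map (top_of_set (charts_range c)) (fac D i) (%w. charts_inv c w i)"
  by (rule continuous_map_eq) (use gi in \<open>auto simp: charts_inv_def charts_range_def\<close>)
qed

lemma base_chartD:
 assumes "b : base_charts D"
 shows "openin (base D) (bdom b)" "!!i. snd (snd b) i : fac_atlas D i"
  "continuous_map (subtopology (base D) (bdom b)) (cover_space) (fst (snd b))"
  "!!p. p : bdom b ==> cov D (fst (snd b) p) = p" "!!p i. p : bdom b ==> fst (snd b) p i : fst (snd (snd b) i)"
  "open (bcoord D b ` bdom b)" using assms unfolding base_charts_def bdom_def by (simp_all add: case_prod_beta)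

lemma bcoord_nth: "bcoord D b p $ a = snd (snd (snd b) (blk D a)) (fst (snd b) p (blk D a)) $ a"
 by (cases b) (simp add: bcoord_def)

lemma coord_proj_bcoord:
 assumes "!!i. snd (snd b) i : fac_atlas D i" "!!i. fst (snd b) p i : fst (snd (snd b) i)"
 shows "blkproj i (bcoord D b p) = snd (snd (snd b) i) (fst (snd b) p i)"
proof -
 have "snd (snd (snd b) i) (fst (snd b) p i) : coord_space (block D i)"
  using factor_chart(2)[OF assms(1)[of i]] assms(2)[of i] by blast
 thus ?thesis by (auto simp: vec_eq_iff coord_proj_def bcoord_nth block_def coord_space_def)
qed

lemma charts_inv_bcoord:
 assumes b: "b : base_charts D" and p: "p : bdom b"
 shows "bcoord D b p : charts_range (snd (snd b))" "charts_inv (snd (snd b)) (bcoord D b p) = fst (snd b) p"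
  "cov D (charts_inv (snd (snd b)) (bcoord D b p)) = p"
proof -
 note c = base_chartD(2)[OF b] and m = base_chartD(5)[OF b p]
 note cp = coord_proj_bcoord[OF c m]
 show "bcoord D b p : charts_range (snd (snd b))" using cp m by (auto simp: charts_range_def)
 show e: "charts_inv (snd (snd b)) (bcoord D b p) = fst (snd b) p"
  using factor_chart(5)[OF c] m by (auto simp: charts_inv_def fun_eq_iff cp inv_into_f_f)
 show "cov D (charts_inv (snd (snd b)) (bcoord D b p)) = p" unfolding e by (rule base_chartD(4)[OF b p])
qed

lemma bcoord_inj: "b : base_charts D ==> inj_on (bcoord D b) (bdom b)"
 by (rule inj_on_inverseI[where g = "%w. cov D (charts_inv (snd (snd b)) w)"]) (rule charts_inv_bcoord(3))

lemma binv_bcoord: "b : base_charts D ==> p : bdom b ==> binv D b (bcoord D b p) = p"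
 unfolding binv_def by (rule inv_into_f_f[OF bcoord_inj])

lemma cov_continuous: "continuous_map (cover_space) (base D) (cov D)" using cov by (simp add: covering_projection_def)

text \<open>On the open set \<open>charts_range\<close> the map \<open>cov\<close> after
  \<open>charts_inv\<close> is continuous and undoes \<open>bcoord\<close>, so the image is the
  preimage of \<open>A\<close> under it, cut down to the open image of the whole chart.\<close>

lemma open_bcoord_image:
 assumes b: "b : base_charts D" and A: "openin (base D) A"
 shows "open (bcoord D b ` (bdom b \<inter> A))"
proof -
 let ?c = "snd (snd b)"
 have sub: "bcoord D b ` bdom b \<subseteq> charts_range ?c" using charts_inv_bcoord(1)[OF b] by blast
 have "continuous_map (top_of_set (charts_range ?c)) (base D) (cov D \<circ> charts_inv ?c)"
  by (rule continuous_map_compose[OF continuous_charts_inv[OF base_chartD(2)[OF b]] cov_continuous])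
 hence "openin (top_of_set (charts_range ?c)) {w : topspace (top_of_set (charts_range ?c)). (cov D \<circ> charts_inv ?c) w : A}"
  using A by (rule openin_continuous_map_preimage)
 hence "open {w : charts_range ?c. cov D (charts_inv ?c w) : A}"
  using open_charts_range[OF base_chartD(2)[OF b]] by (simp add: openin_open_eq)
 moreover have "bcoord D b ` (bdom b \<inter> A) = bcoord D b ` bdom b \<inter> {w : charts_range ?c. cov D (charts_inv ?c w) : A}"
 proof (intro equalityI subsetI)
  fix w assume "w : bcoord D b ` (bdom b \<inter> A)"
  thus "w : bcoord D b ` bdom b \<inter> {w : charts_range ?c. cov D (charts_inv ?c w) : A}"
   using charts_inv_bcoord[OF b] by auto
 next
  fix w assume w: "w : bcoord D b ` bdom b \<inter> {w : charts_range ?c. cov D (charts_inv ?c w) : A}"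
  then obtain p where p: "p : bdom b" "w = bcoord D b p" by blast
  with w have "p : A" using charts_inv_bcoord(3)[OF b p(1)] by simp
  with p show "w : bcoord D b ` (bdom b \<inter> A)" by blast
 qed
 ultimately show ?thesis using base_chartD(6)[OF b] by (simp add: open_Int)
qed

lemma base_chart_restrict:
 assumes b: "b : base_charts D" and A: "openin (base D) A"
 shows "(bdom b \<inter> A, fst (snd b), snd (snd b)) : base_charts D"
  "bcoord D (bdom b \<inter> A, fst (snd b), snd (snd b)) = bcoord D b"
  "bdom (bdom b \<inter> A, fst (snd b), snd (snd b)) = bdom b \<inter> A"
proof -
 show bc: "bcoord D (bdom b \<inter> A, fst (snd b), snd (snd b)) = bcoord D b"
  by (auto simp: fun_eq_iff vec_eq_iff bcoord_nth)
 show "bdom (bdom b \<inter> A, fst (snd b), snd (snd b)) = bdom b \<inter> A" by (simp add: bdom_def)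
 have "continuous_map (subtopology (base D) (bdom b \<inter> A)) (cover_space) (fst (snd b))"
  using continuous_map_from_subtopology[OF base_chartD(3)[OF b], of A] by (simp add: subtopology_subtopology)
 thus "(bdom b \<inter> A, fst (snd b), snd (snd b)) : base_charts D"
  unfolding base_charts_def mem_Collect_eq case_prod_conv bc
  using base_chartD[OF b] open_bcoord_image[OF b A] A by (auto intro: openin_Int)
qed

text \<open>An evenly covered neighbourhood provides a section onto the sheet \<open>V\<close>
  through a lift \<open>x\<close> of \<open>p\<close>; factor charts around the components of
  \<open>x\<close> give coordinates once the neighbourhood is shrunk so that the section stays in
  their domains.\<close>

lemma base_charts_cover:
 assumes p: "p : topspace (base D)"
 obtains b where "b : base_charts D" "p : bdom b"
proof -
 have "p : cov D ` topspace (cover_space)" using cov p unfolding covering_projection_def by blast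
 then obtain x where x: "x : topspace (cover_space)" "cov D x = p" by blast
 have "\<exists>U \<V>. openin (base D) U & p : U & \<Union>\<V> = {x : topspace (cover_space). cov D x : U} & pairwise disjnt \<V> &
   (\<forall>V\<in>\<V>. openin (cover_space) V & homeomorphic_map (subtopology (cover_space) V) (subtopology (base D) U) (cov D))"
  using cov p unfolding covering_projection_def by (elim conjE) (erule bspec)
 then obtain U \<V> where U: "openin (base D) U" "p : U" "\<Union>\<V> = {x : topspace (cover_space). cov D x : U}"
   and \<V>: "\<forall>V\<in>\<V>. openin (cover_space) V &
    homeomorphic_map (subtopology (cover_space) V) (subtopology (base D) U) (cov D)" by (elim exE conjE) (rule that)
 have "x : \<Union>\<V>" unfolding U(3) using x U(2) by auto
 then obtain V where V: "V : \<V>" "x : V" by blast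
 note oV = \<V>[rule_format, OF V(1)]
 have tV: "topspace (subtopology (cover_space) V) = V"
  by (rule topspace_subtopology_subset[OF openin_subset[OF conjunct1[OF oV]]])
 have tU: "topspace (subtopology (base D) U) = U" by (rule topspace_subtopology_subset[OF openin_subset[OF U(1)]])
 obtain \<sigma> where "homeomorphic_maps (subtopology (cover_space) V) (subtopology (base D) U) (cov D) \<sigma>"
  using oV homeomorphic_map_maps by blast
 hence \<sigma>: "continuous_map (subtopology (base D) U) (subtopology (cover_space) V) \<sigma>"
  "!!y. y : V ==> \<sigma> (cov D y) = y" "!!y. y : U ==> cov D (\<sigma> y) = y" using tV tU by (auto simp: homeomorphic_maps_def)
 have \<sigma>V: "\<sigma> y : V" if "y : U" for y using continuous_map_image_subset_topspace[OF \<sigma>(1)] tV tU that by auto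
 have covV: "cov D y : U" if "y : V" for y using homeomorphic_imp_surjective_map[OF conjunct2[OF oV]] tV tU that by blast
 have c\<sigma>: "continuous_map (subtopology (base D) U) (cover_space) \<sigma>"
  using \<sigma>(1) by (simp add: continuous_map_in_subtopology)
 have "\<exists>c\<in>fac_atlas D i. x i : fst c" for i
 proof -
  have "x i : topspace (fac D i)" using x(1) by (auto simp: PiE_iff)
  moreover have "\<Union>(fst ` fac_atlas D i) = topspace (fac D i)"
   using factor_manifold[of i] unfolding complex_manifold_def by (elim conjE)
  ultimately show ?thesis by blast
 qed
 then obtain c where c: "!!i. c i : fac_atlas D i" "!!i. x i : fst (c i)" by metis
 define Q where "Q = (\<Pi>\<^sub>E i\<in>UNIV. fst (c i))"
 have oQ: "openin (cover_space) Q" unfolding Q_def using factor_chart(1)[OF c(1)] by (simp add: openin_PiE_gen)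
 define U' where "U' = {y : topspace (subtopology (base D) U). \<sigma> y : Q}"
 have oU': "openin (base D) U'"
 proof -
  have "openin (subtopology (base D) U) U'" unfolding U'_def by (rule openin_continuous_map_preimage[OF c\<sigma> oQ])
  thus ?thesis using U(1) by (simp add: openin_open_subtopology)
 qed
 have U': "U' \<subseteq> U" "!!y. y : U' ==> \<sigma> y i : fst (c i)" for i by (auto simp: U'_def Q_def PiE_iff)
 define b where "b = (U', \<sigma>, c)"
 \<comment> \<open>This is what makes the image open: it is the preimage of the open sheet
   \<open>V\<close> under a continuous map.\<close>
 have im: "bcoord D b ` U' = {w : charts_range c. charts_inv c w : V}"
 proof (intro equalityI subsetI)
  fix w assume "w : bcoord D b ` U'"
  then obtain y where y: "y : U'" "w = bcoord D b y" by blast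
  have cp: "blkproj i w = snd (c i) (\<sigma> y i)" for i
   using coord_proj_bcoord[of b y i] c(1) U'(2)[OF y(1)] y(2) by (simp add: b_def)
  hence 1: "w : charts_range c" using U'(2)[OF y(1)] by (auto simp: charts_range_def)
  moreover have "charts_inv c w = \<sigma> y"
   using factor_chart(5)[OF c(1)] U'(2)[OF y(1)] by (auto simp: charts_inv_def fun_eq_iff cp inv_into_f_f)
  ultimately show "w : {w : charts_range c. charts_inv c w : V}" using \<sigma>V y(1) U'(1) by auto
 next
  fix w assume w: "w : {w : charts_range c. charts_inv c w : V}"
  define y where "y = cov D (charts_inv c w)"
  have y: "y : U" "\<sigma> y = charts_inv c w" using w covV \<sigma>(2) by (auto simp: y_def)
  have "\<sigma> y : Q" using y(2) charts_inv_in(1)[of w c] w by (auto simp: Q_def)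
  hence yU: "y : U'" using y(1) tU by (simp add: U'_def)
  have "bcoord D b y $ a = w $ a" for a
   using charts_inv_in(2)[of w c "blk D a"] w y(2) by (simp add: bcoord_nth b_def coord_proj_def block_def)
  hence "w = bcoord D b y" by (simp add: vec_eq_iff)
  thus "w : bcoord D b ` U'" using yU by blast
 qed
 have "open {w : charts_range c. charts_inv c w : V}"
  using openin_continuous_map_preimage[OF continuous_charts_inv[of c, OF c(1)], of V] oV open_charts_range[of c, OF c(1)]
  by (simp add: openin_open_eq)
 hence "b : base_charts D" unfolding base_charts_def b_def mem_Collect_eq case_prod_conv
  using oU' c(1) U' \<sigma>(3) im continuous_map_from_subtopology_mono[OF c\<sigma> U'(1)] by (auto simp: b_def)
 moreover have "\<sigma> p = x" using \<sigma>(2)[OF V(2)] x(2) by simp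
 hence "p : U'" using c(2) U(2) tU by (auto simp: U'_def Q_def)
 hence "p : bdom b" by (simp add: bdom_def b_def)
 ultimately show thesis using that by blast
qed

lemma continuous_bcoord:
 assumes b: "b : base_charts D"
 shows "continuous_map (subtopology (base D) (bdom b)) euclidean (bcoord D b)"
proof -
 let ?X = "subtopology (base D) (bdom b)" and ?c = "snd (snd b)" and ?\<sigma> = "fst (snd b)"
 have tX: "topspace ?X = bdom b" using base_chartD(1)[OF b] openin_subset by fastforce
 have comp: "continuous_map ?X euclidean (%p. bcoord D b p $ a)" for a
 proof -
  let ?i = "blk D a"
  have "continuous_map ?X (fac D ?i) (%p. ?\<sigma> p ?i)"
   using base_chartD(3)[OF b] by (simp add: continuous_map_componentwise_UNIV)
  hence "continuous_map ?X (subtopology (fac D ?i) (fst (?c ?i))) (%p. ?\<sigma> p ?i)"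
   using base_chartD(5)[OF b] tX by (auto simp: continuous_map_in_subtopology)
  moreover have "continuous_map (subtopology (fac D ?i) (fst (?c ?i))) (top_of_set (snd (?c ?i) ` fst (?c ?i))) (snd (?c ?i))"
   using factor_chart(4)[OF base_chartD(2)[OF b]] homeomorphic_imp_continuous_map by blast
  moreover have "continuous_map (top_of_set (snd (?c ?i) ` fst (?c ?i))) euclidean (%v. v $ a)"
   by (simp add: continuous_on_component)
  ultimately have "continuous_map ?X euclidean ((%v. v $ a) \<circ> (snd (?c ?i) \<circ> (%p. ?\<sigma> p ?i)))"
   by (blast intro: continuous_map_compose)
  moreover have "(%v. v $ a) \<circ> (snd (?c ?i) \<circ> (%p. ?\<sigma> p ?i)) = (%p. bcoord D b p $ a)" by (auto simp: bcoord_nth)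
  ultimately show ?thesis by simp
 qed
 have "continuous_map ?X euclidean (%p. \<Sum>a\<in>UNIV. axis a (bcoord D b p $ a))"
 proof (intro continuous_map_sum)
  fix a :: 'd
  have "continuous_on UNIV (%x::complex. axis a x)" unfolding axis_def
  proof (rule continuous_on_vec_lambda)
   show "continuous_on UNIV (%x::complex. if i = a then x else 0)" for i by (cases "i = a") auto
  qed
  hence "continuous_map euclidean euclidean (%x::complex. axis a x)" by simp
  from continuous_map_compose[OF comp this] show "continuous_map ?X euclidean (%p. axis a (bcoord D b p $ a))"
   by (simp add: o_def)
 qed auto
 moreover have "(\<Sum>a\<in>UNIV. axis a (w $ a)) = w" for w :: "complex^'d" by (simp add: vec_eq_iff axis_def)
 ultimately show ?thesis by simp
qed

section \<open>Bundle charts and the Hermitian norm\<close>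

lemma bundle_charts_cover:
 assumes p: "p : topspace (base D)" and A: "openin (base D) A" "p : A"
 obtains c where "c : bundle_charts D" "p : bdom (fst c)" "bdom (fst c) \<subseteq> A"
proof -
 obtain b where b: "b : base_charts D" "p : bdom b" using base_charts_cover[OF p] .
 have "\<Union>(fst ` triv D) = topspace (base D)" using hlb unfolding hermitian_line_bundle_def by (elim conjE)
 then obtain t where t: "t : triv D" "p : fst t" using p by blast
 obtain U f where U: "(U, f) : triv D" "p : U" using t by (cases t) auto
 have "\<forall>(U, f)\<in>triv D. openin (base D) U & bij_betw (%l. (prj D l, f l)) {l : tot D. prj D l : U} (U \<times> UNIV)"
  using hlb unfolding hermitian_line_bundle_def by (elim conjE)
 hence oU: "openin (base D) U" using U(1) by blast
 let ?b = "(bdom b \<inter> (A \<inter> U), fst (snd b), snd (snd b))"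
 have "?b : base_charts D" "bdom ?b = bdom b \<inter> (A \<inter> U)"
  using base_chart_restrict[OF b(1), of "A \<inter> U"] A(1) oU by (auto intro: openin_Int)
 hence "(?b, U, f) : bundle_charts D" using U(1) by (auto simp: bundle_charts_def)
 thus thesis by (rule that) (use b(2) A(2) U(2) in \<open>auto simp: bdom_def\<close>)
qed

lemma bundle_chartD:
 assumes "c : bundle_charts D"
 shows "fst c : base_charts D" "bdom (fst c) \<subseteq> fst (snd c)"
  "bij_betw (%l. (prj D l, snd (snd c) l)) {l : tot D. prj D l : fst (snd c)} (fst (snd c) \<times> UNIV)" "snd c : triv D"
proof -
 show t: "snd c : triv D" "fst c : base_charts D" "bdom (fst c) \<subseteq> fst (snd c)"
  using assms unfolding bundle_charts_def by auto
 have "\<forall>(U, f)\<in>triv D. openin (base D) U & bij_betw (%l. (prj D l, f l)) {l : tot D. prj D l : U} (U \<times> UNIV)"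
  using hlb unfolding hermitian_line_bundle_def by (elim conjE)
 from bspec[OF this t(1)] show "bij_betw (%l. (prj D l, snd (snd c) l)) {l : tot D. prj D l : fst (snd c)} (fst (snd c) \<times> UNIV)"
  by (simp add: case_prod_beta)
qed

text \<open>The local weight of the Hermitian norm: \<open>hnorm = |f| exp hpot\<close> in the
  trivialisation \<open>f\<close> of the chart. \<open>rho\<close> is the same function in
  coordinates.\<close>

definition hpot :: "('a, 's, 'l, 'd, 'b) bundle_chart => 's => real" where
 "hpot c = (SOME r. (\<forall>l\<in>tot D. prj D l : fst (snd c) --> hnorm D l = cmod (snd (snd c) l) * exp (r (prj D l))) &
    (\<forall>b\<in>base_charts D. smooth_in UNIV (bcoord D b ` (bdom b \<inter> fst (snd c))) (%w. r (binv D b w))))"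

definition rho :: "('a, 's, 'l, 'd, 'b) bundle_chart => complex^'d => real" where "rho c w = hpot c (binv D (fst c) w)"

definition bimg :: "('a, 's, 'l, 'd, 'b) bundle_chart => (complex^'d) set" where
 "bimg c = bcoord D (fst c) ` bdom (fst c)"

lemma hpot:
 assumes "c : bundle_charts D"
 shows "!!l. l : tot D ==> prj D l : fst (snd c) ==> hnorm D l = cmod (snd (snd c) l) * exp (hpot c (prj D l))"
  "smooth_in UNIV (bimg c) (rho c)"
proof -
 obtain b U f where c: "c = (b, U, f)" by (cases c) auto
 have "(U, f) : triv D" using bundle_chartD(4)[OF assms] c by simp
 hence "\<exists>r. (\<forall>l\<in>tot D. prj D l : U --> hnorm D l = cmod (f l) * exp (r (prj D l))) &
    (\<forall>b\<in>base_charts D. smooth_in UNIV (bcoord D b ` (bdom b \<inter> U)) (%w. r (binv D b w)))"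
  using hlb unfolding hermitian_line_bundle_def by fast
 hence *: "(\<forall>l\<in>tot D. prj D l : fst (snd c) --> hnorm D l = cmod (snd (snd c) l) * exp (hpot c (prj D l))) &
    (\<forall>b\<in>base_charts D. smooth_in UNIV (bcoord D b ` (bdom b \<inter> fst (snd c))) (%w. hpot c (binv D b w)))"
  unfolding hpot_def c fst_conv snd_conv by (rule someI_ex)
 show "hnorm D l = cmod (snd (snd c) l) * exp (hpot c (prj D l))" if "l : tot D" "prj D l : fst (snd c)" for l
  using * that by blast
 have "bdom (fst c) \<inter> fst (snd c) = bdom (fst c)" using bundle_chartD(2)[OF assms] by blast
 thus "smooth_in UNIV (bimg c) (rho c)"
  using * bundle_chartD(1)[OF assms] unfolding rho_def[abs_def] bimg_def by metis
qed

lemma open_bimg: "c : bundle_charts D ==> open (bimg c)"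
 unfolding bimg_def using base_chartD(6) bundle_chartD(1) by blast

lemma cdomD:
 assumes c: "c : bundle_charts D" and l: "l : cdom D c"
 shows "l : tot D" "prj D l : bdom (fst c)" "snd (snd c) l ~= 0" "bcoord D (fst c) (prj D l) : bimg c"
  "rho c (bcoord D (fst c) (prj D l)) = hpot c (prj D l)" "hnorm D l > 0"
  "ylog D l = - ln (cmod (snd (snd c) l)) - hpot c (prj D l)"
proof -
 show t: "l : tot D" "prj D l : bdom (fst c)" using l by (auto simp: cdom_def M0_def)
 have h: "hnorm D l = cmod (snd (snd c) l) * exp (hpot c (prj D l))"
  by (rule hpot(1)[OF c]) (use t bundle_chartD(2)[OF c] in auto)
 have "hnorm D l ~= 0" using l by (auto simp: cdom_def M0_def)
 thus f: "snd (snd c) l ~= 0" using h by auto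
 show "hnorm D l > 0" using h f by simp
 show "ylog D l = - ln (cmod (snd (snd c) l)) - hpot c (prj D l)" unfolding ylog_def h using f by (simp add: ln_mult)
 show "bcoord D (fst c) (prj D l) : bimg c" unfolding bimg_def using t by blast
 show "rho c (bcoord D (fst c) (prj D l)) = hpot c (prj D l)"
  unfolding rho_def using binv_bcoord[OF bundle_chartD(1)[OF c] t(2)] by simp
qed

lemma cdom_eqI:
 assumes c: "c : bundle_charts D" and l: "l : cdom D c" "l' : cdom D c"
  and "bcoord D (fst c) (prj D l) = bcoord D (fst c) (prj D l')" "snd (snd c) l = snd (snd c) l'"
 shows "l = l'"
proof -
 note a = cdomD[OF c l(1)] and b = cdomD[OF c l(2)]
 have "prj D l = prj D l'" using bcoord_inj[OF bundle_chartD(1)[OF c]] a(2) b(2) assms(4) by (auto simp: inj_on_def)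
 moreover have "inj_on (%l. (prj D l, snd (snd c) l)) {l : tot D. prj D l : fst (snd c)}"
  using bundle_chartD(3)[OF c] by (simp add: bij_betw_def)
 ultimately show ?thesis using a b assms(5) bundle_chartD(2)[OF c] by (auto simp: inj_on_def)
qed

lemma cdom_exists:
 assumes c: "c : bundle_charts D" and w: "w : bimg c" and "\<xi> ~= 0"
 obtains l where "l : cdom D c" "bcoord D (fst c) (prj D l) = w" "snd (snd c) l = \<xi>"
proof -
 obtain p where p: "p : bdom (fst c)" "w = bcoord D (fst c) p" using w by (auto simp: bimg_def)
 have "(p, \<xi>) : (%l. (prj D l, snd (snd c) l)) ` {l : tot D. prj D l : fst (snd c)}"
  using bundle_chartD(2,3)[OF c] p(1) by (auto simp: bij_betw_def)
 then obtain l where l: "l : tot D" "prj D l = p" "snd (snd c) l = \<xi>" by auto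
 have "hnorm D l ~= 0" using hpot(1)[OF c l(1)] l p(1) bundle_chartD(2)[OF c] assms(3) by auto
 hence "l : cdom D c" using l p(1) by (simp add: cdom_def M0_def)
 thus thesis using that l p by blast
qed

lemma ccoord_parts: "ccoord D Y c l $ None = of_real (exp (Y l - ylog D l)) / snd (snd c) l"
 "base_part (ccoord D Y c l) = bcoord D (fst c) (prj D l)" by (simp_all add: ccoord_def base_part_def vec_eq_iff)

text \<open>The rescaling in \<open>ccoord\<close> is made for this: whichever \<open>Y\<close> is
  chosen, it reads \<open>ln |\<zeta>| - rho\<close> in its own chart. In coordinates the choices
  differ only in the range of this expression.\<close>

lemma Y_in_chart:
 assumes c: "c : bundle_charts D" and l: "l : cdom D c"
 shows "Y l = ln (cmod (ccoord D Y c l $ None)) - rho c (base_part (ccoord D Y c l))"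
  "ccoord D Y c l $ None ~= 0" "base_part (ccoord D Y c l) : bimg c"
proof -
 note a = cdomD[OF c l]
 have "cmod (ccoord D Y c l $ None) = exp (Y l - ylog D l) / cmod (snd (snd c) l)"
  by (simp add: ccoord_parts norm_divide)
 hence "ln (cmod (ccoord D Y c l $ None)) = Y l - ylog D l - ln (cmod (snd (snd c) l))"
  using a(3) by (simp add: ln_div)
 thus "Y l = ln (cmod (ccoord D Y c l $ None)) - rho c (base_part (ccoord D Y c l))"
  using a(5,7) by (simp add: ccoord_parts)
 show "ccoord D Y c l $ None ~= 0" using a(3) by (simp add: ccoord_parts)
 show "base_part (ccoord D Y c l) : bimg c" using a(4) by (simp add: ccoord_parts)
qed

lemma ccoord_inj:
 assumes c: "c : bundle_charts D" and T: "inj_on T J" and P: "!!l. l : P ==> ylog D l : J"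
 shows "inj_on (ccoord D (%l. T (ylog D l)) c) (P \<inter> cdom D c)"
proof (rule inj_onI)
 let ?Y = "%l. T (ylog D l)"
 fix l l' assume l: "l : P \<inter> cdom D c" "l' : P \<inter> cdom D c" and eq: "ccoord D ?Y c l = ccoord D ?Y c l'"
 have "T (ylog D l) = T (ylog D l')" using Y_in_chart(1)[OF c, of l ?Y] Y_in_chart(1)[OF c, of l' ?Y] l eq by simp
 hence y: "ylog D l = ylog D l'" using T P l by (auto simp: inj_on_def)
 have "ccoord D ?Y c l $ None = ccoord D ?Y c l' $ None" "base_part (ccoord D ?Y c l) = base_part (ccoord D ?Y c l')"
  using eq by auto
 hence "snd (snd c) l = snd (snd c) l'" "bcoord D (fst c) (prj D l) = bcoord D (fst c) (prj D l')"
  using y cdomD(3)[OF c, of l] cdomD(3)[OF c, of l'] l by (auto simp: ccoord_parts)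
 thus "l = l'" using cdom_eqI[OF c] l by blast
qed

text \<open>The chart image of the part where \<open>Y\<close> takes values in \<open>K\<close>. It
  is written without \<open>Y\<close>, whose coordinate expression is always the same.\<close>

definition cimg :: "('a, 's, 'l, 'd, 'b) bundle_chart => real set => (complex^('d option)) set" where
 "cimg c K = {q. base_part q : bimg c & q $ None ~= 0 & ln (cmod (q $ None)) - rho c (base_part q) : K}"

lemma ccoord_image:
 assumes c: "c : bundle_charts D"
 shows "ccoord D (%l. T (ylog D l)) c ` ({l : M0 D. ylog D l : J} \<inter> cdom D c) = cimg c (T ` J)"
proof (intro equalityI subsetI)
 fix q assume "q : ccoord D (%l. T (ylog D l)) c ` ({l : M0 D. ylog D l : J} \<inter> cdom D c)"
 then obtain l where l: "l : cdom D c" "ylog D l : J" "q = ccoord D (%l. T (ylog D l)) c l" by blast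
 have "T (ylog D l) : T ` J" using l(2) by blast
 thus "q : cimg c (T ` J)" using Y_in_chart[OF c l(1), of "%l. T (ylog D l)"] l(3) by (simp add: cimg_def)
next
 fix q assume q: "q : cimg c (T ` J)"
 then obtain y where y: "y : J" "ln (cmod (q $ None)) - rho c (base_part q) = T y" by (auto simp: cimg_def)
 \<comment> \<open>The fibre value that \<open>ccoord\<close> sends to \<open>q $ None\<close>,
   since \<open>ccoord\<close> divides \<open>exp (Y - y)\<close> by it.\<close>
 have "of_real (exp (T y - y)) / q $ None ~= 0" "base_part q : bimg c" using q by (auto simp: cimg_def)
 then obtain l where l: "l : cdom D c" "bcoord D (fst c) (prj D l) = base_part q" "snd (snd c) l = of_real (exp (T y - y)) / q $ None"
  using cdom_exists[OF c] by metis
 note a = cdomD[OF c l(1)]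
 have "cmod (snd (snd c) l) = exp (T y - y) / cmod (q $ None)" by (simp add: l(3) norm_divide)
 hence "ln (cmod (snd (snd c) l)) = T y - y - ln (cmod (q $ None))" using q by (simp add: ln_div cimg_def)
 hence yl: "ylog D l = y" using a(5,7) l(2) y(2) by simp
 have "base_part q = base_part (ccoord D (%l. T (ylog D l)) c l)" by (simp add: ccoord_parts l(2))
 moreover have "q $ None = ccoord D (%l. T (ylog D l)) c l $ None"
  using q by (simp add: ccoord_parts l(3) yl cimg_def)
 ultimately have "q = ccoord D (%l. T (ylog D l)) c l" by (simp add: vec_eq_iff base_part_def split_option_all)
 moreover have "l : M0 D" using l(1) by (simp add: cdom_def)
 ultimately show "q : ccoord D (%l. T (ylog D l)) c ` ({l : M0 D. ylog D l : J} \<inter> cdom D c)"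
  using l(1) yl y(1) by blast
qed

lemma in_chart_ccoord:
 assumes "inj_on (ccoord D Y c) (P \<inter> cdom D c)" "l : P \<inter> cdom D c"
 shows "in_chart D P Y c f (ccoord D Y c l) = f l" unfolding in_chart_def using assms by (simp add: inv_into_f_f)

lemma open_cimg:
 assumes c: "c : bundle_charts D" and K: "open K"
 shows "open (cimg c K)"
proof -
 have cr: "continuous_on (bimg c) (rho c)" using hpot(2)[OF c] by (rule smooth_in_continuous)
 have cb: "continuous_on S (base_part :: complex^('d option) => complex^'d)" for S
  unfolding base_part_def by (rule continuous_on_vec_lambda) (intro continuous_on_component continuous_on_id)
 let ?S = "{q. base_part q : bimg c} \<inter> {q. q $ None ~= 0}"
 have "open ?S"
 proof (rule open_Int)
  have "{q. base_part q : bimg c} = base_part -` bimg c" by auto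
  thus "open {q :: complex^('d option). base_part q : bimg c}" using open_vimage[OF open_bimg[OF c] cb] by metis
  show "open {q :: complex^('d option). q $ None ~= 0}" by (intro open_Collect_neq continuous_intros)
 qed
 moreover have "continuous_on ?S (%q. ln (cmod (q $ None)) - rho c (base_part q))"
  by (intro continuous_intros continuous_on_compose2[OF cr cb]) auto
 ultimately have "open (?S \<inter> (%q. ln (cmod (q $ None)) - rho c (base_part q)) -` K)"
  using K by (intro continuous_open_preimage)
 moreover have "?S \<inter> (%q. ln (cmod (q $ None)) - rho c (base_part q)) -` K = cimg c K" by (auto simp: cimg_def)
 ultimately show ?thesis by simp
qed

end

section \<open>Lebesgue measure in fibre coordinates\<close>

definition join :: "complex^'d::finite => complex => complex^('d option)" where
 "join w \<zeta> = (\<chi> k. case k of None => \<zeta> | Some a => w $ a)"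

lemma join_nth [simp]: "join w \<zeta> $ None = \<zeta>" "join w \<zeta> $ Some a = w $ a" by (simp_all add: join_def)

lemma base_part_nth [simp]: "base_part v $ a = v $ Some a" by (simp add: base_part_def)

lemma base_part_join [simp]: "base_part (join w \<zeta>) = w" by (simp add: vec_eq_iff)

lemma join_base_part [simp]: "join (base_part q) (q $ None) = q"
 by (simp add: vec_eq_iff join_def split: option.split)

lemma bounded_linear_base_part: "bounded_linear (base_part :: complex^('d::finite option) => complex^'d)"
 unfolding linear_conv_bounded_linear[symmetric] by (rule linearI) (simp_all add: vec_eq_iff)

lemma continuous_on_join: "continuous_on UNIV (%p. join (fst p) (snd p) :: complex^('d::finite option))"
 unfolding join_def
proof (rule continuous_on_vec_lambda)
 show "continuous_on UNIV (%p. case i of None => snd p | Some a => fst p $ a)" for i :: "'d option"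
  by (cases i) (auto intro!: continuous_intros)
qed

lemma measurable_join: "(%p. join (fst p) (snd p)) : borel_measurable (borel \<Otimes>\<^sub>M borel)"
 unfolding borel_prod by (rule borel_measurable_continuous_onI[OF continuous_on_join])

lemma prod_Basis_vec:
 fixes f :: "complex^'n::finite => real"
 shows "(\<Prod>v\<in>Basis. f v) = (\<Prod>k\<in>UNIV. \<Prod>b\<in>Basis. f (axis k b))"
proof -
 have "(\<Prod>v\<in>Basis. f v) = (\<Prod>v\<in>(\<Union>k\<in>UNIV. (%b. axis k b) ` Basis). f v)" by (rule prod.cong) (auto simp: Basis_vec_def)
 also have "... = (\<Prod>k\<in>UNIV. \<Prod>v\<in>(%b. axis k b) ` Basis. f v)" by (rule prod.UNION_disjoint) (auto simp: axis_eq_axis)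
 also have "... = (\<Prod>k\<in>UNIV. \<Prod>b\<in>Basis. f (axis k b))"
  by (intro prod.cong refl prod.reindex_cong[where l = "%b. axis _ b"]) (auto simp: inj_on_def axis_eq_axis)
 finally show ?thesis .
qed

lemma prod_option_UNIV: "prod f (UNIV :: 'd::finite option set) = f None * prod (%a. f (Some a)) UNIV"
proof -
 have eq: "(UNIV :: 'd option set) = insert None (range Some)" by (auto simp: UNIV_option_conv)
 show ?thesis unfolding eq by (subst prod.insert) (auto simp: prod.reindex)
qed

lemma lborel_join:
 "distr (lborel \<Otimes>\<^sub>M lborel) borel (%p. join (fst p) (snd p)) = (lborel :: (complex^('d::finite option)) measure)"
proof (rule lborel_eqI[symmetric])
 fix l u :: "complex^('d option)" assume lu: "!!b. b : Basis ==> l \<bullet> b <= u \<bullet> b"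
 have le: "l $ k \<bullet> b <= u $ k \<bullet> b" if "b : Basis" for k b
  using lu[of "axis k b"] that by (auto simp: inner_axis Basis_vec_def)
 have mb: "x : box l u \<longleftrightarrow> (\<forall>k. x $ k : box (l $ k) (u $ k))" for x :: "complex^('d option)" and l u
  by (auto simp: mem_box Basis_vec_def inner_axis)
 have mb': "x : box l u \<longleftrightarrow> (\<forall>k. x $ k : box (l $ k) (u $ k))" for x :: "complex^'d" and l u
  by (auto simp: mem_box Basis_vec_def inner_axis)
 have pre: "(%p. join (fst p) (snd p)) -` box l u \<inter> space (lborel \<Otimes>\<^sub>M lborel) = box (base_part l) (base_part u) \<times> box (l $ None) (u $ None)"
  by (auto simp: mb mb' space_pair_measure split_option_all)
 have "emeasure (distr (lborel \<Otimes>\<^sub>M lborel) borel (%p. join (fst p) (snd p))) (box l u)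
  = emeasure (lborel \<Otimes>\<^sub>M lborel) (box (base_part l) (base_part u) \<times> box (l $ None) (u $ None))"
  using measurable_join[where 'a = 'd] by (subst emeasure_distr) (auto simp: pre)
 also have "... = emeasure lborel (box (base_part l) (base_part u)) * emeasure lborel (box (l $ None) (u $ None))"
  by (rule lborel.emeasure_pair_measure_Times) auto
 also have "... = ennreal (\<Prod>b\<in>Basis. (base_part u - base_part l) \<bullet> b) * ennreal (\<Prod>b\<in>Basis. (u $ None - l $ None) \<bullet> b)"
  using le by (subst (1 2) emeasure_lborel_box) (auto simp: Basis_vec_def inner_axis)
 also have "... = ennreal ((\<Prod>b\<in>Basis. (base_part u - base_part l) \<bullet> b) * (\<Prod>b\<in>Basis. (u $ None - l $ None) \<bullet> b))"
  using le by (intro ennreal_mult[symmetric] prod_nonneg) (auto simp: Basis_vec_def inner_axis inner_diff_left)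
 also have "(\<Prod>b\<in>Basis. (base_part u - base_part l) \<bullet> b) * (\<Prod>b\<in>Basis. (u $ None - l $ None) \<bullet> b) = (\<Prod>b\<in>Basis. (u - l) \<bullet> b)"
  unfolding prod_Basis_vec prod_option_UNIV by (simp add: inner_axis mult.commute)
 finally show "emeasure (distr (lborel \<Otimes>\<^sub>M lborel) borel (%p. join (fst p) (snd p))) (box l u) = ennreal (\<Prod>b\<in>Basis. (u - l) \<bullet> b)" .
qed simp

lemma lborel_Complex: "distr (lborel \<Otimes>\<^sub>M lborel) borel (%p. Complex (fst p) (snd p)) = (lborel :: complex measure)"
proof (rule lborel_eqI[symmetric])
 fix l u :: complex assume lu: "!!b. b : Basis ==> l \<bullet> b <= u \<bullet> b"
 have le: "Re l <= Re u" "Im l <= Im u" using lu[of 1] lu[of \<i>] by (auto simp: Basis_complex_def inner_complex_def)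
 have m: "(%p. Complex (fst p) (snd p)) : borel_measurable (borel \<Otimes>\<^sub>M borel)"
  unfolding borel_prod by (intro borel_measurable_continuous_onI continuous_on_Complex continuous_intros)
 have pre: "(%p. Complex (fst p) (snd p)) -` box l u \<inter> space (lborel \<Otimes>\<^sub>M lborel) = {Re l<..<Re u} \<times> {Im l<..<Im u}"
  by (auto simp: mem_box Basis_complex_def inner_complex_def space_pair_measure)
 have "emeasure (distr (lborel \<Otimes>\<^sub>M lborel) borel (%p. Complex (fst p) (snd p))) (box l u)
  = emeasure (lborel \<Otimes>\<^sub>M lborel) ({Re l<..<Re u} \<times> {Im l<..<Im u})" using m by (subst emeasure_distr) (auto simp: pre)
 also have "... = emeasure lborel {Re l<..<Re u} * emeasure lborel {Im l<..<Im u}"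
  by (rule lborel.emeasure_pair_measure_Times) auto
 also have "... = ennreal ((Re u - Re l) * (Im u - Im l))" using le by (simp add: ennreal_mult)
 also have "(Re u - Re l) * (Im u - Im l) = (\<Prod>b\<in>Basis. (u - l) \<bullet> b)"
  by (simp add: Basis_complex_def inner_complex_def)
 finally show "emeasure (distr (lborel \<Otimes>\<^sub>M lborel) borel (%p. Complex (fst p) (snd p))) (box l u) = ennreal (\<Prod>b\<in>Basis. (u - l) \<bullet> b)" .
qed simp

lemma measurable_Complex: "(%p. Complex (fst p) (snd p)) : borel_measurable (borel \<Otimes>\<^sub>M borel)"
 unfolding borel_prod by (intro borel_measurable_continuous_onI continuous_on_Complex continuous_intros)

lemma nn_integral_complex_Re_Im:
 fixes f :: "complex => ennreal"
 assumes [measurable]: "f : borel_measurable borel"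
 shows "(\<integral>\<^sup>+ z. f z \<partial>lborel) = (\<integral>\<^sup>+ y. \<integral>\<^sup>+ x. f (Complex x y) \<partial>lborel \<partial>lborel)"
  "(\<integral>\<^sup>+ z. f z \<partial>lborel) = (\<integral>\<^sup>+ x. \<integral>\<^sup>+ y. f (Complex x y) \<partial>lborel \<partial>lborel)"
proof -
 note [measurable] = measurable_Complex
 have m: "(%p. f (Complex (fst p) (snd p))) : borel_measurable (lborel \<Otimes>\<^sub>M lborel)" by measurable
 have "(\<integral>\<^sup>+ z. f z \<partial>lborel) = (\<integral>\<^sup>+ p. f (Complex (fst p) (snd p)) \<partial>(lborel \<Otimes>\<^sub>M lborel))"
  by (subst lborel_Complex[symmetric], subst nn_integral_distr) (use measurable_Complex in auto)
 thus "(\<integral>\<^sup>+ z. f z \<partial>lborel) = (\<integral>\<^sup>+ y. \<integral>\<^sup>+ x. f (Complex x y) \<partial>lborel \<partial>lborel)"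
  "(\<integral>\<^sup>+ z. f z \<partial>lborel) = (\<integral>\<^sup>+ x. \<integral>\<^sup>+ y. f (Complex x y) \<partial>lborel \<partial>lborel)"
  using lborel_pair.nn_integral_snd[of "%p. f (Complex (fst p) (snd p))"] m lborel.nn_integral_fst[OF m] by auto
qed

lemma nn_integral_lborel_translate:
 fixes f :: "real => ennreal"
 assumes [measurable]: "f : borel_measurable borel"
 shows "(\<integral>\<^sup>+ x. f (x + c) \<partial>lborel) = (\<integral>\<^sup>+ x. f x \<partial>lborel)"
 using nn_integral_real_affine[of f 1 c] by (simp add: add.commute)

lemma nn_integral_lborel_reflect:
 fixes f :: "real => ennreal"
 assumes [measurable]: "f : borel_measurable borel"
 shows "(\<integral>\<^sup>+ x. f (- x) \<partial>lborel) = (\<integral>\<^sup>+ x. f x \<partial>lborel)" using nn_integral_real_affine[of f "-1" 0] by simp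

lemma nn_integral_shear:
 fixes f :: "complex => ennreal"
 assumes [measurable]: "f : borel_measurable borel"
 shows "(\<integral>\<^sup>+ z. f (Complex (Re z + t * Im z) (Im z)) \<partial>lborel) = (\<integral>\<^sup>+ z. f z \<partial>lborel)"
  "(\<integral>\<^sup>+ z. f (Complex (Re z) (Im z + t * Re z)) \<partial>lborel) = (\<integral>\<^sup>+ z. f z \<partial>lborel)"
proof -
 have c: "(%z. Complex (Re z + t * Im z) (Im z)) : borel_measurable borel" "(%z. Complex (Re z) (Im z + t * Re z)) : borel_measurable borel"
  "(%x. Complex x y) : borel_measurable borel" "(%y. Complex x y) : borel_measurable borel" for x y
  by (intro borel_measurable_continuous_onI continuous_on_Complex continuous_intros)+
 note [measurable] = c
 have "(\<integral>\<^sup>+ z. f (Complex (Re z + t * Im z) (Im z)) \<partial>lborel) = (\<integral>\<^sup>+ y. \<integral>\<^sup>+ x. f (Complex (x + t * y) y) \<partial>lborel \<partial>lborel)"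
  by (subst nn_integral_complex_Re_Im(1)) auto
 also have "... = (\<integral>\<^sup>+ y. \<integral>\<^sup>+ x. f (Complex x y) \<partial>lborel \<partial>lborel)"
  using nn_integral_lborel_translate[of "%x. f (Complex x y)" "t * y" for y] by simp
 finally show "(\<integral>\<^sup>+ z. f (Complex (Re z + t * Im z) (Im z)) \<partial>lborel) = (\<integral>\<^sup>+ z. f z \<partial>lborel)"
  by (subst nn_integral_complex_Re_Im(1)) auto
 have "(\<integral>\<^sup>+ z. f (Complex (Re z) (Im z + t * Re z)) \<partial>lborel) = (\<integral>\<^sup>+ x. \<integral>\<^sup>+ y. f (Complex x (y + t * x)) \<partial>lborel \<partial>lborel)"
  by (subst nn_integral_complex_Re_Im(2)) auto
 also have "... = (\<integral>\<^sup>+ x. \<integral>\<^sup>+ y. f (Complex x y) \<partial>lborel \<partial>lborel)"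
  using nn_integral_lborel_translate[of "%y. f (Complex x y)" "t * x" for x] by simp
 finally show "(\<integral>\<^sup>+ z. f (Complex (Re z) (Im z + t * Re z)) \<partial>lborel) = (\<integral>\<^sup>+ z. f z \<partial>lborel)"
  by (subst nn_integral_complex_Re_Im(2)) auto
qed

text \<open>A rotation is a product of three shears.\<close>

lemma nn_integral_rotate:
 fixes f :: "complex => ennreal"
 assumes f [measurable]: "f : borel_measurable borel" and c: "cmod c = 1"
 shows "(\<integral>\<^sup>+ z. f (c * z) \<partial>lborel) = (\<integral>\<^sup>+ z. f z \<partial>lborel)"
proof -
 have *: "(\<integral>\<^sup>+ z. f (c * z) \<partial>lborel) = (\<integral>\<^sup>+ z. f z \<partial>lborel)"
  if [measurable]: "f : borel_measurable borel" and c: "cmod c = 1" and im: "Im c ~= 0" for f :: "complex => ennreal" and c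
 proof -
  have cc: "(Re c)^2 + (Im c)^2 = 1" using c by (metis cmod_power2 one_power2)
  \<comment> \<open>Minus the tangent of half the rotation angle.\<close>
  define t where "t = (Re c - 1) / Im c"
  have t: "t * Im c = Re c - 1" using im by (simp add: t_def)
  have t2: "2 * t + t * t * Im c = - Im c"
  proof -
   have "(2 * t + t * t * Im c) * Im c = 2 * (t * Im c) + (t * Im c) * (t * Im c)" by (simp add: algebra_simps)
   also have "... = (Re c)^2 - 1" unfolding t by (simp add: power2_eq_square algebra_simps)
   also have "... = (- Im c) * Im c" using cc by (simp add: power2_eq_square)
   finally show ?thesis by (rule mult_right_cancel[OF im, THEN iffD1])
  qed
  define S where "S z = Complex (Re z + t * Im z) (Im z)" for z
  define T where "T z = Complex (Re z) (Im z + Im c * Re z)" for z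
  have [measurable]: "S : borel_measurable borel" "T : borel_measurable borel"
   unfolding S_def T_def by (intro borel_measurable_continuous_onI continuous_on_Complex continuous_intros)+
  have "S (T (S z)) = c * z" for z
  proof (rule complex_eqI)
   have "Re (S (T (S z))) = Re z * (1 + t * Im c) + Im z * (2 * t + t * t * Im c)"
    by (simp add: S_def T_def algebra_simps)
   also have "... = Re z * Re c + Im z * (- Im c)" unfolding t2 using t by simp
   finally show "Re (S (T (S z))) = Re (c * z)" by (simp add: mult.commute)
   have "Im (S (T (S z))) = Im c * Re z + Im z * (1 + t * Im c)" by (simp add: S_def T_def algebra_simps)
   also have "... = Im c * Re z + Im z * Re c" using t by simp
   finally show "Im (S (T (S z))) = Im (c * z)" by (simp add: mult.commute)
  qed
  hence "(\<integral>\<^sup>+ z. f (c * z) \<partial>lborel) = (\<integral>\<^sup>+ z. f (S (T (S z))) \<partial>lborel)" by simp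
  also have "... = (\<integral>\<^sup>+ z. f (S (T z)) \<partial>lborel)"
  proof -
   have m: "(%z. f (S (T z))) : borel_measurable borel" by measurable
   from nn_integral_shear(1)[OF this, of t] show ?thesis unfolding S_def[symmetric] .
  qed
  also have "... = (\<integral>\<^sup>+ z. f (S z) \<partial>lborel)"
  proof -
   have m: "(%z. f (S z)) : borel_measurable borel" by measurable
   from nn_integral_shear(2)[OF this, of "Im c"] show ?thesis unfolding T_def[symmetric] .
  qed
  also have "... = (\<integral>\<^sup>+ z. f z \<partial>lborel)"
   using nn_integral_shear(1)[OF \<open>f : borel_measurable borel\<close>, of t] unfolding S_def[symmetric] .
  finally show ?thesis .
 qed
 show ?thesis
 proof (cases "Im c = 0")
  case False
  thus ?thesis using * f c by blast
 next
  \<comment> \<open>Here \<open>c\<close> is real; the rotation is factored as multiplication by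
    \<open>\<i>\<close> followed by multiplication by \<open>- \<i> * c\<close>, and both have
    nonzero imaginary part.\<close>
  case True
  have [measurable]: "(%z. f (- \<i> * c * z)) : borel_measurable borel" by measurable
  have "Re c ~= 0" using True c by (auto simp: cmod_def)
  hence "(\<integral>\<^sup>+ z. f (- \<i> * c * z) \<partial>lborel) = (\<integral>\<^sup>+ z. f z \<partial>lborel)" by (intro *) (use c in \<open>auto simp: norm_mult\<close>)
  moreover have "(\<integral>\<^sup>+ z. f (- \<i> * c * (\<i> * z)) \<partial>lborel) = (\<integral>\<^sup>+ z. f (- \<i> * c * z) \<partial>lborel)"
   using *[of "%z. f (- \<i> * c * z)" \<i>] by simp
  ultimately show ?thesis by (simp add: mult.assoc mult.left_commute)
 qed
qed

section \<open>Rotation invariance and radial integration in the fibre\<close>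

lemma lborel_rotate:
 assumes "cmod c = 1" shows "distr lborel borel (%z. c * z) = (lborel :: complex measure)"
proof (rule measure_eqI)
 fix A :: "complex set" assume "A : sets (distr lborel borel (%z. c * z))"
 hence [measurable]: "A : sets borel" by simp
 have "emeasure (distr lborel borel (%z. c * z)) A = (\<integral>\<^sup>+ z. indicator A (c * z) \<partial>lborel)"
  by (subst nn_integral_indicator[symmetric], simp, subst nn_integral_distr) auto
 also have "... = (\<integral>\<^sup>+ z. indicator A z \<partial>lborel)" by (rule nn_integral_rotate[OF _ assms]) auto
 finally show "emeasure (distr lborel borel (%z. c * z)) A = emeasure lborel A" by simp
qed simp

text \<open>With this sign the half-lines \<open>{x<..}\<close> pull back, up to the origin, to
  discs of radius \<open>exp (- x)\<close>, which have finite area; agreement on all half-lines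
  identifies the measures.\<close>

lemma distr_minus_ln_cmod:
 "distr (lborel :: complex measure) borel (%z. - ln (cmod z)) = density lborel (%y. ennreal (2 * pi * exp (- 2 * y)))"
proof (rule measure_eqI_lessThan)
 have N: "emeasure (density lborel (%y. ennreal (2 * pi * exp (- 2 * y)))) {x<..} = ennreal (pi * exp (- 2 * x))" for x :: real
 proof -
  have "emeasure (density lborel (%y. ennreal (2 * pi * exp (- 2 * y)))) {x<..} = (\<integral>\<^sup>+ y. ennreal (2 * pi * exp (- 2 * y)) * indicator {x<..} y \<partial>lborel)"
   by (subst emeasure_density) auto
  also have "... = (\<integral>\<^sup>+ y. ennreal (2 * pi * exp (- 2 * y)) * indicator {x..} y \<partial>lborel)"
   by (rule nn_integral_cong_AE, rule AE_mp[OF AE_lborel_singleton[of x]]) (auto split: split_indicator)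
  also have "... = ennreal (0 - (- pi * exp (- 2 * x)))"
  proof (rule nn_integral_FTC_atLeast)
   show "((%y. - pi * exp (- 2 * y)) \<longlongrightarrow> 0) at_top"
   proof -
    have "filterlim (%y::real. - 2 * y) at_bot at_top"
     by (rule filterlim_tendsto_neg_mult_at_bot[OF tendsto_const]) (auto simp: filterlim_ident)
    hence "((%y::real. exp (- 2 * y)) \<longlongrightarrow> 0) at_top" by (rule filterlim_compose[OF exp_at_bot])
    from tendsto_mult_left[OF this, of "- pi"] show ?thesis by simp
   qed
  qed (auto intro!: derivative_eq_intros)
  finally show ?thesis by simp
 qed
 have M: "emeasure (distr (lborel :: complex measure) borel (%z. - ln (cmod z))) {x<..} = ennreal (pi * exp (- 2 * x))" for x :: real
 proof -
  have "emeasure (distr (lborel :: complex measure) borel (%z. - ln (cmod z))) {x<..} = emeasure lborel {z. x < - ln (cmod z)}"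
   by (subst emeasure_distr) (auto simp: vimage_def)
  also have "... = emeasure lborel (ball (0::complex) (exp (- x)))"
  proof (rule emeasure_eq_AE, rule AE_mp[OF AE_lborel_singleton[of 0]])
   have "- ln (cmod z) > x \<longleftrightarrow> cmod z < exp (- x)" if "z ~= 0" for z
   proof -
    have "- ln (cmod z) > x \<longleftrightarrow> ln (cmod z) < - x" by linarith
    also have "... \<longleftrightarrow> cmod z < exp (- x)" using that by (metis exp_less_cancel_iff exp_ln zero_less_norm_iff)
    finally show ?thesis .
   qed
   thus "AE z in lborel. z ~= (0::complex) --> (z : {z. x < - ln (cmod z)}) = (z : ball 0 (exp (- x)))"
    by (intro AE_I2) auto
  qed auto
  also have "... = ennreal (pi * exp (- 2 * x))"
   by (subst emeasure_ball) (simp_all add: unit_ball_vol_2 DIM_complex exp_of_nat_mult[symmetric] power2_eq_square exp_add[symmetric])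
  finally show ?thesis .
 qed
 show "emeasure (distr lborel borel (%z::complex. - ln (cmod z))) {x<..} < \<infinity>" for x using M by simp
 show "emeasure (distr lborel borel (%z::complex. - ln (cmod z))) {x<..} =
   emeasure (density lborel (%y. ennreal (2 * pi * exp (- 2 * y)))) {x<..}" for x using M N by simp
qed auto

text \<open>The measure with density \<open>1 / |z|^2\<close> is invariant under dilation, so in the
  variable \<open>ln |z|\<close> it becomes \<open>2 pi dy\<close>, whatever the shift
  \<open>\<rho>\<close>.\<close>

lemma nn_integral_radial:
 fixes k :: "real => ennreal"
 assumes [measurable]: "k : borel_measurable borel"
 shows "(\<integral>\<^sup>+ z. k (ln (cmod z) - \<rho>) * ennreal (1 / (cmod z)^2) \<partial>lborel) = ennreal (2 * pi) * (\<integral>\<^sup>+ y. k y \<partial>lborel)"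
proof -
 let ?h = "%y. k (- y - \<rho>) * ennreal (exp (2 * y))"
 have "(\<integral>\<^sup>+ z. k (ln (cmod z) - \<rho>) * ennreal (1 / (cmod z)^2) \<partial>lborel) = (\<integral>\<^sup>+ z. ?h (- ln (cmod z)) \<partial>lborel)"
 proof (rule nn_integral_cong_AE, rule AE_mp[OF AE_lborel_singleton[of 0]], rule AE_I2, rule impI)
  fix z :: complex assume "z ~= 0"
  hence "exp (2 * - ln (cmod z)) = 1 / (cmod z)^2"
   by (simp add: exp_minus exp_double power2_eq_square inverse_eq_divide)
  thus "k (ln (cmod z) - \<rho>) * ennreal (1 / (cmod z)^2) = k (- (- ln (cmod z)) - \<rho>) * ennreal (exp (2 * - ln (cmod z)))"
   by simp
 qed
 also have "... = (\<integral>\<^sup>+ y. ?h y \<partial>distr (lborel :: complex measure) borel (%z. - ln (cmod z)))"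
  by (rule nn_integral_distr[symmetric]) auto
 also have "... = (\<integral>\<^sup>+ y. ennreal (2 * pi * exp (- 2 * y)) * ?h y \<partial>lborel)"
  unfolding distr_minus_ln_cmod by (rule nn_integral_density) auto
 also have "... = (\<integral>\<^sup>+ y. ennreal (2 * pi) * k (- y - \<rho>) \<partial>lborel)"
 proof (rule nn_integral_cong)
  fix y :: real
  have "ennreal (2 * pi * exp (- 2 * y)) * ?h y = k (- y - \<rho>) * ennreal (2 * pi * exp (- 2 * y) * exp (2 * y))"
   by (subst ennreal_mult) (auto simp: mult_ac)
  also have "2 * pi * exp (- 2 * y) * exp (2 * y) = 2 * pi" by (simp add: mult.assoc exp_add[symmetric])
  finally show "ennreal (2 * pi * exp (- 2 * y)) * ?h y = ennreal (2 * pi) * k (- y - \<rho>)" by (simp add: mult.commute)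
 qed
 also have "... = ennreal (2 * pi) * (\<integral>\<^sup>+ y. k (- y - \<rho>) \<partial>lborel)" by (rule nn_integral_cmult) auto
 also have "(\<integral>\<^sup>+ y. k (- y - \<rho>) \<partial>lborel) = (\<integral>\<^sup>+ y. k (y - \<rho>) \<partial>lborel)"
  using nn_integral_lborel_reflect[of "%y. k (y - \<rho>)"] by simp
 also have "... = (\<integral>\<^sup>+ y. k y \<partial>lborel)" using nn_integral_lborel_translate[of k "- \<rho>"] by simp
 finally show ?thesis .
qed

text \<open>Substitution \<open>z = Z(y)\<close>, \<open>dz = \<Theta>(Z) dy\<close>, over the whole
  line. The improper fundamental theorem asks for a nonnegative integrand, so \<open>\<phi>\<close>
  is first shifted by a constant.\<close>

lemma integral_momentum_substitution:
 assumes Z: "!!y. -1 < Z y & Z y < (1::real)" "!!y. (Z has_real_derivative \<Theta> (Z y)) (at y)"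
  and lim: "(Z \<longlongrightarrow> 1) at_top" "(Z \<longlongrightarrow> -1) at_bot" and \<Theta>: "!!z. -1 < z ==> z < 1 ==> \<Theta> z > 0" "continuous_on {-1<..<1} \<Theta>"
  and \<phi>: "continuous_on {-1..1} \<phi>"
 shows "has_bochner_integral lborel (%y. \<phi> (Z y) * \<Theta> (Z y)) (integral {-1..1} \<phi>)"
proof -
 have cZ: "isCont Z y" for y using Z(2) DERIV_isCont by blast
 have c\<Theta>: "isCont \<Theta> z" if "-1 < z" "z < 1" for z using \<Theta>(2) that by (simp add: continuous_on_eq_continuous_at)
 have nonneg: "has_bochner_integral lborel (%y. \<phi> (Z y) * \<Theta> (Z y)) (integral {-1..1} \<phi>)"
  if \<phi>: "continuous_on {-1..1} \<phi>" and pos: "!!z. z : {-1..1} ==> \<phi> z >= 0" for \<phi>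
 proof -
  define \<Psi> where "\<Psi> z = integral {-1..z} \<phi>" for z
  have D: "(\<Psi> has_real_derivative \<phi> z) (at z within {-1..1})" if "z : {-1..1}" for z
   unfolding \<Psi>_def using integral_has_vector_derivative[OF \<phi> that] real_deriv_vec by blast
  hence c\<Psi>: "continuous_on {-1..1} \<Psi>" by (rule DERIV_continuous_on)
  have D': "(\<Psi> has_real_derivative \<phi> z) (at z)" if "-1 < z" "z < 1" for z
   by (rule deriv_Icc_interior[OF D]) (use that in auto)
  have c\<phi>: "isCont \<phi> z" if "-1 < z" "z < 1" for z by (rule continuous_on_interior[OF \<phi>]) (use that in auto)
  have Zin: "\<forall>\<^sub>F y in G. Z y : {-1..1}" for G using Z(1) by (auto simp: less_imp_le intro!: always_eventually)
  have lt: "((%y. \<Psi> (Z y)) \<longlongrightarrow> \<Psi> 1) at_top" by (rule continuous_on_tendsto_compose[OF c\<Psi> lim(1) _ Zin]) auto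
  have lb: "((%y. \<Psi> (Z y)) \<longlongrightarrow> \<Psi> (-1)) at_bot" by (rule continuous_on_tendsto_compose[OF c\<Psi> lim(2) _ Zin]) auto
  have FD: "((%y. \<Psi> (Z y)) has_real_derivative \<phi> (Z y) * \<Theta> (Z y)) (at y)" for y
   by (rule DERIV_chain2[OF D' Z(2)]) (use Z in auto)
  have Fc: "isCont (%y. \<phi> (Z y) * \<Theta> (Z y)) y" for y
   using Z(1)[of y] by (intro continuous_mult isCont_o2[OF cZ] c\<phi> c\<Theta>) auto
  have Fn: "AE y in lborel. - \<infinity> < ereal y --> ereal y < \<infinity> --> 0 <= \<phi> (Z y) * \<Theta> (Z y)"
   using pos Z(1) \<Theta>(1) by (intro AE_I2 impI mult_nonneg_nonneg) (auto simp: less_imp_le)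
  have FA: "(((%y. \<Psi> (Z y)) \<circ> real_of_ereal) \<longlongrightarrow> \<Psi> (-1)) (at_right (- \<infinity>))" using lb by (simp add: ereal_tendsto_simps)
  have FB: "(((%y. \<Psi> (Z y)) \<circ> real_of_ereal) \<longlongrightarrow> \<Psi> 1) (at_left \<infinity>)" using lt by (simp add: ereal_tendsto_simps)
  note interval_integral_FTC_nonneg[OF _ FD Fc Fn FA FB]
  hence "integrable lborel (%y. \<phi> (Z y) * \<Theta> (Z y))" "integral\<^sup>L lborel (%y. \<phi> (Z y) * \<Theta> (Z y)) = \<Psi> 1 - \<Psi> (-1)"
   by (auto simp: set_integrable_def interval_lebesgue_integral_def set_lebesgue_integral_def einterval_eq_UNIV)
  thus ?thesis by (simp add: has_bochner_integral_iff \<Psi>_def)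
 qed
 have "bounded (\<phi> ` {-1..1})" using \<phi> by (intro compact_imp_bounded compact_continuous_image) auto
 then obtain B where B: "B > 0" "!!z. z : {-1..1} ==> \<bar>\<phi> z\<bar> <= B" by (auto simp: bounded_pos)
 have "has_bochner_integral lborel (%y. (\<phi> (Z y) + B) * \<Theta> (Z y)) (integral {-1..1} (%z. \<phi> z + B))"
  by (rule nonneg) (use B(2) \<phi> in \<open>force intro!: continuous_intros simp: abs_le_iff\<close>)+
 moreover have "has_bochner_integral lborel (%y. B * \<Theta> (Z y)) (integral {-1..1} (%z::real. B))"
  by (rule nonneg[of "%_. B"]) (use B(1) in auto)
 ultimately have "has_bochner_integral lborel (%y. (\<phi> (Z y) + B) * \<Theta> (Z y) - B * \<Theta> (Z y))
   (integral {-1..1} (%z. \<phi> z + B) - integral {-1..1} (%z::real. B))" by (rule has_bochner_integral_diff)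
 moreover have "integral {-1..1} (%z. \<phi> z + B) = integral {-1..1} \<phi> + integral {-1..1} (%z::real. B)"
  by (intro integral_add integrable_continuous_real \<phi> continuous_intros)
 ultimately show ?thesis by (simp add: algebra_simps)
qed

section \<open>The scalar curvature in a chart\<close>

lemma i_smult_axis: "\<i> *s axis a c = axis a (\<i> * c)" by (simp add: vec_eq_iff axis_def)

lemma subspace_coord_space: "subspace (coord_space B)" by (auto simp: subspace_def coord_space_def)

lemma axis_in_coord_space: "a : B ==> axis a c : coord_space B" by (auto simp: coord_space_def axis_def)

lemma relopen_coord_space:
 assumes "openin (top_of_set (coord_space B)) W"
 shows "relopen (coord_space B) W" unfolding relopen_def
proof (intro conjI ballI)
 show "subspace (coord_space B)" by (rule subspace_coord_space)
 fix q assume q: "q : W"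
 obtain T where T: "open T" "W = coord_space B \<inter> T" using assms by (auto simp: openin_open)
 then obtain e where e: "e > 0" "ball q e \<subseteq> T" using q open_contains_ball by blast
 have "q + h : W" if "h : coord_space B" "norm h < e" for h
  using that q T(2) e(2) subspace_add[OF subspace_coord_space] by (auto simp: dist_norm)
 thus "\<exists>e>0. \<forall>h\<in>coord_space B. norm h < e --> q + h : W" using e(1) by blast
qed

lemma kaehler_coordsD:
 assumes "kaehler_coords B W g"
 shows "!!v w. v : coord_space B ==> w : coord_space B ==> smooth_in (coord_space B) W (%q. g q v w)"
  "!!q. q : W ==> bilinear (g q)" "!!q v w. q : W ==> v : coord_space B ==> w : coord_space B ==> g q v w = g q w v"
  "!!q v w. q : W ==> v : coord_space B ==> w : coord_space B ==> g q (\<i> *s v) (\<i> *s w) = g q v w"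
  "!!q v. q : W ==> v : coord_space B ==> v ~= 0 ==> g q v v > 0" using assms unfolding kaehler_coords_def by blast+

lemma herm_matrix_sesquilinear:
 assumes kc: "kaehler_coords B W g" and q: "q : W" and ab: "a : B" "b : B"
 shows "g q (axis a \<alpha>) (axis b \<beta>) = Re (\<alpha> * herm_matrix B g q $ a $ b * cnj \<beta>)"
proof -
 note bl = kaehler_coordsD(2)[OF kc q]
 have d: "axis a \<gamma> = Re \<gamma> *\<^sub>R axis a 1 + Im \<gamma> *\<^sub>R axis a \<i>" for a :: 'a and \<gamma>
  by (auto simp: vec_eq_iff axis_def complex_eq_iff)
 have j: "g q (axis a \<i>) (axis b \<i>) = g q (axis a 1) (axis b 1)"
  using kaehler_coordsD(4)[OF kc q axis_in_coord_space[OF ab(1), of 1] axis_in_coord_space[OF ab(2), of 1]]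
  by (simp add: i_smult_axis)
 have "axis b (-1) = - axis b (1::complex)" by (simp add: vec_eq_iff axis_def)
 hence k: "g q (axis a \<i>) (axis b 1) = - g q (axis a 1) (axis b \<i>)"
  using kaehler_coordsD(4)[OF kc q axis_in_coord_space[OF ab(1), of 1] axis_in_coord_space[OF ab(2), of \<i>]]
   bilinear_rneg[OF bl, of "axis a \<i>" "axis b 1"] by (simp add: i_smult_axis)
 have "g q (axis a \<alpha>) (axis b \<beta>) = Re \<alpha> * Re \<beta> * g q (axis a 1) (axis b 1) + Re \<alpha> * Im \<beta> * g q (axis a 1) (axis b \<i>)
   + Im \<alpha> * Re \<beta> * g q (axis a \<i>) (axis b 1) + Im \<alpha> * Im \<beta> * g q (axis a \<i>) (axis b \<i>)" unfolding d[of a \<alpha>] d[of b \<beta>]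
  by (simp add: bilinear_ladd[OF bl] bilinear_radd[OF bl] bilinear_lmul[OF bl] bilinear_rmul[OF bl] algebra_simps)
 thus ?thesis unfolding j k using ab by (simp add: herm_matrix_def algebra_simps)
qed

lemma herm_matrix_hermitian:
 assumes kc: "kaehler_coords B W g" and q: "q : W"
 shows "herm_matrix B g q $ a $ b = cnj (herm_matrix B g q $ b $ a)"
proof (cases "a : B & b : B")
 case True
 note ax = axis_in_coord_space[of a B] axis_in_coord_space[of b B]
 have "Re (herm_matrix B g q $ a $ b) = Re (herm_matrix B g q $ b $ a)"
  using herm_matrix_sesquilinear[OF kc q, of a b 1 1] herm_matrix_sesquilinear[OF kc q, of b a 1 1]
   kaehler_coordsD(3)[OF kc q ax(1)[of 1] ax(2)[of 1]] True by simp
 moreover have "Im (herm_matrix B g q $ a $ b) = - Im (herm_matrix B g q $ b $ a)"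
  using herm_matrix_sesquilinear[OF kc q, of a b 1 \<i>] herm_matrix_sesquilinear[OF kc q, of b a \<i> 1]
   kaehler_coordsD(3)[OF kc q ax(1)[of 1] ax(2)[of \<i>]] True by simp
 ultimately show ?thesis by (simp add: complex_eq_iff)
qed (auto simp: herm_matrix_def)

lemma herm_matrix_posdef:
 assumes kc: "kaehler_coords B W g" and q: "q : W" and v: "v ~= 0"
 shows "Re (\<Sum>a\<in>UNIV. \<Sum>b\<in>UNIV. cnj (v $ a) * herm_matrix B g q $ a $ b * v $ b) > 0"
proof -
 note bl = kaehler_coordsD(2)[OF kc q]
 \<comment> \<open>\<open>herm_matrix_sesquilinear\<close> conjugates the second argument, the
   matrix form the first: hence the conjugated vector. Off \<open>B\<close> the padding contributes
   the squares of the moduli.\<close>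
 define u :: "complex^'a" where "u = (\<chi> a. if a : B then cnj (v $ a) else 0)"
 have uB: "u : coord_space B" by (simp add: u_def coord_space_def)
 have u: "u = (\<Sum>a\<in>B. axis a (cnj (v $ a)))" by (simp add: vec_eq_iff u_def axis_def sum.delta)
 have "g q u u = (\<Sum>(a, b)\<in>B \<times> B. g q (axis a (cnj (v $ a))) (axis b (cnj (v $ b))))"
  unfolding u using bilinear_sum[OF bl] by simp
 also have "... = (\<Sum>a\<in>B. \<Sum>b\<in>B. Re (cnj (v $ a) * herm_matrix B g q $ a $ b * v $ b))"
  unfolding sum.cartesian_product[symmetric] by (intro sum.cong refl) (simp add: herm_matrix_sesquilinear[OF kc q])
 finally have gu: "g q u u = (\<Sum>a\<in>B. \<Sum>b\<in>B. Re (cnj (v $ a) * herm_matrix B g q $ a $ b * v $ b))" .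
 have inner: "(\<Sum>b\<in>UNIV. Re (cnj (v $ a) * herm_matrix B g q $ a $ b * v $ b)) =
   (if a : B then (\<Sum>b\<in>B. Re (cnj (v $ a) * herm_matrix B g q $ a $ b * v $ b)) else (cmod (v $ a))^2)" for a
 proof (cases "a : B")
  case True
  have "herm_matrix B g q $ a $ b = 0" if "b \<notin> B" for b using that True by (auto simp: herm_matrix_def)
  hence "(\<Sum>b\<in>UNIV. Re (cnj (v $ a) * herm_matrix B g q $ a $ b * v $ b)) = (\<Sum>b\<in>B. Re (cnj (v $ a) * herm_matrix B g q $ a $ b * v $ b))"
   by (intro sum.mono_neutral_right) auto
  thus ?thesis using True by simp
 next
  case False
  hence "Re (cnj (v $ a) * herm_matrix B g q $ a $ b * v $ b) = (if b = a then (cmod (v $ a))^2 else 0)" for b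
   by (auto simp: herm_matrix_def cmod_power2) (auto simp: power2_eq_square)
  thus ?thesis using False by simp
 qed
 have "Re (\<Sum>a\<in>UNIV. \<Sum>b\<in>UNIV. cnj (v $ a) * herm_matrix B g q $ a $ b * v $ b)
  = (\<Sum>a\<in>UNIV. if a : B then (\<Sum>b\<in>B. Re (cnj (v $ a) * herm_matrix B g q $ a $ b * v $ b)) else (cmod (v $ a))^2)"
  using inner by simp
 also have "... = (\<Sum>a\<in>B. (\<Sum>b\<in>B. Re (cnj (v $ a) * herm_matrix B g q $ a $ b * v $ b))) + (\<Sum>a\<in>-B. (cmod (v $ a))^2)"
  by (subst sum.If_cases) (auto simp: Compl_eq)
 also have "... = g q u u + (\<Sum>a\<in>-B. (cmod (v $ a))^2)" using gu by simp
 finally have eq: "Re (\<Sum>a\<in>UNIV. \<Sum>b\<in>UNIV. cnj (v $ a) * herm_matrix B g q $ a $ b * v $ b) = g q u u + (\<Sum>a\<in>-B. (cmod (v $ a))^2)" .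
 show ?thesis
 proof (cases "u = 0")
  case True
  obtain a where a: "v $ a ~= 0" using v by (auto simp: vec_eq_iff)
  have "u $ a = 0" using True by simp
  hence "a \<notin> B" using a by (auto simp: u_def split: if_splits)
  hence "(\<Sum>a\<in>-B. (cmod (v $ a))^2) > 0" using a by (intro sum_pos2[of _ a]) auto
  moreover have "g q u u = 0" using True bilinear_lzero[OF bl] by simp
  ultimately show ?thesis using eq by simp
 next
  case False
  thus ?thesis using kaehler_coordsD(5)[OF kc q uB] eq by (simp add: add_pos_nonneg sum_nonneg)
 qed
qed

lemma vol_density_pos:
 assumes "kaehler_coords B W g" "q : W"
 shows "vol_density B g q > 0" "det (herm_matrix B g q) = of_real (vol_density B g q)"
 using det_hermitian_pos[OF herm_matrix_hermitian[OF assms] herm_matrix_posdef[OF assms]]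
 by (auto simp: vol_density_def complex_eq_iff)

lemma smooth_vol_density:
 assumes kc: "kaehler_coords B W g" and ro: "relopen (coord_space B) W"
 shows "smooth_in (coord_space B) W (vol_density B g)"
proof -
 have entry: "smooth_in (coord_space B) W (%q. herm_matrix B g q $ a $ b)" for a b
 proof (cases "a : B & b : B")
  case True
  hence "(%q. herm_matrix B g q $ a $ b) = (%q. of_real (g q (axis a 1) (axis b 1)) + \<i> * of_real (g q (axis a 1) (axis b \<i>)))"
   by (auto simp: herm_matrix_def complex_eq_iff)
  moreover have "smooth_in (coord_space B) W (%q. g q (axis a 1) (axis b t))" for t
   using kaehler_coordsD(1)[OF kc] True axis_in_coord_space by blast
  ultimately show ?thesis
   using ro by (auto intro!: smooth_in_add smooth_in_mult smooth_in_const smooth_in_bounded_linear_comp[OF bounded_linear_of_real])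
 next
  case False
  hence "(%q. herm_matrix B g q $ a $ b) = (%q. if a = b then 1 else 0)" by (auto simp: herm_matrix_def)
  thus ?thesis using ro by (simp add: smooth_in_const)
 qed
 have "smooth_in (coord_space B) W (%q. det (herm_matrix B g q))"
  unfolding det_def by (intro smooth_in_sum smooth_in_mult smooth_in_prod smooth_in_const entry ro)
 thus ?thesis unfolding vol_density_def[abs_def] by (intro smooth_in_bounded_linear_comp[OF bounded_linear_Re] ro)
qed

section \<open>Levi forms\<close>

abbreviation D2 :: "('v::real_normed_vector => real) => 'v => 'v => 'v => real" where
 "D2 f q v w \<equiv> dirD (%p. dirD f p v) q w"

text \<open>The real Hessian made invariant under multiplication by \<open>\<i>\<close>;
  \<open>ddbar\<close> is a quarter of its Hermitian matrix, so metrics and logarithms of volume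
  densities give forms of the same kind.\<close>

definition levi :: "(complex^'n::finite => real) => complex^'n => complex^'n => complex^'n => real" where
 "levi f q v w = D2 f q v w + D2 f q (\<i> *s v) (\<i> *s w)"

text \<open>The passage from a real bilinear form to its Hermitian matrix, as in
  \<open>herm_matrix\<close>. It is linear, which lets the summands of a metric or of a Levi form be
  treated separately.\<close>

definition herm_entry :: "(complex^'n::finite => complex^'n => real) => 'n => 'n => complex" where
 "herm_entry T a b = Complex (T (axis a 1) (axis b 1)) (T (axis a 1) (axis b \<i>))"

lemma herm_entry_add: "herm_entry (%v w. S v w + T v w) a b = herm_entry S a b + herm_entry T a b"
 by (simp add: herm_entry_def complex_eq_iff)

lemma herm_entry_cmult: "herm_entry (%v w. c * T v w) a b = of_real c * herm_entry T a b"
 by (simp add: herm_entry_def complex_eq_iff)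

lemma ddbar_levi:
 assumes "smooth_in E W f" "q : W" "axis a 1 : E" "axis a \<i> : E" "axis b 1 : E"
 shows "ddbar f q a b = herm_entry (levi f q) a b / 4"
proof -
 have "ddiff (%p. dirD f p v) q w" if "v : E" "w : E" for v w
  using smooth_in_ddiff[OF smooth_in_dirD[OF assms(1) that(1)] assms(2) that(2)] .
 hence "D2 f q v (- w) = - D2 f q v w" if "v : E" "w : E" for v w using that by (intro dirD_minus)
 from this[OF assms(4,5)] have "D2 f q (axis a \<i>) (- axis b 1) = - D2 f q (axis a \<i>) (axis b 1)" .
 moreover have "axis b (-1) = - axis b (1::complex)" for b :: 'a by (simp add: vec_eq_iff axis_def)
 ultimately show ?thesis by (simp add: ddbar_def herm_entry_def levi_def i_smult_axis complex_eq_iff)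
qed

lemma levi_add:
 assumes "open W" "smooth_in UNIV W f" "smooth_in UNIV W g" "q : W"
 shows "levi (%p. f p + g p) q v w = levi f q v w + levi g q v w"
proof -
 have ro: "relopen UNIV W" using assms(1) by (rule relopen_UNIV)
 have "D2 (%p. f p + g p) q v w = D2 f q v w + D2 g q v w" for v w
 proof -
  have "D2 (%p. f p + g p) q v w = dirD (%p. dirD f p v + dirD g p v) q w"
  proof (rule dirD_cong(1)[OF ro assms(4) UNIV_I])
   fix p assume "p : W"
   thus "dirD (%p. f p + g p) p v = dirD f p v + dirD g p v"
    by (intro dirD_add_fun(1) smooth_in_ddiff[OF assms(2)] smooth_in_ddiff[OF assms(3)] UNIV_I)
  qed
  also have "... = D2 f q v w + D2 g q v w"
   by (rule dirD_add_fun(1)[OF smooth_in_ddiff[OF smooth_in_dirD[OF assms(2)] assms(4)] smooth_in_ddiff[OF smooth_in_dirD[OF assms(3)] assms(4)]]) auto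
  finally show ?thesis .
 qed
 thus ?thesis by (simp add: levi_def)
qed

lemma levi_cong:
 assumes "open W" "q : W" "!!p. p : W ==> f p = g p"
 shows "levi f q v w = levi g q v w"
proof -
 have ro: "relopen UNIV W" using assms(1) by (rule relopen_UNIV)
 have "D2 f q v w = D2 g q v w" for v w
  by (intro dirD_cong(1)[OF ro assms(2)] UNIV_I) (rule dirD_cong(1)[OF ro], use assms in auto)
 thus ?thesis by (simp add: levi_def)
qed

lemma levi_sum:
 assumes "open W" "!!i. i : I ==> smooth_in UNIV W (f i)" "q : W"
 shows "levi (%p. \<Sum>i\<in>I. f i p) q v w = (\<Sum>i\<in>I. levi (f i) q v w)" using assms(2)
proof (induction I rule: infinite_finite_induct)
 case (insert i I)
 have "levi (%p. f i p + (\<Sum>i\<in>I. f i p)) q v w = levi (f i) q v w + levi (%p. \<Sum>i\<in>I. f i p) q v w"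
  by (rule levi_add[OF assms(1) _ _ assms(3)]) (use insert relopen_UNIV[OF assms(1)] in \<open>auto intro!: smooth_in_sum\<close>)
 thus ?case using insert by simp
qed (simp_all add: levi_def dirD_const)

lemma levi_compose_real:
 assumes W: "open W" and f: "smooth_in UNIV W f" and q: "q : W"
  and K: "f ` W \<subseteq> K" and h: "!!y. y : K ==> (h has_real_derivative h1 y) (at y)" "!!y. y : K ==> (h1 has_real_derivative h2 y) (at y)"
 shows "levi (%p. h (f p)) q v w = h1 (f q) * levi f q v w
  + h2 (f q) * (dirD f q v * dirD f q w + dirD f q (\<i> *s v) * dirD f q (\<i> *s w))"
proof -
 have ro: "relopen UNIV W" using W by (rule relopen_UNIV)
 have dd: "ddiff f p v" if "p : W" for p v using smooth_in_ddiff[OF f that] by simp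
 have "D2 (%p. h (f p)) q v w = h1 (f q) * D2 f q v w + h2 (f q) * (dirD f q v * dirD f q w)" for v w
 proof -
  have "D2 (%p. h (f p)) q v w = dirD (%p. h1 (f p) * dirD f p v) q w"
   by (rule dirD_cong(1)[OF ro q UNIV_I], rule dirD_compose_real(1)) (use h K dd in auto)
  also have "... = h1 (f q) * D2 f q v w + dirD (%p. h1 (f p)) q w * dirD f q v"
   by (rule dirD_mult_fun(1)[OF dirD_compose_real(2)]) (use h K dd q smooth_in_ddiff[OF smooth_in_dirD[OF f] q] in auto)
  also have "dirD (%p. h1 (f p)) q w = h2 (f q) * dirD f q w" by (rule dirD_compose_real(1)) (use h K dd q in auto)
  finally show ?thesis by (simp add: mult_ac)
 qed
 thus ?thesis by (simp add: levi_def algebra_simps)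
qed

lemma dirD_precomp_linear:
 assumes "linear A"
 shows "dirD (%p. f (A p)) q v = dirD f (A q) (A v)" using assms by (simp add: dirD_def linear_add linear_cmul)

lemma D2_precomp_linear: "linear A ==> D2 (%p. f (A p)) q v w = D2 f (A q) (A v) (A w)"
 by (simp add: dirD_precomp_linear) (simp add: dirD_precomp_linear[of A "%p. dirD f p (A v)"])

section \<open>The logarithm of the fibre norm\<close>

lemma bounded_linear_Re_nth: "bounded_linear (%q::complex^'n. Re (q $ k))"
 and bounded_linear_Im_nth: "bounded_linear (%q::complex^'n. Im (q $ k))"
 by (intro bounded_linear_compose[OF bounded_linear_Re] bounded_linear_compose[OF bounded_linear_Im] bounded_linear_vec_nth)+

lemma ln_cmod_eq: "ln (cmod z) = ln ((Re z)^2 + (Im z)^2) / 2" by (simp add: cmod_def ln_sqrt)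

lemma smooth_ln_cmod_nth:
 assumes "open W" "!!q. q : W ==> q $ k ~= 0"
 shows "smooth_in UNIV W (%q::complex^'n. ln (cmod (q $ k)))"
proof -
 have ro: "relopen UNIV W" using assms(1) by (rule relopen_UNIV)
 have "smooth_in UNIV W (%q::complex^'n. Re (q $ k) * Re (q $ k) + Im (q $ k) * Im (q $ k))"
  by (intro smooth_in_add smooth_in_mult ro smooth_in_linear bounded_linear_Re_nth bounded_linear_Im_nth)
 moreover have "(%q. Re (q $ k) * Re (q $ k) + Im (q $ k) * Im (q $ k)) ` W \<subseteq> {0<..}"
 proof
  fix y assume "y : (%q. Re (q $ k) * Re (q $ k) + Im (q $ k) * Im (q $ k)) ` W"
  then obtain q where q: "q : W" "y = Re (q $ k) * Re (q $ k) + Im (q $ k) * Im (q $ k)" by auto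
  have "y = (cmod (q $ k))^2" unfolding q cmod_power2 by (simp add: power2_eq_square)
  thus "y : {0<..}" using assms(2)[OF q(1)] by simp
 qed
 moreover have "smooth_on_line {0<..} (%x::real. ln x)" by (rule smooth_line_ln) (auto intro: smooth_line_ident)
 ultimately have "smooth_in UNIV W (%q::complex^'n. ln (Re (q $ k) * Re (q $ k) + Im (q $ k) * Im (q $ k)))"
  using smooth_in_compose_real[OF open_greaterThan, of 0 ln UNIV W "%q. Re (q $ k) * Re (q $ k) + Im (q $ k) * Im (q $ k)"] ro
  by blast
 from smooth_in_mult[OF ro this smooth_in_const[OF ro, of "1/2"]] show ?thesis
  by (simp add: ln_cmod_eq power2_eq_square)
qed

lemma dirD_ln_cmod_nth:
 fixes q v :: "complex^'n"
 assumes "q $ k ~= 0"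
 shows "dirD (%q. ln (cmod (q $ k))) q v = Re (v $ k / q $ k)"
proof -
 have n: "(Re (q $ k))^2 + (Im (q $ k))^2 > 0" using assms by (metis cmod_power2 zero_less_norm_iff zero_less_power)
 have 1: "((%t. (Re (q $ k) + t * Re (v $ k))^2 + (Im (q $ k) + t * Im (v $ k))^2) has_real_derivative
   2 * Re (q $ k) * Re (v $ k) + 2 * Im (q $ k) * Im (v $ k)) (at 0)" by (auto intro!: derivative_eq_intros)
 have "((%t. ln ((Re (q $ k) + t * Re (v $ k))^2 + (Im (q $ k) + t * Im (v $ k))^2)) has_real_derivative
   1 / ((Re (q $ k))^2 + (Im (q $ k))^2) * (2 * Re (q $ k) * Re (v $ k) + 2 * Im (q $ k) * Im (v $ k))) (at 0)"
  by (rule DERIV_chain2[OF _ 1]) (use DERIV_ln_divide[OF n] in simp)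
 from DERIV_cdivide[OF this, of 2]
 have "((%t. ln (cmod ((q + t *\<^sub>R v) $ k))) has_vector_derivative
   (2 * Re (q $ k) * Re (v $ k) + 2 * Im (q $ k) * Im (v $ k)) / ((Re (q $ k))^2 + (Im (q $ k))^2) / 2) (at 0)"
  by (simp add: ln_cmod_eq real_deriv_vec)
 from dirDI(1)[OF this] have "dirD (%q. ln (cmod (q $ k))) q v =
   (2 * Re (q $ k) * Re (v $ k) + 2 * Im (q $ k) * Im (v $ k)) / ((Re (q $ k))^2 + (Im (q $ k))^2) / 2" by simp
 moreover have "(2 * A * a + 2 * B * b) / S / 2 = (a * A + b * B) / S" for S A B a b :: real
  by (simp add: algebra_simps add_divide_distrib)
 ultimately show ?thesis by (simp only: Re_divide)
qed

text \<open>The function \<open>ln |\<zeta>|\<close> is pluriharmonic: its Hessian is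
  \<open>- Re (v w / \<zeta>^2)\<close>, which changes sign when both arguments are multiplied by
  \<open>\<i>\<close>.\<close>

lemma levi_ln_cmod_nth:
 fixes q v w :: "complex^'n"
 assumes "q $ k ~= 0"
 shows "levi (%q. ln (cmod (q $ k))) q v w = 0"
proof -
 have W: "open {p::complex^'n. p $ k ~= 0}" by (intro open_Collect_neq continuous_intros)
 have "D2 (%q. ln (cmod (q $ k))) q v w = - Re (v $ k * w $ k / (q $ k)^2)" for v w
 proof -
  have "D2 (%q. ln (cmod (q $ k))) q v w = dirD (%p. Re (v $ k / p $ k)) q w"
   by (rule dirD_cong(1)[OF relopen_UNIV[OF W]]) (use assms dirD_ln_cmod_nth in auto)
  also have "... = Re (- (v $ k * w $ k) / (q $ k)^2)"
  proof (rule dirDI(1))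
   have "((%z. v $ k / z) has_field_derivative - (v $ k) / (q $ k)^2) (at (q $ k))"
    using assms by (auto intro!: derivative_eq_intros simp: power2_eq_square)
   moreover have "((%t. q $ k + t *\<^sub>R w $ k) has_vector_derivative w $ k) (at 0)"
    by (auto intro!: derivative_eq_intros)
   ultimately have "((%t. v $ k / (q $ k + t *\<^sub>R w $ k)) has_vector_derivative w $ k * (- (v $ k) / (q $ k)^2)) (at 0)"
    using field_vector_diff_chain_at[of "%t. q $ k + t *\<^sub>R w $ k" "w $ k" 0 "%z. v $ k / z" "- (v $ k) / (q $ k)^2"] by (simp add: o_def)
   from bounded_linear.has_vector_derivative[OF bounded_linear_Re this]
   show "((%t. Re (v $ k / (q + t *\<^sub>R w) $ k)) has_vector_derivative Re (- (v $ k * w $ k) / (q $ k)^2)) (at 0)"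
    by (simp add: mult.commute)
  qed
  finally show ?thesis by simp
 qed
 moreover have "\<i> * a * (\<i> * b) = - (a * b)" for a b :: complex by (simp add: complex_eq_iff)
 hence "\<i> * v $ k * (\<i> * w $ k) / (q $ k)^2 = - (v $ k * w $ k / (q $ k)^2)" by simp
 ultimately show ?thesis by (simp add: levi_def)
qed

lemma linear_base_part: "linear (base_part :: complex^('d::finite option) => complex^'d)"
 using bounded_linear_base_part by (simp add: linear_conv_bounded_linear)

lemma base_part_i: "base_part (\<i> *s v) = \<i> *s base_part v" by (simp add: vec_eq_iff)

lemma base_part_axis [simp]: "base_part (axis (Some a) t) = axis a t" "base_part (axis None t) = 0"
 by (auto simp: vec_eq_iff axis_def)

lemma linear_coord_proj: "linear (coord_proj B :: complex^'n::finite => complex^'n)"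
 by (rule linearI) (auto simp: vec_eq_iff coord_proj_def)

lemma coord_proj_i: "coord_proj B (\<i> *s v) = \<i> *s coord_proj B v" by (auto simp: vec_eq_iff coord_proj_def)

lemma coord_proj_axis: "coord_proj B (axis a t) = (if a : B then axis a t else 0)"
 by (auto simp: vec_eq_iff coord_proj_def axis_def)

lemma coord_proj_in_coord_space: "coord_proj B v : coord_space B" by (simp add: coord_proj_def coord_space_def)

section \<open>The coordinate expression of \<open>Y\<close> and its Levi form\<close>

context admissible
begin

abbreviation fch :: "('a, 's, 'l, 'd, 'b) bundle_chart => 'b => ('a, 'd) chart" where "fch c i \<equiv> snd (snd (fst c)) i"

lemma factor_kaehler:
 assumes "c : bundle_charts D"
 shows "kaehler_coords (block D i) (snd (fch c i) ` fst (fch c i)) (fac_metric D i (fch c i))"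
  "relopen (coord_space (block D i)) (snd (fch c i) ` fst (fch c i))"
  "w : bimg c ==> blkproj i w : snd (fch c i) ` fst (fch c i)"
proof -
 have a: "fch c i : fac_atlas D i" by (rule base_chartD(2)[OF bundle_chartD(1)[OF assms]])
 show "kaehler_coords (block D i) (snd (fch c i) ` fst (fch c i)) (fac_metric D i (fch c i))"
  using factor_metric[of i] a unfolding kaehler_metric_def by blast
 show "relopen (coord_space (block D i)) (snd (fch c i) ` fst (fch c i))"
  by (rule relopen_coord_space[OF factor_chart(3)[OF a]])
 show "w : bimg c ==> blkproj i w : snd (fch c i) ` fst (fch c i)"
  using charts_inv_bcoord(1)[OF bundle_chartD(1)[OF assms]] by (auto simp: bimg_def charts_range_def)
qed

lemma base_metric_props:
 assumes c: "c : bundle_charts D" and w: "w : bimg c"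
 shows "bilinear (base_metric D (fst c) i w)" "base_metric D (fst c) i w u v = base_metric D (fst c) i w v u"
  "base_metric D (fst c) i w (\<i> *s u) (\<i> *s v) = base_metric D (fst c) i w u v"
proof -
 note k = kaehler_coordsD[OF factor_kaehler(1)[OF c, of i]]
 note W = factor_kaehler(3)[OF c w, of i]
 note p = linear_coord_proj[of "block D i"] and cp = coord_proj_in_coord_space[of "block D i"]
 note bl = k(2)[OF W]
 show "bilinear (base_metric D (fst c) i w)" unfolding bilinear_def base_metric_def by (intro conjI allI linearI)
   (simp_all add: linear_add[OF p] linear_cmul[OF p] bilinear_ladd[OF bl] bilinear_radd[OF bl] bilinear_lmul[OF bl] bilinear_rmul[OF bl])
 show "base_metric D (fst c) i w u v = base_metric D (fst c) i w v u"
  unfolding base_metric_def by (rule k(3)[OF W cp cp])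
 show "base_metric D (fst c) i w (\<i> *s u) (\<i> *s v) = base_metric D (fst c) i w u v"
  unfolding base_metric_def coord_proj_i by (rule k(4)[OF W cp cp])
qed

text \<open>The expression that every \<open>Y\<close> has in its own chart, see
  \<open>Y_in_chart\<close>.\<close>

definition Yc :: "('a, 's, 'l, 'd, 'b) bundle_chart => complex^('d option) => real" where
 "Yc c q = ln (cmod (q $ None)) - rho c (base_part q)"

lemma cimgD: "q : cimg c K ==> base_part q : bimg c" "q : cimg c K ==> q $ None ~= 0" "q : cimg c K ==> Yc c q : K"
 by (auto simp: cimg_def Yc_def)

lemma cimg_mono: "K \<subseteq> K' ==> cimg c K \<subseteq> cimg c K'" by (auto simp: cimg_def)

lemma smooth_rho_base:
 assumes c: "c : bundle_charts D" and K: "open K"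
 shows "smooth_in UNIV (cimg c K) (%q. rho c (base_part q))"
 by (rule smooth_in_precomp_linear[OF bounded_linear_base_part relopen_UNIV[OF open_cimg[OF c K]] relopen_UNIV[OF open_bimg[OF c]] _ _ hpot(2)[OF c]])
  (auto simp: cimg_def)

lemma smooth_ln_fibre:
 assumes c: "c : bundle_charts D" and K: "open K"
 shows "smooth_in UNIV (cimg c K) (%q. ln (cmod (q $ None)))"
 by (rule smooth_ln_cmod_nth[OF open_cimg[OF c K]]) (rule cimgD(2))

lemma smooth_Yc:
 assumes c: "c : bundle_charts D" and K: "open K"
 shows "smooth_in UNIV (cimg c K) (Yc c)" unfolding Yc_def[abs_def]
 by (intro smooth_in_diff relopen_UNIV open_cimg smooth_ln_fibre smooth_rho_base c K)

lemma dirD_Yc: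
 assumes c: "c : bundle_charts D" and q: "q : cimg c UNIV"
 shows "dirD (Yc c) q v = Re (v $ None / q $ None) - dirD (rho c) (base_part q) (base_part v)"
proof -
 note dd = smooth_in_ddiff[OF smooth_ln_fibre[OF c open_UNIV] q UNIV_I, of v] smooth_in_ddiff[OF smooth_rho_base[OF c open_UNIV] q UNIV_I, of v]
 have "dirD (%p. ln (cmod (p $ None)) + - rho c (base_part p)) q v = dirD (%p. ln (cmod (p $ None))) q v + - dirD (%p. rho c (base_part p)) q v"
  unfolding dirD_uminus_fun(1)[OF dd(2), symmetric] by (rule dirD_add_fun(1)[OF dd(1) dirD_uminus_fun(2)[OF dd(2)]])
 thus ?thesis
  unfolding Yc_def[abs_def] using dirD_ln_cmod_nth[OF cimgD(2)[OF q]] dirD_precomp_linear[OF linear_base_part, of "rho c" q v] by simp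
qed

lemma levi_Yc_eq_rho:
 assumes c: "c : bundle_charts D" and q: "q : cimg c UNIV"
 shows "levi (Yc c) q v w = - levi (rho c) (base_part q) (base_part v) (base_part w)"
proof -
 note op = open_cimg[OF c open_UNIV] note ro = relopen_UNIV[OF op]
 note sm = smooth_ln_fibre[OF c open_UNIV] smooth_rho_base[OF c open_UNIV]
 have "levi (Yc c) q v w = levi (%p. ln (cmod (p $ None)) + (- 1) * rho c (base_part p)) q v w"
  by (simp add: Yc_def[abs_def])
 also have "... = levi (%p. ln (cmod (p $ None))) q v w + levi (%p. (- 1) * rho c (base_part p)) q v w"
  by (rule levi_add[OF op sm(1) _ q]) (intro smooth_in_mult smooth_in_const ro sm)
 also have "levi (%p. (- 1) * rho c (base_part p)) q v w = (- 1) * levi (%p. rho c (base_part p)) q v w"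
 proof -
  have "((%y::real. (- 1) * y) has_real_derivative - 1) (at y)" for y
   using DERIV_cmult[OF DERIV_ident, of "- 1 :: real"] by simp
  from levi_compose_real[OF op sm(2) q subset_UNIV this DERIV_const, of v w] show ?thesis by simp
 qed
 also have "levi (%p. rho c (base_part p)) q v w = levi (rho c) (base_part q) (base_part v) (base_part w)"
  by (simp add: levi_def D2_precomp_linear[OF linear_base_part] base_part_i)
 finally show ?thesis using levi_ln_cmod_nth[OF cimgD(2)[OF q]] by simp
qed

lemma standard_image:
 assumes c: "c : bundle_charts D"
 shows "scoord c ` cdom D c = cimg c UNIV"
proof -
 have "{l : M0 D. ylog D l : UNIV} \<inter> cdom D c = cdom D c" by (auto simp: cdom_def)
 thus ?thesis using ccoord_image[OF c, of "%y. y" UNIV] by simp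
qed

lemma standard_in_chart:
 assumes c: "c : bundle_charts D" and q: "q : cimg c UNIV"
 shows "in_chart D (M0 D) (ylog D) c (ylog D) q = Yc c q"
proof -
 note im = standard_image[OF c]
 have inj: "inj_on (scoord c) (M0 D \<inter> cdom D c)" using ccoord_inj[OF c, of "%y. y" UNIV "M0 D"] by simp
 from q im obtain l where l: "l : cdom D c" "q = scoord c l" by blast
 have "l : M0 D \<inter> cdom D c" using l(1) by (simp add: cdom_def)
 from in_chart_ccoord[OF inj this, of "ylog D"] show ?thesis
  using Y_in_chart(1)[OF c l(1), of "ylog D"] l(2) by (simp add: Yc_def)
qed

text \<open>\<open>theta\<close> is \<open>- dY\<close> after multiplication by \<open>\<i>\<close>.
  Inserting one more \<open>\<i>\<close> into the condition on \<open>d theta\<close> and using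
  symmetry of second derivatives turns it into an equation for the Levi form.\<close>

lemma levi_Yc:
 assumes c: "c : bundle_charts D" and q: "q : cimg c K"
 shows "levi (Yc c) q v w = (\<Sum>i\<in>UNIV. base_met c i q v w)"
proof -
 have qU: "q : cimg c UNIV" using q cimg_mono by blast
 note op = open_cimg[OF c open_UNIV] note ro = relopen_UNIV[OF op]
 define w0 where "w0 = base_part q"
 have w0: "w0 : bimg c" using q by (simp add: w0_def cimg_def)
 \<comment> \<open>A convenient point over \<open>w0\<close>; by \<open>levi_Yc_eq_rho\<close> the
   Levi form sees only the base components, so it is the same at \<open>q\<close>.\<close>
 define q1 where "q1 = join w0 1"
 have q1: "q1 : cimg c UNIV" "base_part q1 = w0" using w0 by (auto simp: q1_def cimg_def)
 have th: "theta D (M0 D) (ylog D) c p u = - dirD (Yc c) p (\<i> *s u)" if "p : cimg c UNIV" for p u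
  unfolding theta_def by (subst dirD_cong(1)[OF ro that UNIV_I standard_in_chart[OF c]]) auto
 have sY: "smooth_in UNIV (cimg c UNIV) (Yc c)" by (rule smooth_Yc[OF c open_UNIV])
 have D2Y: "dirD (%p. theta D (M0 D) (ylog D) c p u) q1 v = - D2 (Yc c) q1 (\<i> *s u) v" for u v
 proof -
  have "dirD (%p. theta D (M0 D) (ylog D) c p u) q1 v = dirD (%p. - dirD (Yc c) p (\<i> *s u)) q1 v"
   by (rule dirD_cong(1)[OF ro q1(1) UNIV_I th])
  also have "... = - D2 (Yc c) q1 (\<i> *s u) v"
   by (rule dirD_uminus_fun(1)) (rule smooth_in_ddiff[OF smooth_in_dirD[OF sY] q1(1)], auto)
  finally show ?thesis .
 qed
 have C2: "Ck_on 2 UNIV (cimg c UNIV) (Yc c)" using sY by (simp add: smooth_in_def)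
 have sym: "D2 (Yc c) q1 u v = D2 (Yc c) q1 v u" for u v by (rule dirD_symmetric[OF ro C2 q1(1)]) auto
 have neg: "D2 (Yc c) q1 (- u) v = - D2 (Yc c) q1 u v" for u v
  unfolding sym[of _ v] by (rule dirD_minus) (rule smooth_in_ddiff[OF smooth_in_dirD[OF sY] q1(1)], auto)
 have adm': "\<forall>v w. dirD (%p. theta D (M0 D) (ylog D) c p w) q1 v - dirD (%p. theta D (M0 D) (ylog D) c p v) q1 w
     = (\<Sum>i\<in>UNIV. kform (base_metric D (fst c) i) (base_part q1) (base_part v) (base_part w))"
  using adm c q1(1) standard_image[OF c] unfolding admissible_manifold_def Let_def by blast
 have lev: "levi (Yc c) q1 v w = (\<Sum>i\<in>UNIV. base_metric D (fst c) i w0 (base_part v) (base_part w))" for v w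
 proof -
  have "(\<Sum>i\<in>UNIV. kform (base_metric D (fst c) i) (base_part q1) (base_part (- (\<i> *s v))) (base_part w)) =
   D2 (Yc c) q1 (\<i> *s (- (\<i> *s v))) w - D2 (Yc c) q1 (\<i> *s w) (- (\<i> *s v))"
   using adm'[rule_format, of w "- (\<i> *s v)"] unfolding D2Y by simp
  also have "\<i> *s (- (\<i> *s v)) = v" by (simp add: vec_eq_iff)
  also have "D2 (Yc c) q1 (\<i> *s w) (- (\<i> *s v)) = - D2 (Yc c) q1 (\<i> *s v) (\<i> *s w)" unfolding sym[of "\<i> *s w"] neg ..
  also have "(\<Sum>i\<in>UNIV. kform (base_metric D (fst c) i) (base_part q1) (base_part (- (\<i> *s v))) (base_part w)) =
   (\<Sum>i\<in>UNIV. base_metric D (fst c) i w0 (base_part v) (base_part w))"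
  proof -
   have "\<i> *s base_part (- (\<i> *s v)) = base_part v" by (simp add: vec_eq_iff)
   thus ?thesis by (simp add: kform_def q1(2))
  qed
  finally show ?thesis by (simp add: levi_def)
 qed
 define v' where "v' = join (base_part v) 0" define w' where "w' = join (base_part w) 0"
 have "levi (Yc c) q v w = - levi (rho c) w0 (base_part v) (base_part w)"
  using levi_Yc_eq_rho[OF c qU] by (simp add: w0_def)
 also have "... = levi (Yc c) q1 v' w'" using levi_Yc_eq_rho[OF c q1(1), of v' w'] by (simp add: q1(2) v'_def w'_def)
 also have "... = (\<Sum>i\<in>UNIV. base_metric D (fst c) i w0 (base_part v) (base_part w))"
  unfolding lev by (simp add: v'_def w'_def)
 finally show ?thesis by (simp add: w0_def)
qed

text \<open>The base factor of the volume density: the denominators are what is left of the factors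
  \<open>(1 + x i z) / x i\<close> once \<open>p_c\<close> is taken out.\<close>

definition cvol :: "('b => real) => ('a, 's, 'l, 'd, 'b) bundle_chart => complex^'d => real" where
 "cvol x c w = (\<Prod>i\<in>UNIV. vol_density (block D i) (fac_metric D i (fch c i)) (blkproj i w)) / (\<Prod>i\<in>UNIV. x i ^ card (block D i))"

end

text \<open>Covers two situations. In the fixed complex structure \<open>K\<close> is the whole line
  and \<open>Z = momentum u\<close>. For a given profile on an interval \<open>I\<close>,
  \<open>Z\<close> inverts an antiderivative of \<open>1 / \<Theta>\<close> and \<open>K\<close> is
  the range of that antiderivative.\<close>

locale adm_chart = admissible D s
 for D :: "('a, 's, 'l, 'd::finite, 'b::finite) admissible_data" and s :: "'b => real" +
 fixes x :: "'b => real" and c :: "('a, 's, 'l, 'd, 'b) bundle_chart"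
  and P :: "'l set" and Y z :: "'l => real" and \<Theta> Z :: "real => real" and K I :: "real set"
 assumes x: "!!i. 0 < x i & x i < 1" and c: "c : bundle_charts D"
  and opK: "open K" and opI: "open I" and I: "I \<subseteq> {-1<..<1}"
  and Z: "!!y. y : K ==> Z y : I" "!!y. y : K ==> (Z has_real_derivative \<Theta> (Z y)) (at y)"
  and \<Theta>: "smooth_on_line I \<Theta>" "!!z. z : I ==> \<Theta> z > 0" and Yq: "!!q. q : cimg c K ==> in_chart D P Y c Y q = Yc c q"
  and zq: "!!q. q : cimg c K ==> in_chart D P Y c z q = Z (Yc c q)"
begin

abbreviation G :: "('d option) tensor" where "G \<equiv> adm_metric D x P Y z \<Theta> c"

definition lam :: "'b => real => real" where "lam i t = (1 + x i * t) / x i"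

lemma lam_pos: "t : I ==> lam i t > 0"
proof -
 assume "t : I"
 hence t: "-1 < t" "t < 1" using I by auto
 have "x i * t > x i * (-1)" using x[of i] t by (intro mult_strict_left_mono) auto
 thus ?thesis using x[of i] by (simp add: lam_def)
qed

lemma op: "open (cimg c K)" by (rule open_cimg[OF c opK])
lemma ro: "relopen UNIV (cimg c K)" by (rule relopen_UNIV[OF op])
lemma sY: "smooth_in UNIV (cimg c K) (Yc c)" by (rule smooth_Yc[OF c opK])

lemma dirD_z:
 assumes "q : cimg c K"
 shows "dirD (in_chart D P Y c z) q v = \<Theta> (Z (Yc c q)) * dirD (Yc c) q v"
proof -
 have "dirD (in_chart D P Y c z) q v = dirD (%p. Z (Yc c p)) q v" by (rule dirD_cong(1)[OF ro assms UNIV_I zq])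
 also have "... = \<Theta> (Z (Yc c q)) * dirD (Yc c) q v"
  by (rule dirD_compose_real(1)[where h = Z and f = "Yc c", OF Z(2)[OF cimgD(3)[OF assms]] smooth_in_ddiff[OF sY assms UNIV_I]])
 finally show ?thesis .
qed

lemma theta_eq:
 assumes "q : cimg c K"
 shows "theta D P Y c q v = - dirD (Yc c) q (\<i> *s v)"
 unfolding theta_def by (subst dirD_cong(1)[OF ro assms UNIV_I Yq]) auto

text \<open>As \<open>dz = \<Theta> dY\<close> and \<open>theta\<close> is \<open>- dY\<close> after
  multiplication by \<open>\<i>\<close>, the two fibre terms combine to \<open>\<Theta>\<close>
  times a Hermitian square.\<close>

lemma G_eq:
 assumes q: "q : cimg c K"
 shows "G q v w = (\<Sum>i\<in>UNIV. lam i (Z (Yc c q)) * base_met c i q v w)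
   + \<Theta> (Z (Yc c q)) * (dirD (Yc c) q v * dirD (Yc c) q w + dirD (Yc c) q (\<i> *s v) * dirD (Yc c) q (\<i> *s w))"
proof -
 have "\<Theta> (Z (Yc c q)) ~= 0" using \<Theta>(2)[OF Z(1)[OF cimgD(3)[OF q]]] by simp
 hence "S + \<Theta> (Z (Yc c q)) * a * (\<Theta> (Z (Yc c q)) * b) / \<Theta> (Z (Yc c q)) + \<Theta> (Z (Yc c q)) * - e * - f = S + \<Theta> (Z (Yc c q)) * (a * b + e * f)"
  for S a b e f by (simp add: distrib_left)
 thus ?thesis unfolding adm_metric_def Let_def zq[OF q] dirD_z[OF q] theta_eq[OF q] lam_def .
qed

lemma dirD_Yc_linear:
 assumes q: "q : cimg c K" shows "linear (dirD (Yc c) q)"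
proof -
 have "Ck_on 1 UNIV (cimg c K) (Yc c)" using sY by (simp add: smooth_in_def)
 from has_derivative_of_C1[OF op this q] show ?thesis by (rule has_derivative_linear)
qed

text \<open>The coefficients of \<open>2 \<partial>Yc\<close>; the fibre component is
  \<open>1 / \<zeta>\<close>, in particular nonzero.\<close>

definition eta :: "complex^('d option) => 'd option => complex" where
 "eta q a = Complex (dirD (Yc c) q (axis a 1)) (- dirD (Yc c) q (axis a \<i>))"

lemma eta_None: "q : cimg c K ==> eta q None = 1 / q $ None"
proof -
 assume q: "q : cimg c K"
 hence "q : cimg c UNIV" using cimg_mono by blast
 from dirD_Yc[OF c this] have "dirD (Yc c) q (axis None t) = Re (t / q $ None)" for t by (simp add: dirD_zero)
 thus ?thesis by (simp add: eta_def complex_eq_iff Re_divide Im_divide)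
qed

lemma herm_entry_dY:
 assumes q: "q : cimg c K"
 shows "herm_entry (%v w. dirD (Yc c) q v * dirD (Yc c) q w + dirD (Yc c) q (\<i> *s v) * dirD (Yc c) q (\<i> *s w)) a b
  = eta q a * cnj (eta q b)"
proof -
 have m: "axis b (-1) = - axis b (1::complex)" for b :: "'d option" by (simp add: vec_eq_iff axis_def)
 have "dirD (Yc c) q (axis b (-1)) = - dirD (Yc c) q (axis b 1)" for b
  unfolding m using linear_neg[OF dirD_Yc_linear[OF q]] by blast
 thus ?thesis by (simp add: herm_entry_def eta_def i_smult_axis complex_eq_iff)
qed

definition Kb :: "complex^('d option) => 'b => complex^'d^'d" where
 "Kb q i = herm_matrix (block D i) (fac_metric D i (fch c i)) (blkproj i (base_part q))"

lemma Kb_block: "block_matrix (blk D) (Kb q)" by standard (auto simp: Kb_def herm_matrix_def block_def)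

lemma herm_entry_base:
 assumes q: "q : cimg c K"
 shows "herm_entry (%v w. base_met c i q v w) a b
  = (case (a, b) of (Some a', Some b') => (if blk D a' = i & blk D b' = i then Kb q i $ a' $ b' else 0) | _ => 0)"
proof -
 note bl = kaehler_coordsD(2)[OF factor_kaehler(1)[OF c, of i] factor_kaehler(3)[OF c cimgD(1)[OF q]]]
 have m: "a : block D i \<longleftrightarrow> blk D a = i" for a by (simp add: block_def)
 show ?thesis by (cases a; cases b)
   (simp_all add: herm_entry_def base_metric_def coord_proj_axis linear_0[OF linear_coord_proj]
    bilinear_lzero[OF bl] bilinear_rzero[OF bl] m Kb_def herm_matrix_def complex_eq_iff)
qed

lemma herm_entry_sum: "herm_entry (%v w. \<Sum>i\<in>UNIV. T i v w) a b = (\<Sum>i\<in>UNIV. herm_entry (T i) a b)"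
 by (simp add: herm_entry_def complex_eq_iff)

text \<open>The bordered shape required by \<open>det_bordered_hermitian\<close> and
  \<open>trace_inv_bordered_hermitian\<close>.\<close>

lemma herm_G:
 assumes q: "q : cimg c K"
 shows "herm_matrix UNIV G q $ a $ b =
   (case (a, b) of (Some a', Some b') => block_matrix.blockdiag (blk D) (Kb q) (%i. of_real (lam i (Z (Yc c q)))) $ a' $ b' | _ => 0)
   + of_real (\<Theta> (Z (Yc c q))) * eta q a * cnj (eta q b)"
proof -
 let ?t = "Z (Yc c q)"
 have "herm_matrix UNIV G q $ a $ b = herm_entry (G q) a b" by (simp add: herm_matrix_def herm_entry_def)
 also have "... = herm_entry (%v w. \<Sum>i\<in>UNIV. lam i ?t * base_met c i q v w) a b
   + herm_entry (%v w. \<Theta> ?t * (dirD (Yc c) q v * dirD (Yc c) q w + dirD (Yc c) q (\<i> *s v) * dirD (Yc c) q (\<i> *s w))) a b"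
  by (subst G_eq[OF q, abs_def]) (rule herm_entry_add)
 also have "... = (\<Sum>i\<in>UNIV. of_real (lam i ?t) * herm_entry (%v w. base_met c i q v w) a b)
   + of_real (\<Theta> ?t) * (eta q a * cnj (eta q b))" unfolding herm_entry_cmult herm_entry_sum herm_entry_dY[OF q] ..
 also have "(\<Sum>i\<in>UNIV. of_real (lam i ?t) * herm_entry (%v w. base_met c i q v w) a b) =
  (case (a, b) of (Some a', Some b') => block_matrix.blockdiag (blk D) (Kb q) (%i. of_real (lam i ?t)) $ a' $ b' | _ => 0)"
 proof (cases a; cases b)
  fix a' b' assume ab: "a = Some a'" "b = Some b'"
  have "(\<Sum>i\<in>UNIV. of_real (lam i ?t) * herm_entry (%v w. base_met c i q v w) a b)
   = (\<Sum>i\<in>UNIV. if i = blk D a' then (if blk D a' = blk D b' then of_real (lam (blk D a') ?t) * Kb q (blk D a') $ a' $ b' else 0) else 0)"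
   by (intro sum.cong refl) (auto simp: herm_entry_base[OF q] ab)
  thus ?thesis by (simp add: ab block_matrix.blockdiag_def[OF Kb_block])
 qed (simp_all add: herm_entry_base[OF q])
 finally show ?thesis by (simp add: mult.assoc)
qed

lemma Kb_det:
 assumes q: "q : cimg c K"
 shows "det (Kb q i) = of_real (vol_density (block D i) (fac_metric D i (fch c i)) (blkproj i (base_part q)))"
  "vol_density (block D i) (fac_metric D i (fch c i)) (blkproj i (base_part q)) > 0" unfolding Kb_def
 by (rule vol_density_pos(2)[OF factor_kaehler(1)[OF c] factor_kaehler(3)[OF c cimgD(1)[OF q]]])
  (rule vol_density_pos(1)[OF factor_kaehler(1)[OF c] factor_kaehler(3)[OF c cimgD(1)[OF q]]])

lemma prod_lam: "(\<Prod>a\<in>UNIV. lam (blk D a) t) = p_c D x t / (\<Prod>i\<in>UNIV. x i ^ card (block D i))"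
proof -
 have "(\<Prod>a\<in>UNIV. lam (blk D a) t) = (\<Prod>i\<in>UNIV. \<Prod>a\<in>{a. blk D a = i}. lam (blk D a) t)"
  using prod.group[of "UNIV :: 'd set" "UNIV :: 'b set" "blk D" "%a. lam (blk D a) t"] by simp
 also have "... = (\<Prod>i\<in>UNIV. lam i t ^ card (block D i))" by (intro prod.cong refl) (simp add: block_def)
 also have "... = (\<Prod>i\<in>UNIV. (1 + x i * t) ^ card (block D i)) / (\<Prod>i\<in>UNIV. x i ^ card (block D i))"
  by (simp add: lam_def power_divide prod_dividef)
 finally show ?thesis by (simp add: p_c_def)
qed

lemma p_c_pos: "t : I ==> p_c D x t > 0"
proof -
 assume "t : I"
 hence "0 < (\<Prod>a\<in>UNIV. lam (blk D a) t) * (\<Prod>i\<in>UNIV. x i ^ card (block D i))"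
  using x by (intro mult_pos_pos prod_pos zero_less_power lam_pos) auto
 moreover have "(\<Prod>i\<in>UNIV. x i ^ card (block D i)) ~= 0" using x by (auto simp: less_imp_neq[symmetric])
 ultimately show ?thesis unfolding prod_lam by simp
qed

lemma cvol_pos: "q : cimg c K ==> cvol x c (base_part q) > 0"
 unfolding cvol_def using x Kb_det(2) by (intro divide_pos_pos prod_pos zero_less_power) auto

lemma vol_G:
 assumes q: "q : cimg c K"
 shows "vol_density UNIV G q = p_c D x (Z (Yc c q)) * \<Theta> (Z (Yc c q)) / (cmod (q $ None))^2 * cvol x c (base_part q)"
  "det (herm_matrix UNIV G q) ~= 0"
proof -
 let ?t = "Z (Yc c q)"
 let ?V = "%i. vol_density (block D i) (fac_metric D i (fch c i)) (blkproj i (base_part q))"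
 have n0: "eta q None ~= 0" using eta_None[OF q] cimgD(2)[OF q] by simp
 have "det (herm_matrix UNIV G q) = of_real (\<Theta> ?t) * of_real ((cmod (eta q None))^2) * det (block_matrix.blockdiag (blk D) (Kb q) (%i. of_real (lam i ?t)))"
  by (rule det_bordered_hermitian[where \<eta> = "eta q", OF n0]) (rule herm_G[OF q])
 also have "... = of_real (\<Theta> ?t * (cmod (eta q None))^2 * ((\<Prod>a\<in>UNIV. lam (blk D a) ?t) * (\<Prod>i\<in>UNIV. ?V i)))"
  unfolding block_matrix.det_blockdiag[OF Kb_block] Kb_det(1)[OF q] by simp
 finally have d: "det (herm_matrix UNIV G q) = of_real (\<Theta> ?t * (cmod (eta q None))^2 * ((\<Prod>a\<in>UNIV. lam (blk D a) ?t) * (\<Prod>i\<in>UNIV. ?V i)))" .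
 have tI: "?t : I" using Z(1) cimgD(3)[OF q] by blast
 show "det (herm_matrix UNIV G q) ~= 0"
  unfolding d using n0 \<Theta>(2)[OF tI] lam_pos[OF tI] Kb_det(2)[OF q] by (auto simp: less_imp_neq[symmetric])
 show "vol_density UNIV G q = p_c D x ?t * \<Theta> ?t / (cmod (q $ None))^2 * cvol x c (base_part q)"
 proof -
  have "vol_density UNIV G q = Re (det (herm_matrix UNIV G q))" by (simp only: vol_density_def)
  also have "... = \<Theta> ?t * (cmod (eta q None))^2 * ((\<Prod>a\<in>UNIV. lam (blk D a) ?t) * (\<Prod>i\<in>UNIV. ?V i))"
   unfolding d by (rule Re_complex_of_real)
  finally show ?thesis unfolding prod_lam cvol_def eta_None[OF q] by (simp add: norm_divide power_divide)
 qed
qed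

end

lemma trace_mult_linear:
 fixes A :: "complex^'n::finite^'n"
 shows "trace (A ** (\<chi> a b. c * M $ a $ b + N $ a $ b)) = c * trace (A ** M) + trace (A ** N)"
 by (simp add: trace_def matrix_matrix_mult_def sum.distrib sum_distrib_left distrib_left mult.left_commute)

section \<open>Derivatives of \<open>p_c\<close>, the factor volumes, and the scalar
  curvature\<close>

context adm_chart
begin

lemma p_c_deriv:
 assumes "t : I"
 shows "(p_c D x has_real_derivative p_c D x t * (\<Sum>i\<in>UNIV. real (card (block D i)) / lam i t)) (at t)"
proof -
 have nz: "1 + x i * t ~= 0" for i using lam_pos[OF assms, of i] x[of i] by (auto simp: lam_def)
 have "((%t. \<Prod>i\<in>UNIV. (1 + x i * t) ^ card (block D i)) has_real_derivative
   (\<Sum>i\<in>UNIV. (real (card (block D i)) * (x i * (1 + x i * t) ^ (card (block D i) - 1))) * (\<Prod>j\<in>UNIV - {i}. (1 + x j * t) ^ card (block D j)))) (at t)"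
  by (rule has_field_derivative_prod) (auto intro!: derivative_eq_intros)
 moreover have "(real (card (block D i)) * (x i * (1 + x i * t) ^ (card (block D i) - 1))) * (\<Prod>j\<in>UNIV - {i}. (1 + x j * t) ^ card (block D j))
   = p_c D x t * (real (card (block D i)) / lam i t)" for i
 proof -
  have "p_c D x t = (1 + x i * t) ^ card (block D i) * (\<Prod>j\<in>UNIV - {i}. (1 + x j * t) ^ card (block D j))"
   unfolding p_c_def by (rule prod.remove) auto
  moreover have "(1 + x i * t) ^ card (block D i) = (1 + x i * t) * (1 + x i * t) ^ (card (block D i) - 1)"
   using block_nonempty[of i] by (metis Suc_diff_1 power_Suc)
  ultimately show ?thesis using nz[of i] x[of i] by (simp add: lam_def)
 qed
 ultimately show ?thesis unfolding p_c_def[abs_def] by (simp add: sum_distrib_left)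
qed

lemma smooth_p_c: "smooth_on_line J (p_c D x)"
proof -
 have "smooth_on_line J (%t. \<Prod>i\<in>S. (1 + x i * t) ^ card (block D i))" if "finite S" for S using that
 proof (induction S rule: finite_induct)
  case (insert i S)
  have "smooth_on_line J (%t. (1 + x i * t) ^ n)" for n
  proof (induction n)
   case (Suc n)
   thus ?case using smooth_line_mult[OF smooth_line_linear[of J "x i" 1] Suc] by (simp add: add.commute)
  qed (simp add: smooth_line_const)
  thus ?case using insert by (simp add: smooth_line_mult)
 qed (simp add: smooth_line_const)
 from this[of UNIV] show ?thesis by (simp add: p_c_def[abs_def])
qed

definition lnvol :: "'b => complex^'d => real" where
 "lnvol i p = ln (vol_density (block D i) (fac_metric D i (fch c i)) p)"

definition Ai :: "'b => complex^('d option) => complex^'d" where "Ai i q = blkproj i (base_part q)"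

lemma linear_Ai: "linear (Ai i)"
 unfolding Ai_def[abs_def] using linear_compose[OF linear_base_part linear_coord_proj] by (simp add: o_def)

lemma Ai_i: "Ai i (\<i> *s v) = \<i> *s Ai i v" by (simp add: Ai_def base_part_i coord_proj_i)

lemma smooth_lnvol: "smooth_in (coord_space (block D i)) (snd (fch c i) ` fst (fch c i)) (lnvol i)"
 unfolding lnvol_def[abs_def]
proof (rule smooth_in_compose_real[of "{0<..}" ln])
 show "relopen (coord_space (block D i)) (snd (fch c i) ` fst (fch c i))" by (rule factor_kaehler(2)[OF c])
 show "smooth_in (coord_space (block D i)) (snd (fch c i) ` fst (fch c i)) (vol_density (block D i) (fac_metric D i (fch c i)))"
  by (rule smooth_vol_density[OF factor_kaehler(1,2)[OF c]])
 show "smooth_on_line {0<..} (%x::real. ln x)" by (rule smooth_line_ln) (auto intro: smooth_line_ident)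
 show "vol_density (block D i) (fac_metric D i (fch c i)) ` (snd (fch c i) ` fst (fch c i)) \<subseteq> {0<..}"
  using vol_density_pos(1)[OF factor_kaehler(1)[OF c]] by auto
qed simp

lemma Ai_in: "q : cimg c K ==> Ai i q : snd (fch c i) ` fst (fch c i)"
 unfolding Ai_def by (rule factor_kaehler(3)[OF c cimgD(1)])

text \<open>\<open>lnvol i\<close> lives on a set that is open only in its coordinate subspace;
  composing with the projection \<open>Ai i\<close> makes it a function on the open chart
  image.\<close>

lemma smooth_lnvol_Ai: "smooth_in UNIV (cimg c K) (%q. lnvol i (Ai i q))"
proof (rule smooth_in_precomp_linear[OF _ ro factor_kaehler(2)[OF c, of i] _ _ smooth_lnvol])
 show "bounded_linear (Ai i)" using linear_Ai by (simp add: linear_conv_bounded_linear)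
 show "Ai i ` UNIV \<subseteq> coord_space (block D i)" by (auto simp: Ai_def coord_proj_in_coord_space)
 show "Ai i ` cimg c K \<subseteq> snd (fch c i) ` fst (fch c i)" using Ai_in by blast
qed

lemma herm_entry_lnvol:
 assumes q: "q : cimg c K"
 shows "herm_entry (levi (%q. lnvol i (Ai i q)) q) a b
  = (case (a, b) of (Some a', Some b') => (if blk D a' = i & blk D b' = i then 4 * ddbar (lnvol i) (Ai i q) a' b' else 0) | _ => 0)"
proof -
 have L: "levi (%q. lnvol i (Ai i q)) q v w = levi (lnvol i) (Ai i q) (Ai i v) (Ai i w)" for v w
  by (simp add: levi_def D2_precomp_linear[OF linear_Ai] Ai_i)
 have z: "levi (lnvol i) (Ai i q) 0 w = 0" "levi (lnvol i) (Ai i q) v 0 = 0" for v w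
  by (simp_all add: levi_def dirD_zero dirD_const(1))
 have A: "Ai i (axis None t) = 0" "Ai i (axis (Some a') t) = (if blk D a' = i then axis a' t else 0)" for t a'
  by (simp_all add: Ai_def coord_proj_axis block_def linear_0[OF linear_coord_proj])
 show ?thesis
 proof (cases a; cases b)
  fix a' b' assume ab: "a = Some a'" "b = Some b'"
  show ?thesis
  proof (cases "blk D a' = i & blk D b' = i")
   case True
   hence "ddbar (lnvol i) (Ai i q) a' b' = herm_entry (levi (lnvol i) (Ai i q)) a' b' / 4"
    by (intro ddbar_levi[OF smooth_lnvol Ai_in[OF q]] axis_in_coord_space) (auto simp: block_def)
   hence "4 * ddbar (lnvol i) (Ai i q) a' b' = herm_entry (levi (lnvol i) (Ai i q)) a' b'" by (simp add: mult.commute)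
   thus ?thesis using True by (simp add: ab herm_entry_def L A mult.commute)
  next
   case False
   thus ?thesis by (auto simp: ab herm_entry_def L A z complex_eq_iff)
  qed
 qed (simp_all add: herm_entry_def L A z complex_eq_iff)
qed

lemma ln_aux:
 fixes a b C :: real
 assumes "a > 0" "b > 0" "C > 0"
 shows "ln (a / b\<^sup>2 * C) = ln a - 2 * ln b + ln C" using assms by (simp add: ln_mult ln_div ln_realpow)

lemma trace_aux:
 fixes X h N R t :: real
 assumes "X = h / 4 * N + R" "- 4 * R = 2 * N * t"
 shows "- 4 * X = N * (2 * t - h)"
proof -
 have "- 4 * X = - h * N + - 4 * R" unfolding assms(1) by simp
 thus ?thesis unfolding assms(2) by (simp add: algebra_simps)
qed

text \<open>The logarithm of the volume density is \<open>h(Yc) - 2 ln |\<zeta>|\<close>, plus a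
  constant, plus the logarithms of the factor volumes. Its Levi form is again bordered, with
  \<open>h'\<close> times the base metrics and the factor Ricci terms on the blocks and
  \<open>h''\<close> in the rank one part, so the trace lemmas apply.\<close>

theorem scalar_curvature_G:
 assumes q: "q : cimg c K" and F1: "!!t. t : I ==> ((%t. p_c D x t * \<Theta> t) has_real_derivative F1 t) (at t)"
  and F2: "!!t. t : I ==> (F1 has_real_derivative F2 t) (at t)"
 shows "scalar_curvature UNIV G q = 2 * base_scal D x s (Z (Yc c q)) - F2 (Z (Yc c q)) / p_c D x (Z (Yc c q))"
proof -
 let ?t = "Z (Yc c q)" and ?y = "Yc c q"
 define h where "h y = ln (p_c D x (Z y) * \<Theta> (Z y))" for y
 \<comment> \<open>The derivative of \<open>h\<close>: the chain rule produces
   \<open>F1 \<Theta> / (p_c \<Theta>)\<close>, and \<open>\<Theta>\<close> cancels.\<close>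
 define h1 where "h1 y = F1 (Z y) / p_c D x (Z y)" for y
 define P1 where "P1 t = p_c D x t * (\<Sum>i\<in>UNIV. real (card (block D i)) / lam i t)" for t
 define h2 where "h2 y = ((F2 (Z y) * p_c D x (Z y) - F1 (Z y) * P1 (Z y)) / (p_c D x (Z y) * p_c D x (Z y))) * \<Theta> (Z y)" for y
 have tI: "Z y : I" if "y : K" for y using Z(1)[OF that] .
 have Pp: "p_c D x (Z y) > 0" "\<Theta> (Z y) > 0" if "y : K" for y using p_c_pos \<Theta>(2) tI[OF that] by auto
 have h1: "(h has_real_derivative h1 y) (at y)" if y: "y : K" for y
 proof -
  have g1: "((%y. p_c D x (Z y) * \<Theta> (Z y)) has_real_derivative F1 (Z y) * \<Theta> (Z y)) (at y)"
   by (rule DERIV_chain2[of "%t. p_c D x t * \<Theta> t", OF F1[OF tI[OF y]] Z(2)[OF y]])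
  have b: "p_c D x (Z y) * \<Theta> (Z y) > 0" using Pp[OF y] by simp
  have "(h has_real_derivative 1 / (p_c D x (Z y) * \<Theta> (Z y)) * (F1 (Z y) * \<Theta> (Z y))) (at y)"
   unfolding h_def by (rule DERIV_chain2[where f = ln and g = "%y. p_c D x (Z y) * \<Theta> (Z y)", OF DERIV_ln_divide[OF b] g1])
  thus ?thesis using Pp[OF y] by (simp add: h1_def)
 qed
 have h2: "(h1 has_real_derivative h2 y) (at y)" if y: "y : K" for y unfolding h1_def h2_def
 proof (rule DERIV_chain2[of "%t. F1 t / p_c D x t", OF _ Z(2)[OF y]])
  show "((%t. F1 t / p_c D x t) has_real_derivative
    (F2 (Z y) * p_c D x (Z y) - F1 (Z y) * P1 (Z y)) / (p_c D x (Z y) * p_c D x (Z y))) (at (Z y))"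
   unfolding P1_def using Pp(1)[OF y] by (intro DERIV_divide F2 p_c_deriv tI y) simp
 qed
 have sh: "smooth_in UNIV (cimg c K) (%q. h (Yc c q))"
 proof (rule smooth_in_compose_real[OF opK _ ro _ sY])
  have "smooth_on_line I (%t. ln (p_c D x t * \<Theta> t))"
   by (rule smooth_line_ln[OF opI]) (auto intro!: smooth_line_mult smooth_p_c \<Theta> mult_pos_pos p_c_pos)
  thus "smooth_on_line K h"
   unfolding h_def[abs_def] using smooth_line_compose_flow[OF opK opI Z \<Theta>(1), of "%t. ln (p_c D x t * \<Theta> t)"] by simp
  show "Yc c ` cimg c K \<subseteq> K" using cimgD(3) by blast
 qed
 define cst where "cst = - ln (\<Prod>i\<in>UNIV. x i ^ card (block D i))"
 define f where "f q = (h (Yc c q) + ((-2) * ln (cmod (q $ None)) + cst)) + (\<Sum>i\<in>UNIV. lnvol i (Ai i q))" for q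
 have s2: "smooth_in UNIV (cimg c K) (%q. (-2) * ln (cmod (q $ None)) + cst)"
  by (intro smooth_in_add smooth_in_mult smooth_in_const ro smooth_ln_fibre c opK)
 have s3: "smooth_in UNIV (cimg c K) (%q. \<Sum>i\<in>UNIV. lnvol i (Ai i q))" by (intro smooth_in_sum ro smooth_lnvol_Ai)
 have sf: "smooth_in UNIV (cimg c K) f" unfolding f_def[abs_def] by (intro smooth_in_add ro sh s2 s3)
 have lv: "ln (vol_density UNIV G p) = f p" if p: "p : cimg c K" for p
 proof -
  have a: "p_c D x (Z (Yc c p)) * \<Theta> (Z (Yc c p)) > 0" using Pp[OF cimgD(3)[OF p]] by simp
  have b: "cmod (p $ None) > 0" using cimgD(2)[OF p] by simp
  have V: "vol_density (block D i) (fac_metric D i (fch c i)) (Ai i p) > 0" for i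
   using Kb_det(2)[OF p] by (simp add: Ai_def)
  have X: "(\<Prod>i\<in>UNIV. x i ^ card (block D i)) > 0" using x by (intro prod_pos zero_less_power) auto
  have "ln (cvol x c (base_part p)) = (\<Sum>i\<in>UNIV. lnvol i (Ai i p)) + cst"
   unfolding cvol_def Ai_def[symmetric] using X V
   by (subst ln_div) (auto intro!: prod_pos simp: ln_prod cst_def lnvol_def less_imp_neq[symmetric])
  moreover have "ln (vol_density UNIV G p) = h (Yc c p) - 2 * ln (cmod (p $ None)) + ln (cvol x c (base_part p))"
   unfolding vol_G(1)[OF p] h_def by (rule ln_aux[OF a b cvol_pos[OF p]])
  ultimately show ?thesis by (simp add: f_def)
 qed
 have dd: "ddbar (%p. ln (vol_density UNIV G p)) q a b = herm_entry (levi f q) a b / 4" for a b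
 proof -
  have "smooth_in UNIV (cimg c K) (%p. ln (vol_density UNIV G p))"
   using sf smooth_in_cong[OF ro, of "%p. ln (vol_density UNIV G p)" f] lv by blast
  from ddbar_levi[OF this q] have "ddbar (%p. ln (vol_density UNIV G p)) q a b = herm_entry (levi (%p. ln (vol_density UNIV G p)) q) a b / 4"
   by simp
  also have "levi (%p. ln (vol_density UNIV G p)) q = levi f q" by (intro ext levi_cong[OF op q lv])
  finally show ?thesis .
 qed
 have levf: "levi f q v w = (h1 ?y * (\<Sum>i\<in>UNIV. base_met c i q v w)
   + h2 ?y * (dirD (Yc c) q v * dirD (Yc c) q w + dirD (Yc c) q (\<i> *s v) * dirD (Yc c) q (\<i> *s w)))
   + (\<Sum>i\<in>UNIV. levi (%q. lnvol i (Ai i q)) q v w)" for v w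
 proof -
  have "levi f q v w = levi (%q. h (Yc c q) + ((-2) * ln (cmod (q $ None)) + cst)) q v w + levi (%q. \<Sum>i\<in>UNIV. lnvol i (Ai i q)) q v w"
   unfolding f_def[abs_def] by (rule levi_add[OF op smooth_in_add[OF ro sh s2] s3 q])
  also have "levi (%q. h (Yc c q) + ((-2) * ln (cmod (q $ None)) + cst)) q v w
    = levi (%q. h (Yc c q)) q v w + levi (%q. (-2) * ln (cmod (q $ None)) + cst) q v w"
   by (rule levi_add[OF op sh s2 q])
  also have "levi (%q. (-2) * ln (cmod (q $ None)) + cst) q v w = 0"
  proof -
   have "((%y::real. (-2) * y + cst) has_real_derivative -2) (at y)" for y by (auto intro!: derivative_eq_intros)
   from levi_compose_real[OF op smooth_ln_fibre[OF c opK] q subset_UNIV this DERIV_const, of v w]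
   show ?thesis using levi_ln_cmod_nth[OF cimgD(2)[OF q]] by simp
  qed
  also have "levi (%q. h (Yc c q)) q v w = h1 ?y * levi (Yc c) q v w
   + h2 ?y * (dirD (Yc c) q v * dirD (Yc c) q w + dirD (Yc c) q (\<i> *s v) * dirD (Yc c) q (\<i> *s w))"
   by (rule levi_compose_real[OF op sY q _ h1 h2, where K = K]) (blast intro: cimgD(3))+
  also have "levi (Yc c) q v w = (\<Sum>i\<in>UNIV. base_met c i q v w)" by (rule levi_Yc[OF c q])
  also have "levi (%q. \<Sum>i\<in>UNIV. lnvol i (Ai i q)) q v w = (\<Sum>i\<in>UNIV. levi (%q. lnvol i (Ai i q)) q v w)"
   by (rule levi_sum[OF op smooth_lnvol_Ai q])
  finally show ?thesis by simp
 qed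
 define Dd where "Dd i = (\<chi> a b. if a : block D i & b : block D i then ddbar (lnvol i) (Ai i q) a b else 0)" for i
 define Ks where "Ks i = (\<chi> a b. if blk D a = i & blk D b = i then Kb q i $ a $ b else 0)" for i
 define m where "m i = (\<chi> a b. of_real (h1 ?y / 4) * Ks i $ a $ b + Dd i $ a $ b)" for i
 define M where "M = (\<chi> a b. if a : UNIV & b : UNIV then ddbar (%p. ln (vol_density UNIV G p)) q a b else 0)"
 have M: "M $ a $ b = (case (a, b) of (Some a', Some b') => (\<chi> a b. \<Sum>i\<in>UNIV. m i $ a $ b) $ a' $ b' | _ => 0)
   + of_real (h2 ?y / 4) * eta q a * cnj (eta q b)" for a b
 proof -
  have "M $ a $ b = herm_entry (levi f q) a b / 4" by (simp add: M_def dd)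
  also have "herm_entry (levi f q) a b = herm_entry (%v w. h1 ?y * (\<Sum>i\<in>UNIV. base_met c i q v w)) a b
   + herm_entry (%v w. h2 ?y * (dirD (Yc c) q v * dirD (Yc c) q w + dirD (Yc c) q (\<i> *s v) * dirD (Yc c) q (\<i> *s w))) a b
   + herm_entry (%v w. \<Sum>i\<in>UNIV. levi (%q. lnvol i (Ai i q)) q v w) a b"
   unfolding levf[abs_def] herm_entry_add[of "%v w. h1 ?y * _ v w + h2 ?y * _ v w"]
   by (simp add: herm_entry_def complex_eq_iff)
  also have "... = of_real (h1 ?y) * (\<Sum>i\<in>UNIV. herm_entry (%v w. base_met c i q v w) a b)
   + of_real (h2 ?y) * (eta q a * cnj (eta q b)) + (\<Sum>i\<in>UNIV. herm_entry (levi (%q. lnvol i (Ai i q)) q) a b)"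
   unfolding herm_entry_cmult herm_entry_sum herm_entry_dY[OF q] ..
  also have "... / 4 = (\<Sum>i\<in>UNIV. of_real (h1 ?y / 4) * herm_entry (%v w. base_met c i q v w) a b
    + herm_entry (levi (%q. lnvol i (Ai i q)) q) a b / 4) + of_real (h2 ?y / 4) * eta q a * cnj (eta q b)"
   by (simp add: sum.distrib sum_distrib_left sum_divide_distrib add_divide_distrib)
  also have "(\<Sum>i\<in>UNIV. of_real (h1 ?y / 4) * herm_entry (%v w. base_met c i q v w) a b
    + herm_entry (levi (%q. lnvol i (Ai i q)) q) a b / 4) =
    (case (a, b) of (Some a', Some b') => (\<chi> a b. \<Sum>i\<in>UNIV. m i $ a $ b) $ a' $ b' | _ => 0)"
  proof (cases a; cases b)
   fix a' b' assume ab: "a = Some a'" "b = Some b'"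
   have "of_real (h1 ?y / 4) * herm_entry (%v w. base_met c i q v w) a b
    + herm_entry (levi (%q. lnvol i (Ai i q)) q) a b / 4 = m i $ a' $ b'" for i
    by (simp add: herm_entry_base[OF q] herm_entry_lnvol[OF q] ab m_def Ks_def Dd_def block_def)
   thus ?thesis by (simp add: ab)
  qed (simp_all add: herm_entry_base[OF q] herm_entry_lnvol[OF q])
  finally show ?thesis .
 qed
 interpret B: block_matrix "blk D" "Kb q" by (rule Kb_block)
 have tq: "?t : I" by (rule tI[OF cimgD(3)[OF q]])
 have Tp: "\<Theta> ?t > 0" by (rule \<Theta>(2)[OF tq])
 have lp: "lam i ?t > 0" for i by (rule lam_pos[OF tq])
 have Kd: "det (Kb q i) ~= 0" for i using Kb_det[OF q, of i] by simp
 have n0: "eta q None ~= 0" using eta_None[OF q] cimgD(2)[OF q] by simp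
 have dB: "det (B.blockdiag (%i. of_real (lam i ?t))) ~= 0"
  unfolding B.det_blockdiag using Kd lp by (auto simp: less_imp_neq[symmetric])
 have T0: "of_real (\<Theta> ?t) ~= (0::complex)" using Tp by simp
 have "trace (matrix_inv (herm_matrix UNIV G q) ** M) = trace (matrix_inv (B.blockdiag (%i. of_real (lam i ?t))) ** (\<chi> a b. \<Sum>i\<in>UNIV. m i $ a $ b))
  + of_real (h2 ?y / 4) / of_real (\<Theta> ?t)"
  by (rule trace_inv_bordered_hermitian[where \<eta> = "eta q", OF n0 dB T0 herm_G[OF q] M])
 also have "trace (matrix_inv (B.blockdiag (%i. of_real (lam i ?t))) ** (\<chi> a b. \<Sum>i\<in>UNIV. m i $ a $ b))
  = (\<Sum>i\<in>UNIV. trace (matrix_inv (Kb q i) ** m i) / of_real (lam i ?t))"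
 proof (rule B.trace_inv_blockdiag)
  show "of_real (lam i ?t) ~= (0::complex)" for i using lp[of i] by simp
  show "m i $ a $ b = 0" if "~ (blk D a = i & blk D b = i)" for i a b
   using that by (auto simp: m_def Ks_def Dd_def block_def)
 qed (rule Kd)
 finally have tr: "trace (matrix_inv (herm_matrix UNIV G q) ** M) = (\<Sum>i\<in>UNIV. trace (matrix_inv (Kb q i) ** m i) / of_real (lam i ?t))
  + of_real (h2 ?y / 4) / of_real (\<Theta> ?t)" .
 have tri: "- 4 * Re (trace (matrix_inv (Kb q i) ** m i)) = real (card (block D i)) * (2 * s i - h1 ?y)" for i
 proof -
  have "trace (matrix_inv (Kb q i) ** m i) = of_real (h1 ?y / 4) * trace (matrix_inv (Kb q i) ** Ks i) + trace (matrix_inv (Kb q i) ** Dd i)"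
   unfolding m_def by (rule trace_mult_linear)
  also have "trace (matrix_inv (Kb q i) ** Ks i) = of_nat (card (block D i))"
   unfolding Ks_def block_def by (rule B.trace_inv_block_self[OF Kd])
  finally have "Re (trace (matrix_inv (Kb q i) ** m i)) = h1 ?y / 4 * real (card (block D i)) + Re (trace (matrix_inv (Kb q i) ** Dd i))"
   by simp
  moreover have "- 4 * Re (trace (matrix_inv (Kb q i) ** Dd i)) = 2 * real (card (block D i)) * s i"
  proof -
   have "fch c i : fac_atlas D i" by (rule base_chartD(2)[OF bundle_chartD(1)[OF c]])
   from factor_scalar[OF this Ai_in[OF q]]
   show ?thesis unfolding scalar_curvature_def Kb_def Dd_def lnvol_def[abs_def] Ai_def[symmetric] .
  qed
  ultimately show ?thesis by (rule trace_aux)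
 qed
 have Re_tr: "Re (trace (matrix_inv (herm_matrix UNIV G q) ** M)) = (\<Sum>i\<in>UNIV. Re (trace (matrix_inv (Kb q i) ** m i)) / lam i ?t) + h2 ?y / 4 / \<Theta> ?t"
  unfolding tr of_real_divide[symmetric] by (simp add: Re_divide_of_real)
 have "scalar_curvature UNIV G q = - 4 * Re (trace (matrix_inv (herm_matrix UNIV G q) ** M))"
  unfolding scalar_curvature_def M_def ..
 also have "... = (\<Sum>i\<in>UNIV. (- 4 * Re (trace (matrix_inv (Kb q i) ** m i))) / lam i ?t) - h2 ?y / \<Theta> ?t"
  unfolding Re_tr by (simp add: distrib_left sum_distrib_left sum_negf[symmetric])
 also have "... = (\<Sum>i\<in>UNIV. 2 * (real (card (block D i)) * s i / lam i ?t) - h1 ?y * (real (card (block D i)) / lam i ?t)) - h2 ?y / \<Theta> ?t"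
  unfolding tri by (intro arg_cong2[where f = "(-)"] sum.cong refl) (simp add: right_diff_distrib diff_divide_distrib mult_ac)
 also have "... = 2 * (\<Sum>i\<in>UNIV. real (card (block D i)) * s i / lam i ?t) - h1 ?y * (\<Sum>i\<in>UNIV. real (card (block D i)) / lam i ?t) - h2 ?y / \<Theta> ?t"
  by (simp add: sum_subtractf sum_distrib_left)
 also have "(\<Sum>i\<in>UNIV. real (card (block D i)) * s i / lam i ?t) = base_scal D x s ?t"
  unfolding base_scal_def lam_def by (simp add: mult_ac)
 \<comment> \<open>The term with the derivative of \<open>p_c\<close> cancels the contribution of
   \<open>h1\<close> from the blocks.\<close>
 also have "h2 ?y / \<Theta> ?t = F2 ?t / p_c D x ?t - h1 ?y * (\<Sum>i\<in>UNIV. real (card (block D i)) / lam i ?t)"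
 proof -
  have "p_c D x ?t > 0" by (rule p_c_pos[OF tq])
  thus ?thesis using Tp unfolding h2_def h1_def P1_def by (simp add: field_simps)
 qed
 finally show ?thesis by simp
qed

end

section \<open>The volume measure\<close>

lemma momentum_at_top:
 assumes u: "u : potentials \<kappa>" and \<kappa>: "\<kappa> > 0"
 shows "(momentum u \<longlongrightarrow> 1) at_top" "(momentum u \<longlongrightarrow> -1) at_bot"
proof -
 have gt: "momentum u y > a" if "a < 1" "y > deriv u (max a 0)" for a y
 proof -
  have "max a 0 < momentum u y" by (rule momentum_between(1)[OF u \<kappa>, where b = "(1 + momentum u y) / 2"])
    (use that momentum[OF u \<kappa>, of y] potentials_strict_mono[OF u \<kappa>, of "momentum u y" "(1 + momentum u y) / 2"] in auto)
  thus ?thesis by simp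
 qed
 have lt: "momentum u y < a" if "a > -1" "y < deriv u (min a 0)" for a y
 proof -
  have "momentum u y < min a 0" by (rule momentum_between(2)[OF u \<kappa>, where a = "(momentum u y - 1) / 2"])
    (use that momentum[OF u \<kappa>, of y] potentials_strict_mono[OF u \<kappa>, of "(momentum u y - 1) / 2" "momentum u y"] in auto)
  thus ?thesis by simp
 qed
 show "(momentum u \<longlongrightarrow> 1) at_top"
 proof (rule order_tendstoI)
  show "\<forall>\<^sub>F y in at_top. a < momentum u y" if "a < 1" for a
   using eventually_gt_at_top[of "deriv u (max a 0)"] by eventually_elim (rule gt[OF that])
  show "\<forall>\<^sub>F y in at_top. momentum u y < a" if "1 < a" for a
   by (rule always_eventually, rule allI, rule less_trans[OF momentum(2)[OF u \<kappa>] that])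
 qed
 show "(momentum u \<longlongrightarrow> -1) at_bot"
 proof (rule order_tendstoI)
  show "\<forall>\<^sub>F y in at_bot. momentum u y < a" if "-1 < a" for a
   using eventually_gt_at_bot[of "deriv u (min a 0)"] by eventually_elim (rule lt[OF that])
  show "\<forall>\<^sub>F y in at_bot. a < momentum u y" if "a < -1" for a
   by (rule always_eventually, rule allI, rule less_trans[OF that momentum(1)[OF u \<kappa>]])
 qed
qed

lemma potentials_deriv2:
 assumes u: "u : potentials \<kappa>" and \<kappa>: "\<kappa> > 0"
 shows "smooth_on_line {-1<..<1} (deriv (deriv u))" "smooth_on_line {-1<..<1} (%z. 1 / deriv (deriv u) z)"
  "!!z. z : {-1<..<1} ==> deriv (deriv u) z > 0"
proof -
 obtain w2 where w: "smooth_on_line {-1..1} w2" "!!z. abs z < 1 ==> deriv (deriv u) z = ddu_can \<kappa> z + w2 z"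
  by (rule potentialsE[OF u \<kappa>], rule that, assumption+)
 have p: "poly [:\<kappa>, 0, - \<kappa>:] z = \<kappa> * (1 - z\<^sup>2)" for z by (simp add: power2_eq_square algebra_simps)
 have nz: "\<kappa> * (1 - z\<^sup>2) ~= 0" if "z : {-1<..<1}" for z
 proof -
  have "z\<^sup>2 < 1" using that by (simp add: abs_square_less_1 abs_less_iff)
  thus ?thesis using \<kappa> by simp
 qed
 have "smooth_on_line {-1<..<1} (%z. 1 / poly [:\<kappa>, 0, - \<kappa>:] z + w2 z)"
  by (intro smooth_line_add smooth_line_divide smooth_line_const smooth_line_poly smooth_line_subset[OF w(1)])
   (use nz p in auto)
 thus s: "smooth_on_line {-1<..<1} (deriv (deriv u))"
  by (rule smooth_line_cong) (use w(2) in \<open>auto simp: p abs_less_iff simp del: poly_pCons\<close>)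
 show pos: "deriv (deriv u) z > 0" if "z : {-1<..<1}" for z using u that by (auto simp: potentials_def)
 show "smooth_on_line {-1<..<1} (%z. 1 / deriv (deriv u) z)"
  by (intro smooth_line_divide smooth_line_const s) (use pos in force)
qed

context admissible
begin

abbreviation ich :: "('a, 's, 'l, 'd, 'b) bundle_chart => complex^('d option) => 'l" where
 "ich c q \<equiv> inv_into (cdom D c) (scoord c) q"

lemma M0_cdom: "M0 D \<inter> cdom D c = cdom D c" by (auto simp: cdom_def)

lemma ccoord_inj_std: "c : bundle_charts D ==> inj_on (scoord c) (cdom D c)"
 using ccoord_inj[of c "%y. y" UNIV "M0 D"] by (simp add: M0_cdom)

lemma ich:
 assumes c: "c : bundle_charts D"
 shows "l : cdom D c ==> ich c (scoord c l) = l" "q : cimg c UNIV ==> scoord c (ich c q) = q"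
  "q : cimg c UNIV ==> ich c q : cdom D c"
 using ccoord_inj_std[OF c] standard_image[OF c] by (auto simp: inv_into_f_f f_inv_into_f inv_into_into)

lemma in_chart_std: "in_chart D (M0 D) (ylog D) c f q = f (ich c q)" by (simp add: in_chart_def M0_cdom)

lemma ylog_ich: "c : bundle_charts D ==> q : cimg c UNIV ==> ylog D (ich c q) = Yc c q"
 using standard_in_chart[of c q] by (simp add: in_chart_std)

lemma potential_chart:
 assumes u: "u : potentials \<kappa>" and \<kappa>: "\<kappa> > 0" and x: "!!i. 0 < x i & x i < 1" and c: "c : bundle_charts D"
 shows "adm_chart D s x c (M0 D) (ylog D) (zfun D u) (%z. 1 / deriv (deriv u) z) (momentum u) UNIV {-1<..<1}"
proof (unfold_locales)
 show "momentum u y : {-1<..<1}" for y using momentum(1,2)[OF u \<kappa>, of y] by simp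
 show "(momentum u has_real_derivative 1 / deriv (deriv u) (momentum u y)) (at y)" for y
  by (rule momentum_deriv[OF u \<kappa>])
 show "0 < 1 / deriv (deriv u) z" if "z : {-1<..<1}" for z using potentials_deriv2(3)[OF u \<kappa> that] by simp
 show "in_chart D (M0 D) (ylog D) c (ylog D) q = Yc c q" if "q : cimg c UNIV" for q
  by (rule standard_in_chart[OF c that])
 show "in_chart D (M0 D) (ylog D) c (zfun D u) q = momentum u (Yc c q)" if "q : cimg c UNIV" for q
  using ylog_ich[OF c that] by (simp add: in_chart_std zfun_def)
qed (use x c potentials_deriv2(2)[OF u \<kappa>] in auto)

lemma continuous_on_cvol:
 assumes c: "c : bundle_charts D" and x: "!!i. 0 < x i & x i < 1"
 shows "continuous_on (bimg c) (cvol x c)" unfolding cvol_def[abs_def]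
proof (intro continuous_on_divide continuous_on_prod continuous_on_const)
 fix i
 show "continuous_on (bimg c) (%w. vol_density (block D i) (fac_metric D i (fch c i)) (blkproj i w))"
  by (rule continuous_on_compose2[OF smooth_in_continuous[OF smooth_vol_density[OF factor_kaehler(1,2)[OF c]]] continuous_coord_proj])
   (use factor_kaehler(3)[OF c] in blast)
qed (use x in \<open>auto simp: less_imp_neq[symmetric]\<close>)

definition over :: "'s set => 'l set" where "over B = {l : M0 D. prj D l : B}"

lemma over_image:
 assumes c: "c : bundle_charts D"
 shows "scoord c ` (over B \<inter> cdom D c) = {q : cimg c UNIV. base_part q : bcoord D (fst c) ` (bdom (fst c) \<inter> B)}"
proof (intro equalityI subsetI)
 fix q assume "q : scoord c ` (over B \<inter> cdom D c)"
 then obtain l where l: "l : over B" "l : cdom D c" "q = scoord c l" by blast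
 have "q : cimg c UNIV" using l standard_image[OF c] by blast
 moreover have "base_part q = bcoord D (fst c) (prj D l)" by (simp add: l(3) ccoord_parts)
 moreover have "prj D l : bdom (fst c) \<inter> B" using l cdomD(2)[OF c] by (auto simp: over_def)
 ultimately show "q : {q : cimg c UNIV. base_part q : bcoord D (fst c) ` (bdom (fst c) \<inter> B)}" by blast
next
 fix q assume "q : {q : cimg c UNIV. base_part q : bcoord D (fst c) ` (bdom (fst c) \<inter> B)}"
 then obtain p where q: "q : cimg c UNIV" and p: "p : bdom (fst c)" "p : B" "base_part q = bcoord D (fst c) p" by blast
 have l: "ich c q : cdom D c" "scoord c (ich c q) = q" using ich[OF c] q by auto
 have "bcoord D (fst c) (prj D (ich c q)) = bcoord D (fst c) p"
  using p(3) ccoord_parts(2)[of "ylog D" c "ich c q"] l(2) by simp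
 hence "prj D (ich c q) = p"
  using bcoord_inj[OF bundle_chartD(1)[OF c]] cdomD(2)[OF c l(1)] p(1) by (auto simp: inj_on_def)
 hence "ich c q : over B" using p(2) l(1) by (auto simp: over_def cdom_def)
 thus "q : scoord c ` (over B \<inter> cdom D c)" using l by (metis IntI image_eqI)
qed

lemma continuous_base_part: "continuous_on S (base_part :: complex^('d option) => complex^'d)"
 using linear_continuous_on[OF bounded_linear_base_part] .

lemma measurable_base_part: "(base_part :: complex^('d option) => complex^'d) : borel_measurable borel"
 by (rule borel_measurable_continuous_onI[OF continuous_base_part])

lemma cimg_sets: "c : bundle_charts D ==> cimg c UNIV : sets borel" using open_cimg[OF _ open_UNIV] by simp

lemma over_image_borel:
 assumes c: "c : bundle_charts D" and "bcoord D (fst c) ` (bdom (fst c) \<inter> B) : sets borel"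
 shows "scoord c ` (over B \<inter> cdom D c) : sets borel"
proof -
 have "{q : cimg c UNIV. base_part q : bcoord D (fst c) ` (bdom (fst c) \<inter> B)}
  = cimg c UNIV \<inter> (base_part -` (bcoord D (fst c) ` (bdom (fst c) \<inter> B)) \<inter> space borel)" by auto
 also have "... : sets borel"
  using measurable_sets[OF measurable_base_part assms(2)] cimg_sets[OF c] by (rule sets.Int[rotated])
 finally show ?thesis unfolding over_image[OF c] .
qed

end

locale adm_measure = admissible D s
 for D :: "('a, 's, 'l, 'd::finite, 'b::finite) admissible_data" and s :: "'b => real" +
 fixes x :: "'b => real" and \<kappa> :: real and u :: "real => real" and \<nu> :: "'l measure"
 assumes x: "!!i. 0 < x i & x i < 1" and \<kappa>: "\<kappa> > 0" and u: "u : potentials \<kappa>" and vol: "volume_measure D x u \<nu>"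
begin

lemma space_nu: "space \<nu> = M0 D"
 and sets_nu: "A : sets \<nu> \<longleftrightarrow> A \<subseteq> M0 D & (\<forall>c\<in>bundle_charts D. scoord c ` (A \<inter> cdom D c) : sets borel)"
 and emeasure_nu: "c : bundle_charts D ==> A : sets \<nu> ==> A \<subseteq> cdom D c ==>
    emeasure \<nu> A = (\<integral>\<^sup>+ q \<in> scoord c ` A. ennreal (vol_density UNIV (metric_of D x u c) q) \<partial>lborel)"
 using vol unfolding volume_measure_def by blast+

lemma chart: "c : bundle_charts D ==> adm_chart D s x c (M0 D) (ylog D) (zfun D u) (%z. 1 / deriv (deriv u) z) (momentum u) UNIV {-1<..<1}"
 by (rule potential_chart[OF u \<kappa> x])

text \<open>The volume density in the fibre variable \<open>y\<close>: it is
  \<open>p_c \<Theta>\<close> at \<open>z = momentum u y\<close>.\<close>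

definition ydens :: "real => real" where "ydens y = p_c D x (momentum u y) / deriv (deriv u) (momentum u y)"

lemma mom_in: "momentum u y : {-1<..<1}" using momentum(1,2)[OF u \<kappa>, of y] by simp

lemma ydens_nonneg: "ydens y >= 0"
proof -
 have "p_c D x (momentum u y) >= 0" unfolding p_c_def
 proof (intro prod_nonneg ballI zero_le_power)
  fix i
  have "x i * momentum u y >= x i * (-1)" using x[of i] mom_in[of y] by (intro mult_left_mono) auto
  thus "0 <= 1 + x i * momentum u y" using x[of i] by simp
 qed
 thus ?thesis using potentials_deriv2(3)[OF u \<kappa> mom_in[of y]] by (simp add: ydens_def)
qed

lemma continuous_momentum: "continuous_on S (momentum u)"
 using momentum_deriv[OF u \<kappa>] by (intro continuous_at_imp_continuous_on) (auto intro: DERIV_isCont)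

lemma continuous_ydens: "continuous_on UNIV ydens"
proof -
 have "continuous_on UNIV (%y. deriv (deriv u) (momentum u y))"
  by (rule continuous_on_compose2[OF smooth_line_continuous[OF potentials_deriv2(1)[OF u \<kappa>]] continuous_momentum])
   (use mom_in in auto)
 thus ?thesis unfolding ydens_def[abs_def] p_c_def
  by (intro continuous_on_divide continuous_on_prod continuous_on_power continuous_on_add continuous_on_mult continuous_on_const continuous_momentum)
   (use potentials_deriv2(3)[OF u \<kappa> mom_in] in \<open>auto simp: less_imp_neq[symmetric]\<close>)
qed

lemma measurable_ydens [measurable]: "ydens : borel_measurable borel"
 by (rule borel_measurable_continuous_onI[OF continuous_ydens])

lemma vol_metric_of:
 assumes c: "c : bundle_charts D" and q: "q : cimg c UNIV"
 shows "vol_density UNIV (metric_of D x u c) q = ydens (Yc c q) * (1 / (cmod (q $ None))^2) * cvol x c (base_part q)"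
 using adm_chart.vol_G(1)[OF chart[OF c] q] unfolding metric_of_def ydens_def by simp

lemma cvol_nonneg: "c : bundle_charts D ==> w : bimg c ==> cvol x c w > 0"
 using adm_chart.cvol_pos[OF chart, of c "join w 1"] by (simp add: cimg_def)

lemma continuous_Yc: "c : bundle_charts D ==> continuous_on (cimg c UNIV) (Yc c)"
 using smooth_in_continuous[OF smooth_Yc[OF _ open_UNIV]] .

definition dens :: "('a, 's, 'l, 'd, 'b) bundle_chart => complex^('d option) => real" where
 "dens c q = ydens (Yc c q) * (1 / (cmod (q $ None))^2) * cvol x c (base_part q)"

lemma continuous_dens:
 assumes c: "c : bundle_charts D" shows "continuous_on (cimg c UNIV) (dens c)" unfolding dens_def[abs_def]
 by (intro continuous_on_mult continuous_on_divide continuous_on_const continuous_intros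
   continuous_on_compose2[OF continuous_ydens continuous_Yc[OF c]]
   continuous_on_compose2[OF continuous_on_cvol[OF c x] continuous_base_part]) (auto simp: cimg_def)

text \<open>Measurability chart by chart, matching how \<open>volume_measure\<close> prescribes the
  sigma-algebra of \<open>\<nu>\<close>.\<close>

definition chart_measurable :: "('l => 'e::topological_space) => bool" where
 "chart_measurable g \<longleftrightarrow> (\<forall>c\<in>bundle_charts D. (%q. g (ich c q)) : borel_measurable (restrict_space borel (cimg c UNIV)))"

lemma image_vimage:
 assumes c: "c : bundle_charts D" and A: "A \<subseteq> M0 D"
 shows "scoord c ` ((A \<inter> g -` S) \<inter> cdom D c) = (scoord c ` (A \<inter> cdom D c)) \<inter> {q : cimg c UNIV. g (ich c q) : S}"
 using ich[OF c] standard_image[OF c] by (auto simp: image_iff)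

lemma chart_measurable_sets:
 assumes g: "chart_measurable g" and A: "A : sets \<nu>" and S: "S : sets borel"
 shows "A \<inter> g -` S : sets \<nu>" unfolding sets_nu
proof (intro conjI ballI)
 show "A \<inter> g -` S \<subseteq> M0 D" using A sets_nu by blast
 fix c assume c: "c : bundle_charts D"
 have "(%q. g (ich c q)) -` S \<inter> space (restrict_space borel (cimg c UNIV)) : sets (restrict_space borel (cimg c UNIV))"
  using g c S unfolding chart_measurable_def by (auto intro: measurable_sets)
 hence "{q : cimg c UNIV. g (ich c q) : S} : sets borel"
  using cimg_sets[OF c] by (simp add: sets_restrict_space_iff space_restrict_space vimage_def Int_def conj_commute)
 moreover have "scoord c ` (A \<inter> cdom D c) : sets borel" using A c sets_nu by blast
 ultimately show "scoord c ` (A \<inter> g -` S \<inter> cdom D c) : sets borel"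
  using image_vimage[OF c, of A g S] A sets_nu by auto
qed

lemma M0_sets: "M0 D : sets \<nu>" using sets.top[of \<nu>] by (simp add: space_nu)

lemma chart_measurable_nu: "chart_measurable g ==> g : borel_measurable \<nu>"
 using chart_measurable_sets[OF _ M0_sets] by (intro measurableI) (auto simp: space_nu vimage_def Int_def conj_commute)

text \<open>The defining property of \<open>\<nu>\<close> gives measures of sets inside one chart.
  Comparing push-forwards under \<open>g\<close> turns this into formulas for integrals of functions
  of \<open>g\<close>.\<close>

lemma distr_chart:
 assumes g: "chart_measurable g" and c: "c : bundle_charts D" and A: "A : sets \<nu>" "A \<subseteq> cdom D c"
 defines "\<Omega> \<equiv> scoord c ` A"
 shows "\<Omega> : sets borel" "\<Omega> \<subseteq> cimg c UNIV" "(%q. g (ich c q)) : borel_measurable (restrict_space lborel \<Omega>)"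
  "dens c : borel_measurable (restrict_space lborel \<Omega>)"
  "distr (restrict_space \<nu> A) borel g = distr (density (restrict_space lborel \<Omega>) (%q. ennreal (dens c q))) borel (%q. g (ich c q))"
proof -
 have Ac: "A \<inter> cdom D c = A" using A by blast
 show O: "\<Omega> : sets borel" using A c sets_nu[of A] unfolding \<Omega>_def by (metis Ac)
 show Oc: "\<Omega> \<subseteq> cimg c UNIV" using A standard_image[OF c] unfolding \<Omega>_def by blast
 have sub: "h : borel_measurable (restrict_space lborel \<Omega>)" if "h : borel_measurable (restrict_space borel (cimg c UNIV))"
  for h :: "complex^('d option) => 'z::topological_space"
 proof -
  have "h : borel_measurable (restrict_space (restrict_space borel (cimg c UNIV)) \<Omega>)"
   by (rule measurable_restrict_space1[OF that])
  moreover have "restrict_space (restrict_space borel (cimg c UNIV)) \<Omega> = restrict_space borel \<Omega>"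
   using Oc by (subst restrict_restrict_space) (auto simp: cimg_sets[OF c] O Int_absorb1 Int_absorb2 inf_commute)
  moreover have "sets (restrict_space lborel \<Omega>) = sets (restrict_space borel \<Omega>)"
   by (rule sets_restrict_space_cong) simp
  ultimately show ?thesis using measurable_cong_sets[OF _ refl] by metis
 qed
 show gm: "(%q. g (ich c q)) : borel_measurable (restrict_space lborel \<Omega>)"
  using g c by (intro sub) (simp add: chart_measurable_def)
 show dm: "dens c : borel_measurable (restrict_space lborel \<Omega>)"
  by (intro sub borel_measurable_continuous_on_restrict continuous_dens c)
 have gA: "g : borel_measurable (restrict_space \<nu> A)"
  by (rule measurable_restrict_space1[OF chart_measurable_nu[OF g]])
 show "distr (restrict_space \<nu> A) borel g = distr (density (restrict_space lborel \<Omega>) (%q. ennreal (dens c q))) borel (%q. g (ich c q))"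
 proof (rule measure_eqI)
  fix S assume "S : sets (distr (restrict_space \<nu> A) borel g)"
  hence S: "S : sets borel" by simp
  have AS: "A \<inter> g -` S : sets \<nu>" by (rule chart_measurable_sets[OF g A(1) S])
  have im: "scoord c ` (A \<inter> g -` S) = \<Omega> \<inter> (%q. g (ich c q)) -` S"
  proof -
   have "(A \<inter> g -` S) \<inter> cdom D c = A \<inter> g -` S" using A(2) by blast
   moreover have "A \<subseteq> M0 D" using A(1) sets_nu by blast
   moreover have "\<Omega> \<inter> {q : cimg c UNIV. g (ich c q) : S} = \<Omega> \<inter> (%q. g (ich c q)) -` S" using Oc by blast
   ultimately show ?thesis using image_vimage[OF c, of A g S] unfolding Ac \<Omega>_def[symmetric] by simp
  qed
  have OS: "\<Omega> \<inter> (%q. g (ich c q)) -` S : sets borel"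
  proof -
   have "(A \<inter> g -` S) \<inter> cdom D c = A \<inter> g -` S" using A(2) by blast
   thus ?thesis using AS c unfolding sets_nu im[symmetric] by auto
  qed
  have "emeasure (distr (restrict_space \<nu> A) borel g) S = emeasure (restrict_space \<nu> A) (g -` S \<inter> A)"
   using emeasure_distr[OF gA S] A sets_nu[of A] by (simp add: space_restrict_space space_nu Int_absorb2)
  also have "... = emeasure \<nu> (A \<inter> g -` S)"
   using A(1) by (subst emeasure_restrict_space) (simp_all add: sets.Int_space_eq2 Int_commute)
  also have "... = (\<integral>\<^sup>+ q \<in> \<Omega> \<inter> (%q. g (ich c q)) -` S. ennreal (vol_density UNIV (metric_of D x u c) q) \<partial>lborel)"
   using emeasure_nu[OF c AS] A(2) im by auto
  also have "... = (\<integral>\<^sup>+ q. (ennreal (dens c q) * indicator ((%q. g (ich c q)) -` S) q) * indicator \<Omega> q \<partial>lborel)"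
   using Oc by (intro nn_integral_cong) (auto simp: vol_metric_of[OF c] dens_def split: split_indicator)
  also have "... = (\<integral>\<^sup>+ q. ennreal (dens c q) * indicator ((%q. g (ich c q)) -` S) q \<partial>restrict_space lborel \<Omega>)"
   using O by (subst nn_integral_restrict_space) auto
  also have "... = (\<integral>\<^sup>+ q. ennreal (dens c q) * indicator ((%q. g (ich c q)) -` S \<inter> \<Omega>) q \<partial>restrict_space lborel \<Omega>)"
   by (intro nn_integral_cong) (auto simp: space_restrict_space split: split_indicator)
  also have "... = emeasure (density (restrict_space lborel \<Omega>) (%q. ennreal (dens c q))) ((%q. g (ich c q)) -` S \<inter> \<Omega>)"
   using dm OS O by (subst emeasure_density) (auto simp: sets_restrict_space_iff Int_commute)
  also have "... = emeasure (distr (density (restrict_space lborel \<Omega>) (%q. ennreal (dens c q))) borel (%q. g (ich c q))) S"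
   using gm S by (subst emeasure_distr) (auto simp: space_restrict_space)
  finally show "emeasure (distr (restrict_space \<nu> A) borel g) S = emeasure (distr (density (restrict_space lborel \<Omega>) (%q. ennreal (dens c q))) borel (%q. g (ich c q))) S" .
 qed simp
qed

end

text \<open>A finite Borel partition of the base subordinate to charts, with pieces of finite
  volume; piece 0 has an open nonempty image, which makes the total mass positive. No potential
  enters, so one partition serves all \<open>u\<close>.\<close>

locale adm_pieces = admissible D s
 for D :: "('a, 's, 'l, 'd::finite, 'b::finite) admissible_data" and s :: "'b => real" +
 fixes x :: "'b => real" and n :: nat and c :: "nat => ('a, 's, 'l, 'd, 'b) bundle_chart" and B :: "nat => 's set"
 assumes cB: "j < n ==> c j : bundle_charts D" "j < n ==> B j \<subseteq> bdom (fst (c j))"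
  and Bdisj: "disjoint_family_on B {..<n}" and BUN: "(\<Union>j<n. B j) = topspace (base D)"
  and Bmeas: "j < n ==> b : base_charts D ==> bcoord D b ` (bdom b \<inter> B j) : sets borel"
  and Bfin: "j < n ==> (\<integral>\<^sup>+ w \<in> bcoord D (fst (c j)) ` B j. ennreal (cvol x (c j) w) \<partial>lborel) < \<infinity>"
  and Bpos: "0 < n" "B 0 ~= {}" "open (bcoord D (fst (c 0)) ` B 0)"

context admissible
begin

lemma base_nonempty: "topspace (base D) ~= {}"
proof -
 have "topspace (fac D i) ~= {}" for i using factor_manifold[of i] unfolding complex_manifold_def by blast
 hence "(\<Pi>\<^sub>E i\<in>UNIV. topspace (fac D i)) ~= {}" by (simp add: PiE_eq_empty_iff)
 moreover have "cov D ` topspace (cover_space) = topspace (base D)"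
  using cov unfolding covering_projection_def by blast
 ultimately show ?thesis by (metis image_is_empty topspace_product_topology)
qed

text \<open>The compact set inside the chart image bounds \<open>cvol\<close> on the piece, whence
  its finite volume.\<close>

definition good_piece :: "('a, 's, 'l, 'd, 'b) bundle_chart => 's set => bool" where
 "good_piece c U \<longleftrightarrow> openin (base D) U & U ~= {} & c : bundle_charts D & U \<subseteq> bdom (fst c) &
   (\<exists>K. compact K & bcoord D (fst c) ` U \<subseteq> K & K \<subseteq> bimg c)"

lemma good_piece_exists:
 assumes p: "p : topspace (base D)" obtains c U where "good_piece c U" "p : U"
proof -
 obtain c where c: "c : bundle_charts D" "p : bdom (fst c)" using bundle_charts_cover[OF p openin_topspace p] by blast
 have b: "fst c : base_charts D" by (rule bundle_chartD(1)[OF c(1)])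
 have "bcoord D (fst c) p : bimg c" using c(2) by (simp add: bimg_def)
 then obtain e where e: "e > 0" "cball (bcoord D (fst c) p) e \<subseteq> bimg c"
  using open_bimg[OF c(1)] open_contains_cball by blast
 let ?U = "{p' : topspace (subtopology (base D) (bdom (fst c))). bcoord D (fst c) p' : ball (bcoord D (fst c) p) e}"
 have "openin (subtopology (base D) (bdom (fst c))) ?U"
  by (rule openin_continuous_map_preimage[OF continuous_bcoord[OF b]]) simp
 hence "openin (base D) ?U" using base_chartD(1)[OF b] by (rule openin_trans_full)
 moreover have "p : ?U" using p c(2) e(1) by simp
 ultimately have "good_piece c ?U" unfolding good_piece_def using c(1) e(2)
  by (intro conjI exI[of _ "cball (bcoord D (fst c) p) e"]) auto
 thus ?thesis using \<open>p : ?U\<close> by (rule that)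
qed

text \<open>Compactness of the base gives finitely many good pieces; \<open>disjointed\<close> makes
  them a partition and leaves the first one as it is, hence open.\<close>

lemma pieces_exist:
 assumes x: "!!i. 0 < x i & x i < 1"
 shows "\<exists>n c B. adm_pieces D s x n c B"
proof -
 let ?\<U> = "{U. \<exists>c. good_piece c U}"
 have o: "openin (base D) U" if "U : ?\<U>" for U using that by (auto simp: good_piece_def)
 have cov: "topspace (base D) \<subseteq> \<Union>?\<U>"
 proof
  fix p assume "p : topspace (base D)"
  then obtain c U where "good_piece c U" "p : U" by (rule good_piece_exists)
  thus "p : \<Union>?\<U>" by blast
 qed
 have "\<exists>\<F>. finite \<F> & \<F> \<subseteq> ?\<U> & topspace (base D) \<subseteq> \<Union>\<F>"
  using compact_base[unfolded compact_space_alt, rule_format, OF conjI, OF ballI[OF o] cov] .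
 then obtain \<F> where F: "finite \<F>" "\<F> \<subseteq> ?\<U>" "topspace (base D) \<subseteq> \<Union>\<F>" by blast
 obtain Us where Us: "set Us = \<F>" using finite_list[OF F(1)] by blast
 define n where "n = length Us"
 have "\<forall>j. \<exists>c. j < n --> good_piece c (Us ! j)"
 proof
  fix j show "\<exists>c. j < n --> good_piece c (Us ! j)"
  proof (cases "j < n")
   case True
   hence "Us ! j : ?\<U>" using F(2) Us nth_mem n_def by blast
   thus ?thesis by blast
  qed simp
 qed
 then obtain c where c: "!!j. j < n ==> good_piece (c j) (Us ! j)" by metis
 define B where "B = disjointed (%j. Us ! j)"
 have Bs: "B j \<subseteq> Us ! j" for j unfolding B_def by (rule disjointed_subset)
 have n0: "0 < n" using F(3) base_nonempty Us by (cases Us) (auto simp: n_def)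
 have B0: "B 0 = Us ! 0" by (simp add: B_def disjointed_def)
 have gD: "openin (base D) (Us ! j)" "Us ! j ~= {}" "c j : bundle_charts D" "Us ! j \<subseteq> bdom (fst (c j))" if "j < n" for j
  using c[OF that] unfolding good_piece_def by blast+
 have opn: "openin (base D) (\<Union>i<j. Us ! i)" if "j < n" for j using gD(1) that by (intro openin_Union) auto
 have "adm_pieces D s x n c B"
 proof
  show "c j : bundle_charts D" "B j \<subseteq> bdom (fst (c j))" if "j < n" for j using gD[OF that] Bs[of j] by auto
  show "disjoint_family_on B {..<n}"
   unfolding B_def by (rule disjoint_family_on_mono[OF subset_UNIV disjoint_family_disjointed])
  have "(\<Union>j<n. B j) = (\<Union>j<n. Us ! j)"
   unfolding B_def using finite_UN_disjointed_eq[of "%j. Us ! j" n] by (simp add: atLeast0LessThan)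
  also have "... = \<Union>\<F>" unfolding Us[symmetric] n_def set_conv_nth by blast
  also have "... = topspace (base D)"
  proof (intro equalityI Union_least F(3))
   fix U assume "U : \<F>"
   thus "U \<subseteq> topspace (base D)" using F(2) o openin_subset by blast
  qed
  finally show "(\<Union>j<n. B j) = topspace (base D)" .
  show "bcoord D b ` (bdom b \<inter> B j) : sets borel" if j: "j < n" and b: "b : base_charts D" for j b
  proof -
   have "bcoord D b ` (bdom b \<inter> B j) = bcoord D b ` ((bdom b \<inter> Us ! j) - (bdom b \<inter> (\<Union>i<j. Us ! i)))"
    unfolding B_def disjointed_def by (rule arg_cong[where f = "image (bcoord D b)"]) (auto simp: atLeast0LessThan)
   also have "... = bcoord D b ` (bdom b \<inter> Us ! j) - bcoord D b ` (bdom b \<inter> (\<Union>i<j. Us ! i))"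
    by (rule inj_on_image_set_diff[OF bcoord_inj[OF b]]) auto
   finally show ?thesis using open_bcoord_image[OF b gD(1)[OF j]] open_bcoord_image[OF b opn[OF j]] by simp
  qed
  show "(\<integral>\<^sup>+ w \<in> bcoord D (fst (c j)) ` B j. ennreal (cvol x (c j) w) \<partial>lborel) < \<infinity>" if j: "j < n" for j
  proof -
   obtain K where K: "compact K" "bcoord D (fst (c j)) ` (Us ! j) \<subseteq> K" "K \<subseteq> bimg (c j)"
    using c[OF j] unfolding good_piece_def by blast
   have "compact (cvol x (c j) ` K)"
    by (rule compact_continuous_image[OF continuous_on_subset[OF continuous_on_cvol[OF gD(3)[OF j] x] K(3)] K(1)])
   hence "bounded (cvol x (c j) ` K)" by (rule compact_imp_bounded)
   then obtain M where M: "\<forall>y\<in>cvol x (c j) ` K. norm y <= M" unfolding bounded_iff by (rule exE)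
   have M': "ennreal (cvol x (c j) w) <= ennreal M" if "w : K" for w
    using bspec[OF M imageI[OF that]] by (intro ennreal_leI) simp
   have sub: "bcoord D (fst (c j)) ` B j \<subseteq> K" using K(2) image_mono[OF Bs[of j]] by (rule order_trans[rotated])
   have "(\<integral>\<^sup>+ w \<in> bcoord D (fst (c j)) ` B j. ennreal (cvol x (c j) w) \<partial>lborel) <= (\<integral>\<^sup>+ w. ennreal M * indicator K w \<partial>lborel)"
   proof (rule nn_integral_mono)
    fix w :: "complex^'d"
    show "ennreal (cvol x (c j) w) * indicator (bcoord D (fst (c j)) ` B j) w <= ennreal M * indicator K w"
    proof (cases "w : bcoord D (fst (c j)) ` B j")
     case True
     thus ?thesis using M'[of w] subsetD[OF sub True] by simp
    qed simp
   qed
   also have "... = ennreal M * emeasure lborel K" using K(1) by (intro nn_integral_cmult_indicator) (simp add: borel_compact)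
   also have "... < \<infinity>" using emeasure_bounded_finite[OF compact_imp_bounded[OF K(1)]]
    by (simp add: ennreal_mult_less_top)
   finally show ?thesis .
  qed
  show "0 < n" by (rule n0)
  show "B 0 ~= {}" using gD(2)[OF n0] B0 by simp
  have "bcoord D (fst (c 0)) ` B 0 = bcoord D (fst (c 0)) ` (bdom (fst (c 0)) \<inter> Us ! 0)"
   unfolding B0 using gD(4)[OF n0] by (simp add: Int_absorb1)
  thus "open (bcoord D (fst (c 0)) ` B 0)"
   using open_bcoord_image[OF bundle_chartD(1)[OF gD(3)[OF n0]] gD(1)[OF n0]] by simp
 qed
 thus ?thesis by blast
qed

end

section \<open>Integration over the pieces\<close>

context adm_pieces
begin

definition Bi :: "nat => (complex^'d) set" where "Bi j = bcoord D (fst (c j)) ` B j"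

definition vol_base :: "nat => ennreal" where "vol_base j = (\<integral>\<^sup>+ w \<in> Bi j. ennreal (cvol x (c j) w) \<partial>lborel)"

text \<open>\<open>2 pi\<close> from the circles in the fibres times the base volume.\<close>

definition mass :: real where "mass = 2 * pi * enn2real (\<Sum>j<n. vol_base j)"

lemma Bi:
 assumes "j < n"
 shows "Bi j : sets borel" "Bi j \<subseteq> bimg (c j)" "vol_base j < \<infinity>" "over (B j) \<subseteq> cdom D (c j)"
proof -
 show "Bi j : sets borel" unfolding Bi_def
  using Bmeas[OF assms bundle_chartD(1)[OF cB(1)[OF assms]]] cB(2)[OF assms] by (simp add: Int_absorb1)
 show "Bi j \<subseteq> bimg (c j)" unfolding Bi_def bimg_def using cB(2)[OF assms] by blast
 show "vol_base j < \<infinity>" unfolding vol_base_def Bi_def by (rule Bfin[OF assms])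
 show "over (B j) \<subseteq> cdom D (c j)" using cB(2)[OF assms] by (auto simp: over_def cdom_def)
qed

lemma over_UN: "(\<Union>j<n. over (B j)) = M0 D" "disjoint_family_on (%j. over (B j)) {..<n}"
proof -
 have "prj D ` tot D = topspace (base D)" using hlb unfolding hermitian_line_bundle_def by (elim conjE)
 thus "(\<Union>j<n. over (B j)) = M0 D" using BUN by (auto simp: over_def M0_def)
 show "disjoint_family_on (%j. over (B j)) {..<n}" using Bdisj by (auto simp: disjoint_family_on_def over_def)
qed

lemma over_Bi: "j < n ==> scoord (c j) ` over (B j) = {q : cimg (c j) UNIV. base_part q : Bi j}"
 using over_image[OF cB(1), of j "B j"] Bi(4)[of j] cB(2)[of j] by (simp add: Bi_def Int_absorb1 Int_absorb2)

end

locale adm_measure_pieces = adm_measure D s x \<kappa> u \<nu> + adm_pieces D s x n c B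
 for D :: "('a, 's, 'l, 'd::finite, 'b::finite) admissible_data" and s x \<kappa> u \<nu> n c B
begin

lemma over_sets: "j < n ==> over (B j) : sets \<nu>"
proof -
 assume j: "j < n"
 have "over (B j) \<subseteq> M0 D" by (auto simp: over_def)
 moreover have "scoord c' ` (over (B j) \<inter> cdom D c') : sets borel" if "c' : bundle_charts D" for c'
  by (rule over_image_borel[OF that Bmeas[OF j bundle_chartD(1)[OF that]]])
 ultimately show ?thesis using sets_nu by blast
qed

lemma dens_join:
 assumes "j < n" "w : bimg (c j)" "\<zeta> ~= 0"
 shows "join w \<zeta> : cimg (c j) UNIV" "dens (c j) (join w \<zeta>) = cvol x (c j) w * (ydens (ln (cmod \<zeta>) - rho (c j) w) * (1 / (cmod \<zeta>)^2))"
 using assms by (simp_all add: cimg_def dens_def Yc_def)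

lemma nn_integral_piece:
 fixes g :: "'l => 'e::{second_countable_topology, t2_space}"
 assumes g: "chart_measurable g" and h [measurable]: "h : borel_measurable borel" and j: "j < n"
 shows "(\<integral>\<^sup>+ l \<in> over (B j). h (g l) \<partial>\<nu>) =
  (\<integral>\<^sup>+ q \<in> {q : cimg (c j) UNIV. base_part q : Bi j}. ennreal (dens (c j) q) * h (g (ich (c j) q)) \<partial>lborel)"
proof -
 note A = over_sets[OF j] Bi(4)[OF j]
 note dc = distr_chart[OF g cB(1)[OF j] A]
 let ?\<Omega> = "{q : cimg (c j) UNIV. base_part q : Bi j}"
 have O: "scoord (c j) ` over (B j) = ?\<Omega>" by (rule over_Bi[OF j])
 have gA: "g : borel_measurable (restrict_space \<nu> (over (B j)))"
  by (rule measurable_restrict_space1[OF chart_measurable_nu[OF g]])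
 have dm: "(%q. ennreal (dens (c j) q)) : borel_measurable (restrict_space lborel ?\<Omega>)"
  using dc(4) unfolding O by measurable
 have gm: "(%q. g (ich (c j) q)) : borel_measurable (restrict_space lborel ?\<Omega>)" using dc(3) unfolding O .
 have hm: "(%q. h (g (ich (c j) q))) : borel_measurable (restrict_space lborel ?\<Omega>)"
  by (rule measurable_compose[OF gm h])
 have "(\<integral>\<^sup>+ l \<in> over (B j). h (g l) \<partial>\<nu>) = (\<integral>\<^sup>+ l. h (g l) \<partial>restrict_space \<nu> (over (B j)))"
  using A(1) by (subst nn_integral_restrict_space) auto
 also have "... = (\<integral>\<^sup>+ e. h e \<partial>distr (restrict_space \<nu> (over (B j))) borel g)"
  by (rule nn_integral_distr[symmetric, OF gA]) simp
 also have "... = (\<integral>\<^sup>+ q. h (g (ich (c j) q)) \<partial>density (restrict_space lborel ?\<Omega>) (%q. ennreal (dens (c j) q)))"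
  unfolding dc(5) O by (rule nn_integral_distr) (use gm in \<open>simp_all cong: measurable_cong_sets\<close>)
 also have "... = (\<integral>\<^sup>+ q. ennreal (dens (c j) q) * h (g (ich (c j) q)) \<partial>restrict_space lborel ?\<Omega>)"
  by (rule nn_integral_density[OF dm hm])
 also have "... = (\<integral>\<^sup>+ q \<in> ?\<Omega>. ennreal (dens (c j) q) * h (g (ich (c j) q)) \<partial>lborel)"
  using dc(1) unfolding O by (subst nn_integral_restrict_space) auto
 finally show ?thesis .
qed

lemma nn_integral_pieces:
 assumes "h : borel_measurable \<nu>"
 shows "(\<integral>\<^sup>+ l. h l \<partial>\<nu>) = (\<Sum>j<n. \<integral>\<^sup>+ l \<in> over (B j). h l \<partial>\<nu>)"
proof -
 have "(\<integral>\<^sup>+ l. h l \<partial>\<nu>) = (\<integral>\<^sup>+ l. (\<Sum>j<n. h l * indicator (over (B j)) l) \<partial>\<nu>)"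
 proof (rule nn_integral_cong)
  fix l assume "l : space \<nu>"
  hence "l : (\<Union>j<n. over (B j))" unfolding space_nu over_UN(1) .
  then obtain i where i: "i < n" "l : over (B i)" by blast
  have "indicator (over (B j)) l = (if j = i then 1 else 0 :: ennreal)" if "j < n" for j
   using over_UN(2) i that unfolding disjoint_family_on_def by (auto split: split_indicator)
  hence "(\<Sum>j<n. indicator (over (B j)) l :: ennreal) = (\<Sum>j<n. if j = i then 1 else 0)" by (intro sum.cong) auto
  also have "... = 1" using i by simp
  finally have "(\<Sum>j<n. indicator (over (B j)) l :: ennreal) = 1" .
  thus "h l = (\<Sum>j<n. h l * indicator (over (B j)) l)" by (simp add: sum_distrib_left[symmetric])
 qed
 also have "... = (\<Sum>j<n. \<integral>\<^sup>+ l \<in> over (B j). h l \<partial>\<nu>)" using assms over_sets by (intro nn_integral_sum) auto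
 finally show ?thesis .
qed

lemma chart_measurable_continuous:
 assumes "!!c. c : bundle_charts D ==> continuous_on (cimg c UNIV) (%q. g (ich c q))"
 shows "chart_measurable g"
 unfolding chart_measurable_def using assms by (auto intro: borel_measurable_continuous_on_restrict)

lemma chart_measurable_ylog: "chart_measurable (ylog D)"
proof (rule chart_measurable_continuous)
 fix c assume c: "c : bundle_charts D"
 show "continuous_on (cimg c UNIV) (%q. ylog D (ich c q))"
  using continuous_Yc[OF c] ylog_ich[OF c] by (simp cong: continuous_on_cong)
qed

lemma measurable_ylog [measurable]: "ylog D : borel_measurable \<nu>"
 by (rule chart_measurable_nu[OF chart_measurable_ylog])

lemma nn_integral_join:
 fixes f :: "complex^('d option) => ennreal"
 assumes [measurable]: "f : borel_measurable borel"
 shows "(\<integral>\<^sup>+ q. f q \<partial>lborel) = (\<integral>\<^sup>+ w. \<integral>\<^sup>+ \<zeta>. f (join w \<zeta>) \<partial>lborel \<partial>lborel)"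
proof -
 note [measurable] = measurable_join
 have "(\<integral>\<^sup>+ q. f q \<partial>lborel) = (\<integral>\<^sup>+ p. f (join (fst p) (snd p)) \<partial>(lborel \<Otimes>\<^sub>M lborel))"
  unfolding lborel_join[symmetric] by (rule nn_integral_distr) measurable
 also have "... = (\<integral>\<^sup>+ w. \<integral>\<^sup>+ \<zeta>. f (join w \<zeta>) \<partial>lborel \<partial>lborel)" by (subst lborel.nn_integral_fst[symmetric]) simp_all
 finally show ?thesis .
qed

text \<open>Over a base point the density is \<open>cvol\<close> times a function of
  \<open>ln |\<zeta>| - rho\<close> times \<open>1 / |\<zeta>|^2\<close>. The radial formula absorbs
  the shift \<open>rho\<close>, so base and fibre integrals separate.\<close>

lemma nn_integral_ylog_piece:
 assumes h [measurable]: "h : borel_measurable borel" and j: "j < n"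
 shows "(\<integral>\<^sup>+ l \<in> over (B j). h (ylog D l) \<partial>\<nu>) = ennreal (2 * pi) * vol_base j * (\<integral>\<^sup>+ y. ennreal (ydens y) * h y \<partial>lborel)"
proof -
 have em: "ennreal (a * (b * d)) = ennreal a * (ennreal b * ennreal d)" if "a >= 0" "b >= 0" "d >= 0" for a b d
  using that by (simp add: ennreal_mult)
 let ?\<Omega> = "{q : cimg (c j) UNIV. base_part q : Bi j}"
 let ?f = "%q. (ennreal (dens (c j) q) * h (Yc (c j) q)) * indicator ?\<Omega> q"
 have O: "?\<Omega> : sets borel"
  using distr_chart(1)[OF chart_measurable_ylog cB(1)[OF j] over_sets[OF j] Bi(4)[OF j]] unfolding over_Bi[OF j] .
 have sub: "?\<Omega> \<subseteq> cimg (c j) UNIV" by blast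
 have rs: "k : borel_measurable (restrict_space borel ?\<Omega>)" if "continuous_on (cimg (c j) UNIV) k" for k :: "_ => real"
  by (rule borel_measurable_continuous_on_restrict[OF continuous_on_subset[OF that sub]])
 have fm: "?f : borel_measurable borel"
 proof -
  have "(%q. ennreal (dens (c j) q) * h (Yc (c j) q)) : borel_measurable (restrict_space borel ?\<Omega>)"
   using rs[OF continuous_dens[OF cB(1)[OF j]]] rs[OF continuous_Yc[OF cB(1)[OF j]]] h by measurable
  thus ?thesis using O by (subst (asm) borel_measurable_restrict_space_iff_ennreal) auto
 qed
 have "(\<integral>\<^sup>+ l \<in> over (B j). h (ylog D l) \<partial>\<nu>) = (\<integral>\<^sup>+ q. ?f q \<partial>lborel)"
  unfolding nn_integral_piece[OF chart_measurable_ylog h j]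
  by (intro nn_integral_cong) (auto simp: ylog_ich[OF cB(1)[OF j]] split: split_indicator)
 also have "... = (\<integral>\<^sup>+ w. \<integral>\<^sup>+ \<zeta>. ?f (join w \<zeta>) \<partial>lborel \<partial>lborel)" by (rule nn_integral_join[OF fm])
 also have "... = (\<integral>\<^sup>+ w. (ennreal (cvol x (c j) w) * indicator (Bi j) w) * (ennreal (2 * pi) * (\<integral>\<^sup>+ y. ennreal (ydens y) * h y \<partial>lborel)) \<partial>lborel)"
 proof (rule nn_integral_cong)
  fix w :: "complex^'d"
  show "(\<integral>\<^sup>+ \<zeta>. ?f (join w \<zeta>) \<partial>lborel) = (ennreal (cvol x (c j) w) * indicator (Bi j) w) * (ennreal (2 * pi) * (\<integral>\<^sup>+ y. ennreal (ydens y) * h y \<partial>lborel))"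
  proof (cases "w : Bi j")
   case True
   hence w: "w : bimg (c j)" using Bi(2)[OF j] by blast
   let ?k = "%y. ennreal (ydens y) * h y"
   have "(\<integral>\<^sup>+ \<zeta>. ?f (join w \<zeta>) \<partial>lborel) = (\<integral>\<^sup>+ \<zeta>. ennreal (cvol x (c j) w) * (?k (ln (cmod \<zeta>) - rho (c j) w) * ennreal (1 / (cmod \<zeta>)^2)) \<partial>lborel)"
   proof (rule nn_integral_cong_AE, rule AE_mp[OF AE_lborel_singleton[of 0]], rule AE_I2, rule impI)
    fix \<zeta> :: complex assume z: "\<zeta> ~= 0"
    have m: "join w \<zeta> : ?\<Omega>" using dens_join(1)[OF j w z] True by simp
    have "ennreal (dens (c j) (join w \<zeta>)) = ennreal (cvol x (c j) w) * (ennreal (ydens (ln (cmod \<zeta>) - rho (c j) w)) * ennreal (1 / (cmod \<zeta>)^2))"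
     unfolding dens_join(2)[OF j w z]
     by (rule em) (use ydens_nonneg less_imp_le[OF cvol_nonneg[OF cB(1)[OF j] w]] in simp_all)
    thus "?f (join w \<zeta>) = ennreal (cvol x (c j) w) * (?k (ln (cmod \<zeta>) - rho (c j) w) * ennreal (1 / (cmod \<zeta>)^2))"
     using m by (simp add: Yc_def mult_ac)
   qed
   also have "... = ennreal (cvol x (c j) w) * (\<integral>\<^sup>+ \<zeta>. ?k (ln (cmod \<zeta>) - rho (c j) w) * ennreal (1 / (cmod \<zeta>)^2) \<partial>lborel)"
    by (rule nn_integral_cmult) measurable
   also have "... = ennreal (cvol x (c j) w) * (ennreal (2 * pi) * (\<integral>\<^sup>+ y. ?k y \<partial>lborel))"
    by (subst nn_integral_radial) simp_all
   finally show ?thesis using True by simp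
  qed simp
 qed
 also have "... = vol_base j * (ennreal (2 * pi) * (\<integral>\<^sup>+ y. ennreal (ydens y) * h y \<partial>lborel))" unfolding vol_base_def
 proof (rule nn_integral_multc)
  have "cvol x (c j) : borel_measurable (restrict_space borel (Bi j))"
   by (rule borel_measurable_continuous_on_restrict[OF continuous_on_subset[OF continuous_on_cvol[OF cB(1)[OF j] x] Bi(2)[OF j]]])
  hence "(%w. ennreal (cvol x (c j) w)) : borel_measurable (restrict_space borel (Bi j))" by measurable
  thus "(%w. ennreal (cvol x (c j) w) * indicator (Bi j) w) : borel_measurable lborel"
   using Bi(1)[OF j] by (subst (asm) borel_measurable_restrict_space_iff_ennreal) auto
 qed
 finally show ?thesis by (simp add: mult_ac)
qed

lemma mass: "ennreal mass = (\<Sum>j<n. ennreal (2 * pi) * vol_base j)" "mass > 0"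
proof -
 have fin: "(\<Sum>j<n. vol_base j) < \<infinity>" using Bi(3) by simp
 thus *: "ennreal mass = (\<Sum>j<n. ennreal (2 * pi) * vol_base j)" unfolding mass_def sum_distrib_left[symmetric]
  by (subst ennreal_mult) (simp_all only: ennreal_enn2real infinity_ennreal_def enn2real_nonneg, simp)
 \<comment> \<open>An open nonempty set carrying a positive density cannot have volume 0.\<close>
 have "vol_base 0 ~= 0"
 proof
  assume "vol_base 0 = 0"
  have b: "Bi 0 \<subseteq> bimg (c 0)" "Bi 0 ~= {}" "open (Bi 0)" using Bi(2) Bpos by (auto simp: Bi_def)
  have "cvol x (c 0) : borel_measurable (restrict_space borel (Bi 0))"
   by (rule borel_measurable_continuous_on_restrict[OF continuous_on_subset[OF continuous_on_cvol[OF cB(1)[OF Bpos(1)] x] b(1)]])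
  hence "(%w. ennreal (cvol x (c 0) w)) : borel_measurable (restrict_space borel (Bi 0))" by measurable
  hence m: "(%w. ennreal (cvol x (c 0) w) * indicator (Bi 0) w) : borel_measurable lborel"
   using Bi(1)[OF Bpos(1)] by (subst (asm) borel_measurable_restrict_space_iff_ennreal) auto
  from \<open>vol_base 0 = 0\<close> have "AE w in lborel. ennreal (cvol x (c 0) w) * indicator (Bi 0) w = 0"
   unfolding vol_base_def nn_integral_0_iff_AE[OF m] .
  hence "AE w in lborel. w \<notin> Bi 0"
  proof eventually_elim
   case (elim w)
   thus ?case using cvol_nonneg[OF cB(1)[OF Bpos(1)], of w] b(1) by (auto simp: indicator_def split: if_splits)
  qed
  hence "Bi 0 : null_sets lborel" using b(3) by (subst (asm) AE_iff_null_sets[symmetric]) auto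
  hence "negligible (Bi 0)" using b(3) by (simp add: negligible_iff_null_sets null_sets_completionI)
  thus False using open_not_negligible b by blast
 qed
 hence "ennreal (2 * pi) * vol_base 0 > 0" by (simp add: ennreal_zero_less_mult_iff zero_less_iff_neq_zero)
 also have "... <= (\<Sum>j<n. ennreal (2 * pi) * vol_base j)" using Bpos(1) by (intro member_le_sum) auto
 finally show "mass > 0" unfolding *[symmetric] by simp
qed

theorem nn_integral_ylog:
 assumes [measurable]: "h : borel_measurable borel"
 shows "(\<integral>\<^sup>+ l. h (ylog D l) \<partial>\<nu>) = ennreal mass * (\<integral>\<^sup>+ y. ennreal (ydens y) * h y \<partial>lborel)"
proof -
 have "(\<integral>\<^sup>+ l. h (ylog D l) \<partial>\<nu>) = (\<Sum>j<n. \<integral>\<^sup>+ l \<in> over (B j). h (ylog D l) \<partial>\<nu>)" by (rule nn_integral_pieces) measurable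
 also have "... = (\<Sum>j<n. ennreal (2 * pi) * vol_base j * (\<integral>\<^sup>+ y. ennreal (ydens y) * h y \<partial>lborel))"
  by (intro sum.cong refl nn_integral_ylog_piece assms) simp
 finally show ?thesis by (simp add: mass(1) sum_distrib_right)
qed

lemma has_bochner_integral_ydens:
 assumes \<phi>: "continuous_on {-1..1} \<phi>"
 shows "has_bochner_integral lborel (%y. ydens y * \<phi> (momentum u y)) (integral {-1..1} (%z. \<phi> z * p_c D x z))"
proof -
 have pc: "continuous_on {-1..1} (%z. \<phi> z * p_c D x z)" unfolding p_c_def by (intro continuous_intros \<phi>)
 have Th: "continuous_on {-1<..<1} (%z. 1 / deriv (deriv u) z)"
  by (rule smooth_line_continuous[OF potentials_deriv2(2)[OF u \<kappa>]])
 have "has_bochner_integral lborel (%y. (\<phi> (momentum u y) * p_c D x (momentum u y)) * (1 / deriv (deriv u) (momentum u y))) (integral {-1..1} (%z. \<phi> z * p_c D x z))"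
  using momentum(1,2)[OF u \<kappa>] momentum_deriv[OF u \<kappa>] momentum_at_top[OF u \<kappa>] potentials_deriv2(3)[OF u \<kappa>] Th pc
  by (intro integral_momentum_substitution) auto
 thus ?thesis by (rule has_bochner_integral_cong[THEN iffD1, rotated 3]) (simp_all add: ydens_def)
qed

lemma measurable_momentum_comp:
 assumes \<phi>: "continuous_on {-1..1} \<phi>"
 shows "(%y. \<phi> (momentum u y)) : borel_measurable borel"
 by (rule borel_measurable_continuous_onI, rule continuous_on_compose2[OF \<phi> continuous_momentum])
  (use mom_in in \<open>auto simp: less_imp_le\<close>)

text \<open>From nonnegative to signed functions: the push-forward of \<open>\<nu>\<close> under
  \<open>ylog D\<close> is identified as a measure, and then the substitution
  \<open>z = momentum u y\<close> is applied.\<close>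

theorem has_bochner_integral_zfun:
 assumes \<phi>: "continuous_on {-1..1} \<phi>"
 shows "has_bochner_integral \<nu> (%l. \<phi> (zfun D u l)) (mass * integral {-1..1} (%z. \<phi> z * p_c D x z))"
proof -
 note hb = has_bochner_integral_ydens[OF \<phi>] and m\<phi> = measurable_momentum_comp[OF \<phi>]
 have "distr \<nu> borel (ylog D) = density lborel (%y. ennreal (mass * ydens y))"
 proof (rule measure_eqI)
  fix S assume "S : sets (distr \<nu> borel (ylog D))"
  hence [measurable]: "S : sets borel" by simp
  have "emeasure (distr \<nu> borel (ylog D)) S = (\<integral>\<^sup>+ y. indicator S y \<partial>distr \<nu> borel (ylog D))" by simp
  also have "... = (\<integral>\<^sup>+ l. indicator S (ylog D l) \<partial>\<nu>)" by (rule nn_integral_distr) measurable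
  also have "... = ennreal mass * (\<integral>\<^sup>+ y. ennreal (ydens y) * indicator S y \<partial>lborel)"
   by (rule nn_integral_ylog) measurable
  also have "... = (\<integral>\<^sup>+ y. ennreal mass * (ennreal (ydens y) * indicator S y) \<partial>lborel)"
   by (rule nn_integral_cmult[symmetric]) measurable
  also have "... = (\<integral>\<^sup>+ y. ennreal (mass * ydens y) * indicator S y \<partial>lborel)"
   using mass(2) ydens_nonneg by (intro nn_integral_cong) (simp add: ennreal_mult mult.assoc)
  also have "... = emeasure (density lborel (%y. ennreal (mass * ydens y))) S"
   by (rule emeasure_density[symmetric]) measurable
  finally show "emeasure (distr \<nu> borel (ylog D)) S = emeasure (density lborel (%y. ennreal (mass * ydens y))) S" .
 qed simp
 hence "has_bochner_integral (distr \<nu> borel (ylog D)) (%y. \<phi> (momentum u y)) (mass * integral {-1..1} (%z. \<phi> z * p_c D x z))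
  \<longleftrightarrow> has_bochner_integral lborel (%y. mass * (ydens y * \<phi> (momentum u y))) (mass * integral {-1..1} (%z. \<phi> z * p_c D x z))"
  using has_bochner_integral_density[of "%y. \<phi> (momentum u y)" lborel "%y. mass * ydens y"] m\<phi> mass(2) ydens_nonneg
  by (simp add: mult.assoc has_bochner_integral_iff integrable_density integral_density)
 hence "has_bochner_integral (distr \<nu> borel (ylog D)) (%y. \<phi> (momentum u y)) (mass * integral {-1..1} (%z. \<phi> z * p_c D x z))"
  using has_bochner_integral_mult_right[OF hb, of mass] by simp
 thus ?thesis using m\<phi> by (simp add: has_bochner_integral_iff integrable_distr_eq integral_distr zfun_def)
qed

end

section \<open>Killing potentials\<close>

lemma axis_nth_None [simp]: "(axis None a :: complex^('d::finite option)) $ None = a" by (simp add: axis_def)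

context admissible
begin

lemma smooth_dirD_axis:
 assumes c: "c : bundle_charts D" and F: "smooth_in UNIV (cimg c UNIV) F"
 shows "smooth_in UNIV (cimg c UNIV) (%q. dirD F q (axis None (k * q $ None)) :: real)"
proof -
 have op: "open (cimg c UNIV)" by (rule open_cimg[OF c open_UNIV])
 note ro = relopen_UNIV[OF op]
 have eq: "dirD F q (axis None (k * q $ None)) = Re (k * q $ None) * dirD F q (axis None 1) + Im (k * q $ None) * dirD F q (axis None \<i>)"
  if q: "q : cimg c UNIV" for q
 proof -
  have "Ck_on 1 UNIV (cimg c UNIV) F" using F by (simp add: smooth_in_def)
  hence l: "linear (dirD F q)" by (rule has_derivative_linear[OF has_derivative_of_C1[OF op _ q]])
  have "axis None (k * q $ None) = Re (k * q $ None) *\<^sub>R axis None 1 + Im (k * q $ None) *\<^sub>R (axis None \<i> :: complex^('d option))"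
   by (simp add: vec_eq_iff axis_def complex_eq_iff)
  thus ?thesis using linear_add[OF l] linear_scale[OF l] by simp
 qed
 have b: "bounded_linear (%q::complex^('d option). Re (k * q $ None))" "bounded_linear (%q::complex^('d option). Im (k * q $ None))"
  by (intro bounded_linear_compose[OF bounded_linear_Re] bounded_linear_compose[OF bounded_linear_Im]
    bounded_linear_compose[OF bounded_linear_mult_right bounded_linear_vec_nth])+
 have "smooth_in UNIV (cimg c UNIV) (%q. Re (k * q $ None) * dirD F q (axis None 1) + Im (k * q $ None) * dirD F q (axis None \<i>))"
  by (intro smooth_in_add smooth_in_mult ro smooth_in_linear b smooth_in_dirD F UNIV_I)
 thus ?thesis by (subst smooth_in_cong[OF ro eq]) auto
qed

text \<open>Logarithmic polar coordinates in a fibre: \<open>t\<close> is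
  \<open>ln |\<zeta>|\<close> and \<open>\<alpha>\<close> the angle. The coordinate fields are
  \<open>\<zeta>\<close> and \<open>\<i> \<zeta>\<close>, written below with a factor
  \<open>1\<close> or \<open>\<i>\<close> so that they have a common form.\<close>

definition fib :: "complex^'d => real => real => complex^('d option)" where "fib w t \<alpha> = join w (exp (Complex t \<alpha>))"

lemma fib_in: "w : bimg c ==> fib w t \<alpha> : cimg c UNIV" by (simp add: fib_def cimg_def)

lemma fib_parts [simp]: "base_part (fib w t \<alpha>) = w" "fib w t \<alpha> $ None = exp (Complex t \<alpha>)" by (simp_all add: fib_def)

lemma Yc_fib: "Yc c (fib w t \<alpha>) = t - rho c w" by (simp add: Yc_def)

lemma join_eq: "join w (\<zeta> + k) = join w \<zeta> + (axis None k :: complex^('d option))"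
 by (auto simp: vec_eq_iff axis_def join_def split: option.splits)

lemma has_vector_derivative_join:
 assumes "(g has_vector_derivative g') (at t)"
 shows "((%t. join w (g t)) has_vector_derivative (axis None g' :: complex^('d option))) (at t)"
proof -
 have "bounded_linear (%k. axis None k :: complex^('d option))"
  by (intro linear_linear[THEN iffD2] linearI) (simp_all add: vec_eq_iff axis_def)
 from bounded_linear.has_vector_derivative[OF this assms]
 have "((%t. join w 0 + axis None (g t) :: complex^('d option)) has_vector_derivative axis None g') (at t)"
  by (intro derivative_eq_intros) auto
 thus ?thesis by (simp add: join_eq[symmetric])
qed

lemma fib_deriv: "((%t. fib w t \<alpha>) has_vector_derivative axis None (1 * fib w t \<alpha> $ None)) (at t)"
 "((%\<alpha>. fib w t \<alpha>) has_vector_derivative axis None (\<i> * fib w t \<alpha> $ None)) (at \<alpha>)"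
proof -
 have "((%t. exp (Complex t \<alpha>)) has_vector_derivative exp (Complex t \<alpha>)) (at t)"
 proof -
  have "((%t. of_real t + Complex 0 \<alpha>) has_vector_derivative 1) (at t)" by (auto intro!: derivative_eq_intros)
  hence "((%t. exp (of_real t + Complex 0 \<alpha>)) has_vector_derivative 1 * exp (of_real t + Complex 0 \<alpha>)) (at t)"
   using field_vector_diff_chain_at[of "%t. of_real t + Complex 0 \<alpha>" 1 t exp] by (simp add: o_def)
  moreover have e: "of_real t + Complex 0 \<alpha> = Complex t \<alpha>" for t by (simp add: complex_eq_iff)
  ultimately show ?thesis unfolding e mult_1 by -
 qed
 from has_vector_derivative_join[OF this, of w]
 show "((%t. fib w t \<alpha>) has_vector_derivative axis None (1 * fib w t \<alpha> $ None)) (at t)"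
  unfolding fib_def join_nth mult_1 .
 have "((%\<alpha>. exp (Complex t \<alpha>)) has_vector_derivative \<i> * exp (Complex t \<alpha>)) (at \<alpha>)"
 proof -
  have e: "of_real t + \<i> * of_real \<alpha> = Complex t \<alpha>" for \<alpha> by (simp add: complex_eq_iff)
  have "((%\<alpha>. of_real t + \<i> * of_real \<alpha>) has_vector_derivative \<i>) (at \<alpha>)" by (auto intro!: derivative_eq_intros)
  from field_vector_diff_chain_at[OF this DERIV_exp] show ?thesis unfolding e o_def .
 qed
 from has_vector_derivative_join[OF this, of w]
 show "((%\<alpha>. fib w t \<alpha>) has_vector_derivative axis None (\<i> * fib w t \<alpha> $ None)) (at \<alpha>)" unfolding fib_def join_nth .
qed

lemma DERIV_fib:
 assumes c: "c : bundle_charts D" and w: "w : bimg c" and F: "smooth_in UNIV (cimg c UNIV) (F :: _ => real)"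
 shows "((%t. F (fib w t \<alpha>)) has_real_derivative dirD F (fib w t \<alpha>) (axis None (1 * fib w t \<alpha> $ None))) (at t)"
  "((%\<alpha>. F (fib w t \<alpha>)) has_real_derivative dirD F (fib w t \<alpha>) (axis None (\<i> * fib w t \<alpha> $ None))) (at \<alpha>)"
proof -
 have "Ck_on 1 UNIV (cimg c UNIV) F" using F by (simp add: smooth_in_def)
 hence d: "(F has_derivative dirD F (fib w t \<alpha>)) (at (fib w t \<alpha>))"
  by (rule has_derivative_of_C1[OF open_cimg[OF c open_UNIV] _ fib_in[OF w]])
 have "((F \<circ> (%t. fib w t \<alpha>)) has_vector_derivative dirD F (fib w t \<alpha>) (axis None (1 * fib w t \<alpha> $ None))) (at t)"
  by (rule vector_derivative_diff_chain_within[OF fib_deriv(1)]) (rule has_derivative_at_withinI[OF d])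
 thus "((%t. F (fib w t \<alpha>)) has_real_derivative dirD F (fib w t \<alpha>) (axis None (1 * fib w t \<alpha> $ None))) (at t)"
  by (simp add: real_deriv_vec o_def)
 have "((F \<circ> (%\<alpha>. fib w t \<alpha>)) has_vector_derivative dirD F (fib w t \<alpha>) (axis None (\<i> * fib w t \<alpha> $ None))) (at \<alpha>)"
  by (rule vector_derivative_diff_chain_within[OF fib_deriv(2)]) (rule has_derivative_at_withinI[OF d])
 thus "((%\<alpha>. F (fib w t \<alpha>)) has_real_derivative dirD F (fib w t \<alpha>) (axis None (\<i> * fib w t \<alpha> $ None))) (at \<alpha>)"
  by (simp add: real_deriv_vec o_def)
qed

lemma continuous_fib:
 assumes w: "w : bimg c" and F: "continuous_on (cimg c UNIV) F"
 shows "continuous_on S (%p. F (fib w (fst p) (snd p)))"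
proof (rule continuous_on_compose2[OF F])
 have "continuous_on S (%p. (w, exp (Complex (fst p) (snd p))))" unfolding Complex_eq by (intro continuous_intros)
 from continuous_on_compose2[OF continuous_on_join this] show "continuous_on S (%p. fib w (fst p) (snd p))"
  by (simp add: fib_def)
qed (use fib_in[OF w] in auto)

end

lemma i_div: "Re (\<i> * a / b) = - Im (a / b)" "Im (\<i> * a / b) = Re (a / b)"
 by (simp_all only: times_divide_eq_right[symmetric] Re_i_times Im_i_times)

lemma Re_bilinear_has_derivative:
 fixes z k g' :: complex
 assumes z: "z ~= 0" and g: "(g has_vector_derivative g') (at 0)"
 shows "((%t::real. Re (g t / (z + of_real t * k))) has_real_derivative Re (g' / z - g 0 * k / z\<^sup>2)) (at 0)"
proof -
 have l: "((%t::real. z + of_real t * k) has_vector_derivative k) (at 0)" by (auto intro!: derivative_eq_intros)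
 have "(inverse has_field_derivative - (inverse z ^ Suc (Suc 0))) (at (z + of_real 0 * k))"
  using DERIV_inverse[OF z] by simp
 from field_vector_diff_chain_at[OF l this]
 have "((%t::real. inverse (z + of_real t * k)) has_vector_derivative k * - (inverse z ^ Suc (Suc 0))) (at 0)"
  unfolding o_def .
 moreover have "k * - (inverse z ^ Suc (Suc 0)) = - (k / z\<^sup>2)" by (simp add: power2_eq_square divide_inverse)
 ultimately have "((%t::real. inverse (z + of_real t * k)) has_vector_derivative - (k / z\<^sup>2)) (at 0)" by (simp only:)
 hence "((%t::real. g t * inverse (z + of_real t * k)) has_vector_derivative g 0 * (- (k / z\<^sup>2)) + g' * inverse z) (at 0)"
  using has_vector_derivative_mult[OF g, of "%t. inverse (z + of_real t * k)" "- (k / z\<^sup>2)"] by simp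
 from bounded_linear.has_vector_derivative[OF bounded_linear_Re this] show ?thesis
  unfolding real_deriv_vec divide_inverse[of "g _"]
  by (rule has_vector_derivative_eq_rhs) (rule arg_cong[where f = Re], simp add: divide_inverse mult.assoc)
qed

context adm_chart
begin

lemma dirD_Yc_axis:
 assumes q: "q : cimg c K"
 shows "dirD (Yc c) q (axis None a) = Re (a / q $ None)" "dirD (Yc c) q (\<i> *s axis None a) = - Im (a / q $ None)"
proof -
 have qU: "q : cimg c UNIV" using q cimg_mono[of K UNIV c] by blast
 show *: "dirD (Yc c) q (axis None a) = Re (a / q $ None)" for a
  using dirD_Yc[OF c qU, of "axis None a"] by (simp add: dirD_zero)
 have "Re (\<i> * b) = - Im b" for b by simp
 from this[of "a / q $ None"] *[of "\<i> * a"] show "dirD (Yc c) q (\<i> *s axis None a) = - Im (a / q $ None)"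
  by (simp only: i_smult_axis times_divide_eq_right)
qed

lemma G_axis:
 assumes q: "q : cimg c K"
 shows "G q v (axis None a) = \<Theta> (Z (Yc c q)) * (dirD (Yc c) q v * Re (a / q $ None) - dirD (Yc c) q (\<i> *s v) * Im (a / q $ None))"
  "G q (axis None a) v = \<Theta> (Z (Yc c q)) * (dirD (Yc c) q v * Re (a / q $ None) - dirD (Yc c) q (\<i> *s v) * Im (a / q $ None))"
proof -
 note bl = base_metric_props(1)[OF c cimgD(1)[OF q]]
 show "G q v (axis None a) = \<Theta> (Z (Yc c q)) * (dirD (Yc c) q v * Re (a / q $ None) - dirD (Yc c) q (\<i> *s v) * Im (a / q $ None))"
  unfolding G_eq[OF q] dirD_Yc_axis[OF q] by (simp add: bilinear_rzero[OF bl])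
 show "G q (axis None a) v = \<Theta> (Z (Yc c q)) * (dirD (Yc c) q v * Re (a / q $ None) - dirD (Yc c) q (\<i> *s v) * Im (a / q $ None))"
  unfolding G_eq[OF q] dirD_Yc_axis[OF q] by (simp add: bilinear_lzero[OF bl])
qed

text \<open>Polar coordinates in the fibre: \<open>E = \<zeta> \<partial>/\<partial>\<zeta>\<close> and \<open>\<i> E\<close>. The Killing equation, evaluated on \<open>(E, \<i> E)\<close>, says that the
derivative of \<open>E f / \<Theta>\<close> along \<open>E\<close> equals that of \<open>\<i> E f / \<Theta>\<close> along \<open>\<i> E\<close>; the latter integrates to zero over circles.\<close>

theorem killing_ode:
 assumes f: "smooth_in UNIV (cimg c K) f" and gr: "is_gradient (cimg c K) G f Gr"
  and kf: "killing_field (cimg c K) G (%q. \<i> *s Gr q)" and q: "q : cimg c K"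
 shows "dirD (%q. dirD f q (axis None (1 * q $ None)) / \<Theta> (Z (Yc c q))) q (axis None (1 * q $ None))
  = dirD (%q. dirD f q (axis None (\<i> * q $ None)) / \<Theta> (Z (Yc c q))) q (axis None (\<i> * q $ None))"
proof -
 define X where "X q = \<i> *s Gr q" for q
 have Xs: "smooth_in UNIV (cimg c K) X" using kf unfolding killing_field_def X_def by blast
 have kill: "dirD (%p. G p v w) p (X p) + G p (dirD X p v) w + G p v (dirD X p w) = 0" if "p : cimg c K" for p v w
  using kf that unfolding killing_field_def X_def by blast
 have grad: "G p (Gr p) v = dirD f p v" if "p : cimg c K" for p v using gr that unfolding is_gradient_def by blast
 let ?e = "%k p. axis None (k * p $ None) :: complex^('d option)"
 have iX: "\<i> *s X p = - Gr p" for p by (simp add: X_def vec_eq_iff)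
 have pos: "\<Theta> (Z (Yc c p)) ~= 0" if "p : cimg c K" for p using \<Theta>(2)[OF Z(1)[OF cimgD(3)[OF that]]] by simp
 have A: "dirD f p (?e 1 p) / \<Theta> (Z (Yc c p)) = - dirD (Yc c) p (\<i> *s X p)" if p: "p : cimg c K" for p
  using G_axis(1)[OF p, of "Gr p" "1 * p $ None"] grad[OF p] pos[OF p] cimgD(2)[OF p]
  by (simp add: iX linear_neg[OF dirD_Yc_linear[OF p]])
 have B: "dirD f p (?e \<i> p) / \<Theta> (Z (Yc c p)) = - dirD (Yc c) p (X p)" if p: "p : cimg c K" for p
  using G_axis(1)[OF p, of "Gr p" "\<i> * p $ None"] grad[OF p] pos[OF p] cimgD(2)[OF p] by (simp add: X_def)
 \<comment> \<open>Along the fibre direction \<open>rho\<close> does not change, so besides the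
   derivative of \<open>X\<close> only the denominator from \<open>ln |\<zeta>|\<close>
   contributes.\<close>
 have C: "dirD (%p. - dirD (Yc c) p (j *s X p)) q (?e k q) = - dirD (Yc c) q (j *s dirD X q (?e k q)) + Re (j * X q $ None * k / q $ None)"
  for j k :: complex
 proof -
  define w where "w = base_part q"
  let ?v = "?e k q"
  have dr: "linear (dirD (rho c) w)"
  proof -
   have "Ck_on 1 UNIV (bimg c) (rho c)" using hpot(2)[OF c] by (simp add: smooth_in_def)
   from has_derivative_of_C1[OF open_bimg[OF c] this] cimgD(1)[OF q] show ?thesis
    unfolding w_def by (blast intro: has_derivative_linear)
  qed
  have "((%t. X (q + t *\<^sub>R ?v)) has_vector_derivative dirD X q ?v) (at 0)"
   using smooth_in_ddiff[OF Xs q UNIV_I] by (simp add: ddiff_works)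
  hence Xd: "((%t. j *s X (q + t *\<^sub>R ?v)) has_vector_derivative j *s dirD X q ?v) (at 0)"
   by (rule bounded_linear.has_vector_derivative[rotated])
    (intro linear_linear[THEN iffD2] linearI; simp add: vec_eq_iff algebra_simps)
  have d1: "((%t. (j *s X (q + t *\<^sub>R ?v)) $ None) has_vector_derivative (j *s dirD X q ?v) $ None) (at 0)"
   by (rule bounded_linear.has_vector_derivative[OF bounded_linear_vec_nth Xd])
  have d2: "((%t. dirD (rho c) w (base_part (j *s X (q + t *\<^sub>R ?v)))) has_vector_derivative dirD (rho c) w (base_part (j *s dirD X q ?v))) (at 0)"
   by (rule bounded_linear.has_vector_derivative[OF linear_linear[THEN iffD2, OF dr] bounded_linear.has_vector_derivative[OF bounded_linear_base_part Xd]])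
  have d3: "((%t. Re ((j *s X (q + t *\<^sub>R ?v)) $ None / (q $ None + of_real t * (k * q $ None)))) has_real_derivative
    Re ((j *s dirD X q ?v) $ None / q $ None - (j *s X (q + 0 *\<^sub>R ?v)) $ None * (k * q $ None) / (q $ None)^2)) (at 0)"
   by (rule Re_bilinear_has_derivative[where g = "%t. (j *s X (q + t *\<^sub>R ?v)) $ None", OF cimgD(2)[OF q] d1])
  let ?F = "%t. - (Re ((j *s X (q + t *\<^sub>R ?v)) $ None / (q $ None + of_real t * (k * q $ None))) - dirD (rho c) w (base_part (j *s X (q + t *\<^sub>R ?v))))"
  let ?d = "- (Re ((j *s dirD X q ?v) $ None / q $ None - (j *s X (q + 0 *\<^sub>R ?v)) $ None * (k * q $ None) / (q $ None)^2) - dirD (rho c) w (base_part (j *s dirD X q ?v)))"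
  have dF: "(?F has_vector_derivative ?d) (at 0)" unfolding real_deriv_vec[symmetric]
   by (intro DERIV_minus DERIV_diff d3 d2[folded real_deriv_vec])
  have ev: "\<forall>\<^sub>F t in nhds 0. - dirD (Yc c) (q + t *\<^sub>R ?v) (j *s X (q + t *\<^sub>R ?v)) = ?F t"
   using relopen_line[OF ro q UNIV_I, of ?v]
  proof eventually_elim
   case (elim t)
   hence "q + t *\<^sub>R ?v : cimg c UNIV" using cimg_mono[of K UNIV c] by blast
   moreover have "base_part (q + t *\<^sub>R ?v) = w" by (simp add: w_def vec_eq_iff axis_def)
   moreover have "(q + t *\<^sub>R ?v) $ None = q $ None + of_real t * (k * q $ None)"
    by (simp only: vector_add_component vector_scaleR_component axis_nth_None scaleR_conv_of_real[of t "k * q $ None"])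
   ultimately show ?case using dirD_Yc[OF c, of "q + t *\<^sub>R ?v"] by simp
  qed
  have "((%t. - dirD (Yc c) (q + t *\<^sub>R ?v) (j *s X (q + t *\<^sub>R ?v))) has_vector_derivative ?d) (at 0)"
   by (rule has_vector_derivative_cong_ev[where g = ?F, THEN iffD2, OF _ _ dF])
    (rule eventually_mono[OF ev], simp, rule eventually_nhds_x_imp_x[OF ev])
  hence "dirD (%p. - dirD (Yc c) p (j *s X p)) q ?v = ?d" by (rule dirDI(1))
  also have "... = - dirD (Yc c) q (j *s dirD X q ?v) + Re (j * X q $ None * k / q $ None)"
  proof -
   have "q : cimg c UNIV" using q cimg_mono[of K UNIV c] by blast
   from dirD_Yc[OF c this, of "j *s dirD X q ?v"]
   have "dirD (Yc c) q (j *s dirD X q ?v) = Re ((j *s dirD X q ?v) $ None / q $ None) - dirD (rho c) w (base_part (j *s dirD X q ?v))"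
    by (simp only: w_def)
   moreover have "(j *s X (q + 0 *\<^sub>R ?v)) $ None * (k * q $ None) / (q $ None)^2 = j * X q $ None * k / q $ None"
    using cimgD(2)[OF q] by (simp add: power2_eq_square)
   ultimately show ?thesis by (simp only: minus_complex.sel)
  qed
  finally show ?thesis .
 qed
 \<comment> \<open>The two vectors are frozen at \<open>q\<close>; one is \<open>\<i>\<close> times
   the other and both are vertical, so their metric product is 0 at every \<open>p\<close>, and the
   first term of the Killing equation drops out.\<close>
 have "dirD (%p. G p (?e 1 q) (?e \<i> q)) q (X q) = 0"
 proof -
  have "G p (?e 1 q) (?e \<i> q) = 0" if p: "p : cimg c K" for p
   unfolding G_axis(1)[OF p] dirD_Yc_axis[OF p] i_div mult_1 by simp
  hence "dirD (%p. G p (?e 1 q) (?e \<i> q)) q (X q) = dirD (%p. 0) q (X q)" by (intro dirD_cong(1)[OF ro q UNIV_I])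
  thus ?thesis by (simp add: dirD_const)
 qed
 with kill[OF q, of "?e 1 q" "?e \<i> q"]
 have "G q (dirD X q (?e 1 q)) (?e \<i> q) + G q (?e 1 q) (dirD X q (?e \<i> q)) = 0" by simp
 hence K: "dirD (Yc c) q (\<i> *s dirD X q (?e 1 q)) = dirD (Yc c) q (dirD X q (?e \<i> q))"
  unfolding G_axis[OF q] using pos[OF q] cimgD(2)[OF q] by simp
 have "dirD (%q. dirD f q (?e 1 q) / \<Theta> (Z (Yc c q))) q (?e 1 q) = dirD (%p. - dirD (Yc c) p (\<i> *s X p)) q (?e 1 q)"
  by (rule dirD_cong(1)[OF ro q UNIV_I A])
 also have "... = dirD (%p. - dirD (Yc c) p (1 *s X p)) q (?e \<i> q)" unfolding C using K by (simp add: mult.commute)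
 also have "... = dirD (%q. dirD f q (?e \<i> q) / \<Theta> (Z (Yc c q))) q (?e \<i> q)"
  by (rule dirD_cong(1)[OF ro q UNIV_I, symmetric]) (simp add: B)
 finally show ?thesis .
qed

text \<open>The gradient of z is the radial field \<open>\<zeta>\<close> of the fibre, whatever the
  profile; multiplied by \<open>\<i>\<close> it generates the rotations of the fibres, which
  preserve the metric.\<close>

theorem affine_killing:
 fixes A B :: real defines "X \<equiv> %q. axis None (of_real A * q $ None)"
 shows "is_gradient (cimg c K) G (%q. A * Z (Yc c q) + B) X" "killing_field (cimg c K) G (%q. \<i> *s X q)"
proof -
 show "is_gradient (cimg c K) G (%q. A * Z (Yc c q) + B) X" unfolding is_gradient_def
 proof (intro ballI allI)
  fix q v assume q: "q : cimg c K"
  have "((%y. A * Z y + B) has_real_derivative A * \<Theta> (Z (Yc c q))) (at (Yc c q))"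
   using Z(2)[OF cimgD(3)[OF q]] by (auto intro!: derivative_eq_intros)
  from dirD_compose_real(1)[where f = "Yc c" and h = "%y. A * Z y + B", OF this smooth_in_ddiff[OF sY q UNIV_I], of v]
  show "G q (X q) v = dirD (%q. A * Z (Yc c q) + B) q v" unfolding X_def G_axis(2)[OF q] using cimgD(2)[OF q] by simp
 qed
 let ?L = "%v. axis None (\<i> * (of_real A * v $ None)) :: complex^('d option)"
 have iX: "\<i> *s X v = ?L v" for v by (simp add: X_def i_smult_axis)
 have L: "bounded_linear ?L"
  by (intro linear_linear[THEN iffD2] linearI) (simp_all add: vec_eq_iff axis_def algebra_simps)
 have dL: "dirD ?L q v = ?L v" for q v
  by (rule has_derivative_dirD(1)[OF bounded_linear.has_derivative[OF L has_derivative_ident]])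
 show "killing_field (cimg c K) G (%q. \<i> *s X q)" unfolding killing_field_def iX dL
 proof (intro conjI ballI allI)
  show "smooth_in UNIV (cimg c K) ?L" by (rule smooth_in_linear[OF L ro])
  fix q v w assume q: "q : cimg c K"
  define V where "V = ?L q"
  define w0 where "w0 = base_part q"
  define y where "y t = Yc c (q + t *\<^sub>R V)" for t
  define d where "d v t = Re (v $ None / (q $ None + of_real t * (\<i> * (of_real A * q $ None)))) - dirD (rho c) w0 (base_part v)" for v t
  define d' where "d' v = Re (- (v $ None) * (\<i> * (of_real A * q $ None)) / (q $ None)^2)" for v :: "complex^('d option)"
  have dd: "(d v has_real_derivative d' v) (at 0)" for v
  proof -
   have "((%t. Re (v $ None / (q $ None + of_real t * (\<i> * (of_real A * q $ None))))) has_real_derivative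
     Re (0 / q $ None - v $ None * (\<i> * (of_real A * q $ None)) / (q $ None)^2)) (at 0)"
    by (rule Re_bilinear_has_derivative[where g = "%t. v $ None", OF cimgD(2)[OF q] has_vector_derivative_const])
   from DERIV_diff[OF this DERIV_const] show ?thesis unfolding d_def[abs_def] d'_def by simp
  qed
  \<comment> \<open>\<open>Yc\<close> is stationary along a rotation, so all coefficients depending
    on z are too, and only the factors \<open>d v\<close> vary.\<close>
  have yd: "(y has_real_derivative 0) (at 0)"
  proof -
   have "ddiff (Yc c) q V" by (rule smooth_in_ddiff[OF sY q UNIV_I])
   hence "(y has_vector_derivative dirD (Yc c) q V) (at 0)" unfolding y_def[abs_def] ddiff_works .
   moreover have "dirD (Yc c) q V = 0" unfolding V_def dirD_Yc_axis(1)[OF q] using cimgD(2)[OF q] by simp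
   ultimately show ?thesis by (simp add: real_deriv_vec)
  qed
  have y0: "y 0 = Yc c q" by (simp add: y_def)
  have yK: "y 0 : K" unfolding y0 by (rule cimgD(3)[OF q])
  obtain \<Theta>' where Th: "(\<Theta> has_real_derivative \<Theta>') (at (Z (y 0)))"
  proof -
   obtain T where T: "!!z. z : I ==> (\<Theta> has_real_derivative T z) (at z within I)"
    using smooth_line_derivE[OF \<Theta>(1)] by blast
   from T[OF Z(1)[OF yK]] have "(\<Theta> has_real_derivative T (Z (y 0))) (at (Z (y 0)))"
    unfolding at_within_open[OF Z(1)[OF yK] opI] .
   thus ?thesis by (rule that)
  qed
  have "((%t. Z (y t)) has_real_derivative \<Theta> (Z (y 0)) * 0) (at 0)"
   by (rule DERIV_chain2[where f = Z and g = y, OF Z(2)[OF yK] yd])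
  hence Zd: "((%t. Z (y t)) has_real_derivative 0) (at 0)" by simp
  have "((%t. \<Theta> (Z (y t))) has_real_derivative \<Theta>' * 0) (at 0)"
   by (rule DERIV_chain2[where f = \<Theta> and g = "%t. Z (y t)", OF Th Zd])
  hence Td: "((%t. \<Theta> (Z (y t))) has_real_derivative 0) (at 0)" by simp
  have ld: "((%t. lam i (Z (y t)) * b) has_real_derivative 0) (at 0)" for i b
   unfolding lam_def using x[of i] by (auto intro!: derivative_eq_intros Zd)
  let ?F = "%t. (\<Sum>i\<in>UNIV. lam i (Z (y t)) * base_metric D (fst c) i w0 (base_part v) (base_part w))
    + \<Theta> (Z (y t)) * (d v t * d w t + d (\<i> *s v) t * d (\<i> *s w) t)"
  let ?D = "\<Theta> (Z (y 0)) * (d v 0 * d' w + d' v * d w 0 + (d (\<i> *s v) 0 * d' (\<i> *s w) + d' (\<i> *s v) * d (\<i> *s w) 0))"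
  have "(?F has_real_derivative (\<Sum>i\<in>(UNIV::'b set). 0) + (0 * (d v 0 * d w 0 + d (\<i> *s v) 0 * d (\<i> *s w) 0)
    + (d v 0 * d' w + d' v * d w 0 + (d (\<i> *s v) 0 * d' (\<i> *s w) + d' (\<i> *s v) * d (\<i> *s w) 0)) * \<Theta> (Z (y 0)))) (at 0)"
   by (intro DERIV_add DERIV_mult DERIV_sum ld Td DERIV_mult' dd)
  hence "(?F has_real_derivative ?D) (at 0)" by (simp add: mult.commute)
  hence dF: "(?F has_vector_derivative ?D) (at 0)" by (simp add: real_deriv_vec)
  have ev: "\<forall>\<^sub>F t in nhds 0. G (q + t *\<^sub>R V) v w = ?F t" using relopen_line[OF ro q UNIV_I, of V]
  proof eventually_elim
   case (elim t)
   have U: "q + t *\<^sub>R V : cimg c UNIV" using elim cimg_mono[of K UNIV c] by blast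
   have b: "base_part (q + t *\<^sub>R V) = w0" by (simp add: w0_def V_def vec_eq_iff axis_def)
   have "(q + t *\<^sub>R V) $ None = q $ None + of_real t * (\<i> * (of_real A * q $ None))"
    unfolding V_def by (simp only: vector_add_component vector_scaleR_component axis_nth_None scaleR_conv_of_real[of t "\<i> * (of_real A * q $ None)"])
   hence "dirD (Yc c) (q + t *\<^sub>R V) v = d v t" for v unfolding dirD_Yc[OF c U] b d_def by (simp only:)
   thus ?case unfolding G_eq[OF elim] b y_def[symmetric] by (simp only:)
  qed
  have "((%t. G (q + t *\<^sub>R V) v w) has_vector_derivative ?D) (at 0)"
   by (rule has_vector_derivative_cong_ev[where g = ?F, THEN iffD2, OF _ _ dF])
    (rule eventually_mono[OF ev], simp, rule eventually_nhds_x_imp_x[OF ev])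
  hence 1: "dirD (%p. G p v w) q V = ?D" by (rule dirDI(1))
  have qU: "q : cimg c UNIV" using q cimg_mono[of K UNIV c] by blast
  have d0: "dirD (Yc c) q v = d v 0" for v unfolding dirD_Yc[OF c qU] d_def w0_def by simp
  have d'q: "d' v = - Re (\<i> * (of_real A * v $ None) / q $ None)" "d' (\<i> *s v) = Im (\<i> * (of_real A * v $ None) / q $ None)" for v
  proof -
   have e: "- (u * (\<i> * (of_real A * q $ None)) / (q $ None)^2) = - (\<i> * (of_real A * u) / q $ None)" for u
    using cimgD(2)[OF q] by (simp add: power2_eq_square)
   show "d' v = - Re (\<i> * (of_real A * v $ None) / q $ None)" unfolding d'_def using e[of "v $ None"] by simp
   have "d' (\<i> *s v) = - Re (\<i> * (\<i> * (of_real A * v $ None)) / q $ None)"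
    unfolding d'_def using e[of "\<i> * v $ None"] by (simp add: mult.left_commute)
   thus "d' (\<i> *s v) = Im (\<i> * (of_real A * v $ None) / q $ None)" unfolding i_div by simp
  qed
  show "dirD (%p. G p v w) q (?L q) + G q (?L v) w + G q v (?L w) = 0"
   unfolding V_def[symmetric] 1 G_axis[OF q] d0 d'q y0 by (simp add: algebra_simps i_div)
 qed
qed

end

context adm_measure
begin

lemma zfun_deriv: "((%t. momentum u (t - r)) has_real_derivative 1 / deriv (deriv u) (momentum u (t - r))) (at t)"
proof -
 have "((%t. t - r) has_real_derivative 1) (at t)" by (auto intro!: derivative_eq_intros)
 from DERIV_chain2[where f = "momentum u" and g = "%t. t - r", OF momentum_deriv[OF u \<kappa>] this] show ?thesis by simp
qed

text \<open>Integrating \<open>killing_ode\<close> over a circle shows that the circle integral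
  \<open>N\<close> of the radial derivative divided by \<open>\<Theta>\<close> is constant in
  \<open>t\<close>. The circle integral \<open>M\<close> of \<open>f\<close> then has derivative
  \<open>\<Theta> N\<close>, a constant multiple of that of \<open>momentum u\<close>.\<close>

theorem killing_average:
 assumes c: "c : bundle_charts D" and f: "smooth_in UNIV (cimg c UNIV) f"
  and gr: "is_gradient (cimg c UNIV) (metric_of D x u c) f Gr"
  and kf: "killing_field (cimg c UNIV) (metric_of D x u c) (%q. \<i> *s Gr q)" and w: "w : bimg c"
 obtains A C where "!!t. integral {0..2*pi} (%\<alpha>. f (fib w t \<alpha>)) = A + C * momentum u (t - rho c w)"
proof -
 interpret C: adm_chart D s x c "M0 D" "ylog D" "zfun D u" "%z. 1 / deriv (deriv u) z" "momentum u" UNIV "{-1<..<1}"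
  by (rule chart[OF c])
 define \<theta> where "\<theta> t = 1 / deriv (deriv u) (momentum u (t - rho c w))" for t
 have \<theta>0: "\<theta> t > 0" for t using potentials_deriv2(3)[OF u \<kappa> mom_in] by (simp add: \<theta>_def)
 have c\<theta>: "continuous_on UNIV \<theta>"
 proof -
  have "continuous_on UNIV (%t. deriv (deriv u) (momentum u (t - rho c w)))"
   by (rule continuous_on_compose2[OF smooth_line_continuous[OF potentials_deriv2(1)[OF u \<kappa>]]])
    (use mom_in in \<open>auto intro!: continuous_on_compose2[OF continuous_momentum[of UNIV]] continuous_intros\<close>)
  thus ?thesis unfolding \<theta>_def[abs_def]
   by (intro continuous_on_divide continuous_on_const) (use potentials_deriv2(3)[OF u \<kappa> mom_in] in \<open>auto simp: less_imp_neq[symmetric]\<close>)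
 qed
 define k where "k j q = dirD f q (axis None (j * q $ None)) / (1 / deriv (deriv u) (momentum u (Yc c q)))" for j q
 define r where "r q = dirD (k 1) q (axis None (1 * q $ None))" for q
 have ks: "smooth_in UNIV (cimg c UNIV) (k j)" for j
 proof -
  have "smooth_on_line UNIV (%y. deriv (deriv u) (momentum u y))"
   using smooth_line_compose_flow[OF open_UNIV C.opI C.Z C.\<Theta>(1) potentials_deriv2(1)[OF u \<kappa>]] by simp
  from smooth_in_compose_real[where f = "Yc c" and h = "%y. deriv (deriv u) (momentum u y)", OF open_UNIV this C.ro subset_UNIV C.sY]
  have "smooth_in UNIV (cimg c UNIV) (%q. dirD f q (axis None (j * q $ None)) * deriv (deriv u) (momentum u (Yc c q)))"
   by (intro smooth_in_mult C.ro smooth_dirD_axis[OF c f])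
  thus ?thesis unfolding k_def[abs_def] by simp
 qed
 have "r q = dirD (k \<i>) q (axis None (\<i> * q $ None))" if "q : cimg c UNIV" for q
  unfolding r_def k_def[abs_def] using C.killing_ode[OF f gr[unfolded metric_of_def] kf[unfolded metric_of_def] that] .
 hence r2: "r (fib w t \<alpha>) = dirD (k \<i>) (fib w t \<alpha>) (axis None (\<i> * fib w t \<alpha> $ None))" for t \<alpha>
  using fib_in[OF w] by blast
 have rs: "continuous_on (cimg c UNIV) r"
  unfolding r_def[abs_def] by (rule smooth_in_continuous[OF smooth_dirD_axis[OF c ks]])
 note D = DERIV_fib[OF c w]
 have per: "fib w t (2 * pi) = fib w t 0" for t by (simp add: fib_def exp_eq_polar)
 have kf1: "dirD f (fib w t \<alpha>) (axis None (1 * fib w t \<alpha> $ None)) = \<theta> t * k 1 (fib w t \<alpha>)" for t \<alpha>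
  using \<theta>0[of t] by (simp add: k_def \<theta>_def Yc_fib)
 have cont2: "continuous_on (UNIV \<times> cbox 0 (2*pi)) (%(t, \<alpha>). F (fib w t \<alpha>))" if "continuous_on (cimg c UNIV) F" for F :: "_ => real"
  using continuous_fib[OF w that] by (simp add: case_prod_unfold)
 have cont1: "(%\<alpha>. F (fib w t \<alpha>)) integrable_on {0..2*pi}" if "continuous_on (cimg c UNIV) F" for F :: "_ => real" and t
 proof (rule integrable_continuous_real)
  have "continuous_on {0..2*pi} (%\<alpha>. (t, \<alpha>))" by (intro continuous_intros)
  from continuous_on_compose2[OF continuous_fib[OF w that, of UNIV] this] show "continuous_on {0..2*pi} (%\<alpha>. F (fib w t \<alpha>))" by simp
 qed
 define N where "N t = integral {0..2*pi} (%\<alpha>. k 1 (fib w t \<alpha>))" for t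
 have kc: "continuous_on (cimg c UNIV) (k 1)" by (rule smooth_in_continuous[OF ks])
 have N: "(N has_real_derivative 0) (at t)" for t
 proof -
  have "((%t. integral (cbox 0 (2*pi)) (%\<alpha>. k 1 (fib w t \<alpha>))) has_field_derivative integral (cbox 0 (2*pi)) (%\<alpha>. r (fib w t \<alpha>))) (at t within UNIV)"
   by (rule leibniz_rule_field_derivative[where fx = "%t \<alpha>. r (fib w t \<alpha>)"])
    (use D(1)[OF ks] cont1[OF kc] cont2[OF rs] in \<open>auto simp: r_def\<close>)
  moreover have "((%\<alpha>. r (fib w t \<alpha>)) has_integral k \<i> (fib w t (2*pi)) - k \<i> (fib w t 0)) {0..2*pi}"
   by (rule fundamental_theorem_of_calculus)
    (use D(2)[OF ks[of \<i>]] in \<open>auto simp: r2 real_deriv_vec[symmetric] intro: has_field_derivative_at_within\<close>)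
  hence "integral {0..2*pi} (%\<alpha>. r (fib w t \<alpha>)) = 0" unfolding per by (simp add: integral_unique)
  ultimately show ?thesis by (simp add: N_def[abs_def])
 qed
 have Nc: "N t = N 0" for t using DERIV_isconst_all[of N t 0] N by blast
 define M where "M t = integral {0..2*pi} (%\<alpha>. f (fib w t \<alpha>))" for t
 have M: "(M has_real_derivative \<theta> t * N 0) (at t)" for t
 proof -
  have cc: "continuous_on (UNIV \<times> cbox 0 (2*pi)) (%(t, \<alpha>). \<theta> t * k 1 (fib w t \<alpha>))"
   using cont2[OF kc] unfolding case_prod_unfold
   by (intro continuous_on_mult continuous_on_compose2[OF c\<theta>] continuous_on_fst) (auto intro: continuous_intros)
  have "((%t. integral (cbox 0 (2*pi)) (%\<alpha>. f (fib w t \<alpha>))) has_field_derivative integral (cbox 0 (2*pi)) (%\<alpha>. \<theta> t * k 1 (fib w t \<alpha>))) (at t within UNIV)"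
   by (rule leibniz_rule_field_derivative[where fx = "%t \<alpha>. \<theta> t * k 1 (fib w t \<alpha>)"])
    (use D(1)[OF f, unfolded kf1] cont1[OF smooth_in_continuous[OF f]] cc in auto)
  thus ?thesis using Nc[of t] by (simp add: M_def[abs_def] N_def)
 qed
 have "((%t. M t - N 0 * momentum u (t - rho c w)) has_real_derivative 0) (at t)" for t
  using DERIV_diff[OF M[of t] DERIV_cmult[OF zfun_deriv[of "rho c w" t], of "N 0"]] by (simp add: \<theta>_def)
 hence "M t - N 0 * momentum u (t - rho c w) = M 0 - N 0 * momentum u (0 - rho c w)" for t
  using DERIV_isconst_all[of "%t. M t - N 0 * momentum u (t - rho c w)" t 0] by blast
 hence "M t = (M 0 - N 0 * momentum u (0 - rho c w)) + N 0 * momentum u (t - rho c w)" for t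
  by (metis diff_add_cancel)
 thus ?thesis using that unfolding M_def by blast
qed

end

section \<open>Circle averages and orthogonality to the Killing potentials\<close>

lemma integral_periodic_shift:
 fixes g :: "real => real"
 assumes g: "continuous_on UNIV g" and per: "!!y. g (y + p) = g y" and b: "0 <= b" "b <= p"
 shows "integral {0..p} (%y. g (b + y)) = integral {0..p} g"
proof -
 have int: "g integrable_on {a..b}" for a b by (rule integrable_continuous_real[OF continuous_on_subset[OF g subset_UNIV]])
 have "integral {0..p} (%y. g (b + y)) = integral {b..b + p} g"
  using integral_shift_real_ivl[of b b "b + p" g] by (simp add: add.commute)
 also have "... = integral {b..p} g + integral {p..b + p} g"
  using b by (intro Henstock_Kurzweil_Integration.integral_combine[symmetric] int) auto
 also have "integral {p..b + p} g = integral {0..b} g" using integral_shift_real_ivl[of p p "b + p" g] per by simp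
 also have "integral {b..p} g + integral {0..b} g = integral {0..p} g"
  using Henstock_Kurzweil_Integration.integral_combine[of 0 b p g] b int by simp
 finally show ?thesis .
qed

lemma has_bochner_integral_radial:
 assumes k: "has_bochner_integral lborel k v"
 shows "has_bochner_integral lborel (%z. k (ln (cmod z) - \<rho>) * (1 / (cmod z)^2)) (2 * pi * v)"
proof -
 have [measurable]: "k : borel_measurable borel" using k by (auto simp: has_bochner_integral_iff)
 let ?g = "%z. ln (cmod z) - \<rho>"
 let ?M = "density lborel (%z. ennreal (1 / (cmod z)^2))"
 have "distr ?M borel ?g = density lborel (%y. ennreal (2 * pi))"
 proof (rule measure_eqI)
  fix S assume "S : sets (distr ?M borel ?g)"
  hence [measurable]: "S : sets borel" by simp
  have "emeasure (distr ?M borel ?g) S = (\<integral>\<^sup>+ y. indicator S y \<partial>distr ?M borel ?g)" by simp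
  also have "... = (\<integral>\<^sup>+ z. indicator S (?g z) \<partial>?M)" by (rule nn_integral_distr) measurable
  also have "... = (\<integral>\<^sup>+ z. ennreal (1 / (cmod z)^2) * indicator S (?g z) \<partial>lborel)"
   by (rule nn_integral_density) measurable
  also have "... = ennreal (2 * pi) * (\<integral>\<^sup>+ y. indicator S y \<partial>lborel)"
   by (subst nn_integral_radial[symmetric]) (simp_all add: mult.commute)
  also have "... = emeasure (density lborel (%y. ennreal (2 * pi))) S" by (simp add: emeasure_density nn_integral_cmult)
  finally show "emeasure (distr ?M borel ?g) S = emeasure (density lborel (%y. ennreal (2 * pi))) S" .
 qed simp
 moreover have "has_bochner_integral (density lborel (%y. ennreal (2 * pi))) k (2 * pi * v)"
  using k by (simp add: has_bochner_integral_iff integrable_density integral_density)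
 ultimately have "has_bochner_integral (distr ?M borel ?g) k (2 * pi * v)" by simp
 hence "has_bochner_integral ?M (%z. k (?g z)) (2 * pi * v)"
  by (simp add: has_bochner_integral_iff integrable_distr_eq integral_distr)
 thus ?thesis by (simp add: has_bochner_integral_iff integrable_density integral_density mult.commute)
qed

text \<open>Integrals over the plane are invariant under rotation; integrating over all rotations
  and exchanging the integrals replaces \<open>F\<close> by its circle integrals.\<close>

lemma integral_circle_average:
 fixes S F :: "complex => real"
 assumes S: "integrable lborel S" and SF: "!!\<zeta>. \<zeta> ~= 0 ==> S \<zeta> = F \<zeta> * R (cmod \<zeta>)" and F: "continuous_on (- {0}) F"
  and M: "!!\<zeta>. \<zeta> ~= 0 ==> integral {0..2*pi} (%\<alpha>. F (cis \<alpha> * \<zeta>)) = M (cmod \<zeta>)"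
 shows "2 * pi * (\<integral>\<zeta>. S \<zeta> \<partial>lborel) = (\<integral>\<zeta>. M (cmod \<zeta>) * R (cmod \<zeta>) \<partial>lborel)"
proof -
 have [measurable]: "S : borel_measurable borel" using S by auto
 have cm: "(%p. cis (fst p) * snd p) : borel_measurable (borel \<Otimes>\<^sub>M borel)"
  unfolding borel_prod cis_conv_exp by (intro borel_measurable_continuous_onI continuous_intros)
 note [measurable] = measurable_compose[OF cm \<open>S : borel_measurable borel\<close>]
 have rot: "(\<integral>\<zeta>. g (cis \<alpha> * \<zeta>) \<partial>lborel) = (\<integral>\<zeta>. g \<zeta> \<partial>lborel)" "integrable lborel g ==> integrable lborel (%\<zeta>. g (cis \<alpha> * \<zeta>))"
  if [measurable]: "g : borel_measurable borel" for g :: "complex => real" and \<alpha>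
 proof -
  have m: "(%\<zeta>. cis \<alpha> * \<zeta>) : borel_measurable lborel" by (intro borel_measurable_continuous_onI continuous_intros | simp)+
  show "(\<integral>\<zeta>. g (cis \<alpha> * \<zeta>) \<partial>lborel) = (\<integral>\<zeta>. g \<zeta> \<partial>lborel)"
   using integral_distr[OF m that] lborel_rotate[of "cis \<alpha>"] by simp
  show "integrable lborel g ==> integrable lborel (%\<zeta>. g (cis \<alpha> * \<zeta>))"
   using integrable_distr_eq[OF m that] lborel_rotate[of "cis \<alpha>"] by simp
 qed
 define f where "f = (%p. indicator {0..2*pi} (fst p) * S (cis (fst p) * snd p) :: real)"
 have fm: "f : borel_measurable (lborel \<Otimes>\<^sub>M lborel)" unfolding f_def by measurable
 have If: "integrable (lborel \<Otimes>\<^sub>M lborel) f"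
 proof (rule lborel_pair.Fubini_integrable[OF fm])
  have "(\<integral>\<zeta>. norm (f (\<alpha>, \<zeta>)) \<partial>lborel) = indicator {0..2*pi} \<alpha> * (\<integral>\<zeta>. norm (S \<zeta>) \<partial>lborel)" for \<alpha>
   using rot(1)[of "%\<zeta>. norm (S \<zeta>)" \<alpha>] by (simp add: f_def abs_mult)
  thus "integrable lborel (%\<alpha>. \<integral>\<zeta>. norm (f (\<alpha>, \<zeta>)) \<partial>lborel)" by (simp add: emeasure_lborel_Icc_eq)
  show "AE \<alpha> in lborel. integrable lborel (%\<zeta>. f (\<alpha>, \<zeta>))" using rot(2)[OF _ S] by (simp add: f_def)
 qed
 have "2 * pi * (\<integral>\<zeta>. S \<zeta> \<partial>lborel) = (\<integral>\<alpha>. \<integral>\<zeta>. f (\<alpha>, \<zeta>) \<partial>lborel \<partial>lborel)" using rot(1)[of S] by (simp add: f_def)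
 also have "... = (\<integral>\<zeta>. \<integral>\<alpha>. f (\<alpha>, \<zeta>) \<partial>lborel \<partial>lborel)"
  by (rule lborel_pair.Fubini_integral[symmetric]) (use If in \<open>simp add: case_prod_unfold\<close>)
 also have "... = (\<integral>\<zeta>. M (cmod \<zeta>) * R (cmod \<zeta>) \<partial>lborel)"
 proof (rule integral_cong_AE)
  show m1: "(%\<zeta>. \<integral>\<alpha>. f (\<alpha>, \<zeta>) \<partial>lborel) : borel_measurable lborel"
   using lborel_pair.integrable_snd[of "%\<alpha> \<zeta>. f (\<alpha>, \<zeta>)"] If by (auto simp: case_prod_unfold)
  have e: "(\<integral>\<alpha>. f (\<alpha>, \<zeta>) \<partial>lborel) = M (cmod \<zeta>) * R (cmod \<zeta>)" if z: "\<zeta> ~= 0" for \<zeta>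
  proof -
   have "continuous_on {0..2*pi} (%\<alpha>. F (cis \<alpha> * \<zeta>))"
    unfolding cis_conv_exp by (intro continuous_on_compose2[OF F] continuous_intros) (use z in auto)
   hence si: "set_integrable lborel {0..2*pi} (%\<alpha>. F (cis \<alpha> * \<zeta>))"
    by (rule borel_integrable_atLeastAtMost'[unfolded set_integrable_def, folded set_integrable_def])
   have "(\<integral>\<alpha>. f (\<alpha>, \<zeta>) \<partial>lborel) = (\<integral>\<alpha>. R (cmod \<zeta>) * (indicator {0..2*pi} \<alpha> * F (cis \<alpha> * \<zeta>)) \<partial>lborel)"
    using SF z by (intro Bochner_Integration.integral_cong refl) (simp add: f_def norm_mult)
   also have "... = R (cmod \<zeta>) * (LINT \<alpha>:{0..2*pi}|lborel. F (cis \<alpha> * \<zeta>))" by (simp add: set_lebesgue_integral_def)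
   also have "(LINT \<alpha>:{0..2*pi}|lborel. F (cis \<alpha> * \<zeta>)) = M (cmod \<zeta>)"
    using set_borel_integral_eq_integral(2)[OF si] M[OF z] by simp
   finally show ?thesis by simp
  qed
  show ae: "AE \<zeta> in lborel. (\<integral>\<alpha>. f (\<alpha>, \<zeta>) \<partial>lborel) = M (cmod \<zeta>) * R (cmod \<zeta>)"
   using AE_lborel_singleton[of "0::complex"] by eventually_elim (rule e)
  \<comment> \<open>\<open>M\<close> and \<open>R\<close> are arbitrary functions; the measurability
    of this product is inherited from the inner integral, corrected at the origin.\<close>
  have "(%\<zeta>. if \<zeta> = 0 then M 0 * R 0 else \<integral>\<alpha>. f (\<alpha>, \<zeta>) \<partial>lborel) : borel_measurable lborel" using m1 by measurable
  also have "(%\<zeta>. if \<zeta> = 0 then M 0 * R 0 else \<integral>\<alpha>. f (\<alpha>, \<zeta>) \<partial>lborel) = (%\<zeta>. M (cmod \<zeta>) * R (cmod \<zeta>))"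
   using e by (intro ext) auto
  finally show "(%\<zeta>. M (cmod \<zeta>) * R (cmod \<zeta>)) : borel_measurable lborel" .
 qed
 finally show ?thesis .
qed

context adm_measure_pieces
begin

lemma integral_piece:
 assumes hm: "chart_measurable h" and hi: "integrable \<nu> (h :: 'l => real)" and j: "j < n"
 defines "k \<equiv> %q. indicator {q : cimg (c j) UNIV. base_part q : Bi j} q * (dens (c j) q * h (ich (c j) q)) :: real"
 shows "integrable lborel k" "(\<integral>l. indicator (over (B j)) l * h l \<partial>\<nu>) = (\<integral>q. k q \<partial>lborel)"
proof -
 let ?\<Omega> = "{q : cimg (c j) UNIV. base_part q : Bi j}" and ?A = "over (B j)"
 note dc = distr_chart[OF hm cB(1)[OF j] over_sets[OF j] Bi(4)[OF j], unfolded over_Bi[OF j]]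
 have A: "?A \<inter> space \<nu> : sets \<nu>" using over_sets[OF j] by simp
 have O: "?\<Omega> \<inter> space lborel : sets (lborel :: (complex^('d option)) measure)" using dc(1) by simp
 have hA: "h : borel_measurable (restrict_space \<nu> ?A)"
  by (rule measurable_restrict_space1[OF chart_measurable_nu[OF hm]])
 have dp: "AE q in restrict_space lborel ?\<Omega>. 0 <= dens (c j) q"
 proof (rule AE_I2)
  fix q assume "q : space (restrict_space lborel ?\<Omega>)"
  hence "base_part q : Bi j" by (simp add: space_restrict_space)
  hence "base_part q : bimg (c j)" using Bi(2)[OF j] by blast
  thus "0 <= dens (c j) q" unfolding dens_def
   by (intro mult_nonneg_nonneg ydens_nonneg less_imp_le[OF cvol_nonneg[OF cB(1)[OF j]]]) simp_all
 qed
 let ?N = "density (restrict_space lborel ?\<Omega>) (%q. ennreal (dens (c j) q))"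
 have hN: "(%q. h (ich (c j) q)) : borel_measurable ?N" using dc(3) by (simp cong: measurable_cong_sets)
 have "integrable \<nu> (%l. indicator ?A l *\<^sub>R h l)" using over_sets[OF j] hi by (rule integrable_mult_indicator)
 hence "integrable (restrict_space \<nu> ?A) h" using A by (simp add: integrable_restrict_space)
 hence "integrable (distr (restrict_space \<nu> ?A) borel h) (%e. e)" using hA by (simp add: integrable_distr_eq)
 hence "integrable ?N (%q. h (ich (c j) q))" unfolding dc(5) using hN by (simp add: integrable_distr_eq)
 hence "integrable (restrict_space lborel ?\<Omega>) (%q. dens (c j) q * h (ich (c j) q))"
  using dc(3,4) dp by (simp add: integrable_density)
 thus "integrable lborel k" unfolding k_def using O by (simp add: integrable_restrict_space)
 have "(\<integral>l. indicator ?A l * h l \<partial>\<nu>) = (\<integral>l. h l \<partial>restrict_space \<nu> ?A)" using A by (simp add: integral_restrict_space)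
 also have "... = (\<integral>e. e \<partial>distr (restrict_space \<nu> ?A) borel h)" using hA by (simp add: integral_distr)
 also have "... = (\<integral>q. h (ich (c j) q) \<partial>?N)" unfolding dc(5) using hN by (simp add: integral_distr)
 also have "... = (\<integral>q. dens (c j) q * h (ich (c j) q) \<partial>restrict_space lborel ?\<Omega>)"
  using dc(3,4) dp by (simp add: integral_density)
 also have "... = (\<integral>q. k q \<partial>lborel)" unfolding k_def using O by (simp add: integral_restrict_space)
 finally show "(\<integral>l. indicator ?A l * h l \<partial>\<nu>) = (\<integral>q. k q \<partial>lborel)" .
qed

lemma integral_join:
 fixes k :: "complex^('d option) => real"
 assumes "integrable lborel k"
 shows "(\<integral>q. k q \<partial>lborel) = (\<integral>w. \<integral>\<zeta>. k (join w \<zeta>) \<partial>lborel \<partial>lborel)"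
proof -
 note [measurable] = measurable_join
 have km [measurable]: "k : borel_measurable borel" using assms by auto
 have "integrable (lborel \<Otimes>\<^sub>M lborel) (%p. k (join (fst p) (snd p)))"
  using assms unfolding lborel_join[symmetric] by (subst (asm) integrable_distr_eq) auto
 from lborel_pair.integral_fst'[OF this]
 have "(\<integral>w. \<integral>\<zeta>. k (join w \<zeta>) \<partial>lborel \<partial>lborel) = (\<integral>p. k (join (fst p) (snd p)) \<partial>(lborel \<Otimes>\<^sub>M lborel))" by simp
 also have "... = (\<integral>q. k q \<partial>lborel)" unfolding lborel_join[symmetric] by (subst integral_distr) auto
 finally show ?thesis by simp
qed

lemma integral_pieces:
 assumes "integrable \<nu> (h :: 'l => real)"
 shows "(\<integral>l. h l \<partial>\<nu>) = (\<Sum>j<n. \<integral>l. indicator (over (B j)) l * h l \<partial>\<nu>)"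
proof -
 have "(\<integral>l. h l \<partial>\<nu>) = (\<integral>l. (\<Sum>j<n. indicator (over (B j)) l * h l) \<partial>\<nu>)"
 proof (rule Bochner_Integration.integral_cong[OF refl])
  fix l assume "l : space \<nu>"
  hence "l : (\<Union>j<n. over (B j))" unfolding space_nu over_UN(1) .
  then obtain i where i: "i < n" "l : over (B i)" by blast
  have "indicator (over (B j)) l * h l = (if j = i then h l else 0)" if "j < n" for j
   using over_UN(2) i that unfolding disjoint_family_on_def by (auto split: split_indicator)
  hence "(\<Sum>j<n. indicator (over (B j)) l * h l) = (\<Sum>j<n. if j = i then h l else 0)" by (intro sum.cong) auto
  thus "h l = (\<Sum>j<n. indicator (over (B j)) l * h l)" using i by simp
 qed
 also have "... = (\<Sum>j<n. \<integral>l. indicator (over (B j)) l * h l \<partial>\<nu>)"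
  by (rule Bochner_Integration.integral_sum) (use integrable_mult_indicator[OF over_sets assms] in auto)
 finally show ?thesis .
qed

lemma killing_potentialsD:
 assumes "f : killing_potentials D x u \<nu>" and b: "b : bundle_charts D"
 shows "smooth_in UNIV (cimg b UNIV) (%q. f (ich b q))"
  "\<exists>Gr. is_gradient (cimg b UNIV) (metric_of D x u b) (%q. f (ich b q)) Gr & killing_field (cimg b UNIV) (metric_of D x u b) (%q. \<i> *s Gr q)"
proof -
 have "\<forall>c\<in>bundle_charts D. smooth_in UNIV (scoord c ` cdom D c) (%q. f (ich c q)) &
   (\<exists>Gr. is_gradient (scoord c ` cdom D c) (metric_of D x u c) (%q. f (ich c q)) Gr &
    killing_field (scoord c ` cdom D c) (metric_of D x u c) (%q. \<i> *s Gr q))"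
  using assms(1) unfolding killing_potentials_def Let_def in_chart_std[abs_def] by simp
 from bspec[OF this b, unfolded standard_image[OF b]]
 show "smooth_in UNIV (cimg b UNIV) (%q. f (ich b q))"
  "\<exists>Gr. is_gradient (cimg b UNIV) (metric_of D x u b) (%q. f (ich b q)) Gr & killing_field (cimg b UNIV) (metric_of D x u b) (%q. \<i> *s Gr q)"
  by (rule conjunct1, rule conjunct2)
qed

lemma killing_measurable: "f : killing_potentials D x u \<nu> ==> chart_measurable f"
 by (rule chart_measurable_continuous) (rule smooth_in_continuous[OF killing_potentialsD(1)])

lemma killing_integrable:
 assumes "f : killing_potentials D x u \<nu>"
 shows "integrable \<nu> (%l. (f l)^2)" "f : borel_measurable \<nu>"
 using assms chart_measurable_nu[OF killing_measurable[OF assms]] by (auto simp: killing_potentials_def)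

lemma integrable_square_mult:
 fixes f g :: "'l => real"
 assumes "integrable \<nu> (%l. (f l)^2)" "f : borel_measurable \<nu>" "integrable \<nu> (%l. (g l)^2)" "g : borel_measurable \<nu>"
 shows "integrable \<nu> (%l. f l * g l)"
proof (rule Bochner_Integration.integrable_bound[OF Bochner_Integration.integrable_add[OF assms(1,3)]])
 show "AE l in \<nu>. norm (f l * g l) <= norm ((f l)^2 + (g l)^2)"
 proof (rule AE_I2)
  fix l
  have "0 <= (\<bar>f l\<bar> - \<bar>g l\<bar>)^2" by simp
  hence "2 * (\<bar>f l\<bar> * \<bar>g l\<bar>) <= (f l)^2 + (g l)^2" by (simp add: power2_diff)
  moreover have "0 <= \<bar>f l\<bar> * \<bar>g l\<bar>" by simp
  ultimately have "\<bar>f l\<bar> * \<bar>g l\<bar> <= (f l)^2 + (g l)^2" by linarith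
  thus "norm (f l * g l) <= norm ((f l)^2 + (g l)^2)" by (simp add: abs_mult)
 qed
qed (use assms in measurable)

lemma square_zfun:
 fixes \<phi> :: "real => real"
 assumes "continuous_on {-1..1} \<phi>"
 shows "integrable \<nu> (%l. (\<phi> (zfun D u l))^2)" "(%l. \<phi> (zfun D u l)) : borel_measurable \<nu>"
 using has_bochner_integral_zfun[of "%z. (\<phi> z)^2"] has_bochner_integral_zfun[OF assms] assms
 by (auto simp: has_bochner_integral_iff intro!: continuous_intros)

text \<open>On each fibre the weight is invariant under rotation, so \<open>f\<close> may be
  replaced by its circle average, which is affine in z; the two hypotheses then give 0 fibre by
  fibre.\<close>

theorem killing_orthogonal:
 assumes f: "f : killing_potentials D x u \<nu>" and \<psi>: "continuous_on {-1..1} \<psi>"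
  and o: "integral {-1..1} (%z. \<psi> z * p_c D x z) = 0" "integral {-1..1} (%z. z * \<psi> z * p_c D x z) = 0"
 shows "(\<integral>l. \<psi> (zfun D u l) * f l \<partial>\<nu>) = 0"
proof -
 have hi: "integrable \<nu> (%l. \<psi> (zfun D u l) * f l)"
  by (rule integrable_square_mult[OF square_zfun[OF \<psi>] killing_integrable[OF f]])
 have zc: "zfun D u (ich b q) = momentum u (Yc b q)" if "b : bundle_charts D" "q : cimg b UNIV" for b q
  using ylog_ich[OF that] by (simp add: zfun_def)
 have hm: "chart_measurable (%l. \<psi> (zfun D u l) * f l)"
 proof (rule chart_measurable_continuous)
  fix b assume b: "b : bundle_charts D"
  have "continuous_on (cimg b UNIV) (%q. \<psi> (momentum u (Yc b q)))"
   by (rule continuous_on_compose2[OF \<psi> continuous_on_compose2[OF continuous_momentum[of UNIV] continuous_Yc[OF b]]])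
    (use mom_in in \<open>auto simp: less_imp_le\<close>)
  thus "continuous_on (cimg b UNIV) (%q. \<psi> (zfun D u (ich b q)) * f (ich b q))"
   using smooth_in_continuous[OF killing_potentialsD(1)[OF f b]] zc[OF b]
   by (intro continuous_on_mult) (simp_all cong: continuous_on_cong)
 qed
 have "(\<integral>l. indicator (over (B j)) l * (\<psi> (zfun D u l) * f l) \<partial>\<nu>) = 0" if j: "j < n" for j
 proof -
  define k where "k q = indicator {q : cimg (c j) UNIV. base_part q : Bi j} q * (dens (c j) q * (\<psi> (zfun D u (ich (c j) q)) * f (ich (c j) q)))" for q
  note cj = cB(1)[OF j]
  have ki: "integrable lborel k" using integral_piece(1)[OF hm hi j] unfolding k_def[abs_def] .
  have "(\<integral>\<zeta>. k (join w \<zeta>) \<partial>lborel) = 0" for w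
  \<comment> \<open>Off the piece the integrand is 0; where it is not integrable over the fibre, the
    integral is 0 by convention.\<close>
  proof (cases "w : Bi j & integrable lborel (%\<zeta>. k (join w \<zeta>))")
   case False
   thus ?thesis by (auto simp: k_def not_integrable_integral_eq)
  next
   case True
   hence w: "w : bimg (c j)" and Si: "integrable lborel (%\<zeta>. k (join w \<zeta>))" using Bi(2)[OF j] by auto
   obtain Gr where Gr: "is_gradient (cimg (c j) UNIV) (metric_of D x u (c j)) (%q. f (ich (c j) q)) Gr"
    "killing_field (cimg (c j) UNIV) (metric_of D x u (c j)) (%q. \<i> *s Gr q)"
    using killing_potentialsD(2)[OF f cj] by blast
   have "\<exists>A C. \<forall>t. integral {0..2*pi} (%\<alpha>. f (ich (c j) (fib w t \<alpha>))) = A + C * momentum u (t - rho (c j) w)"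
    by (rule killing_average[OF cj killing_potentialsD(1)[OF f cj] Gr w]) blast
   then obtain A C where AC: "!!t. integral {0..2*pi} (%\<alpha>. f (ich (c j) (fib w t \<alpha>))) = A + C * momentum u (t - rho (c j) w)"
    by blast
   define R where "R r = cvol x (c j) w * (\<psi> (momentum u (ln r - rho (c j) w)) * ydens (ln r - rho (c j) w) * (1 / r\<^sup>2))" for r
   have cf: "continuous_on (cimg (c j) UNIV) (%q. f (ich (c j) q))" by (rule smooth_in_continuous[OF killing_potentialsD(1)[OF f cj]])
   have "2 * pi * (\<integral>\<zeta>. k (join w \<zeta>) \<partial>lborel) = (\<integral>\<zeta>. (A + C * momentum u (ln (cmod \<zeta>) - rho (c j) w)) * R (cmod \<zeta>) \<partial>lborel)"
   proof (rule integral_circle_average[OF Si, where F = "%\<zeta>. f (ich (c j) (join w \<zeta>))" and M = "%r. A + C * momentum u (ln r - rho (c j) w)"])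
    show "k (join w \<zeta>) = f (ich (c j) (join w \<zeta>)) * R (cmod \<zeta>)" if z: "\<zeta> ~= 0" for \<zeta>
     using True zc[OF cj dens_join(1)[OF j w z]] dens_join[OF j w z] by (simp add: k_def R_def Yc_def mult_ac)
    show "continuous_on (- {0}) (%\<zeta>. f (ich (c j) (join w \<zeta>)))"
    proof (rule continuous_on_compose2[OF cf])
     have "continuous_on (- {0}) (%\<zeta>::complex. (w, \<zeta>))" by (intro continuous_intros)
     from continuous_on_compose2[OF continuous_on_join this] show "continuous_on (- {0}) (%\<zeta>. join w \<zeta>)" by simp
    qed (use w in \<open>auto simp: cimg_def\<close>)
    show "integral {0..2*pi} (%\<alpha>. f (ich (c j) (join w (cis \<alpha> * \<zeta>)))) = A + C * momentum u (ln (cmod \<zeta>) - rho (c j) w)"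
     if z: "\<zeta> ~= 0" for \<zeta>
    proof -
     define t where "t = ln (cmod \<zeta>)"
     \<comment> \<open>\<open>killing_average\<close> concerns circles that start at angle 0, while
       the circle through \<open>\<zeta>\<close> starts at its argument: hence the periodic
       shift.\<close>
     define b where "b = Arg2pi \<zeta>"
     have b: "0 <= b" "b <= 2 * pi" using Arg2pi_ge_0[of \<zeta>] Arg2pi_lt_2pi[of \<zeta>] by (auto simp: b_def)
     have "\<zeta> = of_real (cmod \<zeta>) * exp (\<i> * of_real b)" unfolding b_def by (rule Arg2pi_eq)
     moreover have "of_real (cmod \<zeta>) = exp (of_real t :: complex)" using z by (simp add: t_def exp_of_real)
     ultimately have "\<zeta> = exp (of_real t) * exp (\<i> * of_real b)" by simp
     hence cz: "cis \<alpha> * \<zeta> = exp (Complex t (b + \<alpha>))" for \<alpha>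
      by (simp add: cis_conv_exp Complex_eq exp_add[symmetric] algebra_simps)
     define g where "g y = f (ich (c j) (fib w t y))" for y
     have gc: "continuous_on UNIV g"
     proof -
      have "continuous_on UNIV (%y. (t, y))" by (intro continuous_intros)
      from continuous_on_compose2[OF continuous_fib[OF w cf, of UNIV] this] show ?thesis by (simp add: g_def[abs_def])
     qed
     have "exp (Complex t (y + 2 * pi)) = exp (Complex t y)" for y by (simp add: exp_eq_polar cis.ctr)
     hence gp: "g (y + 2 * pi) = g y" for y by (simp add: g_def fib_def)
     have "integral {0..2*pi} (%\<alpha>. g (b + \<alpha>)) = integral {0..2*pi} g" by (rule integral_periodic_shift[OF gc gp b])
     thus ?thesis using AC[of t] unfolding cz g_def[abs_def] fib_def t_def by simp
    qed
   qed
   also have "... = (\<integral>\<zeta>. cvol x (c j) w * ((%y. ydens y * (A * \<psi> (momentum u y) + C * (momentum u y * \<psi> (momentum u y)))) (ln (cmod \<zeta>) - rho (c j) w) * (1 / (cmod \<zeta>)^2)) \<partial>lborel)"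
    by (intro Bochner_Integration.integral_cong refl) (simp add: R_def algebra_simps add_divide_distrib)
   also have "... = 0"
   proof -
    have z\<psi>: "continuous_on {-1..1} (%z. A * \<psi> z + C * (z * \<psi> z))" by (intro continuous_intros \<psi>)
    have pi: "(%z. \<psi> z * p_c D x z) integrable_on {-1..1}" "(%z. z * \<psi> z * p_c D x z) integrable_on {-1..1}"
     unfolding p_c_def by (intro integrable_continuous_real continuous_intros \<psi>)+
    have "integral {-1..1} (%z. (A * \<psi> z + C * (z * \<psi> z)) * p_c D x z)
     = integral {-1..1} (%z. A * (\<psi> z * p_c D x z) + C * (z * \<psi> z * p_c D x z))" by (simp add: algebra_simps)
    also have "... = A * integral {-1..1} (%z. \<psi> z * p_c D x z) + C * integral {-1..1} (%z. z * \<psi> z * p_c D x z)"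
     using pi by (subst Henstock_Kurzweil_Integration.integral_add) (auto intro!: integrable_on_mult_right)
    finally have "integral {-1..1} (%z. (A * \<psi> z + C * (z * \<psi> z)) * p_c D x z) = 0" using o by simp
    with has_bochner_integral_ydens[OF z\<psi>]
    have "has_bochner_integral lborel (%y. ydens y * (A * \<psi> (momentum u y) + C * (momentum u y * \<psi> (momentum u y)))) 0" by simp
    from has_bochner_integral_integral_eq[OF has_bochner_integral_mult_right[OF has_bochner_integral_radial[OF this, of "rho (c j) w"], of "cvol x (c j) w"]]
    show ?thesis by simp
   qed
   finally show ?thesis by simp
  qed
  thus ?thesis using integral_piece(2)[OF hm hi j] integral_join[OF ki] unfolding k_def[abs_def] by simp
 qed
 thus ?thesis using integral_pieces[OF hi] by simp
qed

end

section \<open>The projection of the scalar curvature\<close>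

locale adm_extremal_measure = adm_measure_pieces D s x \<kappa> u \<nu> n c B + EP: extremal_profile \<kappa> P F
 for D :: "('a, 's, 'l, 'd::finite, 'b::finite) admissible_data" and s x \<kappa> u \<nu> n c B P F +
 fixes a b :: real
 assumes pc: "poly P z = p_c D x z"
  and ab: "z : {-1..1} ==> poly (pderiv2 F) z = (a * z + b + 2 * base_scal D x s z) * p_c D x z"
begin

lemma affine_killing_potential: "(%l. a' * zfun D u l + b') : killing_potentials D x u \<nu>"
 unfolding killing_potentials_def Let_def
proof (rule CollectI, intro conjI ballI)
 show "integrable \<nu> (%l. (a' * zfun D u l + b')^2)"
  by (rule square_zfun(1)[of "%z. a' * z + b'"]) (intro continuous_intros)
 fix d assume d: "d : bundle_charts D"
 interpret C: adm_chart D s x d "M0 D" "ylog D" "zfun D u" "%z. 1 / deriv (deriv u) z" "momentum u" UNIV "{-1<..<1}"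
  by (rule chart[OF d])
 let ?f = "in_chart D (M0 D) (ylog D) d (%l. a' * zfun D u l + b')"
 have eq: "?f q = a' * momentum u (Yc d q) + b'" if "q : cimg d UNIV" for q
  using ylog_ich[OF d that] by (simp add: in_chart_std zfun_def)
 have "smooth_on_line UNIV (%y. a' * momentum u y + b')"
  using smooth_line_compose_flow[OF open_UNIV C.opI C.Z C.\<Theta>(1) smooth_line_ident]
  by (intro smooth_line_add smooth_line_mult smooth_line_const) simp
 from smooth_in_compose_real[where f = "Yc d" and h = "%y. a' * momentum u y + b'", OF open_UNIV this C.ro subset_UNIV C.sY]
 show "smooth_in UNIV (scoord d ` cdom D d) ?f"
  unfolding standard_image[OF d] by (subst smooth_in_cong[OF C.ro eq]) auto
 have "is_gradient (cimg d UNIV) C.G ?f (%q. axis None (of_real a' * q $ None))"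
  using C.affine_killing(1)[of a' b'] unfolding is_gradient_def
 proof (intro ballI allI)
  fix q v assume q: "q : cimg d UNIV" and g: "\<forall>q\<in>cimg d UNIV. \<forall>v. C.G q (axis None (of_real a' * q $ None)) v = dirD (%q. a' * momentum u (Yc d q) + b') q v"
  have "dirD ?f q v = dirD (%q. a' * momentum u (Yc d q) + b') q v" by (rule dirD_cong(1)[OF C.ro q UNIV_I eq])
  thus "C.G q (axis None (of_real a' * q $ None)) v = dirD ?f q v" using g q by simp
 qed
 with C.affine_killing(2)[of a'] show "\<exists>Gr. is_gradient (scoord d ` cdom D d) (metric_of D x u d) ?f Gr
   & killing_field (scoord d ` cdom D d) (metric_of D x u d) (%q. \<i> *s Gr q)"
  unfolding standard_image[OF d] metric_of_def by blast
qed

text \<open>The splitting behind the projection: an affine function of z, which is a Killing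
  potential, plus the defect \<open>(F'' - F2) / P\<close>, which will be orthogonal to all of
  them.\<close>

lemma scal_of_eq:
 assumes F2: "!!z. abs z < 1 ==> (prof \<kappa> P u has_real_derivative F1 z) (at z)" "!!z. abs z < 1 ==> (F1 has_real_derivative F2 z) (at z)"
  and l: "l : M0 D"
 shows "scal_of D x u l = - a * zfun D u l + - b + (poly (pderiv2 F) (zfun D u l) - F2 (zfun D u l)) / poly P (zfun D u l)"
proof -
 \<comment> \<open>\<open>adm_scal\<close> evaluates in a chart picked by \<open>SOME\<close>; the
   curvature formula holds in whichever chart this is.\<close>
 define d where "d = (SOME d. d : bundle_charts D & l : cdom D d)"
 have "prj D l : topspace (base D)" using over_UN(1) l BUN by (auto simp: over_def)
 from bundle_charts_cover[OF this openin_topspace this] obtain d' where "d' : bundle_charts D" "prj D l : bdom (fst d')" by blast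
 hence "d' : bundle_charts D & l : cdom D d'" using l by (simp add: cdom_def)
 hence d: "d : bundle_charts D" "l : cdom D d" unfolding d_def by (rule someI2, blast)+
 interpret C: adm_chart D s x d "M0 D" "ylog D" "zfun D u" "%z. 1 / deriv (deriv u) z" "momentum u" UNIV "{-1<..<1}"
  by (rule chart[OF d(1)])
 let ?q = "scoord d l" and ?z = "zfun D u l"
 have q: "?q : cimg d UNIV" using standard_image[OF d(1)] d(2) by blast
 have Y: "Yc d ?q = ylog D l" using Y_in_chart(1)[OF d, of "ylog D"] by (simp add: Yc_def)
 have z: "?z : {-1<..<1}" unfolding zfun_def by (rule mom_in)
 have 1: "((%t. p_c D x t * (1 / deriv (deriv u) t)) has_real_derivative F1 t) (at t)" if t: "t : {-1<..<1}" for t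
 proof (rule deriv_interior_cong[of "prof \<kappa> P u" _ t "-1" 1])
  show "(prof \<kappa> P u has_real_derivative F1 t) (at t)" using F2(1) t by (simp add: abs_less_iff)
  show "prof \<kappa> P u z = p_c D x z * (1 / deriv (deriv u) z)" if "-1 < z" "z < 1" for z
   using prof_interior[of z \<kappa> P u] \<kappa> that by (simp add: pc abs_less_iff)
 qed (use t in auto)
 have 2: "(F1 has_real_derivative F2 t) (at t)" if "t : {-1<..<1}" for t using F2(2) that by (simp add: abs_less_iff)
 have pp: "poly P ?z > 0" using EP.P z by auto
 have "scal_of D x u l = scalar_curvature UNIV C.G ?q" unfolding scal_of_def adm_scal_def Let_def d_def[symmetric] ..
 also have "... = 2 * base_scal D x s ?z - F2 ?z / p_c D x ?z"
  using C.scalar_curvature_G[OF q 1 2] unfolding Y zfun_def[symmetric] .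
 also have "2 * base_scal D x s ?z = poly (pderiv2 F) ?z / poly P ?z - a * ?z - b"
  using ab[of ?z] z pp by (simp add: pc field_simps)
 finally show ?thesis by (simp add: pc diff_divide_distrib)
qed

text \<open>\<open>pr_perp_scal\<close> picks the projection by \<open>SOME\<close>, and
  orthogonality determines it only up to null sets: the chosen \<open>p\<close> and the affine
  \<open>p0\<close> differ by a function orthogonal to itself, so they agree almost
  everywhere.\<close>

theorem pr_perp_scal_AE:
 assumes F2: "continuous_on {-1..1} F2" "!!z. z : {-1..1} ==> (prof \<kappa> P u has_real_derivative F1 z) (at z within {-1..1})"
  "!!z. z : {-1..1} ==> (F1 has_real_derivative F2 z) (at z within {-1..1})"
  "F1 1 = - 2 * \<kappa> * poly P 1" "F1 (-1) = 2 * \<kappa> * poly P (-1)"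
  "!!z. abs z < 1 ==> (prof \<kappa> P u has_real_derivative F1 z) (at z)" "!!z. abs z < 1 ==> (F1 has_real_derivative F2 z) (at z)"
 shows "AE l in \<nu>. pr_perp_scal D x u \<nu> l = (poly (pderiv2 F) (zfun D u l) - F2 (zfun D u l)) / poly P (zfun D u l)"
  "pr_perp_scal D x u \<nu> : borel_measurable \<nu>"
proof -
 define \<psi> where "\<psi> z = (poly (pderiv2 F) z - F2 z) / poly P z" for z
 have c\<psi>: "continuous_on {-1..1} \<psi>" unfolding \<psi>_def by (intro continuous_intros F2(1)) (use EP.P in force)
 have \<psi>p: "\<psi> z * p_c D x z = poly (pderiv2 F) z - F2 z" if "z : {-1..1}" for z
  using EP.P[OF that] by (simp add: \<psi>_def pc)
 \<comment> \<open>Double integration by parts against a function with zero second derivative;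
   \<open>w = 1\<close> and \<open>w = z\<close> give the two orthogonality conditions of
   \<open>killing_orthogonal\<close>.\<close>
 have parts: "integral {-1..1} (%z. w z * (poly (pderiv2 F) z - F2 z)) = 0" if "!!z. (w has_real_derivative w1) (at z)" for w w1
 proof -
  have "((%z. w z * (poly (pderiv2 F) z - F2 z) - 0 * (poly F z - prof \<kappa> P u z)) has_integral 0) {-1..1}"
  proof (rule integral_by_parts_twice[where ?w1.0 = "%z. w1" and ?G1.0 = "%z. poly (pderiv F) z - F1 z"])
   show "((%z. poly F z - prof \<kappa> P u z) has_real_derivative poly (pderiv F) z - F1 z) (at z within {-1..1})" if "z : {-1..1}" for z
    by (intro DERIV_diff DERIV_subset[OF poly_DERIV] F2 that) simp
   show "((%z. poly (pderiv F) z - F1 z) has_real_derivative poly (pderiv2 F) z - F2 z) (at z within {-1..1})" if "z : {-1..1}" for z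
    by (intro DERIV_diff DERIV_subset[OF poly_DERIV] F2 that) simp
  qed (use that EP.F0 EP.F1 F2(4,5) in \<open>auto simp: prof_def intro: has_field_derivative_at_within\<close>)
  thus ?thesis by (simp add: integral_unique)
 qed
 have "integral {-1..1} (%z. \<psi> z * p_c D x z) = integral {-1..1} (%z. 1 * (poly (pderiv2 F) z - F2 z))"
  by (rule Henstock_Kurzweil_Integration.integral_cong) (simp add: \<psi>p)
 hence o1: "integral {-1..1} (%z. \<psi> z * p_c D x z) = 0" using parts[of "%z. 1" 0] by simp
 have "integral {-1..1} (%z. z * \<psi> z * p_c D x z) = integral {-1..1} (%z. z * (poly (pderiv2 F) z - F2 z))"
  by (rule Henstock_Kurzweil_Integration.integral_cong) (simp add: \<psi>p mult.assoc)
 hence o2: "integral {-1..1} (%z. z * \<psi> z * p_c D x z) = 0" using parts[of "%z. z" 1] by simp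
 note orth = killing_orthogonal[OF _ c\<psi> o1 o2]
 define p0 where "p0 l = - a * zfun D u l + - b" for l
 let ?S = "scal_of D x u"
 have S: "?S l = p0 l + \<psi> (zfun D u l)" if "l : M0 D" for l
  unfolding p0_def \<psi>_def by (rule scal_of_eq[OF F2(6,7) that])
 have p0: "p0 : killing_potentials D x u \<nu>" unfolding p0_def by (rule affine_killing_potential)
 have S0: "(\<integral>m. (?S m - p m) * f m \<partial>\<nu>) = (\<integral>m. (p0 m - p m) * f m \<partial>\<nu>)"
  if p: "p : killing_potentials D x u \<nu>" and f: "f : killing_potentials D x u \<nu>" for p f
 proof -
  have i: "integrable \<nu> (%l. p0 l * f l)" "integrable \<nu> (%l. p l * f l)" "integrable \<nu> (%l. \<psi> (zfun D u l) * f l)"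
   by (intro integrable_square_mult killing_integrable p0 p f square_zfun[OF c\<psi>])+
  have "(\<integral>m. (?S m - p m) * f m \<partial>\<nu>) = (\<integral>m. (p0 m * f m - p m * f m) + \<psi> (zfun D u m) * f m \<partial>\<nu>)"
   by (rule Bochner_Integration.integral_cong) (auto simp: S space_nu algebra_simps)
  also have "... = (\<integral>m. p0 m * f m - p m * f m \<partial>\<nu>) + (\<integral>m. \<psi> (zfun D u m) * f m \<partial>\<nu>)"
   by (rule Bochner_Integration.integral_add[OF Bochner_Integration.integrable_diff[OF i(1,2)] i(3)])
  finally show ?thesis using orth[OF f] by (simp add: left_diff_distrib)
 qed
 define Q where "Q p \<longleftrightarrow> p : killing_potentials D x u \<nu> & (\<forall>f\<in>killing_potentials D x u \<nu>. (\<integral>m. (?S m - p m) * f m \<partial>\<nu>) = 0)" for p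
 define p where "p = (SOME p. Q p)"
 have "Q p0" unfolding Q_def using p0 S0[OF p0] by simp
 hence "Q p" unfolding p_def by (rule someI[of Q])
 hence p: "p : killing_potentials D x u \<nu>" "!!f. f : killing_potentials D x u \<nu> ==> (\<integral>m. (p0 m - p m) * f m \<partial>\<nu>) = 0"
  using S0 unfolding Q_def by auto
 have i: "integrable \<nu> (%l. p0 l * p0 l)" "integrable \<nu> (%l. p l * p0 l)" "integrable \<nu> (%l. p0 l * p l)" "integrable \<nu> (%l. p l * p l)"
  by (intro integrable_square_mult killing_integrable p0 p(1))+
 have "(\<integral>m. (p0 m - p m)^2 \<partial>\<nu>) = (\<integral>m. (p0 m - p m) * p0 m - (p0 m - p m) * p m \<partial>\<nu>)"
  by (simp add: power2_eq_square algebra_simps)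
 also have "... = (\<integral>m. (p0 m - p m) * p0 m \<partial>\<nu>) - (\<integral>m. (p0 m - p m) * p m \<partial>\<nu>)"
  using i by (intro Bochner_Integration.integral_diff) (simp_all add: left_diff_distrib)
 finally have z: "(\<integral>m. (p0 m - p m)^2 \<partial>\<nu>) = 0" using p(2)[OF p0] p(2)[OF p(1)] by simp
 have "integrable \<nu> (%m. (p0 m * p0 m - p m * p0 m) - (p0 m * p m - p m * p m))"
  using i by (intro Bochner_Integration.integrable_diff)
 hence "integrable \<nu> (%m. (p0 m - p m)^2)" by (simp add: power2_eq_square algebra_simps)
 hence "AE m in \<nu>. (p0 m - p m)^2 = 0" using z by (subst (asm) integral_nonneg_eq_0_iff_AE) auto
 hence "AE m in \<nu>. p m = p0 m" by eventually_elim simp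
 hence "AE m in \<nu>. ?S m - p m = \<psi> (zfun D u m)" using AE_space by eventually_elim (simp add: S space_nu)
 moreover have pr: "pr_perp_scal D x u \<nu> l = ?S l - p l" for l unfolding pr_perp_scal_def p_def Q_def ..
 ultimately show "AE l in \<nu>. pr_perp_scal D x u \<nu> l = (poly (pderiv2 F) (zfun D u l) - F2 (zfun D u l)) / poly P (zfun D u l)"
  by (simp add: \<psi>_def)
 have "(%l. p0 l + \<psi> (zfun D u l) - p l) : borel_measurable \<nu>"
  using killing_integrable(2)[OF p0] killing_integrable(2)[OF p(1)] square_zfun(2)[OF c\<psi>] by measurable
 moreover have "pr_perp_scal D x u \<nu> l = p0 l + \<psi> (zfun D u l) - p l" if "l : space \<nu>" for l
  using S[of l] that by (simp add: pr space_nu)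
 ultimately show "pr_perp_scal D x u \<nu> : borel_measurable \<nu>" by (subst measurable_cong)
qed

theorem integral_pr_perp_scal:
 assumes w: "continuous_on {-1..1} w"
 shows "(\<integral>l. w (zfun D u l) * pr_perp_scal D x u \<nu> l \<partial>\<nu>)
  = mass * integral {-1..1} (%z. w z * (poly (pderiv2 F) z - deriv (deriv (prof \<kappa> P u)) z))"
  "modified_calabi_energy D x u \<nu> = mass * EP.energy u"
proof -
 obtain F1 F2 where F2: "continuous_on {-1..1} F2"
  "!!z. z : {-1..1} ==> (prof \<kappa> P u has_real_derivative F1 z) (at z within {-1..1})"
  "!!z. z : {-1..1} ==> (F1 has_real_derivative F2 z) (at z within {-1..1})"
  "F1 1 = - 2 * \<kappa> * poly P 1" "F1 (-1) = 2 * \<kappa> * poly P (-1)"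
  "!!z. abs z < 1 ==> (prof \<kappa> P u has_real_derivative F1 z) (at z)" "!!z. abs z < 1 ==> (F1 has_real_derivative F2 z) (at z)"
  and dd: "!!z. abs z < 1 ==> deriv (deriv (prof \<kappa> P u)) z = F2 z"
  by (rule prof_derivs[OF u \<kappa>, of P], rule that, assumption+)
 have A: "AE l in \<nu>. pr_perp_scal D x u \<nu> l = (poly (pderiv2 F) (zfun D u l) - F2 (zfun D u l)) / poly P (zfun D u l)"
  "pr_perp_scal D x u \<nu> : borel_measurable \<nu>"
  by (rule pr_perp_scal_AE(1)[OF F2], assumption+) (rule pr_perp_scal_AE(2)[OF F2], assumption+)
 define \<psi> where "\<psi> z = (poly (pderiv2 F) z - F2 z) / poly P z" for z
 have c\<psi>: "continuous_on {-1..1} \<psi>" unfolding \<psi>_def by (intro continuous_intros F2(1)) (use EP.P in force)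
 have \<psi>p: "\<psi> z * p_c D x z = poly (pderiv2 F) z - F2 z" if "z : {-1..1}" for z
  using EP.P[OF that] by (simp add: \<psi>_def pc)
 have c2: "continuous_on {-1..1} (%z. w z * \<psi> z)" "continuous_on {-1..1} (%z. \<psi> z * \<psi> z)"
  by (intro continuous_intros w c\<psi>)+
 note I = has_bochner_integral_zfun[OF c2(1)] has_bochner_integral_zfun[OF c2(2)]
 have "(\<integral>l. w (zfun D u l) * pr_perp_scal D x u \<nu> l \<partial>\<nu>) = (\<integral>l. w (zfun D u l) * \<psi> (zfun D u l) \<partial>\<nu>)"
 proof (rule integral_cong_AE)
  show "AE l in \<nu>. w (zfun D u l) * pr_perp_scal D x u \<nu> l = w (zfun D u l) * \<psi> (zfun D u l)"
   using A(1) by eventually_elim (simp add: \<psi>_def)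
 qed (use A(2) square_zfun(2)[OF w] square_zfun(2)[OF c\<psi>] in measurable)
 also have "... = mass * integral {-1..1} (%z. w z * \<psi> z * p_c D x z)"
  using I(1) by (simp add: has_bochner_integral_iff)
 also have "integral {-1..1} (%z. w z * \<psi> z * p_c D x z) = integral {-1..1} (%z. w z * (poly (pderiv2 F) z - deriv (deriv (prof \<kappa> P u)) z))"
  by (rule integral_spike[of "{-1, 1}"]) (auto simp: \<psi>p dd mult.assoc abs_less_iff)
 finally show "(\<integral>l. w (zfun D u l) * pr_perp_scal D x u \<nu> l \<partial>\<nu>)
  = mass * integral {-1..1} (%z. w z * (poly (pderiv2 F) z - deriv (deriv (prof \<kappa> P u)) z))" .
 have "modified_calabi_energy D x u \<nu> = (\<integral>l. \<psi> (zfun D u l) * \<psi> (zfun D u l) \<partial>\<nu>)" unfolding modified_calabi_energy_def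
 proof (rule integral_cong_AE)
  show "AE l in \<nu>. (pr_perp_scal D x u \<nu> l)^2 = \<psi> (zfun D u l) * \<psi> (zfun D u l)"
   using A(1) by eventually_elim (simp add: \<psi>_def power2_eq_square)
 qed (use A(2) square_zfun(2)[OF c\<psi>] in measurable)
 also have "... = mass * integral {-1..1} (%z. \<psi> z * \<psi> z * p_c D x z)"
  using I(2) by (simp add: has_bochner_integral_iff)
 also have "integral {-1..1} (%z. \<psi> z * \<psi> z * p_c D x z) = integral {-1..1} (%z. (poly (pderiv2 F) z - F2 z)^2 / poly P z)"
  by (rule Henstock_Kurzweil_Integration.integral_cong) (use \<psi>p in \<open>simp add: mult.assoc, simp add: \<psi>_def power2_eq_square\<close>)
 also have "... = EP.energy u" using EP.energy_eq[OF F2(1) dd] by (simp add: integral_unique)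
 finally show "modified_calabi_energy D x u \<nu> = mass * EP.energy u" .
qed

end

section \<open>The modified K-energy and Calabi energy\<close>

lemma p_c_poly: "\<exists>P :: real poly. \<forall>z. poly P z = p_c D x z"
 by (rule exI[of _ "\<Prod>i\<in>UNIV. [:1, x i:] ^ card (block D i)"]) (simp add: p_c_def poly_prod mult.commute)

context admissible
begin

lemma p_c_poly_pos:
 assumes x: "!!i. 0 < x i & x i < 1" and z: "z : {-1..1}" shows "p_c D x z > 0" unfolding p_c_def
proof (intro prod_pos zero_less_power)
 fix i
 have "x i * z >= x i * (-1)" using x[of i] z by (intro mult_left_mono) auto
 thus "0 < 1 + x i * z" using x[of i] by linarith
qed

text \<open>The two linear equations for \<open>A\<close> and \<open>B\<close> prescribe the
  integrals of \<open>F''\<close> and \<open>z F''\<close>. By the fundamental theorem these are the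
  difference and, as F vanishes at the ends, the sum of \<open>F'(1)\<close> and
  \<open>F'(-1)\<close>, which gives the slopes.\<close>

lemma extremal_polynomial_profile:
 assumes x: "!!i. 0 < x i & x i < 1" and \<kappa>: "\<kappa> > 0" and P: "!!z. poly P z = p_c D x z"
  and F: "extremal_polynomial D x s \<kappa> F"
 obtains A B where "extremal_profile \<kappa> P F"
  "!!z. z : {-1..1} ==> poly (pderiv2 F) z = (A * z + B + 2 * base_scal D x s z) * p_c D x z"
proof -
 obtain A B where AB: "A * alpha_c D x 1 + B * alpha_c D x 0 = - 2 * beta_c D x s \<kappa> 0"
  "A * alpha_c D x 2 + B * alpha_c D x 1 = - 2 * beta_c D x s \<kappa> 1" and F0: "poly F (-1) = 0" "poly F 1 = 0"
  and F2: "!!z. z : {-1..1} ==> poly (pderiv2 F) z = (A * z + B + 2 * base_scal D x s z) * p_c D x z"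
  using F unfolding extremal_polynomial_def by blast
 have cp: "continuous_on {-1..1} (p_c D x)" unfolding p_c_def[abs_def] by (intro continuous_intros)
 have nz: "1 + x i * z ~= 0" if "z : {-1..1}" for i z
 proof -
  have "x i * z >= x i * (-1)" using x[of i] that by (intro mult_left_mono) auto
  thus ?thesis using x[of i] by linarith
 qed
 have cb: "continuous_on {-1..1} (base_scal D x s)" unfolding base_scal_def[abs_def] using nz by (intro continuous_intros) auto
 have c1: "(%t. p_c D x t * t ^ r) integrable_on {-1..1}" for r by (intro integrable_continuous_real continuous_intros cp)
 have c2: "(%t. base_scal D x s t * p_c D x t * t ^ r) integrable_on {-1..1}" for r by (intro integrable_continuous_real continuous_intros cp cb)
 have I: "integral {-1..1} (%z. z ^ r * poly (pderiv2 F) z) = - 2 * (\<kappa> * p_c D x 1 + (-1) ^ r * \<kappa> * p_c D x (-1))" if r: "r = 0 | r = 1" for r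
 proof -
  have "integral {-1..1} (%z. z ^ r * poly (pderiv2 F) z)
   = integral {-1..1} (%t. A * (p_c D x t * t ^ (r + 1)) + B * (p_c D x t * t ^ r) + 2 * (base_scal D x s t * p_c D x t * t ^ r))"
   by (rule Henstock_Kurzweil_Integration.integral_cong) (simp add: F2 algebra_simps)
  also have "... = A * alpha_c D x (r + 1) + B * alpha_c D x r + 2 * integral {-1..1} (%t. base_scal D x s t * p_c D x t * t ^ r)"
   unfolding alpha_c_def
   by (subst Henstock_Kurzweil_Integration.integral_add, (intro integrable_add integrable_on_mult_right c1 c2)+)+
    (simp only: Henstock_Kurzweil_Integration.integral_mult_right)
  also have "A * alpha_c D x (r + 1) + B * alpha_c D x r = - 2 * beta_c D x s \<kappa> r"
   using AB r by (auto simp: numeral_2_eq_2)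
  finally show ?thesis by (simp add: beta_c_def)
 qed
 have "((%z. poly (pderiv2 F) z) has_integral poly (pderiv F) 1 - poly (pderiv F) (-1)) {-1..1}"
  by (rule fundamental_theorem_of_calculus) (auto simp: real_deriv_vec[symmetric] intro!: DERIV_subset[OF poly_DERIV])
 hence 1: "poly (pderiv F) 1 - poly (pderiv F) (-1) = - 2 * (\<kappa> * p_c D x 1 + \<kappa> * p_c D x (-1))"
  using I[of 0] by (simp add: integral_unique)
 have "((%z. z * poly (pderiv2 F) z) has_integral (1 * poly (pderiv F) 1 - poly F 1) - ((-1) * poly (pderiv F) (-1) - poly F (-1))) {-1..1}"
  by (rule fundamental_theorem_of_calculus)
   (auto simp: real_deriv_vec[symmetric] intro!: derivative_eq_intros DERIV_subset[OF poly_DERIV])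
 hence 2: "poly (pderiv F) 1 + poly (pderiv F) (-1) = - 2 * (\<kappa> * p_c D x 1 - \<kappa> * p_c D x (-1))"
  using I[of 1] F0 by (simp add: integral_unique)
 have lin: "a = - 2 * X & b = 2 * Y" if "a - b = - 2 * (X + Y)" "a + b = - 2 * (X - Y)" for a b X Y :: real
  using that by auto
 have "extremal_profile \<kappa> P F"
 proof
  show "poly (pderiv F) 1 = - 2 * \<kappa> * poly P 1" "poly (pderiv F) (-1) = 2 * \<kappa> * poly P (-1)"
   using lin[OF 1 2] unfolding P by (simp_all only: mult.assoc)
 qed (use \<kappa> F0 P p_c_poly_pos[OF x] in auto)
 thus ?thesis using F2 by (rule that)
qed

end

context adm_pieces
begin

text \<open>By the envelope formula the Kaehler potential moves with velocity \<open>- w\<close> at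
  z, and this sign cancels the one in front of the K-energy; pushing forward to z leaves the double
  integral of \<open>K_energy_profile\<close>.\<close>

theorem energies:
 fixes F P :: "real poly"
 assumes x: "!!i. 0 < x i & x i < 1" and \<kappa>: "\<kappa> > 0" and P: "!!z. poly P z = p_c D x z" and ep: "extremal_profile \<kappa> P F"
  and AB: "!!z. z : {-1..1} ==> poly (pderiv2 F) z = (A * z + B' + 2 * base_scal D x s z) * p_c D x z"
  and vol: "!!u. u : potentials \<kappa> ==> volume_measure D x u (vol u)" and u: "u : potentials \<kappa>"
 shows "modified_K_energy D x \<kappa> vol u = fact (CARD('d option)) * mass * integral {-1..1} (extremal_profile.Kdens \<kappa> P F u)"
  "modified_calabi_energy D x u (vol u) = mass * extremal_profile.energy \<kappa> P F u" "mass > 0"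
proof -
 interpret EP: extremal_profile \<kappa> P F by (rule ep)
 have loc: "adm_extremal_measure D s x \<kappa> u (vol u) n c B P F A B'" if "u : potentials \<kappa>" for u
  by unfold_locales (use x \<kappa> that vol P AB in auto)
 note L = adm_extremal_measure.integral_pr_perp_scal[OF loc]
 show "modified_calabi_energy D x u (vol u) = mass * EP.energy u" by (rule L(2)[OF u continuous_on_const])
 have "adm_measure_pieces D s x \<kappa> u (vol u) n c B" using loc[OF u] unfolding adm_extremal_measure_def by blast
 thus "mass > 0" by (rule adm_measure_pieces.mass(2))
 define U where "U t z = (1 - t) * u_can \<kappa> z + t * u z" for t z
 define w where "w z = u z - u_can \<kappa> z" for z
 have cw: "continuous_on {-1..1} (%z. - w z)"
 proof -
  have "smooth_on_line {-1..1} w" using u unfolding potentials_def w_def[abs_def] by simp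
  thus ?thesis by (intro continuous_on_minus smooth_line_continuous)
 qed
 have inner: "(\<integral>l. vector_derivative (%t. kpot D \<kappa> (U t) l) (at t within {0..1}) * pr_perp_scal D x (U t) (vol (U t)) l * fact (CARD('d option)) \<partial>(vol (U t)))
   = - (fact (CARD('d option)) * mass) * integral {-1..1} (%z. w z * (poly (pderiv2 F) z - deriv (deriv (prof \<kappa> P (U t))) z))"
  if t: "t : {0..1}" for t
 proof -
  have Ut: "U t : potentials \<kappa>" unfolding U_def using potentials_segment(1)[OF u \<kappa>] t by auto
  have vd: "vector_derivative (%t. kpot D \<kappa> (U t) l) (at t within {0..1}) = - w (zfun D (U t) l)" for l
  proof (rule vector_derivative_within_closed_interval)
   have "((%t. kpot D \<kappa> (U t) l) has_real_derivative - w (zfun D (U t) l) - 0) (at t within {0..1})"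
    unfolding kpot_def w_def zfun_def U_def by (intro DERIV_diff legendre_segment_deriv[OF u \<kappa> t] DERIV_const)
   thus "((%t. kpot D \<kappa> (U t) l) has_vector_derivative - w (zfun D (U t) l)) (at t within {0..1})"
    by (simp add: real_deriv_vec)
  qed (use t in auto)
  have "(\<integral>l. - w (zfun D (U t) l) * pr_perp_scal D x (U t) (vol (U t)) l * fact (CARD('d option)) \<partial>(vol (U t)))
   = (mass * integral {-1..1} (%z. - w z * (poly (pderiv2 F) z - deriv (deriv (prof \<kappa> P (U t))) z))) * fact (CARD('d option))"
   using L(1)[OF Ut cw] by simp
  thus ?thesis unfolding vd by simp
 qed
 have "modified_K_energy D x \<kappa> vol u = - integral {0..1} (%t. - (fact (CARD('d option)) * mass) * integral {-1..1} (%z. w z * (poly (pderiv2 F) z - deriv (deriv (prof \<kappa> P (U t))) z)))"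
  unfolding modified_K_energy_def K_energy_along_def U_def[symmetric, abs_def]
  by (intro arg_cong[where f = uminus] Henstock_Kurzweil_Integration.integral_cong inner)
 also have "... = (fact (CARD('d option)) * mass) * integral {0..1} (%t. integral {-1..1} (%z. w z * (poly (pderiv2 F) z - deriv (deriv (prof \<kappa> P (U t))) z)))"
  by simp
 also have "integral {0..1} (%t. integral {-1..1} (%z. w z * (poly (pderiv2 F) z - deriv (deriv (prof \<kappa> P (U t))) z))) = integral {-1..1} (EP.Kdens u)"
  using EP.K_energy_profile[OF u] unfolding w_def U_def[abs_def] .
 finally show "modified_K_energy D x \<kappa> vol u = fact (CARD('d option)) * mass * integral {-1..1} (EP.Kdens u)" .
qed

end

section \<open>Splitting along the repeated roots\<close>

text \<open>An interior root of a nonnegative polynomial is a local minimum, so the derivative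
  vanishes there too.\<close>

lemma order_nonneg_root:
 fixes F :: "real poly"
 assumes F: "F ~= 0" "!!y. y : {a<..<b} ==> poly F y >= 0" and z: "z : {a<..<b}" "poly F z = 0"
 shows "order z F >= 2"
proof -
 obtain Q where Q: "F = [:- z, 1:] * Q" using z(2) poly_eq_0_iff_dvd by (metis dvd_def)
 have "poly (pderiv F) z = 0"
 proof (rule DERIV_local_min[OF poly_DERIV])
  show "0 < min (z - a) (b - z)" using z(1) by simp
  show "\<forall>y. \<bar>z - y\<bar> < min (z - a) (b - z) --> poly F z <= poly F y" using F(2) z(2) by (auto simp: abs_less_iff)
 qed
 hence "poly Q z = 0" unfolding Q pderiv_mult by (simp add: pderiv_pCons)
 hence "[:- z, 1:] ^ 2 dvd F" unfolding Q power2_eq_square by (intro mult_dvd_mono) (auto simp: poly_eq_0_iff_dvd)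
 thus ?thesis using F(1) by (simp add: order_divides)
qed

text \<open>Near a root of order \<open>k\<close> the linear substitution
  \<open>z = e + \<sigma> t\<close>, with \<open>\<sigma>\<close> pointing into the interval, makes
  the profile \<open>\<rho> t^k\<close> with \<open>\<rho>\<close> smooth and positive up to
  \<open>t = 0\<close>; since \<open>\<sigma>^2 = 1\<close>, the other coefficient is
  \<open>1 / \<rho>\<close>.\<close>

lemma generalized_cusp_polynomial:
 fixes F P :: "real poly" and a b e \<sigma> :: real
 assumes F: "F ~= 0" "poly F e = 0" and P: "!!z. z : {a..b} ==> poly P z > 0" and ab: "a < b"
  and pos: "!!z. z : {a<..<b} ==> poly F z > 0" and e: "e = a & \<sigma> = 1 | e = b & \<sigma> = -1"
 shows "generalized_cusp (%z. 1 / (poly F z / poly P z)) (%z. poly F z / poly P z) {a<..<b} e"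
proof -
 define k where "k = order e F"
 obtain Q where Q: "F = [:- e, 1:] ^ k * Q" "~ [:- e, 1:] dvd Q" using order_decomp[OF F(1)] unfolding k_def by blast
 have Qe: "poly Q e ~= 0" using Q(2) by (simp add: poly_eq_0_iff_dvd)
 have k: "k >= 1" using F order_root[of F e] by (simp add: k_def)
 \<comment> \<open>Half the length keeps the parametrised piece away from the other end, where F may
   vanish as well.\<close>
 define s0 where "s0 = (b - a) / 2"
 define \<psi> where "\<psi> t = e + \<sigma> * t" for t
 define R where "R = pcompose (smult (\<sigma> ^ k) Q) [:e, \<sigma>:]"
 define \<rho> where "\<rho> t = poly R t / poly (pcompose P [:e, \<sigma>:]) t" for t
 have s0: "s0 > 0" using ab by (simp add: s0_def)
 have \<sigma>: "\<sigma>\<^sup>2 = 1" using e by auto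
 have in': "\<psi> t : {a..b}" if "t : {0..s0}" for t
  using e that ab by (elim disjE conjE) (simp_all add: \<psi>_def s0_def field_simps)
 have inn: "\<psi> t : {a<..<b}" if "t : {0<..s0}" for t
  using e that ab by (elim disjE conjE) (simp_all add: \<psi>_def s0_def field_simps)
 have Pp: "poly (pcompose P [:e, \<sigma>:]) t = poly P (\<psi> t)" for t by (simp add: poly_pcompose \<psi>_def mult.commute)
 have Rp: "poly R t = \<sigma> ^ k * poly Q (\<psi> t)" for t by (simp add: R_def poly_pcompose \<psi>_def mult.commute)
 have Fp: "poly F (\<psi> t) = poly R t * t ^ k" for t by (subst Q(1)) (simp add: Rp \<psi>_def power_mult_distrib)
 have Th: "poly F (\<psi> t) / poly P (\<psi> t) = \<rho> t * t ^ k" for t unfolding \<rho>_def Pp Fp by simp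
 have Rpos: "poly R t > 0" if "t : {0<..s0}" for t
 proof -
  have "poly R t * t ^ k > 0" using pos[OF inn[OF that]] by (simp add: Fp)
  moreover have "t ^ k > 0" using that by simp
  ultimately show ?thesis by (rule zero_less_mult_pos2)
 qed
 \<comment> \<open>Nonzero because the full order of the root was split off, nonnegative as a limit
   of positive values.\<close>
 have R0: "poly R 0 > 0"
 proof -
  have "poly R 0 ~= 0" using Qe \<sigma> by (auto simp: Rp \<psi>_def)
  moreover have "poly R 0 >= 0"
  proof (rule tendsto_lowerbound)
   show "(poly R \<longlongrightarrow> poly R 0) (at_right 0)" by (intro tendsto_intros)
   show "\<forall>\<^sub>F t in at_right 0. 0 <= poly R t"
    using eventually_at_right_less[of "0::real"] eventually_at_right_field[of _ "0::real"] Rpos s0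
    by (intro eventually_at_rightI[of 0 s0]) (auto simp: less_imp_le)
  qed simp
  ultimately show ?thesis by simp
 qed
 have \<rho>pos: "\<rho> t > 0" if "t : {0..s0}" for t
  using R0 Rpos[of t] P[OF in'[OF that]] that unfolding \<rho>_def Pp by (cases "t = 0") auto
 have \<rho>s: "smooth_on_line {0..s0} \<rho>"
  unfolding \<rho>_def[abs_def] by (intro smooth_line_divide smooth_line_poly) (use P in' Pp in force)
 show ?thesis unfolding generalized_cusp_def
 proof (rule exI[of _ k], rule conjI[OF k], rule exI[of _ s0], rule conjI[OF s0], rule exI[of _ \<psi>], rule exI[of _ "%t. \<sigma>"],
   rule exI[of _ "%t. 1 / \<rho> t"], rule exI[of _ \<rho>], intro conjI ballI)
  show "smooth_on_line {0<..s0} \<psi>" unfolding \<psi>_def[abs_def]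
   by (intro smooth_line_add smooth_line_mult smooth_line_const smooth_line_ident)
  show "inj_on \<psi> {0<..s0}" using \<sigma> by (auto simp: inj_on_def \<psi>_def)
  show "\<psi> ` {0<..s0} \<subseteq> {a<..<b}" using inn by blast
  have "(\<psi> \<longlongrightarrow> e + \<sigma> * 0) (at_right 0)" unfolding \<psi>_def[abs_def] by (intro tendsto_intros)
  thus "(\<psi> \<longlongrightarrow> e) (at_right 0)" by simp
  show "(\<psi> has_real_derivative \<sigma>) (at t within {0<..s0})" for t
   unfolding \<psi>_def[abs_def] by (auto intro!: derivative_eq_intros)
  show "smooth_on_line {0..s0} (%t. 1 / \<rho> t)" by (intro smooth_line_divide smooth_line_const \<rho>s) (use \<rho>pos in force)
  show "1 / \<rho> t > 0" "\<rho> t > 0" if "t : {0..s0}" for t using \<rho>pos[OF that] by simp_all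
  show "1 / (poly F (\<psi> t) / poly P (\<psi> t)) * \<sigma>\<^sup>2 = 1 / \<rho> t / t ^ k" if "t : {0<..s0}" for t unfolding Th \<sigma> by simp
  show "poly F (\<psi> t) / poly P (\<psi> t) = \<rho> t * t ^ k" for t by (rule Th)
 qed (rule \<rho>s)
qed

text \<open>\<open>V\<close> is the fibre variable \<open>y\<close> of the complex structure
  belonging to \<open>\<Theta>\<close>, as a function of z; its inverse \<open>Z\<close> solves the
  flow equation required by \<open>adm_chart\<close>.\<close>

lemma antiderivative_flow:
 fixes \<Theta> :: "real => real"
 assumes ab: "a < b" and \<Theta>: "continuous_on {a<..<b} \<Theta>" "!!z. z : {a<..<b} ==> \<Theta> z > 0"
 obtains V Z where "!!z. z : {a<..<b} ==> (V has_real_derivative 1 / \<Theta> z) (at z)" "inj_on V {a<..<b}" "open (V ` {a<..<b})"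
  "!!z. z : {a<..<b} ==> Z (V z) = z" "!!y. y : V ` {a<..<b} ==> (Z has_real_derivative \<Theta> (Z y)) (at y)"
proof -
 have "isCont (%z. 1 / \<Theta> z) z" if "z : {a<..<b}" for z
 proof (rule continuous_on_interior)
  show "continuous_on {a<..<b} (%z. 1 / \<Theta> z)" using \<Theta> by (intro continuous_on_divide continuous_on_const) force+
  show "z : interior {a<..<b}" using that by simp
 qed
 hence "\<exists>V. \<forall>z::real. ereal a < z --> z < ereal b --> (V has_vector_derivative 1 / \<Theta> z) (at z)"
  using ab by (intro einterval_antiderivative) auto
 then obtain V where V: "!!z. z : {a<..<b} ==> (V has_real_derivative 1 / \<Theta> z) (at z)" by (auto simp: real_deriv_vec)
 have mono: "V y < V z" if "y : {a<..<b}" "z : {a<..<b}" "y < z" for y z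
 proof (rule DERIV_pos_imp_increasing[OF that(3)])
  fix t assume "y <= t" "t <= z"
  hence "t : {a<..<b}" using that by auto
  thus "\<exists>d. (V has_real_derivative d) (at t) & 0 < d" using V \<Theta>(2) by (intro exI[of _ "1 / \<Theta> t"]) simp
 qed
 have inj: "inj_on V {a<..<b}"
 proof (rule inj_onI)
  fix y z assume "y : {a<..<b}" "z : {a<..<b}" "V y = V z"
  thus "y = z" using mono[of y z] mono[of z y] by (cases y z rule: linorder_cases) auto
 qed
 have cV: "continuous_on {a<..<b} V" by (intro continuous_at_imp_continuous_on ballI) (use V DERIV_isCont in blast)
 define Z where "Z = inv_into {a<..<b} V"
 have ZV: "Z (V z) = z" if "z : {a<..<b}" for z unfolding Z_def by (rule inv_into_f_f[OF inj that])
 have "(Z has_real_derivative \<Theta> (Z y)) (at y)" if "y : V ` {a<..<b}" for y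
 proof -
  from that obtain z where z: "z : {a<..<b}" "y = V z" by blast
  have "(Z has_derivative (*) (\<Theta> z)) (at (V z))"
   by (rule has_derivative_inverse_strong[OF open_greaterThanLessThan z(1) cV ZV V[OF z(1), unfolded has_field_derivative_def]])
    (use \<Theta>(2)[OF z(1)] in \<open>auto simp: fun_eq_iff\<close>)
  hence "(Z has_real_derivative \<Theta> z) (at (V z))" by (simp add: has_field_derivative_def)
  thus ?thesis using ZV[OF z(1)] by (simp add: z(2))
 qed
 thus ?thesis using that V inj ZV invariance_of_domain[OF cV open_greaterThanLessThan inj] by blast
qed

lemma increasing_partition:
 fixes r :: "nat => real"
 assumes "\<forall>i\<le>m. r i < r (i + 1)"
 shows "i < j ==> j <= m + 1 ==> r i < r j" "r 0 < z ==> z < r (m + 1) ==> z \<notin> r ` {0..m + 1} ==> \<exists>i\<le>m. r i < z & z < r (i + 1)"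
proof -
 show *: "i < j ==> j <= m + 1 ==> r i < r j" for i j
 proof (induction j)
  case (Suc j)
  thus ?case using assms[rule_format, of j] by (cases "i = j") force+
 qed simp
 assume z: "r 0 < z" "z < r (m + 1)" "z \<notin> r ` {0..m + 1}"
 define k where "k = (LEAST k. z < r k)"
 have k: "z < r k" "k <= m + 1" unfolding k_def using z(2) by (auto intro: LeastI Least_le)
 have "k ~= 0" using k(1) z(1) by (metis less_asym)
 hence "~ z < r (k - 1)" using not_less_Least[of "k - 1" "%k. z < r k"] by (simp add: k_def)
 moreover have "z ~= r (k - 1)" using z(3) k(2) by auto
 ultimately have "r (k - 1) < z" by simp
 thus "\<exists>i\<le>m. r i < z & z < r (i + 1)" using k \<open>k ~= 0\<close> by (intro exI[of _ "k - 1"]) auto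
qed

section \<open>Extremal metrics on the parts\<close>

context admissible
begin

lemma zM_range:
 assumes \<kappa>: "\<kappa> > 0"
 shows "zM D \<kappa> p : {-1..1}" "l : tot D ==> zM D \<kappa> (Inl l) < 1 ==> l : M0 D & zM D \<kappa> (Inl l) = zfun D (u_can \<kappa>) l"
  "l : M0 D ==> zM D \<kappa> (Inl l) = zfun D (u_can \<kappa>) l" using momentum(1,2)[OF u_can_potential[OF \<kappa>] \<kappa>]
 by (auto simp: zM_def zfun_def M0_def less_imp_le split: sum.splits if_splits)

text \<open>For the profile \<open>F / P\<close> the curvature formula gives
  \<open>2 base_scal - F'' / P\<close>, which is \<open>- A z - B\<close>. What has to be arranged
  is the complex structure: \<open>Y = V(z)\<close>, with z taken from the fixed moment map.\<close>

theorem adm_extremal_on_poly: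
 assumes x: "!!i. 0 < x i & x i < 1" and \<kappa>: "\<kappa> > 0" and P: "!!z. poly P z = p_c D x z"
  and AB: "!!z. z : {-1..1} ==> poly (pderiv2 F) z = (A * z + B + 2 * base_scal D x s z) * p_c D x z"
  and ab: "-1 <= a" "a < b" "b <= 1" and pos: "!!z. z : {a<..<b} ==> poly F z > 0"
 shows "adm_extremal_on D x \<kappa> a b (%z. poly F z / poly P z)"
proof -
 let ?\<Theta> = "%z. poly F z / poly P z" and ?I = "{a<..<b}" and ?u = "u_can \<kappa>"
 let ?z = "zfun D ?u"
 note u = u_can_potential[OF \<kappa>]
 have Pp: "poly P z > 0" if "z : {-1..1}" for z using p_c_poly_pos[OF x that] by (simp add: P)
 have sub: "?I \<subseteq> {-1<..<1}" using ab by auto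
 hence PI: "poly P z > 0" if "z : ?I" for z using Pp[of z] that by auto
 have sT: "smooth_on_line ?I ?\<Theta>" by (intro smooth_line_divide smooth_line_poly) (use PI in force)
 have Tp: "?\<Theta> z > 0" if "z : ?I" for z using pos[OF that] PI[OF that] by simp
 obtain V Z where V: "!!z. z : ?I ==> (V has_real_derivative 1 / ?\<Theta> z) (at z)" "inj_on V ?I" "open (V ` ?I)"
  "!!z. z : ?I ==> Z (V z) = z" "!!y. y : V ` ?I ==> (Z has_real_derivative ?\<Theta> (Z y)) (at y)"
  using antiderivative_flow[OF ab(2) smooth_line_continuous[OF sT] Tp] by blast
 define R where "R = Inl -` zpart D \<kappa> a b"
 define J where "J = {y. momentum ?u y : ?I}"
 \<comment> \<open>\<open>Y\<close> as a function of the original fibre variable, the form in which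
   \<open>ccoord_inj\<close> and \<open>ccoord_image\<close> apply.\<close>
 define T where "T y = V (momentum ?u y)" for y
 let ?Y = "%l. V (?z l)"
 have YT: "?Y = (%l. T (ylog D l))" by (simp add: T_def zfun_def fun_eq_iff)
 have R: "R = {l : M0 D. ylog D l : J}"
 proof (intro equalityI subsetI)
  fix l assume "l : R"
  hence l: "l : tot D" "zM D \<kappa> (Inl l) : ?I" by (auto simp: R_def zpart_def proj_bundle_def)
  hence "l : M0 D & zM D \<kappa> (Inl l) = ?z l" using zM_range(2)[OF \<kappa> l(1)] ab(3) by auto
  thus "l : {l : M0 D. ylog D l : J}" using l(2) by (simp add: J_def zfun_def)
 next
  fix l assume "l : {l : M0 D. ylog D l : J}"
  thus "l : R" using zM_range(3)[OF \<kappa>, of l] by (simp add: R_def zpart_def proj_bundle_def M0_def J_def zfun_def image_iff)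
 qed
 have injT: "inj_on T J"
 proof (rule inj_onI)
  fix y y' assume "y : J" "y' : J" "T y = T y'"
  hence "momentum ?u y = momentum ?u y'" using V(2) by (auto simp: J_def T_def inj_on_def)
  thus "y = y'" using momentum(3)[OF u \<kappa>] by metis
 qed
 have TJ: "T ` J = V ` ?I"
 proof (intro equalityI subsetI)
  fix y assume "y : V ` ?I"
  then obtain z where z: "z : ?I" "y = V z" by blast
  have "momentum ?u (deriv ?u z) = z" using momentum(4)[OF u \<kappa>, of z] z(1) sub by (auto simp: abs_less_iff)
  thus "y : T ` J" using z by (intro image_eqI[of _ _ "deriv ?u z"]) (auto simp: T_def J_def)
 qed (auto simp: T_def J_def)
 have ch: "adm_chart D s x c R ?Y ?z ?\<Theta> Z (V ` ?I) ?I" "!!l. l : R \<inter> cdom D c ==> ccoord D ?Y c l : cimg c (V ` ?I) & Z (Yc c (ccoord D ?Y c l)) = ?z l"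
  if c: "c : bundle_charts D" for c
 proof -
  have inj: "inj_on (ccoord D ?Y c) (R \<inter> cdom D c)" unfolding YT by (rule ccoord_inj[OF c injT]) (simp add: R)
  have im: "ccoord D ?Y c ` (R \<inter> cdom D c) = cimg c (V ` ?I)"
   unfolding YT R TJ[symmetric] by (rule ccoord_image[OF c])
  have val: "in_chart D R ?Y c f q = f l" "Yc c q = V (?z l)" if "l : R \<inter> cdom D c" "q = ccoord D ?Y c l" for l q f
   using in_chart_ccoord[OF inj that(1)] Y_in_chart(1)[OF c, of l ?Y] that by (auto simp: Yc_def)
  have zl: "?z l : ?I" if "l : R" for l using that by (simp add: R J_def zfun_def)
  show "adm_chart D s x c R ?Y ?z ?\<Theta> Z (V ` ?I) ?I"
  proof
   show "in_chart D R ?Y c ?Y q = Yc c q" "in_chart D R ?Y c ?z q = Z (Yc c q)" if "q : cimg c (V ` ?I)" for q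
   proof -
    from that obtain l where l: "l : R \<inter> cdom D c" "q = ccoord D ?Y c l" unfolding im[symmetric] by blast
    show "in_chart D R ?Y c ?Y q = Yc c q" "in_chart D R ?Y c ?z q = Z (Yc c q)"
     using val[OF l] V(4)[OF zl[of l]] l(1) by auto
   qed
   show "Z y : ?I" if "y : V ` ?I" for y using that V(4) by force
  qed (use x c V sT Tp sub in auto)
  show "ccoord D ?Y c l : cimg c (V ` ?I) & Z (Yc c (ccoord D ?Y c l)) = ?z l" if "l : R \<inter> cdom D c" for l
   using im that val(2)[OF that refl] V(4)[OF zl[of l]] by auto
 qed
 have "adm_scal D x R ?Y ?z ?\<Theta> l = - A * ?z l + - B" if l: "l : R" for l
 proof -
  define d where "d = (SOME d. d : bundle_charts D & l : cdom D d)"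
  have lM: "l : M0 D" using l by (simp add: R)
  have "prj D ` tot D = topspace (base D)" using hlb unfolding hermitian_line_bundle_def by (elim conjE)
  hence "prj D l : topspace (base D)" using lM by (auto simp: M0_def)
  from bundle_charts_cover[OF this openin_topspace this] obtain d' where "d' : bundle_charts D" "prj D l : bdom (fst d')" by blast
  hence "d' : bundle_charts D & l : cdom D d'" using lM by (simp add: cdom_def)
  hence d: "d : bundle_charts D" "l : cdom D d" unfolding d_def by (rule someI2, blast)+
  interpret C: adm_chart D s x d R ?Y ?z ?\<Theta> Z "V ` ?I" ?I by (rule ch(1)[OF d(1)])
  have q: "ccoord D ?Y d l : cimg d (V ` ?I)" "Z (Yc d (ccoord D ?Y d l)) = ?z l" using ch(2)[OF d(1)] l d(2) by auto
  have zI: "?z l : ?I" using l by (simp add: R J_def zfun_def)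
  have 1: "((%t. p_c D x t * ?\<Theta> t) has_real_derivative poly (pderiv F) t) (at t)" if t: "t : ?I" for t
  proof (rule deriv_interior_cong[of "poly F" _ t a b])
   show "poly F z = p_c D x z * ?\<Theta> z" if "a < z" "z < b" for z using PI[of z] that by (simp add: P[symmetric])
  qed (use t poly_DERIV in auto)
  have "adm_scal D x R ?Y ?z ?\<Theta> l = scalar_curvature UNIV C.G (ccoord D ?Y d l)"
   unfolding adm_scal_def Let_def d_def[symmetric] ..
  also have "... = 2 * base_scal D x s (?z l) - poly (pderiv2 F) (?z l) / p_c D x (?z l)"
   using C.scalar_curvature_G[OF q(1) 1 poly_DERIV] unfolding q(2) .
  also have "... = - A * ?z l + - B" using AB[of "?z l"] zI sub PI[OF zI] by (auto simp: P field_simps)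
  finally show ?thesis .
 qed
 thus ?thesis unfolding adm_extremal_on_def Let_def R_def[symmetric] using sT Tp V(1) by blast
qed

lemma zpart_partition:
 fixes r :: "nat => real" and m :: nat
 assumes \<kappa>: "\<kappa> > 0" and r: "r 0 = -1" "r (m + 1) = 1" "\<forall>i\<le>m. r i < r (i + 1)"
 shows "proj_bundle D - {p. zM D \<kappa> p : r ` {0..m + 1}} = (\<Union>i\<le>m. zpart D \<kappa> (r i) (r (i + 1)))"
  "disjoint_family_on (%i. zpart D \<kappa> (r i) (r (i + 1))) {..m}"
proof -
 note mono = increasing_partition[of m r, OF r(3)]
 have le: "r i <= r j" if "i <= j" "j <= m + 1" for i j using mono(1)[of i j] that by (cases "i = j") auto
 show "proj_bundle D - {p. zM D \<kappa> p : r ` {0..m + 1}} = (\<Union>i\<le>m. zpart D \<kappa> (r i) (r (i + 1)))"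
 proof (intro equalityI subsetI)
  fix p assume p: "p : proj_bundle D - {p. zM D \<kappa> p : r ` {0..m + 1}}"
  hence n: "zM D \<kappa> p \<notin> r ` {0..m + 1}" by simp
  hence "zM D \<kappa> p ~= r 0" "zM D \<kappa> p ~= r (m + 1)" by auto
  hence "r 0 < zM D \<kappa> p" "zM D \<kappa> p < r (m + 1)" using zM_range(1)[OF \<kappa>, of p] r(1,2) by auto
  from mono(2)[OF this n] show "p : (\<Union>i\<le>m. zpart D \<kappa> (r i) (r (i + 1)))" using p by (auto simp: zpart_def)
 next
  fix p assume "p : (\<Union>i\<le>m. zpart D \<kappa> (r i) (r (i + 1)))"
  then obtain i where i: "i <= m" "p : proj_bundle D" "r i < zM D \<kappa> p" "zM D \<kappa> p < r (i + 1)" by (auto simp: zpart_def)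
  have "zM D \<kappa> p ~= r j" if "j <= m + 1" for j using i(1,3,4) le[of j i] le[of "i + 1" j] that by (cases "j <= i") auto
  hence "zM D \<kappa> p \<notin> r ` {0..m + 1}" by (metis atLeastAtMost_iff imageE)
  thus "p : proj_bundle D - {p. zM D \<kappa> p : r ` {0..m + 1}}" using i(2) by simp
 qed
 show "disjoint_family_on (%i. zpart D \<kappa> (r i) (r (i + 1))) {..m}" unfolding disjoint_family_on_def
 proof (intro ballI impI)
  fix i j assume ij: "i : {..m}" "j : {..m}" "i ~= j"
  have "r (i + 1) <= r j | r (j + 1) <= r i" using ij le[of "i + 1" j] le[of "j + 1" i] by (cases "i < j") auto
  thus "zpart D \<kappa> (r i) (r (i + 1)) \<inter> zpart D \<kappa> (r j) (r (j + 1)) = {}" by (auto simp: zpart_def)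
 qed
qed

end

theorem theorem1p4:
  fixes D :: "('a, 's, 'l, 'd::finite, 'b::finite) admissible_data"
    and x s :: "'b \<Rightarrow> real" and \<kappa> :: real
    and vol :: "(real \<Rightarrow> real) \<Rightarrow> 'l measure"
    and F :: "real poly"
  assumes "admissible_manifold D s"
    and "\<And>i. 0 < x i \<and> x i < 1"
    and "\<kappa> > 0"
    and "\<And>u. u \<in> potentials \<kappa> \<Longrightarrow> volume_measure D x u (vol u)"
    and "extremal_polynomial D x s \<kappa> F"
  shows
    "((\<exists>C. \<forall>u\<in>potentials \<kappa>. C \<le> modified_K_energy D x \<kappa> vol u)
        \<longleftrightarrow> (\<forall>z\<in>{-1<..<1}. poly F z \<ge> 0)) \<and>
     ((\<forall>z\<in>{-1<..<1}. poly F z \<ge> 0)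
        \<longleftrightarrow> (INF u\<in>potentials \<kappa>. modified_calabi_energy D x u (vol u)) = 0) \<and>
     ((\<forall>z\<in>{-1<..<1}. poly F z \<ge> 0) \<longrightarrow>
        (\<forall>m. \<forall>r :: nat \<Rightarrow> real.
           r 0 = -1 \<and> r (m + 1) = 1 \<and> (\<forall>i\<le>m. r i < r (i + 1)) \<and>
           r ` {1..m} = {z \<in> {-1<..<1}. order z F \<ge> 2} \<longrightarrow>
             proj_bundle D - {p. zM D \<kappa> p \<in> r ` {0..m + 1}} = (\<Union>i\<le>m. zpart D \<kappa> (r i) (r (i + 1))) \<and>
             disjoint_family_on (\<lambda>i. zpart D \<kappa> (r i) (r (i + 1))) {..m} \<and>
             (\<forall>i\<le>m. \<exists>\<Theta>. adm_extremal_on D x \<kappa> (r i) (r (i + 1)) \<Theta> \<and>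
                (i \<ge> 1 \<longrightarrow> generalized_cusp (\<lambda>z. 1 / \<Theta> z) \<Theta> {r i<..<r (i + 1)} (r i)) \<and>
                (i < m \<longrightarrow> generalized_cusp (\<lambda>z. 1 / \<Theta> z) \<Theta> {r i<..<r (i + 1)} (r (i + 1))))))"
proof -
 interpret admissible D s by unfold_locales (rule assms(1))
 note x = assms(2) and \<kappa> = assms(3)
 obtain P :: "real poly" where P: "\<And>z. poly P z = p_c D x z" using p_c_poly by blast
 obtain A B where ep: "extremal_profile \<kappa> P F"
  and AB: "\<And>z. z \<in> {-1..1} \<Longrightarrow> poly (pderiv2 F) z = (A * z + B + 2 * base_scal D x s z) * p_c D x z"
  using extremal_polynomial_profile[of x, OF x \<kappa> P assms(5)] by blast
 interpret EP: extremal_profile \<kappa> P F by (rule ep)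
 \<comment> \<open>One partition of the base for all potentials, so that the mass is a common factor
   of all energies.\<close>
 obtain n c S where "adm_pieces D s x n c S" using pieces_exist[of x, OF x] by blast
 then interpret AP: adm_pieces D s x n c S .
 have E: "modified_K_energy D x \<kappa> vol u = fact (CARD('d option)) * AP.mass * integral {-1..1} (EP.Kdens u)"
  "modified_calabi_energy D x u (vol u) = AP.mass * EP.energy u" "AP.mass > 0" if "u \<in> potentials \<kappa>" for u
  by (rule AP.energies[OF x \<kappa> P ep AB assms(4) that]; assumption)+
 have V: "AP.mass > 0" by (rule E(3)[OF u_can_potential[OF \<kappa>]])
 define nf where "nf = (fact (CARD('d option)) :: real) * AP.mass"
 have nf: "nf > 0" unfolding nf_def using V by simp
 have "(\<exists>C. \<forall>u\<in>potentials \<kappa>. C \<le> modified_K_energy D x \<kappa> vol u) \<longleftrightarrow> (\<exists>C. \<forall>u\<in>potentials \<kappa>. C \<le> nf * integral {-1..1} (EP.Kdens u))"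
  using E(1) unfolding nf_def by simp
 also have "\<dots> \<longleftrightarrow> (\<exists>C. \<forall>u\<in>potentials \<kappa>. C \<le> integral {-1..1} (EP.Kdens u))"
 proof (intro iffI; elim exE)
  fix C assume "\<forall>u\<in>potentials \<kappa>. C \<le> nf * integral {-1..1} (EP.Kdens u)"
  thus "\<exists>C. \<forall>u\<in>potentials \<kappa>. C \<le> integral {-1..1} (EP.Kdens u)"
   using nf by (intro exI[of _ "C / nf"]) (simp add: pos_divide_le_eq mult.commute)
 next
  fix C assume "\<forall>u\<in>potentials \<kappa>. C \<le> integral {-1..1} (EP.Kdens u)"
  thus "\<exists>C. \<forall>u\<in>potentials \<kappa>. C \<le> nf * integral {-1..1} (EP.Kdens u)"
   using nf by (intro exI[of _ "nf * C"]) simp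
 qed
 finally have 1: "(\<exists>C. \<forall>u\<in>potentials \<kappa>. C \<le> modified_K_energy D x \<kappa> vol u) \<longleftrightarrow> (\<forall>z\<in>{-1<..<1}. poly F z \<ge> 0)"
  unfolding EP.K_bounded_iff .
 have "(INF u\<in>potentials \<kappa>. modified_calabi_energy D x u (vol u)) = (INF u\<in>potentials \<kappa>. AP.mass * EP.energy u)"
  by (rule INF_cong[OF refl E(2)])
 hence 2: "(\<forall>z\<in>{-1<..<1}. poly F z \<ge> 0) \<longleftrightarrow> (INF u\<in>potentials \<kappa>. modified_calabi_energy D x u (vol u)) = 0"
  using EP.energy_INF_iff[OF V] by simp
 have 3: "proj_bundle D - {p. zM D \<kappa> p \<in> r ` {0..m + 1}} = (\<Union>i\<le>m. zpart D \<kappa> (r i) (r (i + 1))) \<and>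
       disjoint_family_on (\<lambda>i. zpart D \<kappa> (r i) (r (i + 1))) {..m} \<and>
       (\<forall>i\<le>m. \<exists>\<Theta>. adm_extremal_on D x \<kappa> (r i) (r (i + 1)) \<Theta> \<and>
        (i \<ge> 1 \<longrightarrow> generalized_cusp (\<lambda>z. 1 / \<Theta> z) \<Theta> {r i<..<r (i + 1)} (r i)) \<and>
        (i < m \<longrightarrow> generalized_cusp (\<lambda>z. 1 / \<Theta> z) \<Theta> {r i<..<r (i + 1)} (r (i + 1))))"
  if nn: "\<forall>z\<in>{-1<..<1}. poly F z \<ge> 0" and r: "r 0 = -1" "r (m + 1) = 1" "\<forall>i\<le>m. r i < r (i + 1)"
   and roots: "r ` {1..m} = {z \<in> {-1<..<1}. order z F \<ge> 2}" for m and r :: "nat \<Rightarrow> real"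
 proof (intro conjI allI impI)
  note mono = increasing_partition(1)[OF r(3)]
  show "proj_bundle D - {p. zM D \<kappa> p \<in> r ` {0..m + 1}} = (\<Union>i\<le>m. zpart D \<kappa> (r i) (r (i + 1)))"
   "disjoint_family_on (\<lambda>i. zpart D \<kappa> (r i) (r (i + 1))) {..m}"
   by (rule zpart_partition[OF \<kappa> r])+
  fix i assume i: "i \<le> m"
  let ?a = "r i" and ?b = "r (i + 1)" and ?\<Theta> = "\<lambda>z. poly F z / poly P z"
  have ab: "-1 \<le> ?a" "?a < ?b" "?b \<le> 1"
   using mono[of 0 i] mono[of "i + 1" "m + 1"] r i by (cases "i = 0"; cases "i = m"; force)+
  have pos: "poly F z > 0" if z: "z \<in> {?a<..<?b}" for z
  proof -
   have z1: "z \<in> {-1<..<1}" using z ab by auto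
   \<comment> \<open>A root here would be repeated by nonnegativity, hence one of the listed points,
     and none of these lies strictly between two consecutive ones.\<close>
   have "poly F z \<noteq> 0"
   proof
    assume "poly F z = 0"
    hence "order z F \<ge> 2" using order_nonneg_root[OF EP.F_nonzero _ z1] nn by blast
    hence "z \<in> r ` {1..m}" unfolding roots using z1 by blast
    then obtain j where j: "z = r j" "j \<le> m" by auto
    thus False using z mono[of j i] mono[of "i + 1" j] i by (cases "j = i"; cases "j = i + 1"; cases "j < i") auto
   qed
   thus ?thesis using nn z1 by (simp add: less_le)
  qed
  have Pp: "poly P z > 0" if "z \<in> {?a..?b}" for z using EP.P[of z] that ab by auto
  have root: "poly F (r j) = 0" if "1 \<le> j" "j \<le> m" for j
  proof -
   have "r j \<in> {z \<in> {-1<..<1}. order z F \<ge> 2}" unfolding roots[symmetric] using that by auto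
   thus ?thesis using order_root[of F "r j"] by auto
  qed
  show "\<exists>\<Theta>. adm_extremal_on D x \<kappa> ?a ?b \<Theta> \<and>
    (i \<ge> 1 \<longrightarrow> generalized_cusp (\<lambda>z. 1 / \<Theta> z) \<Theta> {?a<..<?b} ?a) \<and>
    (i < m \<longrightarrow> generalized_cusp (\<lambda>z. 1 / \<Theta> z) \<Theta> {?a<..<?b} ?b)"
  proof (rule exI[of _ ?\<Theta>], intro conjI impI)
   show "adm_extremal_on D x \<kappa> ?a ?b ?\<Theta>" by (rule adm_extremal_on_poly[of x, OF x \<kappa> P AB ab pos]; assumption)
   show "generalized_cusp (\<lambda>z. 1 / ?\<Theta> z) ?\<Theta> {?a<..<?b} ?a" if "1 \<le> i"
    by (rule generalized_cusp_polynomial[OF EP.F_nonzero root[OF that i] Pp ab(2) pos, of 1]) auto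
   show "generalized_cusp (\<lambda>z. 1 / ?\<Theta> z) ?\<Theta> {?a<..<?b} ?b" if "i < m"
    by (rule generalized_cusp_polynomial[OF EP.F_nonzero root Pp ab(2) pos, of "i + 1" "-1"]) (use that in auto)
  qed
 qed
 show ?thesis
  by (rule conjI[OF 1], rule conjI[OF 2], rule impI, rule allI, rule allI, rule impI, elim conjE) (rule 3; assumption)
qed

end
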